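(* Let $K$ be a number field, $n$ a positive integer, $w$ a place of $K$ and $\xi\in K_w$. Put $c_3=(2n)!$ and $c_4=e^{2n(n+1)}c_3^n$. Suppose that, for any sufficiently large real number $X$, there is a nonzero polynomial $P=P_X\in K[T]$ of degree $\le n$ and height $\mathrm{H}(P)\le X$ such that $$\frac{|P(\xi)|_w}{\|P\|_w}\le c_4^{-1}\,\mathrm{H}(P)^{-n}X^{-\deg(P)}.$$ Then $\xi$ is algebraic over $K$ of degree $\le n$, and the polynomials $P_X$ vanish at $\xi$ for every sufficiently large $X$.
   Context: $K$ has degree $d$ over $\mathbb{Q}$. For each place $v$ of $K$, $K_v$ is the completion, $d_v$ the local degree, and $|\cdot|_v$ is normalized by $|p|_v=p^{-d_v/d}$ if $v$ lies above the prime $p$, and $|x|_v=|x|^{d_v/d}$ for $x\in\mathbb{Q}$ if $v$ is Archimedean. For a polynomial $P$ with coefficients in $K_v$, $\|P\|_v$ is the maximum of the $v$-adic absolute values of its coefficients. For $P\in K[T]$, $\mathrm{H}(P)=\prod_v\|P\|_v$, the product over all places of $K$. *)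

theory Defs
  imports
    "HOL-Computational_Algebra.Polynomial"
    "HOL-Computational_Algebra.Primes"
    "HOL-Analysis.Abstract_Metric_Spaces"
    "HOL-Algebra.Finite_Extensions"
begin

section \<open>Number fields\<close>

abbreviation rat_scale :: "rat \<Rightarrow> 'k \<Rightarrow> 'k :: field_char_0" where
  "rat_scale q x \<equiv> of_rat q * x"

definition number_field :: "'k :: field_char_0 itself \<Rightarrow> bool" where
  "number_field _ \<longleftrightarrow>
     (\<exists>B :: 'k set. finite B \<and> module.span rat_scale B = UNIV)"

definition global_degree :: "'k :: field_char_0 itself \<Rightarrow> nat" where
  "global_degree _ = vector_space.dim rat_scale (UNIV :: 'k set)"


section \<open>Absolute values and places\<close>

definition absolute_value :: "('k :: field \<Rightarrow> real) \<Rightarrow> bool" where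
  "absolute_value a \<longleftrightarrow>
     (\<forall>x. a x \<ge> 0) \<and> (\<forall>x. a x = 0 \<longleftrightarrow> x = 0) \<and>
     (\<forall>x y. a (x * y) = a x * a y) \<and> (\<forall>x y. a (x + y) \<le> a x + a y)"

definition nontrivial_absolute_value :: "('k :: field \<Rightarrow> real) \<Rightarrow> bool" where
  "nontrivial_absolute_value a \<longleftrightarrow> absolute_value a \<and> (\<exists>x. x \<noteq> 0 \<and> a x \<noteq> 1)"

text \<open>A place is a class of nontrivial absolute values modulo equivalence, two absolute values
  being equivalent if one is a positive power of the other.\<close>

definition av_equiv :: "(('k :: field \<Rightarrow> real) \<times> ('k \<Rightarrow> real)) set" where
  "av_equiv = {(a, b). nontrivial_absolute_value a \<and> nontrivial_absolute_value b \<and>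
                       (\<exists>s>0. \<forall>x. b x = a x powr s)}"

definition places :: "('k :: field \<Rightarrow> real) set set" where
  "places = Collect nontrivial_absolute_value // av_equiv"

definition archimedean_av :: "('k :: field \<Rightarrow> real) \<Rightarrow> bool" where
  "archimedean_av a \<longleftrightarrow> \<not> (\<forall>x y. a (x + y) \<le> max (a x) (a y))"

definition padic_abs :: "nat \<Rightarrow> rat \<Rightarrow> real" where
  "padic_abs p x =
     (if x = 0 then 0
      else real p powi (int (multiplicity (int p) (snd (quotient_of x)))
                        - int (multiplicity (int p) (fst (quotient_of x)))))"

definition lies_above :: "('k :: field_char_0 \<Rightarrow> real) \<Rightarrow> nat \<Rightarrow> bool" where
  "lies_above a p \<longleftrightarrow> (padic_abs p, \<lambda>x :: rat. a (of_rat x)) \<in> av_equiv"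


section \<open>Completions\<close>

text \<open>The completion is the ring of Cauchy sequences modulo the ideal of null sequences.
  As a ring it depends only on the equivalence class of the absolute value.\<close>

definition cauchy_ring :: "('k :: field \<Rightarrow> real) \<Rightarrow> (nat \<Rightarrow> 'k) ring" where
  "cauchy_ring a =
     \<lparr>carrier = {f. Metric_space.MCauchy UNIV (\<lambda>x y. a (x - y)) f},
      monoid.mult = (\<lambda>f g n. f n * g n), one = (\<lambda>_. 1),
      zero = (\<lambda>_. 0), add = (\<lambda>f g n. f n + g n)\<rparr>"

definition null_seqs :: "('k :: field \<Rightarrow> real) \<Rightarrow> (nat \<Rightarrow> 'k) set" where
  "null_seqs a = {f. (\<lambda>n. a (f n)) \<longlonglongrightarrow> 0}"

definition completion :: "('k :: field \<Rightarrow> real) \<Rightarrow> (nat \<Rightarrow> 'k) set ring" where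
  "completion a = cauchy_ring a Quot null_seqs a"

definition embed :: "('k :: field \<Rightarrow> real) \<Rightarrow> 'k \<Rightarrow> (nat \<Rightarrow> 'k) set" where
  "embed a x = null_seqs a +>\<^bsub>cauchy_ring a\<^esub> (\<lambda>_. x)"

definition completion_abs :: "('k :: field \<Rightarrow> real) \<Rightarrow> (nat \<Rightarrow> 'k) set \<Rightarrow> real" where
  "completion_abs a \<xi> = (THE r. \<exists>f\<in>\<xi>. (\<lambda>n. a (f n)) \<longlonglongrightarrow> r)"

text \<open>The closure of \<open>\<rat>\<close> in the completion, that is, the completion of \<open>\<rat>\<close> with respect to
  the restricted absolute value.\<close>

definition rat_closure :: "('k :: field_char_0 \<Rightarrow> real) \<Rightarrow> (nat \<Rightarrow> 'k) set set" where
  "rat_closure a =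
     {null_seqs a +>\<^bsub>cauchy_ring a\<^esub> f | f. f \<in> carrier (cauchy_ring a) \<and> range f \<subseteq> \<rat>}"

definition local_degree :: "('k :: field_char_0 \<Rightarrow> real) \<Rightarrow> nat" where
  "local_degree a =
     ring.dim (completion a) (rat_closure a) (carrier (completion a))"


section \<open>Normalized absolute values and heights\<close>

definition normalized :: "('k :: field_char_0 \<Rightarrow> real) \<Rightarrow> bool" where
  "normalized a \<longleftrightarrow>
     (let e = real (local_degree a) / real (global_degree TYPE('k)) in
        (\<forall>p::nat. Factorial_Ring.prime p \<and> lies_above a p \<longrightarrow> a (of_nat p) = real p powr (- e)) \<and>
        (archimedean_av a \<longrightarrow> (\<forall>x :: rat. a (of_rat x) = (real_of_rat \<bar>x\<bar>) powr e)))"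

text \<open>On a number field every place contains exactly one normalized absolute value.\<close>

definition place_abs :: "('k :: field_char_0 \<Rightarrow> real) set \<Rightarrow> 'k \<Rightarrow> real" where
  "place_abs v = (THE a. a \<in> v \<and> normalized a)"

definition poly_norm :: "('k :: field_char_0 \<Rightarrow> real) set \<Rightarrow> 'k poly \<Rightarrow> real" where
  "poly_norm v P = Max ((\<lambda>i. place_abs v (Polynomial.coeff P i)) ` {..Polynomial.degree P})"

text \<open>If \<open>P \<noteq> 0\<close>, only finitely many places have \<open>poly_norm v P \<noteq> 1\<close>; restricting to them is
  what makes the product over all places a finite one.\<close>

definition height :: "'k :: field_char_0 poly \<Rightarrow> real" where
  "height P = (\<Prod>v\<in>{v\<in>places. poly_norm v P \<noteq> 1}. poly_norm v P)"


section \<open>The completion at a place\<close>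

definition place_completion ::
    "('k :: field_char_0 \<Rightarrow> real) set \<Rightarrow> (nat \<Rightarrow> 'k) set ring" where
  "place_completion v = completion (place_abs v)"

text \<open>The canonical copy of the number field inside its completion.\<close>

definition base_field :: "('k :: field_char_0 \<Rightarrow> real) set \<Rightarrow> (nat \<Rightarrow> 'k) set set" where
  "base_field v = range (embed (place_abs v))"

text \<open>\<open>ring.eval\<close> expects the list of coefficients with the leading one first.\<close>

definition poly_at ::
    "('k :: field_char_0 \<Rightarrow> real) set \<Rightarrow> 'k poly \<Rightarrow> (nat \<Rightarrow> 'k) set \<Rightarrow> (nat \<Rightarrow> 'k) set" where
  "poly_at v P \<xi> =
     ring.eval (place_completion v) (map (embed (place_abs v)) (rev (Polynomial.coeffs P))) \<xi>"

definition algebraic_degree ::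
    "('k :: field_char_0 \<Rightarrow> real) set \<Rightarrow> (nat \<Rightarrow> 'k) set \<Rightarrow> nat" where
  "algebraic_degree v \<xi> =
     Polynomials.degree (ring.Irr (place_completion v) (base_field v) \<xi>)"

end

theory Submission
  imports
    Defs
    "HOL-Algebra.Algebraic_Closure_Type"
    "HOL-Computational_Algebra.Fundamental_Theorem_Algebra"
    "Jordan_Normal_Form.Determinant"
begin

text \<open>Two coprime polynomials over \<open>K\<close> cannot both be very small at \<open>\<xi>\<close>: expanding their
  resultant, a nonzero element of \<open>K\<close>, place by place, the product formula turns smallness at \<open>w\<close>
  into a lower bound for the heights. By Gelfond's inequality some irreducible factor of \<open>P\<^sub>Y\<close>
  inherits the approximation quality of \<open>P\<^sub>Y\<close>, so the irreducible factors found at \<open>Y\<close> and at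
  \<open>Y' \<in> [Y, 2 Y]\<close> are associated. Hence one fixed irreducible polynomial divides all \<open>P\<^sub>Y\<close>; its
  value at \<open>\<xi>\<close> is at most a constant times \<open>1 / Y\<close> for every \<open>Y\<close>, so it is zero.

  The product formula comes from the one over \<open>\<rat>\<close> by comparing \<open>\<bar>N x\<bar>\<^sub>u\<close>, for the field norm \<open>N\<close>, with
  the product of the extensions of \<open>u\<close>. All extensions are restrictions of one absolute value of an
  algebraically closed field, because the \<open>\<rat>\<close>-linear maps from \<open>K\<close> to such a field are spanned by
  the field embeddings.\<close>

section \<open>Absolute values of the rationals\<close>

text \<open>The resultant needs coprime inputs, while different \<open>P Y\<close> may share
  factors; hence irreducible factors are compared. The hypothesis is shaped for this: relative
  value, height to the power n and \<open>Y\<close> to the degree are multiplicative up to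
  constants, so a bound for a product forces one for some factor. The constants pay for the losses:
  (2n)! comes from the determinant, and e^(2(n+1)) exceeds 4 G^2 with G = 2^n sqrt(n+1): one G for
  the product of the heights of the factors, one for the height of a single factor, a 2 for the norm
  at \<open>w\<close>, a 2 for passing from \<open>Y\<close> to 2 \<open>Y\<close>. Since \<xi> is a
  coset of Cauchy sequences, estimates are made at elements of K and carried to \<xi> as limits. The
  main obstacle is the normalization: it takes exponents from the dimension of a completion over the
  closure of \<rat>, so the product formula requires these dimensions to add up to the degree of K.
  They are read off from finite subsets of K subject to inequalities, which treats archimedean and
  p-adic places alike, without ramification or residue fields.\<close>

lemma powers_linear_bound_imp_le_1:
  fixes r C :: real
  assumes "\<And>m::nat. r ^ m \<le> C * (real m + 1)" "r \<ge> 0"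
  shows "r \<le> 1"
proof (rule ccontr)
  assume "\<not> r \<le> 1"
  then have r: "r > 1" by simp
  have 1: "(\<lambda>m. real m * (1/r) ^ m) \<longlonglongrightarrow> 0"
    by (rule powser_times_n_limit_0) (use r in auto)
  have 2: "(\<lambda>m. (1/r) ^ m) \<longlonglongrightarrow> 0"
    by (rule LIMSEQ_power_zero) (use r in auto)
  have 3: "(\<lambda>m. C * (real m * (1/r) ^ m + (1/r) ^ m)) \<longlonglongrightarrow> C * (0 + 0)"
    by (intro tendsto_intros 1 2)
  have "1 \<le> C * (real m * (1/r) ^ m + (1/r) ^ m)" for m
    using assms(1)[of m] r by (simp add: field_simps power_divide)
  then have "1 \<le> C * (0 + 0)"
    by (intro LIMSEQ_le_const[OF 3]) auto
  then show False by simp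
qed

text \<open>Factors of linear growth disappear under m-th roots. Bounds obtained by expanding m-th
  powers, with m + 1 binomial terms or a number of digits proportional to m, thereby turn into sharp
  inequalities.\<close>

lemma powers_bound_imp_le:
  fixes x y C :: real
  assumes "\<And>m::nat. x ^ m \<le> C * (real m + 1) * y ^ m" "x \<ge> 0" "y > 0"
  shows "x \<le> y"
proof -
  have "(x / y) ^ m \<le> C * (real m + 1)" for m
    using assms(1)[of m] assms(3) by (simp add: power_divide field_simps)
  then have "x / y \<le> 1"
    by (rule powers_linear_bound_imp_le_1) (use assms in auto)
  then show ?thesis using assms(3) by (simp add: field_simps)
qed

section \<open>Absolute values on a field and the ultrametric criterion\<close>

locale abs_value =
  fixes a :: "'k :: field \<Rightarrow> real"
  assumes av: "absolute_value a"
begin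

lemma nonneg [simp]: "a x \<ge> 0"
  and eq_0_iff [simp]: "a x = 0 \<longleftrightarrow> x = 0"
  and mult: "a (x * y) = a x * a y"
  and add: "a (x + y) \<le> a x + a y"
  using av unfolding absolute_value_def by blast+

lemma zero [simp]: "a 0 = 0"
  by simp

lemma pos: "x \<noteq> 0 \<Longrightarrow> a x > 0"
  using nonneg[of x] eq_0_iff[of x] by linarith

lemma pos_iff [simp]: "a x > 0 \<longleftrightarrow> x \<noteq> 0"
  using pos by fastforce

lemma one [simp]: "a 1 = 1"
  using mult[of 1 1] eq_0_iff[of 1] by simp

lemma minus [simp]: "a (- x) = a x"
proof -
  have "a (-1) * a (-1) = 1" using mult[of "-1" "-1"] by simp
  then have "a (-1) = 1" using nonneg[of "-1"] by (smt (verit) mult_less_cancel_left1 mult_left_le)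
  then show ?thesis using mult[of "-1" x] by simp
qed

lemma minus_commute: "a (x - y) = a (y - x)"
  using minus[of "x - y"] by simp

lemma diff: "a (x - y) \<le> a x + a y"
  using add[of x "- y"] by simp

lemma abs_diff_le: "\<bar>a x - a y\<bar> \<le> a (x - y)"
  using add[of "x - y" y] add[of "y - x" x] minus_commute[of x y] by simp

lemma power: "a (x ^ n) = a x ^ n"
  by (induction n) (simp_all add: mult)

lemma inverse: "a (inverse x) = inverse (a x)"
proof (cases "x = 0")
  case False
  then have "a x * a (inverse x) = 1" using mult[of x "inverse x"] by simp
  then show ?thesis by (simp add: inverse_unique)
qed simp

lemma divide: "a (x / y) = a x / a y"
  by (simp add: divide_inverse mult inverse)

lemma sum_le: "a (sum f A) \<le> (\<Sum>i\<in>A. a (f i))"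
proof (induction A rule: infinite_finite_induct)
  case (insert x F)
  then show ?case using add[of "f x" "sum f F"] by simp
qed auto

lemma prod: "a (prod f A) = (\<Prod>i\<in>A. a (f i))"
  by (induction A rule: infinite_finite_induct) (simp_all add: mult)

lemma of_nat_le: "a (of_nat n) \<le> real n"
proof (induction n)
  case (Suc n)
  then show ?case using add[of 1 "of_nat n"] by simp
qed simp

lemma av_of_int: "a (of_int m) = a (of_nat (nat \<bar>m\<bar>))"
proof (cases "m \<ge> 0")
  case False
  then have "of_int m = - (of_nat (nat \<bar>m\<bar>) :: 'k)"
    by (metis abs_ge_zero abs_of_neg add.inverse_inverse int_nat_eq linorder_not_le of_int_minus of_int_of_nat_eq)
  then show ?thesis by (metis minus)
qed simp

text \<open>In the binomial expansion of \<open>(x + y) ^ m\<close> the coefficients have value at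
  most 1, so each of the m + 1 terms is at most \<open>M ^ m\<close>; taking m-th roots removes the
  factor m + 1.\<close>

lemma ultrametricI:
  assumes "\<And>n. a (of_nat n) \<le> 1"
  shows "a (x + y) \<le> max (a x) (a y)"
proof (cases "x = 0 \<and> y = 0")
  case False
  define M where "M = max (a x) (a y)"
  have M: "M > 0" using False by (auto simp: M_def less_max_iff_disj)
  have "a (x + y) ^ m \<le> 1 * (real m + 1) * M ^ m" for m
  proof -
    have "a (x + y) ^ m = a (\<Sum>k\<le>m. of_nat (m choose k) * x ^ k * y ^ (m - k))"
      by (simp add: power[symmetric] binomial_ring)
    also have "\<dots> \<le> (\<Sum>k\<le>m. a (of_nat (m choose k) * x ^ k * y ^ (m - k)))"
      by (rule sum_le)
    also have "\<dots> \<le> (\<Sum>k\<le>m. M ^ m)"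
    proof (rule sum_mono)
      fix k assume k: "k \<in> {..m}"
      have "a (of_nat (m choose k)) * (a x ^ k * a y ^ (m - k)) \<le> 1 * (M ^ k * M ^ (m - k))"
        using M by (intro mult_mono power_mono assms) (auto simp: M_def)
      also have "\<dots> = M ^ m" using k by (simp add: power_add[symmetric])
      finally show "a (of_nat (m choose k) * x ^ k * y ^ (m - k)) \<le> M ^ m"
        by (simp add: mult power mult.assoc)
    qed
    finally show ?thesis by (simp add: add.commute)
  qed
  then have "a (x + y) \<le> M" by (rule powers_bound_imp_le) (use M in auto)
  then show ?thesis by (simp add: M_def)
qed simp

lemma ultrametric_sum:
  assumes um: "\<And>x y. a (x + y) \<le> max (a x) (a y)" and "\<And>i. i \<in> A \<Longrightarrow> a (f i) \<le> M" "M \<ge> 0"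
  shows "a (sum f A) \<le> M"
  using assms(2)
proof (induction A rule: infinite_finite_induct)
  case (insert x F)
  then show ?case using um[of "f x" "sum f F"] by (auto intro: order.trans)
qed (use assms in auto)

text \<open>Reduces the archimedean property to the values at natural numbers, which are known as
  soon as the restriction to \<rat> is known.\<close>

lemma archimedean_iff: "archimedean_av a \<longleftrightarrow> (\<exists>n::nat. a (of_nat n) > 1)"
proof
  show "archimedean_av a \<Longrightarrow> \<exists>n. a (of_nat n) > 1"
    unfolding archimedean_av_def using ultrametricI by (meson not_le)
next
  assume "\<exists>n. a (of_nat n) > 1"
  then obtain n where n: "a (of_nat n) > 1" by blast
  show "archimedean_av a"
    unfolding archimedean_av_def
  proof
    assume *: "\<forall>x y. a (x + y) \<le> max (a x) (a y)"
    have "a (of_nat m) \<le> 1" for m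
    proof (induction m)
      case (Suc m)
      then show ?case using *[rule_format, of 1 "of_nat m"] by auto
    qed simp
    then show False using n by (meson not_le)
  qed
qed

end

section \<open>The p-adic absolute values of the rationals\<close>

lemma rat_cases_of_int:
  fixes x :: rat
  obtains m n :: int where "n \<noteq> 0" "x = of_int m / of_int n"
  by (metis Fract_of_int_quotient Rat_cases not_less_iff_gr_or_eq)

text \<open>Multiplicativity propagates agreement from the naturals to quotients of integers. The
  exponent \<open>s\<close> serves Ostrowski's theorem, and s = 1 gives plain uniqueness.\<close>

lemma rat_av_eqI:
  fixes a b :: "rat \<Rightarrow> real"
  assumes "absolute_value a" "absolute_value b"
    and eq: "\<And>n::nat. b (of_nat n) = a (of_nat n) powr s"
  shows "b x = a x powr s"
proof -
  interpret a: abs_value a by unfold_locales fact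
  interpret b: abs_value b by unfold_locales fact
  obtain m n :: int where x: "x = of_int m / of_int n" by (rule rat_cases_of_int)
  show ?thesis unfolding x a.divide b.divide a.av_of_int b.av_of_int eq by (simp add: powr_divide)
qed

text \<open>\<open>padic_abs\<close> is defined through the reduced fraction. The difference of the
  two multiplicities is unchanged by cancellation, so any representation may be used, in particular
  a common denominator for two summands.\<close>

lemma padic_abs_frac:
  assumes p: "Factorial_Ring.prime p" and "m \<noteq> 0" "n \<noteq> 0"
  shows "padic_abs p (of_int m / of_int n) =
         real p powi (int (multiplicity (int p) n) - int (multiplicity (int p) m))"
proof -
  define x :: rat where "x = of_int m / of_int n"
  obtain m' n' where q: "quotient_of x = (m', n')" by force
  have n': "n' > 0" using quotient_of_denom_pos[OF q] .
  have x': "x = of_int m' / of_int n'" using quotient_of_div[OF q] .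
  have "x \<noteq> 0" using assms by (simp add: x_def)
  then have m': "m' \<noteq> 0" using x' by auto
  have "(of_int (m * n') :: rat) = of_int (m' * n)"
    using x' n' assms(3) unfolding x_def by (simp add: field_simps)
  then have eq: "m * n' = m' * n" by (simp only: of_int_eq_iff)
  have pe: "prime_elem (int p)" using p by auto
  have "multiplicity (int p) m + multiplicity (int p) n' = multiplicity (int p) m' + multiplicity (int p) n"
    using eq prime_elem_multiplicity_mult_distrib[OF pe] assms m' n' by (metis less_irrefl)
  then have "int (multiplicity (int p) n') - int (multiplicity (int p) m') =
    int (multiplicity (int p) n) - int (multiplicity (int p) m)" by linarith
  then show ?thesis using \<open>x \<noteq> 0\<close> unfolding x_def[symmetric] padic_abs_def q by simp
qed

lemma multiplicity_int:
  assumes p: "Factorial_Ring.prime p" and "n \<noteq> 0"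
  shows "multiplicity (int p) (int n) = multiplicity p n"
proof -
  have u: "\<not> is_unit p" "\<not> is_unit (int p)" using p by auto
  show ?thesis
  proof (rule antisym)
    show "multiplicity (int p) (int n) \<le> multiplicity p n"
      using multiplicity_dvd[of "int p" "int n"] assms u
      by (intro multiplicity_geI) (auto simp flip: of_nat_power)
    show "multiplicity p n \<le> multiplicity (int p) (int n)"
      using multiplicity_dvd[of p n] assms u
      by (intro multiplicity_geI) (auto simp flip: of_nat_power)
  qed
qed

lemma padic_abs_of_nat:
  assumes "Factorial_Ring.prime p" "n \<noteq> 0"
  shows "padic_abs p (of_nat n) = real p powi (- int (multiplicity p n))"
  using padic_abs_frac[OF assms(1), of "int n" 1] assms
  by (simp add: multiplicity_int[OF assms])

lemma padic_abs_prime: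
  assumes p: "Factorial_Ring.prime p" shows "padic_abs p (of_nat p) = 1 / real p"
proof -
  have "p \<noteq> 0" "multiplicity p p = 1" using p by (auto simp: prime_gt_0_nat multiplicity_prime)
  then show ?thesis using padic_abs_of_nat[OF p, of p] by (simp add: power_int_minus inverse_eq_divide)
qed

lemma padic_abs_ultrametric:
  assumes p: "Factorial_Ring.prime p"
  shows "padic_abs p (x + y) \<le> max (padic_abs p x) (padic_abs p y)"
proof (cases "x = 0 \<or> y = 0 \<or> x + y = 0")
  case True
  then show ?thesis by (auto simp: padic_abs_def le_max_iff_disj)
next
  case False
  obtain m n where x: "n \<noteq> 0" "x = of_int m / of_int n" by (rule rat_cases_of_int)
  obtain k l where y: "l \<noteq> 0" "y = of_int k / of_int l" by (rule rat_cases_of_int)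
  have xl: "x = of_int (m * l) / of_int (n * l)" and yn: "y = of_int (k * n) / of_int (n * l)"
    and xy: "x + y = of_int (m * l + k * n) / of_int (n * l)"
    using x y by (simp_all add: field_simps)
  have "m * l + k * n \<noteq> 0" using xy False by (metis div_0 of_int_0)
  then have nz: "m * l \<noteq> 0" "k * n \<noteq> 0" "m * l + k * n \<noteq> 0" "n * l \<noteq> 0"
    using False x y by auto
  let ?v = "multiplicity (int p)"
  have unit: "\<not> is_unit (int p)" using p by (metis not_prime_unit prime_int_nat_transfer prime_nat_int_transfer)
  have "int p ^ min (?v (m*l)) (?v (k*n)) dvd m * l + k * n"
    by (intro dvd_add) (meson min.cobounded1 min.cobounded2 multiplicity_dvd')+
  then have "min (?v (m*l)) (?v (k*n)) \<le> ?v (m * l + k * n)"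
    using nz unit by (intro multiplicity_geI) auto
  then have "?v (m*l) \<le> ?v (m*l+k*n) \<or> ?v (k*n) \<le> ?v (m*l+k*n)" by linarith
  then have "real p powi (int (?v (n*l)) - int (?v (m*l+k*n))) \<le> real p powi (int (?v (n*l)) - int (?v (m*l)))
    \<or> real p powi (int (?v (n*l)) - int (?v (m*l+k*n))) \<le> real p powi (int (?v (n*l)) - int (?v (k*n)))"
    using prime_ge_1_nat[OF p] by (auto intro!: power_int_increasing)
  moreover have "padic_abs p x = real p powi (int (?v (n*l)) - int (?v (m*l)))"
    "padic_abs p y = real p powi (int (?v (n*l)) - int (?v (k*n)))"
    "padic_abs p (x + y) = real p powi (int (?v (n*l)) - int (?v (m*l+k*n)))"
    unfolding xy by (subst xl yn padic_abs_frac[OF p] | use nz in simp)+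
  ultimately show ?thesis by (simp only: le_max_iff_disj)
qed

lemma padic_abs_absolute_value:
  assumes p: "Factorial_Ring.prime p"
  shows "absolute_value (padic_abs p)"
proof -
  have nn: "padic_abs p x \<ge> 0" for x by (auto simp: padic_abs_def)
  have z: "padic_abs p x = 0 \<longleftrightarrow> x = 0" for x
    using prime_gt_0_nat[OF p] by (auto simp: padic_abs_def)
  have m: "padic_abs p (x * y) = padic_abs p x * padic_abs p y" for x y
  proof (cases "x = 0 \<or> y = 0")
    case False
    obtain m n where x: "n \<noteq> 0" "x = of_int m / of_int n" by (rule rat_cases_of_int)
    obtain k l where y: "l \<noteq> 0" "y = of_int k / of_int l" by (rule rat_cases_of_int)
    have xy: "x * y = of_int (m * k) / of_int (n * l)" using x y by simp
    have nz: "m \<noteq> 0" "k \<noteq> 0" using False x y by auto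
    have pe: "prime_elem (int p)" using p by auto
    have e: "int (multiplicity (int p) (n * l)) - int (multiplicity (int p) (m * k)) =
      (int (multiplicity (int p) n) - int (multiplicity (int p) m)) +
      (int (multiplicity (int p) l) - int (multiplicity (int p) k))"
      using nz x y by (simp add: prime_elem_multiplicity_mult_distrib[OF pe])
    have "padic_abs p (x * y) = real p powi (int (multiplicity (int p) (n * l)) - int (multiplicity (int p) (m * k)))"
      unfolding xy using nz x y by (intro padic_abs_frac[OF p]) auto
    also have "\<dots> = padic_abs p x * padic_abs p y"
      unfolding e x(2) y(2) using nz x y prime_gt_0_nat[OF p] by (simp add: padic_abs_frac[OF p] power_int_add)
    finally show ?thesis .
  qed (auto simp: padic_abs_def)
  have "padic_abs p (x + y) \<le> padic_abs p x + padic_abs p y" for x y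
    using padic_abs_ultrametric[OF p, of x y] nn[of x] nn[of y] by linarith
  then show ?thesis using nn z m unfolding absolute_value_def by blast
qed

lemma rat_abs_absolute_value: "absolute_value (\<lambda>x::rat. real_of_rat \<bar>x\<bar>)"
  unfolding absolute_value_def
  by (auto simp: abs_mult of_rat_mult of_rat_add[symmetric] of_rat_less_eq abs_triangle_ineq)

section \<open>Ostrowski's theorem over the rationals\<close>

lemma (in abs_value) digit_bound:
  fixes n m L :: nat
  assumes n: "n \<ge> 2" and "m < n ^ L"
  shows "a (of_nat m) \<le> real L * real n * max 1 (a (of_nat n)) ^ L"
  using assms(2)
proof (induction L arbitrary: m)
  case (Suc L)
  define M where "M = max 1 (a (of_nat n))"
  have M: "M \<ge> 1" "a (of_nat n) \<le> M" by (auto simp: M_def)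
  have "m div n < n ^ L" using Suc.prems n
    by (metis less_mult_imp_div_less mult.commute power_Suc)
  then have IH: "a (of_nat (m div n)) \<le> real L * real n * M ^ L" using Suc.IH by (simp add: M_def)
  have "of_nat m = of_nat (m div n) * of_nat n + (of_nat (m mod n) :: 'k)"
    by (metis div_mult_mod_eq of_nat_add of_nat_mult)
  then have "a (of_nat m) \<le> a (of_nat (m div n)) * a (of_nat n) + a (of_nat (m mod n))"
    by (metis add mult)
  also have "\<dots> \<le> (real L * real n * M ^ L) * M + real n * M ^ Suc L"
  proof (rule add_mono)
    show "a (of_nat (m div n)) * a (of_nat n) \<le> (real L * real n * M ^ L) * M"
      using IH M by (intro mult_mono) auto
    have "a (of_nat (m mod n)) \<le> real (m mod n)" by (rule of_nat_le)
    also have "\<dots> \<le> real n" using n by simp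
    also have "\<dots> = real n * 1" by simp
    also have "\<dots> \<le> real n * M ^ Suc L" using M by (intro mult_left_mono one_le_power) auto
    finally show "a (of_nat (m mod n)) \<le> real n * M ^ Suc L" .
  qed
  also have "\<dots> = real (Suc L) * real n * M ^ Suc L" by (simp add: algebra_simps)
  finally show ?case by (simp add: M_def)
qed simp

text \<open>\<open>m ^ k\<close> has about k ln m / ln n digits in base n, each of value at most n
  by the triangle inequality, so \<open>digit_bound\<close> controls its value up to a factor linear
  in k. Extracting k-th roots leaves only the exponent ln m / ln n.\<close>

lemma (in abs_value) of_nat_compare:
  fixes m n :: nat
  assumes n: "n \<ge> 2" and m: "m \<ge> 2"
  shows "a (of_nat m) \<le> max 1 (a (of_nat n)) powr (ln m / ln n)"
proof -
  define M where "M = max 1 (a (of_nat n))"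
  define l where "l = ln m / ln n"
  have M: "M \<ge> 1" by (auto simp: M_def)
  have l: "l > 0" using n m by (auto simp: l_def)
  have "a (of_nat m) ^ k \<le> (real n * M * (l + 1)) * (real k + 1) * (M powr l) ^ k" for k
  proof -
    \<comment> \<open>One more than the floor, which makes \<open>n ^ L\<close> strictly larger than
      \<open>m ^ k\<close>; the excess over \<open>real k * l\<close> costs a single factor
      M.\<close>
    define L where "L = nat \<lfloor>real k * l\<rfloor> + 1"
    have L1: "real L \<le> real k * l + 1" "real k * l < real L" using l by (auto simp: L_def; linarith)+
    have "ln (real (m ^ k)) = real k * l * ln n" using n m by (simp add: l_def ln_realpow)
    also have "\<dots> < real L * ln n" using L1 n by simp
    also have "\<dots> = ln (real (n ^ L))" using n by (simp add: ln_realpow)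
    finally have "m ^ k < n ^ L" using n m by (simp add: ln_less_cancel_iff del: of_nat_power add: of_nat_power[symmetric])
    from digit_bound[OF n this] have "a (of_nat m) ^ k \<le> real L * real n * M ^ L"
      by (simp add: M_def power)
    also have "\<dots> \<le> ((l + 1) * (real k + 1)) * real n * (M powr (real k * l) * M)"
    proof (intro mult_mono)
      show "real L \<le> (l + 1) * (real k + 1)" using L1 l by (simp add: algebra_simps)
      have "M ^ L = M powr real L" using M by (simp add: powr_realpow)
      also have "\<dots> \<le> M powr (real k * l + 1)" using M L1 by (intro powr_mono) auto
      also have "\<dots> = M powr (real k * l) * M" using M by (simp add: powr_add)
      finally show "M ^ L \<le> M powr (real k * l) * M" .
    qed (use l M in auto)
    also have "M powr (real k * l) = (M powr l) ^ k"
      using M by (simp add: powr_realpow[symmetric] powr_powr mult.commute)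
    finally show ?thesis by (simp add: algebra_simps)
  qed
  then have "a (of_nat m) \<le> M powr l"
    by (rule powers_bound_imp_le) (use M in auto)
  then show ?thesis by (simp add: M_def l_def)
qed

theorem ostrowski_rat:
  fixes a :: "rat \<Rightarrow> real"
  assumes "nontrivial_absolute_value a"
  shows "(\<exists>s>0. \<forall>x. a x = real_of_rat \<bar>x\<bar> powr s) \<or>
         (\<exists>p. Factorial_Ring.prime p \<and> (\<exists>s>0. \<forall>x. a x = padic_abs p x powr s))"
proof -
  have av: "absolute_value a" and nt: "\<exists>x. x \<noteq> 0 \<and> a x \<noteq> 1"
    using assms by (auto simp: nontrivial_absolute_value_def)
  interpret abs_value a by unfold_locales fact
  show ?thesis
  proof (cases "\<exists>N::nat. a (of_nat N) > 1")
    case True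
    then obtain N :: nat where N: "a (of_nat N) > 1" by blast
    have N2: "N \<ge> 2"
    proof (rule ccontr)
      assume "\<not> N \<ge> 2"
      then have "N = 0 \<or> N = 1" by linarith
      then show False using N by auto
    qed
    have gt1: "a (of_nat n) > 1" if n: "n \<ge> 2" for n :: nat
    proof (rule ccontr)
      assume "\<not> ?thesis"
      then have "max 1 (a (of_nat n)) = 1" by simp
      then show False using of_nat_compare[OF n N2] N by simp
    qed
    \<comment> \<open>The comparison in both directions makes this logarithmic slope constant; its
      value is the exponent.\<close>
    define f where "f n = ln (a (of_nat n)) / ln (real n)" for n :: nat
    have le: "f m \<le> f n" if m: "m \<ge> 2" and n: "n \<ge> 2" for m n
    proof -
      have "a (of_nat m) \<le> a (of_nat n) powr (ln m / ln n)"
        using of_nat_compare[OF n m] gt1[OF n] by simp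
      then have "ln (a (of_nat m)) \<le> ln (a (of_nat n) powr (ln m / ln n))"
        using gt1[OF n] gt1[OF m] n m by (subst ln_le_cancel_iff) auto
      then show ?thesis using gt1[OF n] n m by (simp add: f_def ln_powr field_simps)
    qed
    define s where "s = f 2"
    have s: "s > 0" using gt1[of 2] by (simp add: s_def f_def)
    have "a (of_nat n) = real_of_rat \<bar>of_nat n\<bar> powr s" for n :: nat
    proof -
      consider "n = 0" | "n = 1" | "n \<ge> 2" by linarith
      then show ?thesis
      proof cases
        case 3
        have "f n = s" using le[OF 3, of 2] le[of 2, OF _ 3] by (auto simp: s_def)
        then have "ln (a (of_nat n)) = s * ln (real n)" using 3 by (auto simp: f_def field_simps)
        moreover have "exp (ln (a (of_nat n))) = a (of_nat n)" using gt1[OF 3] by (intro exp_ln) linarith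
        ultimately have "a (of_nat n) = exp (s * ln (real n))" by simp
        then show ?thesis using 3 by (simp add: powr_def)
      qed auto
    qed
    then have "a x = real_of_rat \<bar>x\<bar> powr s" for x
      using rat_av_eqI[OF rat_abs_absolute_value av] by blast
    then show ?thesis using s by blast
  next
    case False
    then have le1: "a (of_nat n) \<le> 1" for n by (meson not_le)
    have um: "a (x + y) \<le> max (a x) (a y)" for x y by (rule ultrametricI) (rule le1)
    have ile1: "a (of_int n) \<le> 1" for n by (simp only: av_of_int le1)
    have ex: "\<exists>n::nat. n > 0 \<and> a (of_nat n) < 1"
    proof (rule ccontr)
      assume no: "\<not> (\<exists>n::nat. n > 0 \<and> a (of_nat n) < 1)"
      have *: "a (of_nat n) = 1" if "n > 0" for n
        by (rule antisym[OF le1]) (use no that in \<open>meson not_le\<close>)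
      have "a x = 1" if x: "x \<noteq> 0" for x
      proof -
        obtain m n where mn: "n \<noteq> 0" "x = of_int m / of_int n" by (rule rat_cases_of_int)
        have "a (of_int m) = 1" "a (of_int n) = 1"
          unfolding av_of_int by (rule *; use x mn in auto)+
        then show ?thesis using mn by (simp add: divide)
      qed
      then show False using nt by blast
    qed
    \<comment> \<open>The least positive integer of value below 1. A proper factorization would
      write its value as a product of two values equal to 1, so it is prime.\<close>
    define p where "p = (LEAST n::nat. n > 0 \<and> a (of_nat n) < 1)"
    have p: "p > 0" "a (of_nat p) < 1" using LeastI_ex[OF ex] by (auto simp: p_def)
    have least: "a (of_nat n) = 1" if "n > 0" "n < p" for n
      using not_less_Least[of n "\<lambda>n. n > 0 \<and> a (of_nat n) < 1"] that le1[of n] by (force simp: p_def)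
    have "p \<noteq> 1" using p by auto
    have prime: "Factorial_Ring.prime p"
      unfolding prime_nat_iff
    proof (intro conjI allI impI)
      show "1 < p" using p \<open>p \<noteq> 1\<close> by linarith
      fix m assume "m dvd p"
      then obtain k where k: "p = m * k" by blast
      show "m = 1 \<or> m = p"
      proof (rule ccontr)
        assume "\<not> ?thesis"
        then have "m > 0" "k > 0" "m < p" "k < p" using k p by auto
        then have "a (of_nat p) = 1" using least[of m] least[of k] by (simp add: k mult)
        then show False using p by simp
      qed
    qed
    \<comment> \<open>An integer prime to p cannot have value below 1 as well: Bezout would express
      1 as a sum of two elements of value below 1.\<close>
    have cop: "a (of_nat m) = 1" if "\<not> p dvd m" for m
    proof (rule ccontr)
      assume "a (of_nat m) \<noteq> 1"
      then have lt: "a (of_nat m) < 1" using le1[of m] by simp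
      have "coprime (int p) (int m)" using prime that by (simp add: prime_imp_coprime)
      then obtain u v where uv: "u * int p + v * int m = 1" by (metis bezout_int coprime_imp_gcd_eq_1)
      have "(1::rat) = of_int u * of_nat p + of_int v * of_nat m"
        using uv by (metis of_int_1 of_int_add of_int_mult of_int_of_nat_eq)
      then have "1 \<le> max (a (of_int u * of_nat p)) (a (of_int v * of_nat m))" using um one by metis
      moreover have "a (of_int u * of_nat p) \<le> 1 * a (of_nat p)" "a (of_int v * of_nat m) \<le> 1 * a (of_nat m)"
        unfolding mult by (intro mult_right_mono ile1; simp)+
      ultimately show False using lt p by auto
    qed
    define s where "s = - ln (a (of_nat p)) / ln (real p)"
    have p1: "real p > 1" using prime_gt_1_nat[OF prime] by simp
    have ap: "a (of_nat p) > 0" using p by simp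
    have s: "s > 0" using p p1 ap by (simp add: s_def divide_neg_pos)
    have "(1 / real p) powr s = exp (ln (a (of_nat p)))" using p1
      by (simp add: powr_def s_def ln_div)
    then have aps: "a (of_nat p) = (1 / real p) powr s" using ap by simp
    have "a (of_nat n) = padic_abs p (of_nat n) powr s" for n :: nat
    proof (cases "n = 0")
      case False
      define v where "v = multiplicity p n"
      obtain m where m: "n = p ^ v * m" "\<not> p dvd m"
        using multiplicity_decompose'[of n p] False prime unfolding v_def
        by (metis not_prime_unit)
      have "a (of_nat n) = a (of_nat p) ^ v" using cop[OF m(2)] by (simp add: m(1) mult power)
      also have "\<dots> = ((1 / real p) ^ v) powr s" using p1
        by (simp add: aps powr_power powr_realpow[symmetric] powr_powr mult.commute)
      also have "(1 / real p) ^ v = padic_abs p (of_nat n)"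
        using padic_abs_of_nat[OF prime False] by (simp add: v_def power_int_minus power_one_over inverse_eq_divide)
      finally show ?thesis .
    qed (simp add: padic_abs_def)
    then have "a x = padic_abs p x powr s" for x
      using rat_av_eqI[OF padic_abs_absolute_value[OF prime] av] by blast
    then show ?thesis using s prime by blast
  qed
qed

section \<open>Extending p-adic absolute values\<close>

definition unital_subring :: "'a :: comm_ring_1 set \<Rightarrow> bool" where
  "unital_subring S \<longleftrightarrow> 1 \<in> S \<and> (\<forall>x\<in>S. \<forall>y\<in>S. x - y \<in> S \<and> x * y \<in> S)"

text \<open>A subring maximal among those that do not contain \<open>1 / p\<close> is a valuation ring. On a field that
  is algebraic over \<open>\<rat>\<close> its value group has rank one and yields the extension of \<open>padic_abs p\<close>.\<close>

locale maximal_subring =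
  fixes S :: "'a :: field_char_0 set" and p :: nat
  assumes prime: "Factorial_Ring.prime p"
    and sub: "unital_subring S"
    and notin: "inverse (of_nat p) \<notin> S"
    and maximal: "\<And>T. unital_subring T \<Longrightarrow> S \<subseteq> T \<Longrightarrow> inverse (of_nat p) \<notin> T \<Longrightarrow> T = S"
begin

lemma one_in [simp, intro]: "1 \<in> S"
  and diff_in [intro]: "x \<in> S \<Longrightarrow> y \<in> S \<Longrightarrow> x - y \<in> S"
  and mult_in [intro]: "x \<in> S \<Longrightarrow> y \<in> S \<Longrightarrow> x * y \<in> S"
  using sub by (auto simp: unital_subring_def)

lemma zero_in [simp, intro]: "0 \<in> S"
  using diff_in[OF one_in one_in] by simp

lemma minus_in: "x \<in> S \<Longrightarrow> - x \<in> S"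
  using diff_in[OF zero_in] by fastforce

lemma add_in [intro]: "x \<in> S \<Longrightarrow> y \<in> S \<Longrightarrow> x + y \<in> S"
  using diff_in[OF _ minus_in, of x y] by simp

lemma of_nat_in [simp, intro]: "of_nat n \<in> S"
  by (induction n) auto

lemma of_int_in [simp, intro]: "of_int n \<in> S"
  by (cases n) (auto intro!: minus_in simp del: of_nat_Suc)

lemma power_in [intro]: "x \<in> S \<Longrightarrow> x ^ n \<in> S"
  by (induction n) auto

lemma sum_in: "(\<And>i. i \<in> A \<Longrightarrow> f i \<in> S) \<Longrightarrow> sum f A \<in> S"
  by (induction A rule: infinite_finite_induct) auto

lemma p_nz [simp]: "p \<noteq> 0"
  using prime by auto

text \<open>S[z] is a subring strictly larger than \<open>S\<close>, so maximality forces it to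
  contain 1 / p.\<close>

lemma adjoin:
  assumes "z \<notin> S"
  obtains n c where "\<And>i. c i \<in> S" "inverse (of_nat p) = (\<Sum>i\<le>n. c i * z ^ i)"
proof -
  define T where "T = {poly f z | f. \<forall>i. Polynomial.coeff f i \<in> S}"
  have "unital_subring T"
    unfolding unital_subring_def
  proof (intro conjI ballI)
    show "1 \<in> T" unfolding T_def
      by (intro CollectI exI[of _ 1]) (auto simp: Polynomial.coeff_1)
    fix x y assume "x \<in> T" "y \<in> T"
    then obtain f g where fg: "x = poly f z" "y = poly g z" "\<And>i. Polynomial.coeff f i \<in> S" "\<And>i. Polynomial.coeff g i \<in> S"
      by (auto simp: T_def)
    show "x - y \<in> T" unfolding T_def
      by (intro CollectI exI[of _ "f - g"]) (auto simp: fg)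
    show "x * y \<in> T" unfolding T_def
      by (intro CollectI exI[of _ "f * g"]) (auto simp: fg Polynomial.coeff_mult intro!: sum_in)
  qed
  moreover have "S \<subseteq> T"
  proof
    fix x assume "x \<in> S"
    then show "x \<in> T" unfolding T_def
      by (intro CollectI exI[of _ "[:x:]"]) (auto simp: Polynomial.coeff_pCons split: nat.split)
  qed
  moreover have "z \<in> T" unfolding T_def
    by (intro CollectI exI[of _ "[:0, 1:]"]) (auto simp: Polynomial.coeff_pCons split: nat.split)
  ultimately have "inverse (of_nat p) \<in> T" using maximal[of T] assms by blast
  then obtain f where "inverse (of_nat p) = poly f z" "\<And>i. Polynomial.coeff f i \<in> S" by (auto simp: T_def)
  then show thesis using that[of "Polynomial.coeff f" "Polynomial.degree f"] by (simp add: poly_altdef)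
qed

text \<open>This says that p lies in every maximal ideal of \<open>S\<close>. Otherwise 1 / p would
  be a polynomial in 1 / u for u = 1 - p s; multiplying by \<open>u ^ n\<close>, which has the form
  1 - p t, clears the denominators and puts 1 / p - t into \<open>S\<close>, contrary to
  \<open>notin\<close>.\<close>

lemma unit:
  assumes s: "s \<in> S"
  shows "1 - of_nat p * s \<noteq> 0" "inverse (1 - of_nat p * s) \<in> S"
proof -
  define u where "u = 1 - of_nat p * s"
  show nz: "1 - of_nat p * s \<noteq> 0"
  proof
    assume "1 - of_nat p * s = 0"
    then have "s = inverse (of_nat p)" by (simp add: inverse_unique)
    then show False using notin s by simp
  qed
  have u: "u \<in> S" using s by (auto simp: u_def)
  have pow: "\<exists>t\<in>S. u ^ k = 1 - of_nat p * t" for k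
  proof (induction k)
    case 0
    show ?case by (rule bexI[of _ 0]) auto
  next
    case (Suc k)
    then obtain t where t: "t \<in> S" "u ^ k = 1 - of_nat p * t" by blast
    have "u ^ Suc k = 1 - of_nat p * (t + s - of_nat p * (t * s))"
      unfolding power_Suc t(2) by (simp add: u_def algebra_simps)
    moreover have "t + s - of_nat p * (t * s) \<in> S" using s t by blast
    ultimately show ?case by blast
  qed
  show "inverse (1 - of_nat p * s) \<in> S"
  proof (rule ccontr)
    assume "inverse (1 - of_nat p * s) \<notin> S"
    then obtain n c where c: "\<And>i. c i \<in> S" "inverse (of_nat p) = (\<Sum>i\<le>n. c i * inverse u ^ i)"
      unfolding u_def[symmetric] using adjoin by metis
    have "u ^ n * inverse (of_nat p) = (\<Sum>i\<le>n. c i * u ^ (n - i))"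
      unfolding c(2) sum_distrib_left
    proof (intro sum.cong refl)
      fix i assume "i \<in> {..n}"
      then have "u ^ n = u ^ (n - i) * u ^ i" by (simp add: power_add[symmetric])
      then show "u ^ n * (c i * inverse u ^ i) = c i * u ^ (n - i)"
        using nz by (simp add: u_def field_simps)
    qed
    then have "u ^ n * inverse (of_nat p) \<in> S" using c u by (auto intro!: sum_in)
    moreover obtain t where t: "t \<in> S" "u ^ n = 1 - of_nat p * t" using pow by blast
    moreover have "u ^ n * inverse (of_nat p) = inverse (of_nat p) - t" unfolding t(2) by (simp add: field_simps)
    ultimately have "inverse (of_nat p) - t \<in> S" by metis
    then have "inverse (of_nat p) - t + t \<in> S" using t by blast
    then show False using notin by simp
  qed
qed

text \<open>A relation of degree at most n showing that p becomes invertible in S[z], multiplied by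
  p. The degree is recorded because Chevalley's argument descends on it.\<close>

definition rep :: "'a \<Rightarrow> nat \<Rightarrow> bool" where
  "rep z n \<longleftrightarrow> (\<exists>c. (\<forall>i. c i \<in> S) \<and> 1 = (\<Sum>i\<le>n. of_nat p * c i * z ^ i))"

lemma repI:
  assumes "z \<notin> S" shows "\<exists>n. rep z n"
proof -
  obtain n c where c: "\<And>i. c i \<in> S" "inverse (of_nat p) = (\<Sum>i\<le>n. c i * z ^ i)" using adjoin[OF assms] by metis
  have "of_nat p * inverse (of_nat p) = (\<Sum>i\<le>n. of_nat p * c i * z ^ i)"
    unfolding c(2) sum_distrib_left by (simp add: mult.assoc)
  moreover have "of_nat p * inverse (of_nat p) = (1 :: 'a)" by simp
  ultimately have "1 = (\<Sum>i\<le>n. of_nat p * c i * z ^ i)" by metis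
  then show ?thesis using c(1) unfolding rep_def by blast
qed

lemma not_rep_0: "\<not> rep z 0"
  using unit unfolding rep_def by fastforce

text \<open>In the relation for 1 / z the constant terms combine to the unit 1 - p b_0. Dividing by
  it and multiplying by \<open>z ^ m\<close> expresses \<open>z ^ m\<close> through lower powers
  with coefficients in pS, which eliminates the top term of the relation for z. The condition k
  \<le> m keeps all exponents nonnegative.\<close>

lemma rep_reduce:
  assumes z: "z \<noteq> 0" and "rep z m" "rep (inverse z) k" "k \<le> m"
  shows "rep z (m - 1)"
proof -
  obtain a where a: "\<And>i. a i \<in> S" "1 = (\<Sum>i\<le>m. of_nat p * a i * z ^ i)" using assms(2) by (auto simp: rep_def)
  obtain b where b: "\<And>i. b i \<in> S" "1 = (\<Sum>i\<le>k. of_nat p * b i * inverse z ^ i)" using assms(3) by (auto simp: rep_def)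
  have m: "m > 0" using assms(2) not_rep_0 by (cases m) auto
  define u where "u = 1 - of_nat p * b 0"
  have u: "u \<noteq> 0" "inverse u \<in> S" using unit[OF b(1)] by (auto simp: u_def)
  \<comment> \<open>Padding with zeros beyond k gives the sum the length m, so that the powers
    \<open>z ^ (m - i)\<close> can be reindexed.\<close>
  define b' where "b' i = (if i \<le> k then b i * inverse u else 0)" for i
  have b': "b' i \<in> S" for i using b u by (auto simp: b'_def)
  have "1 = of_nat p * b 0 + (\<Sum>i=1..k. of_nat p * b i * inverse z ^ i)"
    using b(2) by (simp add: atMost_atLeast0 sum.atLeast_Suc_atMost)
  then have "u = (\<Sum>i=1..k. of_nat p * b i * inverse z ^ i)"
    unfolding u_def by (metis add_diff_cancel_left')
  then have "1 = inverse u * (\<Sum>i=1..k. of_nat p * b i * inverse z ^ i)" using u by (metis left_inverse)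
  also have "\<dots> = (\<Sum>i=1..k. of_nat p * b' i * inverse z ^ i)"
    by (simp add: sum_distrib_left b'_def mult_ac)
  also have "\<dots> = (\<Sum>i=1..m. of_nat p * b' i * inverse z ^ i)"
    using assms(4) by (intro sum.mono_neutral_left) (auto simp: b'_def)
  finally have "z ^ m = (\<Sum>i=1..m. of_nat p * b' i * inverse z ^ i) * z ^ m" by simp
  also have "\<dots> = (\<Sum>i=1..m. of_nat p * b' i * z ^ (m - i))"
    unfolding sum_distrib_right
  proof (intro sum.cong refl)
    fix i assume "i \<in> {1..m}"
    then have "z ^ m = z ^ (m - i) * z ^ i" by (simp add: power_add[symmetric])
    then show "of_nat p * b' i * inverse z ^ i * z ^ m = of_nat p * b' i * z ^ (m - i)"
      using z by (simp add: field_simps)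
  qed
  also have "\<dots> = (\<Sum>i<m. of_nat p * b' (m - i) * z ^ i)"
    by (rule sum.reindex_bij_witness[of _ "\<lambda>i. m - i" "\<lambda>i. m - i"]) auto
  finally have zm: "z ^ m = (\<Sum>i<m. of_nat p * b' (m - i) * z ^ i)" .
  have "1 = (\<Sum>i<m. of_nat p * a i * z ^ i) + of_nat p * a m * z ^ m"
    using a(2) by (metis lessThan_Suc_atMost sum.lessThan_Suc)
  also have "\<dots> = (\<Sum>i<m. of_nat p * (a i + of_nat p * (a m * b' (m - i))) * z ^ i)"
    unfolding zm by (simp add: sum_distrib_left sum.distrib algebra_simps)
  also have "{..<m} = {..m - 1}" using m by auto
  finally have "1 = (\<Sum>i\<le>m - 1. of_nat p * (a i + of_nat p * (a m * b' (m - i))) * z ^ i)" .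
  moreover have "a i + of_nat p * (a m * b' (m - i)) \<in> S" for i
    using a(1) b' by (intro add_in mult_in) auto
  ultimately show ?thesis unfolding rep_def by (intro exI[of _ "\<lambda>i. a i + of_nat p * (a m * b' (m - i))"]) blast
qed

text \<open>If neither z nor 1 / z lay in \<open>S\<close>, both would satisfy relations. Of two
  shortest ones the longer could be shortened by means of the other.\<close>

lemma valuation_ring: "z \<in> S \<or> inverse z \<in> S"
proof (rule ccontr)
  assume n: "\<not> ?thesis"
  then have z: "z \<noteq> 0" by auto
  define m where "m = (LEAST m. rep z m)"
  define k where "k = (LEAST k. rep (inverse z) k)"
  have m: "rep z m" and k: "rep (inverse z) k" using n repI by (auto simp: m_def k_def intro: LeastI_ex)
  have "m > 0" "k > 0" using m k not_rep_0 by (metis neq0_conv)+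
  then have l: "\<not> rep z (m - 1)" "\<not> rep (inverse z) (k - 1)"
    using not_less_Least[of "m - 1" "rep z"] not_less_Least[of "k - 1" "rep (inverse z)"]
    unfolding m_def[symmetric] k_def[symmetric] by auto
  show False
    using rep_reduce[OF z m k] rep_reduce[of "inverse z" k m] m k z l by force
qed

section \<open>Units of the valuation ring and its value group\<close>

definition unit_in :: "'a \<Rightarrow> bool" where
  "unit_in x \<longleftrightarrow> x \<noteq> 0 \<and> x \<in> S \<and> inverse x \<in> S"

lemma unit_in_1 [simp]: "unit_in 1" by (auto simp: unit_in_def)

lemma unit_in_mult: "unit_in x \<Longrightarrow> unit_in y \<Longrightarrow> unit_in (x * y)"
  by (auto simp: unit_in_def)

lemma unit_in_inverse: "unit_in x \<Longrightarrow> unit_in (inverse x)"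
  by (auto simp: unit_in_def)

lemma unit_in_divide: "unit_in x \<Longrightarrow> unit_in y \<Longrightarrow> unit_in (x / y)"
  by (simp add: divide_inverse unit_in_mult unit_in_inverse)

lemma unit_in_power: "unit_in x \<Longrightarrow> unit_in (x ^ n)"
  by (induction n) (auto intro: unit_in_mult)

lemma unit_in_factor: "unit_in (x * y) \<Longrightarrow> x \<in> S \<Longrightarrow> y \<in> S \<Longrightarrow> unit_in x"
proof -
  assume u: "unit_in (x * y)" and xy: "x \<in> S" "y \<in> S"
  then have "y * inverse (x * y) \<in> S" by (auto simp: unit_in_def)
  moreover have "y * inverse (x * y) = inverse x" using u by (auto simp: unit_in_def field_simps)
  ultimately have "inverse x \<in> S" by metis
  then show ?thesis using u xy by (auto simp: unit_in_def)
qed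

lemma p_not_unit: "\<not> unit_in (of_nat p)"
  using notin by (simp add: unit_in_def)

lemma unit_of_nat: "\<not> p dvd m \<Longrightarrow> unit_in (of_nat m)"
proof -
  assume "\<not> p dvd m"
  then have "coprime (int p) (int m)" using prime by (simp add: prime_imp_coprime)
  then obtain u v where uv: "u * int p + v * int m = 1" by (metis bezout_int coprime_imp_gcd_eq_1)
  have "(1::'a) = of_int u * of_nat p + of_int v * of_nat m"
    using uv by (metis of_int_1 of_int_add of_int_mult of_int_of_nat_eq)
  then have e: "of_nat m * of_int v = (1::'a) - of_nat p * of_int u" by (simp add: algebra_simps)
  have "unit_in (1 - of_nat p * of_int u)"
    unfolding unit_in_def using unit[OF of_int_in] by auto
  then show ?thesis unfolding e[symmetric] by (rule unit_in_factor) auto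
qed

text \<open>One of x and y divides the other in \<open>S\<close>, hence divides the sum; a unit sum
  would make that divisor a unit.\<close>

lemma nonunit_add:
  assumes "x \<in> S" "y \<in> S" "\<not> unit_in x" "\<not> unit_in y"
  shows "\<not> unit_in (x + y)"
proof (cases "x = 0 \<or> y = 0")
  case False
  have *: "\<not> unit_in (x + y)" if h: "x \<in> S" "y \<in> S" "\<not> unit_in x" "x \<noteq> 0" "y / x \<in> S" for x y
  proof
    assume "unit_in (x + y)"
    moreover have "x + y = x * (1 + y / x)" using h by (simp add: field_simps)
    ultimately have "unit_in x" using h unit_in_factor[of x "1 + y / x"] by (metis add_in one_in)
    then show False using h by simp
  qed
  have "y / x \<in> S \<or> x / y \<in> S" using valuation_ring[of "y / x"] by simp
  then show ?thesis using *[of x y] *[of y x] assms False by (auto simp: add.commute)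
qed (use assms in auto)

lemma nonunit_sum:
  assumes "finite A" "\<And>i. i \<in> A \<Longrightarrow> f i \<in> S \<and> \<not> unit_in (f i)"
  shows "\<not> unit_in (sum f A)"
  using assms
proof (induction A)
  case empty
  then show ?case by (simp add: unit_in_def)
next
  case (insert x A)
  then show ?case using nonunit_add[of "f x" "sum f A"] sum_in[of A f] by auto
qed

lemma integrally_closed:
  assumes "x ^ n \<in> S" "n > 0" shows "x \<in> S"
proof (cases "x \<in> S \<or> x = 0")
  case False
  then have "inverse x \<in> S" using valuation_ring by blast
  then have "x ^ n * inverse x ^ (n - 1) \<in> S" using assms by blast
  moreover have "x ^ n * inverse x ^ (n - 1) = x"
    using assms(2) False by (cases n) (auto simp: field_simps)
  ultimately show ?thesis by simp
qed auto

text \<open>No real-valued valuation exists yet. Divisibility in \<open>S\<close> is a total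
  preorder because \<open>S\<close> is a valuation ring, so a finite family of nonzero elements has
  a member of which all others are multiples.\<close>

lemma max_term:
  assumes "finite A" "A \<noteq> {}" "\<And>i. i \<in> A \<Longrightarrow> f i \<noteq> 0"
  shows "\<exists>i\<in>A. \<forall>j\<in>A. f j / f i \<in> S"
  using assms
proof (induction A rule: finite_ne_induct)
  case (insert x A)
  then obtain i where i: "i \<in> A" "\<And>j. j \<in> A \<Longrightarrow> f j / f i \<in> S" by auto
  show ?case
  proof (cases "f x / f i \<in> S")
    case True
    then show ?thesis using i by auto
  next
    case False
    then have fi: "f i / f x \<in> S" using valuation_ring[of "f x / f i"] by simp
    have "f j / f x \<in> S" if "j \<in> A" for j
    proof -
      have "f j / f x = f j / f i * (f i / f x)" using insert.prems i by simp
      then show ?thesis using i(2)[OF that] fi by (simp only: mult_in)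
    qed
    then show ?thesis using insert.prems by (intro bexI[of _ x]) auto
  qed
qed auto

lemma p_powi_unit: "unit_in (of_nat p powi m) \<Longrightarrow> m = 0"
proof (rule ccontr)
  assume u: "unit_in (of_nat p powi m)" and m: "m \<noteq> 0"
  define n where "n = nat \<bar>m\<bar>"
  have "unit_in (of_nat p powi \<bar>m\<bar>)"
  proof (cases "m \<ge> 0")
    case False
    then have "of_nat p powi \<bar>m\<bar> = inverse (of_nat p powi m :: 'a)" by (simp add: power_int_minus)
    then show ?thesis using u by (metis unit_in_inverse)
  qed (use u in simp)
  then have "unit_in (of_nat p ^ n)" by (simp add: n_def power_int_def)
  moreover have "n = Suc (n - 1)" using m by (simp add: n_def)
  ultimately have "unit_in (of_nat p * of_nat p ^ (n - 1))" by (metis power_Suc)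
  then show False using unit_in_factor p_not_unit by blast
qed

lemma unit_of_int_powi:
  assumes "c \<noteq> (0::int)"
  shows "\<exists>m::int. unit_in (of_int c / of_nat p powi m)"
proof -
  define v where "v = multiplicity p (nat \<bar>c\<bar>)"
  obtain m where m: "nat \<bar>c\<bar> = p ^ v * m" "\<not> p dvd m"
    using multiplicity_decompose'[of "nat \<bar>c\<bar>" p] assms prime unfolding v_def
    by (metis not_prime_unit zero_less_abs_iff nat_0_iff not_less)
  have "of_int \<bar>c\<bar> = (of_nat p ^ v * of_nat m :: 'a)"
    using m(1) by (metis abs_ge_zero nat_0_le of_int_of_nat_eq of_nat_mult of_nat_power)
  then have "unit_in (of_int \<bar>c\<bar> / of_nat p powi int v)"
    using unit_of_nat[OF m(2)] by simp
  moreover have "of_int c = (of_int \<bar>c\<bar> :: 'a) \<or> of_int c = - (of_int \<bar>c\<bar> :: 'a)" by (cases "c \<ge> 0") auto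
  moreover have "unit_in (- x)" if "unit_in x" for x using that minus_in by (auto simp: unit_in_def)
  ultimately show ?thesis by (metis minus_divide_left)
qed

text \<open>In an algebraic equation for z at least two terms have the same value, since a single
  dominant term cannot cancel. Their quotient equates a power of z, up to a unit, with a rational
  number, which is a unit times a power of p. Thus the value group lies in the divisible hull of the
  value of p: the valuation has rank one.\<close>

lemma power_unit:
  assumes z: "z \<noteq> 0" and alg: "\<exists>q::rat poly. q \<noteq> 0 \<and> poly (map_poly of_rat q) z = 0"
  shows "\<exists>k m. k > 0 \<and> unit_in (z ^ k / of_nat p powi m)"
proof -
  obtain q :: "rat poly" where q: "q \<noteq> 0" "poly (map_poly of_rat q) z = 0" using alg by blast
  define t where "t i = of_rat (Polynomial.coeff q i) * z ^ i" for i
  define A where "A = {i. i \<le> Polynomial.degree q \<and> Polynomial.coeff q i \<noteq> 0}"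
  have fin: "finite A" by (auto simp: A_def)
  have ne: "A \<noteq> {}" using q by (auto simp: A_def intro: exI[of _ "Polynomial.degree q"])
  have tnz: "t i \<noteq> 0" if "i \<in> A" for i using that z by (auto simp: A_def t_def)
  have "(\<Sum>i\<in>A. t i) = (\<Sum>i\<le>Polynomial.degree q. t i)"
    by (rule sum.mono_neutral_left) (auto simp: A_def t_def)
  also have "\<dots> = poly (map_poly of_rat q) z"
    by (simp add: poly_altdef t_def coeff_map_poly degree_map_poly)
  finally have s0: "(\<Sum>i\<in>A. t i) = 0" using q by simp
  have "\<exists>i\<in>A. \<forall>j\<in>A. t j / t i \<in> S" by (rule max_term[OF fin ne]) (rule tnz)
  then obtain i where i: "i \<in> A" "\<forall>j\<in>A. t j / t i \<in> S" by (elim bexE)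
  \<comment> \<open>The remaining terms, divided by \<open>t i\<close>, add up to -1, which is a
    unit; so not all of them are nonunits.\<close>
  have "\<exists>j\<in>A - {i}. unit_in (t j / t i)"
  proof (rule ccontr)
    assume "\<not> ?thesis"
    then have "\<not> unit_in (\<Sum>j\<in>A-{i}. t j / t i)" using fin i by (intro nonunit_sum) auto
    moreover have "(\<Sum>j\<in>A-{i}. t j / t i) = -1"
    proof -
      have "(\<Sum>j\<in>A-{i}. t j) = - t i" using s0 sum.remove[OF fin i(1), of t] by (metis add_eq_0_iff)
      then have "(\<Sum>j\<in>A-{i}. t j) / t i = -1" using tnz[OF i(1)] by simp
      then show ?thesis by (simp only: sum_divide_distrib)
    qed
    moreover have "unit_in (-1)" using minus_in[of 1] by (auto simp: unit_in_def)
    ultimately show False by simp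
  qed
  then obtain j where j: "j \<in> A" "j \<noteq> i" "unit_in (t j / t i)" by blast
  have un: "\<exists>m. unit_in (of_rat x / of_nat p powi m)" if x: "x \<noteq> 0" for x :: rat
  proof -
    obtain a b where ab: "b \<noteq> 0" "x = of_int a / of_int b" by (rule rat_cases_of_int)
    obtain m1 where m1: "unit_in (of_int a / of_nat p powi m1)" using unit_of_int_powi[of a] x ab by auto
    obtain m2 where m2: "unit_in (of_int b / of_nat p powi m2)" using unit_of_int_powi[of b] ab by auto
    have "unit_in ((of_int a / of_nat p powi m1) / (of_int b / of_nat p powi m2))"
      using m1 m2 by (rule unit_in_divide)
    also have "(of_int a / of_nat p powi m1) / (of_int b / of_nat p powi m2) = of_rat x / of_nat p powi (m1 - m2)"
      using ab(1) by (simp add: ab(2) power_int_diff of_rat_divide)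
    finally show ?thesis by blast
  qed
  obtain m where m: "unit_in (of_rat (Polynomial.coeff q i / Polynomial.coeff q j) / of_nat p powi m)"
    using un[of "Polynomial.coeff q i / Polynomial.coeff q j"] i j by (auto simp: A_def)
  have *: "\<exists>k m. k > 0 \<and> unit_in (z ^ k / of_nat p powi m)"
    if "j > i" "unit_in (t j / t i)" "unit_in (of_rat (Polynomial.coeff q i / Polynomial.coeff q j) / of_nat p powi m)" "i \<in> A" "j \<in> A" for i j m
  proof -
    have "unit_in (t j / t i * (of_rat (Polynomial.coeff q i / Polynomial.coeff q j) / of_nat p powi m))"
      using that by (intro unit_in_mult)
    also have "t j / t i * (of_rat (Polynomial.coeff q i / Polynomial.coeff q j) / of_nat p powi m) = z ^ (j - i) / of_nat p powi m"
      using that z by (simp add: t_def of_rat_divide A_def power_diff field_simps)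
    finally show ?thesis using that(1) by (metis zero_less_diff)
  qed
  show ?thesis
  proof (cases "j > i")
    case True
    then show ?thesis using * i j m by blast
  next
    case False
    then have "i > j" using j by simp
    moreover have "unit_in (t i / t j)" using unit_in_inverse[OF j(3)] by simp
    moreover have "unit_in (of_rat (Polynomial.coeff q j / Polynomial.coeff q i) / of_nat p powi (- m))"
      using unit_in_inverse[OF m] by (simp add: of_rat_divide power_int_minus field_simps)
    ultimately show ?thesis using * i j by blast
  qed
qed

end

section \<open>Existence of a maximal subring and the real-valued extension\<close>

lemma maximal_subring_exists:
  assumes p: "Factorial_Ring.prime p"
  shows "\<exists>S :: 'a :: field_char_0 set. maximal_subring S p"
proof -
  let ?A = "{S :: 'a set. unital_subring S \<and> inverse (of_nat p) \<notin> S}"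
  have "range of_int \<in> ?A"
  proof -
    have "unital_subring (range of_int :: 'a set)"
      unfolding unital_subring_def
    proof (intro conjI ballI)
      show "1 \<in> (range of_int :: 'a set)" by (metis of_int_1 rangeI)
      fix x y assume "x \<in> (range of_int :: 'a set)" "y \<in> (range of_int :: 'a set)"
      then obtain i j where "x = of_int i" "y = of_int j" by blast
      then show "x - y \<in> range of_int" "x * y \<in> range of_int"
        by (metis of_int_diff rangeI) (metis of_int_mult rangeI \<open>x = of_int i\<close> \<open>y = of_int j\<close>)
    qed
    moreover have "inverse (of_nat p) \<notin> (range of_int :: 'a set)"
    proof
      assume "inverse (of_nat p) \<in> (range of_int :: 'a set)"
      then obtain k where k: "inverse (of_nat p) = (of_int k :: 'a)" by blast
      then have "of_nat p * inverse (of_nat p) = (of_int (int p * k) :: 'a)" by simp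
      then have "of_int (int p * k) = (of_int 1 :: 'a)" using p by (simp add: prime_gt_0_nat)
      then have "int p * k = 1" by (simp only: of_int_eq_iff)
      then have "is_unit (int p)" by (metis dvd_triv_left)
      then show False using p by auto
    qed
    ultimately show ?thesis by simp
  qed
  then have ne: "?A \<noteq> {}" by blast
  have chain: "\<Union>C \<in> ?A" if C: "C \<noteq> {}" "subset.chain ?A C" for C
  proof -
    have tot: "U \<subseteq> Y \<or> Y \<subseteq> U" if "U \<in> C" "Y \<in> C" for U Y
      using C(2) that by (auto simp: subset_chain_def)
    have CA: "C \<subseteq> ?A" using C(2) by (auto simp: subset_chain_def)
    have "unital_subring (\<Union>C)"
      unfolding unital_subring_def
    proof (intro conjI ballI)
      show "1 \<in> \<Union>C" using C CA by (auto simp: unital_subring_def)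
      fix x y assume "x \<in> \<Union>C" "y \<in> \<Union>C"
      then obtain U Y where XY: "U \<in> C" "Y \<in> C" "x \<in> U" "y \<in> Y" by blast
      then obtain Z where "Z \<in> C" "x \<in> Z" "y \<in> Z" using tot by blast
      then show "x - y \<in> \<Union>C" "x * y \<in> \<Union>C" using CA by (auto simp: unital_subring_def)
    qed
    then show "\<Union>C \<in> ?A" using CA by auto
  qed
  obtain M where M: "M \<in> ?A" "\<And>U. U \<in> ?A \<Longrightarrow> M \<subseteq> U \<Longrightarrow> U = M"
    using subset_Zorn_nonempty[OF ne chain] by metis
  have "maximal_subring M p"
    using M p by unfold_locales auto
  then show ?thesis by blast
qed

text \<open>By \<open>power_unit\<close> some z^k is a unit times p^m, so the additive value of z
  has to be m / k. With p to the power -m/k as absolute value, p itself receives 1 / p and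
  \<open>S\<close> becomes the closed unit ball, from which the ultrametric inequality is read
  off.\<close>

theorem padic_extension:
  assumes p: "Factorial_Ring.prime p"
    and alg: "\<And>z::'a::field_char_0. \<exists>q::rat poly. q \<noteq> 0 \<and> poly (map_poly of_rat q) z = 0"
  shows "\<exists>b :: 'a \<Rightarrow> real. absolute_value b \<and> (\<forall>q. b (of_rat q) = padic_abs p q)"
proof -
  obtain S :: "'a set" where "maximal_subring S p" using maximal_subring_exists[OF p] by blast
  then interpret maximal_subring S p .
  have p1: "real p > 1" using prime_gt_1_nat[OF p] by simp
  define R where "R z k m \<longleftrightarrow> k > 0 \<and> unit_in (z ^ k / of_nat p powi m)" for z :: 'a and k :: nat and m :: int
  have ex: "\<exists>k m. R z k m" if "z \<noteq> 0" for z using power_unit[OF that alg] by (auto simp: R_def)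
  \<comment> \<open>Raising the two relations to the powers k' and k turns a power of p with
    exponent m' k - m k' into a unit, which forces this exponent to be 0.\<close>
  have uniq: "of_int m / real k = of_int m' / real k'" if "R z k m" "R z k' m'" for z k m k' m'
  proof -
    have "unit_in ((z ^ k / of_nat p powi m) ^ k' / (z ^ k' / of_nat p powi m') ^ k)"
      using that by (intro unit_in_divide[of "_ ^ k'" "_ ^ k"] unit_in_power) (auto simp: R_def)
    moreover have "z \<noteq> 0" using that by (auto simp: R_def unit_in_def)
    ultimately have "unit_in (of_nat p powi (m' * int k - m * int k'))"
      by (simp add: power_divide power_int_diff power_int_mult power_mult[symmetric] mult.commute)
    then have "m' * int k = m * int k'" using p_powi_unit by fastforce
    then have "of_int m' * real k = of_int m * real k'" by (metis of_int_mult of_int_of_nat_eq)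
    then show ?thesis using that by (auto simp: R_def field_simps)
  qed
  define v where "v z = (THE r. \<exists>k m. R z k m \<and> r = of_int m / real k)" for z
  have v: "v z = of_int m / real k" if "R z k m" for z k m
    unfolding v_def by (rule the_equality) (use that uniq in blast)+
  have R_mult: "R (z * w) (k * l) (m * int l + n * int k)" if "R z k m" "R w l n" for z w k l m n
  proof -
    have "unit_in ((z ^ k / of_nat p powi m) ^ l * (w ^ l / of_nat p powi n) ^ k)"
      using that by (intro unit_in_mult[of "_ ^ l" "_ ^ k"] unit_in_power) (auto simp: R_def)
    also have "(z ^ k / of_nat p powi m) ^ l * (w ^ l / of_nat p powi n) ^ k =
      (z * w) ^ (k * l) / of_nat p powi (m * int l + n * int k)"
      by (simp add: power_divide power_mult_distrib power_int_add power_int_mult power_mult[symmetric] mult.commute)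
    finally show ?thesis using that by (simp add: R_def)
  qed
  have v_mult: "v (z * w) = v z + v w" if zw: "z \<noteq> 0" "w \<noteq> 0" for z w
  proof -
    obtain k m l n where kl: "R z k m" "R w l n" using ex zw by metis
    have "k > 0" "l > 0" using kl by (auto simp: R_def)
    then show ?thesis unfolding v[OF R_mult[OF kl]] v[OF kl(1)] v[OF kl(2)]
      by (simp add: add_divide_distrib)
  qed
  have v_S: "z \<in> S \<longleftrightarrow> v z \<ge> 0" if z: "z \<noteq> 0" for z
  proof -
    obtain k m where km: "R z k m" using ex z by metis
    then have k: "k > 0" and u: "unit_in (z ^ k / of_nat p powi m)" by (auto simp: R_def)
    have "z \<in> S \<longleftrightarrow> m \<ge> 0"
    proof
      assume "m \<ge> 0"
      then have "of_nat p powi m \<in> S" by (auto simp: power_int_def)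
      then have "(z ^ k / of_nat p powi m) * of_nat p powi m \<in> S" using u by (intro mult_in) (auto simp: unit_in_def)
      then show "z \<in> S" using integrally_closed k by simp
    next
      assume zS: "z \<in> S"
      show "m \<ge> 0"
      proof (rule ccontr)
        assume m: "\<not> m \<ge> 0"
        then have "unit_in (of_nat p powi (-m) * z ^ k)" using u by (simp add: power_int_minus field_simps)
        then have "unit_in (of_nat p powi (-m))"
          by (rule unit_in_factor) (use zS m in \<open>auto simp: power_int_def\<close>)
        then show False using p_powi_unit m by force
      qed
    qed
    then show ?thesis unfolding v[OF km] using k by (simp add: zero_le_divide_iff)
  qed
  define b where "b z = (if z = 0 then 0 else real p powr (- v z))" for z
  have b_nn: "b z \<ge> 0" for z by (auto simp: b_def)
  have b_z: "b z = 0 \<longleftrightarrow> z = 0" for z using p1 by (auto simp: b_def)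
  have b_m: "b (z * w) = b z * b w" for z w
    by (auto simp: b_def v_mult powr_add[symmetric])
  have b_S: "z \<in> S \<longleftrightarrow> b z \<le> 1" for z
    using v_S[of z] p1 powr_le_cancel_iff[of "real p" "- v z" 0] by (auto simp: b_def)
  have b_1: "b 1 = 1" using b_m[of 1 1] b_z[of 1] by simp
  have b_div: "b (z / w) = b z / b w" if "w \<noteq> 0" for z w
  proof -
    have "b (z / w) * b w = b z" using b_m[of "z / w" w] that by simp
    then show ?thesis using b_z that by (metis nonzero_mult_div_cancel_right)
  qed
  have b_um: "b (z + w) \<le> max (b z) (b w)" for z w
  proof -
    have *: "b (z + w) \<le> b w" if "w \<noteq> 0" "z / w \<in> S" for z w
    proof -
      have "z + w = (1 + z / w) * w" using that by (simp add: field_simps)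
      then have "b (z + w) = b (1 + z / w) * b w" by (simp add: b_m)
      also have "\<dots> \<le> 1 * b w" using that b_S[of "1 + z / w"] b_nn by (intro mult_right_mono) auto
      finally show ?thesis by simp
    qed
    consider "z = 0" | "w = 0" | "z \<noteq> 0" "w \<noteq> 0" "z / w \<in> S" | "z \<noteq> 0" "w \<noteq> 0" "w / z \<in> S"
      using valuation_ring[of "z / w"] by force
    then show ?thesis using *[of w z] *[of z w] by cases (auto simp: le_max_iff_disj add.commute)
  qed
  have b_av: "absolute_value b"
    unfolding absolute_value_def
  proof (intro conjI allI)
    fix x y show "b (x + y) \<le> b x + b y" using b_um[of x y] b_nn[of x] b_nn[of y] by linarith
  qed (use b_nn b_z b_m in auto)
  interpret b: abs_value b by unfold_locales (rule b_av)
  have av: "absolute_value (\<lambda>q. b (of_rat q))"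
    unfolding absolute_value_def by (auto simp: of_rat_mult of_rat_add b.mult b.add)
  have nat: "b (of_nat n) = padic_abs p (of_nat n)" for n
  proof (cases "n = 0")
    case False
    define e where "e = multiplicity p n"
    obtain m where m: "n = p ^ e * m" "\<not> p dvd m"
      using multiplicity_decompose'[of n p] False prime unfolding e_def
      by (metis not_prime_unit)
    have "R (of_nat n) 1 (int e)" using unit_of_nat[OF m(2)] by (simp add: R_def m(1))
    then have "v (of_nat n) = real e" by (simp add: v)
    then have "b (of_nat n) = real p powr (- real e)" using False by (simp add: b_def)
    also have "\<dots> = padic_abs p (of_nat n)" unfolding padic_abs_of_nat[OF p False] e_def[symmetric]
      using p1 by (simp add: powr_real_of_int'[symmetric] powr_minus power_int_minus powr_realpow)
    finally show ?thesis .
  qed (simp add: padic_abs_def)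
  have "b (of_rat q) = padic_abs p q" for q
  proof -
    have "b (of_rat q) = padic_abs p q powr 1"
      by (rule rat_av_eqI[OF padic_abs_absolute_value[OF p] av]) (simp add: nat padic_abs_def)
    then show ?thesis by (simp add: padic_abs_def)
  qed
  then show ?thesis using b_av by blast
qed

section \<open>Rational-linear maps and field embeddings\<close>

interpretation rat_vs: vector_space "rat_scale :: rat \<Rightarrow> 'k \<Rightarrow> 'k :: field_char_0"
  by unfold_locales (simp_all add: algebra_simps of_rat_add of_rat_mult)

declare rat_vs.scale_scale [simp del]

definition rat_linear :: "('k :: field_char_0 \<Rightarrow> 'o :: field_char_0) \<Rightarrow> bool" where
  "rat_linear \<phi> \<longleftrightarrow> (\<forall>x y. \<phi> (x + y) = \<phi> x + \<phi> y) \<and> (\<forall>q x. \<phi> (of_rat q * x) = of_rat q * \<phi> x)"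

definition field_embedding :: "('k :: field_char_0 \<Rightarrow> 'o :: field_char_0) \<Rightarrow> bool" where
  "field_embedding \<eta> \<longleftrightarrow> \<eta> 1 = 1 \<and> (\<forall>x y. \<eta> (x + y) = \<eta> x + \<eta> y) \<and> (\<forall>x y. \<eta> (x * y) = \<eta> x * \<eta> y)"

lemma rat_linear_0: "rat_linear \<phi> \<Longrightarrow> \<phi> 0 = 0"
  unfolding rat_linear_def by (metis add_cancel_right_left)

lemma rat_linear_sum: "rat_linear \<phi> \<Longrightarrow> \<phi> (sum f A) = (\<Sum>i\<in>A. \<phi> (f i))"
  by (induction A rule: infinite_finite_induct) (auto simp: rat_linear_0, auto simp: rat_linear_def)

text \<open>There are more powers of \<alpha> than elements in a spanning set. Linear dependence is
  a property of sets, hence the separate case in which two powers coincide.\<close>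

lemma number_field_algebraic:
  fixes \<alpha> :: "'k :: field_char_0"
  assumes "number_field TYPE('k)"
  shows "\<exists>f::rat poly. f \<noteq> 0 \<and> poly (map_poly of_rat f) \<alpha> = 0"
proof -
  obtain B :: "'k set" where B: "finite B" "rat_vs.span B = UNIV"
    using assms by (auto simp: number_field_def)
  show ?thesis
  proof (cases "inj_on (\<lambda>i. \<alpha> ^ i) {..card B}")
    case True
    define S where "S = (\<lambda>i. \<alpha> ^ i) ` {..card B}"
    have "card S = Suc (card B)" using True by (simp add: S_def card_image)
    then have "rat_vs.dependent S"
      using rat_vs.independent_span_bound[OF B(1), of S] B(2) by auto
    moreover have "finite S" by (simp add: S_def)
    ultimately obtain u where u: "\<exists>v\<in>S. u v \<noteq> 0" "(\<Sum>v\<in>S. of_rat (u v) * v) = 0"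
      using rat_vs.dependent_finite by blast
    define f where "f = (\<Sum>i\<le>card B. Polynomial.monom (u (\<alpha> ^ i)) i)"
    have cf: "Polynomial.coeff f i = (if i \<le> card B then u (\<alpha> ^ i) else 0)" for i
      by (simp add: f_def Polynomial.coeff_sum)
    obtain i where "i \<le> card B" "u (\<alpha> ^ i) \<noteq> 0" using u(1) by (auto simp: S_def)
    then have "Polynomial.coeff f i \<noteq> 0" by (simp add: cf)
    then have "f \<noteq> 0" by auto
    have dg: "Polynomial.degree f \<le> card B" by (rule degree_le) (simp add: cf)
    have "poly (map_poly of_rat f) \<alpha> = (\<Sum>i\<le>Polynomial.degree f. of_rat (Polynomial.coeff f i) * \<alpha> ^ i)"
      by (simp add: poly_altdef coeff_map_poly degree_map_poly)
    also have "\<dots> = (\<Sum>i\<le>card B. of_rat (Polynomial.coeff f i) * \<alpha> ^ i)"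
      using dg by (intro sum.mono_neutral_left) (auto simp: coeff_eq_0)
    also have "\<dots> = (\<Sum>v\<in>S. of_rat (u v) * v)"
      unfolding S_def by (subst sum.reindex[OF True]) (auto simp: cf)
    finally show ?thesis using u \<open>f \<noteq> 0\<close> by auto
  next
    case False
    then obtain i j where ij: "i \<noteq> j" "\<alpha> ^ i = \<alpha> ^ j" by (auto simp: inj_on_def)
    define f :: "rat poly" where "f = Polynomial.monom 1 i - Polynomial.monom 1 j"
    have "Polynomial.coeff f i = 1" using ij by (simp add: f_def)
    then have "f \<noteq> 0" by auto
    moreover have "map_poly of_rat f = (Polynomial.monom 1 i - Polynomial.monom 1 j :: 'k poly)"
      by (intro poly_eqI) (auto simp: coeff_map_poly f_def of_rat_diff)
    then have "poly (map_poly of_rat f) \<alpha> = 0" using ij by (simp add: poly_monom)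
    ultimately show ?thesis by blast
  qed
qed

lemma map_poly_of_rat_mult: "map_poly of_rat (f * g) = (map_poly of_rat f * map_poly of_rat g :: 'a :: field_char_0 poly)"
  by (intro poly_eqI) (simp add: coeff_map_poly Polynomial.coeff_mult of_rat_sum of_rat_mult)

lemma map_poly_of_rat_add: "map_poly of_rat (f + g) = (map_poly of_rat f + map_poly of_rat g :: 'a :: field_char_0 poly)"
  by (intro poly_eqI) (simp add: coeff_map_poly of_rat_add)

lemma map_poly_of_rat_pderiv: "map_poly of_rat (pderiv f) = pderiv (map_poly of_rat f :: 'a :: field_char_0 poly)"
  by (intro poly_eqI) (simp add: coeff_map_poly coeff_pderiv of_rat_mult flip: of_nat_Suc)

text \<open>Irreducibility is replaced by two minimal degrees. Let g be of least degree with root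
  \<rho>. It divides f, and \<alpha> is a root of f div g or of g; minimality of f excludes the
  former and gives deg f \<le> deg g. A double root would make the nonzero derivative, of degree
  below deg f, vanish at \<rho>.\<close>

lemma minimal_annihilator_simple_roots:
  fixes \<alpha> :: "'k :: field_char_0" and \<rho> :: "'o :: field_char_0"
  assumes f: "f \<noteq> (0 :: rat poly)" "poly (map_poly of_rat f) \<alpha> = 0"
    and min: "\<And>g::rat poly. g \<noteq> 0 \<Longrightarrow> poly (map_poly of_rat g) \<alpha> = 0 \<Longrightarrow> Polynomial.degree f \<le> Polynomial.degree g"
    and root: "poly (map_poly of_rat f) \<rho> = 0"
  shows "poly (pderiv (map_poly of_rat f)) \<rho> \<noteq> 0"
proof
  assume "poly (pderiv (map_poly of_rat f)) \<rho> = 0"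
  then have d0: "poly (map_poly of_rat (pderiv f)) \<rho> = 0" by (simp add: map_poly_of_rat_pderiv)
  let ?P = "\<lambda>g::rat poly. g \<noteq> 0 \<and> poly (map_poly of_rat g) \<rho> = 0"
  define g where "g = arg_min Polynomial.degree ?P"
  have g: "g \<noteq> 0" "poly (map_poly of_rat g) \<rho> = 0"
    using arg_min_natI[of ?P f Polynomial.degree] f root by (auto simp: g_def)
  have gmin: "Polynomial.degree g \<le> Polynomial.degree h" if "h \<noteq> 0" "poly (map_poly of_rat h) \<rho> = 0" for h
    using arg_min_nat_le[of ?P h Polynomial.degree] that by (auto simp: g_def)
  have dg: "Polynomial.degree g > 0"
  proof (rule ccontr)
    assume "\<not> ?thesis"
    then obtain c where "g = [:c:]" by (metis degree_eq_zeroE not_gr0)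
    then show False using g by (simp add: map_poly_pCons)
  qed
  have eq: "f = f div g * g + f mod g" by simp
  have m: "f mod g = 0"
  proof (rule ccontr)
    assume nz: "f mod g \<noteq> 0"
    have "map_poly of_rat f = (map_poly of_rat (f div g) * map_poly of_rat g + map_poly of_rat (f mod g) :: 'o poly)"
      by (subst eq) (simp only: map_poly_of_rat_add map_poly_of_rat_mult)
    then have "poly (map_poly of_rat (f mod g)) \<rho> = 0" using root g by simp
    then show False using gmin[OF nz] degree_mod_less'[OF g(1) nz] by simp
  qed
  have "map_poly of_rat f = (map_poly of_rat (f div g) * map_poly of_rat g :: 'k poly)"
    by (subst eq) (simp only: m map_poly_of_rat_mult add_0_right)
  then have "poly (map_poly of_rat (f div g)) \<alpha> = 0 \<or> poly (map_poly of_rat g) \<alpha> = 0" using f(2) by auto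
  moreover have fg: "f = f div g * g" using eq m by simp
  have h0: "f div g \<noteq> 0" using fg f(1) by auto
  have degf: "Polynomial.degree f = Polynomial.degree (f div g) + Polynomial.degree g"
    using h0 g(1) by (subst fg) (rule degree_mult_eq)
  ultimately have le: "Polynomial.degree f \<le> Polynomial.degree g"
    using min[OF h0] min[OF g(1)] dg by force
  have "pderiv f \<noteq> 0" using dg degf pderiv_eq_0_iff[of f] by simp
  from gmin[OF this d0] have "Polynomial.degree g \<le> Polynomial.degree f - 1"
    by (simp add: degree_pderiv)
  then show False using le dg by linarith
qed

text \<open>A polynomial acts on maps through multiplication of the argument by \<open>\<alpha>\<close>; its linear factors
  split a map into eigenvectors of this operator.\<close>

definition act :: "'k :: field \<Rightarrow> 'o :: field poly \<Rightarrow> ('k \<Rightarrow> 'o) \<Rightarrow> 'k \<Rightarrow> 'o" where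
  "act \<alpha> g \<phi> x = (\<Sum>k\<le>Polynomial.degree g. Polynomial.coeff g k * \<phi> (\<alpha> ^ k * x))"

lemma act_eq: "Polynomial.degree g \<le> N \<Longrightarrow> act \<alpha> g \<phi> x = (\<Sum>k\<le>N. Polynomial.coeff g k * \<phi> (\<alpha> ^ k * x))"
  unfolding act_def by (intro sum.mono_neutral_left) (auto simp: coeff_eq_0)

lemma act_add: "act \<alpha> (g + h) \<phi> x = act \<alpha> g \<phi> x + act \<alpha> h \<phi> x"
proof -
  define N where "N = max (Polynomial.degree g) (Polynomial.degree h)"
  have "Polynomial.degree (g + h) \<le> N" "Polynomial.degree g \<le> N" "Polynomial.degree h \<le> N"
    by (auto simp: N_def degree_add_le_max)
  then show ?thesis by (simp add: act_eq[of _ N] sum.distrib algebra_simps)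
qed

lemma act_smult: "act \<alpha> (Polynomial.smult c g) \<phi> x = c * act \<alpha> g \<phi> x"
  by (simp add: act_eq[of _ "Polynomial.degree g"] degree_smult_le sum_distrib_left mult.assoc)

lemma act_sum: "act \<alpha> (sum g A) \<phi> x = (\<Sum>i\<in>A. act \<alpha> (g i) \<phi> x)"
proof (induction A rule: infinite_finite_induct)
  case (insert i A)
  then show ?case by (simp add: act_add)
qed (auto simp: act_def)

lemma act_X: "act \<alpha> (pCons 0 g) \<phi> x = act \<alpha> g \<phi> (\<alpha> * x)"
proof -
  have "act \<alpha> (pCons 0 g) \<phi> x = (\<Sum>k\<le>Suc (Polynomial.degree g). Polynomial.coeff (pCons 0 g) k * \<phi> (\<alpha> ^ k * x))"
    by (rule act_eq) (simp add: degree_pCons_le)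
  also have "\<dots> = act \<alpha> g \<phi> (\<alpha> * x)"
    by (subst sum.atMost_Suc_shift) (simp add: act_def mult_ac)
  finally show ?thesis .
qed

lemma act_linear_factor: "act \<alpha> ([:- \<rho>, 1:] * g) \<phi> x = act \<alpha> g \<phi> (\<alpha> * x) - \<rho> * act \<alpha> g \<phi> x"
proof -
  have "[:- \<rho>, 1:] * g = pCons 0 g + Polynomial.smult (- \<rho>) g" by (simp add: mult_pCons_left add.commute)
  then show ?thesis by (simp only: act_add act_X act_smult) simp
qed

text \<open>Lagrange interpolation at the roots of the minimal annihilator F of \<alpha>: the basis
  polynomials \<open>L \<rho>\<close> sum to 1, and (X - \<rho>) \<open>L \<rho>\<close> is a
  multiple of F. Since F acts as 0, each component is an eigenvector with eigenvalue \<rho>.\<close>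

lemma eigen_split:
  fixes \<phi> :: "'k :: field_char_0 \<Rightarrow> 'o :: {alg_closed_field, field_char_0}"
  assumes lin: "rat_linear \<phi>" and alg: "\<exists>f::rat poly. f \<noteq> 0 \<and> poly (map_poly of_rat f) \<alpha> = 0"
  shows "\<exists>R L. finite R \<and> (\<forall>x. \<phi> x = (\<Sum>\<rho>\<in>R. act \<alpha> (L \<rho>) \<phi> x)) \<and>
    (\<forall>\<rho>\<in>R. \<forall>x. act \<alpha> (L \<rho>) \<phi> (\<alpha> * x) = \<rho> * act \<alpha> (L \<rho>) \<phi> x)"
proof -
  let ?P = "\<lambda>g::rat poly. g \<noteq> 0 \<and> poly (map_poly of_rat g) \<alpha> = 0"
  define f where "f = arg_min Polynomial.degree ?P"
  have f: "f \<noteq> 0" "poly (map_poly of_rat f) \<alpha> = 0"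
    using alg arg_min_natI[of ?P _ Polynomial.degree] by (auto simp: f_def)
  have fmin: "Polynomial.degree f \<le> Polynomial.degree h" if "h \<noteq> 0" "poly (map_poly of_rat h) \<alpha> = 0" for h
    using arg_min_nat_le[of ?P h Polynomial.degree] that by (auto simp: f_def)
  define F :: "'o poly" where "F = map_poly of_rat f"
  have F0: "F \<noteq> 0" using f by (simp add: F_def map_poly_eq_0_iff)
  define R where "R = {\<rho>. poly F \<rho> = 0}"
  have finR: "finite R" using F0 poly_roots_finite by (simp add: R_def)
  obtain A where A: "F = Polynomial.smult (Polynomial.lead_coeff F) (\<Prod>x\<in>#A. [:-x, 1:])"
    using alg_closed_imp_factorization[OF F0] by metis
  \<comment> \<open>Interpolation requires simple roots: with multiple ones the product over the set
    of roots would be a proper divisor of F, which need not act as 0.\<close>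
  have "count A \<rho> \<le> 1" for \<rho>
  proof (rule ccontr)
    assume "\<not> ?thesis"
    then have "\<rho> \<in># A" "\<rho> \<in># A - {#\<rho>#}" by (auto simp: count_greater_zero_iff[symmetric] simp del: count_greater_zero_iff)
    then obtain A' where A': "A = add_mset \<rho> (add_mset \<rho> A')" by (metis insert_DiffM)
    define G where "G = Polynomial.smult (Polynomial.lead_coeff F) (\<Prod>x\<in>#A'. [:-x, 1:])"
    have FG: "F = [:-\<rho>, 1:] * ([:-\<rho>, 1:] * G)"
      by (subst A) (simp only: A' G_def image_mset_add_mset prod_mset.add_mset mult_smult_right)
    have "poly (pderiv F) \<rho> = 0"
      unfolding FG pderiv_mult poly_add poly_mult by simp
    moreover have "poly F \<rho> = 0" unfolding FG poly_mult by simp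
    ultimately show False using minimal_annihilator_simple_roots[OF f fmin, of \<rho>] by (simp add: F_def)
  qed
  then have cnt: "count A \<rho> = (if \<rho> \<in># A then 1 else 0)" for \<rho>
    by (metis count_eq_zero_iff count_greater_eq_one_iff le_antisym)
  have "R = set_mset A"
  proof -
    have "poly F \<rho> = 0 \<longleftrightarrow> \<rho> \<in># A" for \<rho>
      by (subst A) (use F0 in \<open>auto simp: poly_prod_mset prod_mset_zero_iff\<close>)
    then show ?thesis by (auto simp: R_def)
  qed
  then have AR: "A = mset_set R" using cnt finR by (intro multiset_eqI) (auto simp: count_mset_set')
  have F_R: "F = Polynomial.smult (Polynomial.lead_coeff F) (\<Prod>\<rho>\<in>R. [:-\<rho>, 1:])"
    by (subst A) (simp add: AR prod_unfold_prod_mset)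
  define l where "l = Polynomial.lead_coeff F"
  have l: "l \<noteq> 0" and F_l: "F = Polynomial.smult l (\<Prod>\<rho>\<in>R. [:-\<rho>, 1:])"
    using F0 F_R by (simp_all add: l_def)
  define L where "L \<rho> = (\<Prod>\<sigma>\<in>R-{\<rho>}. Polynomial.smult (inverse (\<rho> - \<sigma>)) [:-\<sigma>, 1:])" for \<rho>
  have L_eval: "poly (L \<rho>) \<tau> = (if \<rho> = \<tau> then 1 else 0)" if "\<rho> \<in> R" "\<tau> \<in> R" for \<rho> \<tau>
  proof (cases "\<rho> = \<tau>")
    case True
    have "poly (L \<rho>) \<tau> = (\<Prod>\<sigma>\<in>R-{\<rho>}. 1)" unfolding L_def poly_prod using True
      by (intro prod.cong) (auto simp: field_simps)
    then show ?thesis using True by simp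
  next
    case False
    then show ?thesis using that finR by (auto simp: L_def poly_prod intro!: bexI[of _ \<tau>])
  qed
  have degL: "Polynomial.degree (L \<rho>) < card R" if "\<rho> \<in> R" for \<rho>
  proof -
    have "Polynomial.degree (L \<rho>) \<le> (\<Sum>\<sigma>\<in>R-{\<rho>}. Polynomial.degree (Polynomial.smult (inverse (\<rho> - \<sigma>)) [:-\<sigma>, 1:]))"
      using degree_prod_sum_le[of "R - {\<rho>}" "\<lambda>\<sigma>. Polynomial.smult (inverse (\<rho> - \<sigma>)) [:-\<sigma>, 1:]"] finR
      by (simp add: L_def comp_def del: smult_pCons)
    also have "\<dots> \<le> (\<Sum>\<sigma>\<in>R-{\<rho>}. 1)" by (intro sum_mono) (auto intro: order.trans[OF degree_smult_le])
    also have "\<dots> = card R - 1" using that by simp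
    finally have "Polynomial.degree (L \<rho>) \<le> card R - 1" .
    moreover have "card R > 0" using that finR by (auto simp: card_gt_0_iff)
    ultimately show ?thesis by linarith
  qed
  have R_ne: "R \<noteq> {}"
  proof
    assume "R = {}"
    then have "Polynomial.degree F = 0" using F_R by (metis degree_1 degree_smult_le le_zero_eq prod.empty)
    then have "Polynomial.degree f = 0" by (simp add: F_def degree_map_poly)
    then obtain c where "f = [:c:]" by (metis degree_eq_zeroE)
    then show False using f by (simp add: map_poly_pCons)
  qed
  have sumL: "(\<Sum>\<rho>\<in>R. L \<rho>) = 1"
  proof (rule poly_eqI_degree)
    show "\<And>x. x \<in> R \<Longrightarrow> poly (\<Sum>\<rho>\<in>R. L \<rho>) x = poly 1 x"
      using finR by (simp add: poly_sum L_eval)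
    show "Polynomial.degree (\<Sum>\<rho>\<in>R. L \<rho>) < card R"
      using degL R_ne finR by (intro degree_sum_less) (auto simp: card_gt_0_iff)
    show "Polynomial.degree (1 :: 'o poly) < card R" using R_ne finR by (simp add: card_gt_0_iff)
  qed
  \<comment> \<open>The coefficients are rational, so \<rat>-linearity of \<phi> moves them inside
    and the value of the annihilator at \<alpha> appears.\<close>
  have F_act: "act \<alpha> F \<phi> x = 0" for x
  proof -
    have "act \<alpha> F \<phi> x = (\<Sum>k\<le>Polynomial.degree f. \<phi> (of_rat (Polynomial.coeff f k) * (\<alpha> ^ k * x)))"
      using lin by (simp add: act_def F_def degree_map_poly coeff_map_poly rat_linear_def)
    also have "\<dots> = \<phi> (poly (map_poly of_rat f) \<alpha> * x)"
      by (simp add: rat_linear_sum[OF lin, symmetric] poly_altdef degree_map_poly coeff_map_poly sum_distrib_right mult.assoc)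
    also have "\<dots> = 0" using f lin by (simp add: rat_linear_0)
    finally show ?thesis .
  qed
  have "\<phi> x = (\<Sum>\<rho>\<in>R. act \<alpha> (L \<rho>) \<phi> x)" for x
    unfolding act_sum[symmetric] sumL by (simp add: act_def)
  moreover have "act \<alpha> (L \<rho>) \<phi> (\<alpha> * x) = \<rho> * act \<alpha> (L \<rho>) \<phi> x" if "\<rho> \<in> R" for \<rho> x
  proof -
    define c where "c = (\<Prod>\<sigma>\<in>R-{\<rho>}. inverse (\<rho> - \<sigma>))"
    have "[:-\<rho>, 1:] * L \<rho> = Polynomial.smult c (\<Prod>\<sigma>\<in>R. [:-\<sigma>, 1:])"
      unfolding L_def c_def prod_smult by (subst prod.remove[OF finR that]) (simp only: mult_smult_right)
    also have "\<dots> = Polynomial.smult c (Polynomial.smult (inverse l) F)"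
      by (subst F_l) (use l in simp)
    finally have "act \<alpha> ([:-\<rho>, 1:] * L \<rho>) \<phi> x = 0" by (simp only: act_smult F_act mult_zero_right)
    then show ?thesis unfolding act_linear_factor by simp
  qed
  ultimately show ?thesis using finR by blast
qed

lemma act_rat_linear: "rat_linear \<phi> \<Longrightarrow> rat_linear (act \<alpha> g \<phi>)"
  unfolding rat_linear_def act_def
  by (auto simp: distrib_left sum.distrib sum_distrib_left mult.left_commute)

lemma act_eigen:
  assumes "\<And>x. \<phi> (\<beta> * x) = m * \<phi> x"
  shows "act \<alpha> g \<phi> (\<beta> * x) = m * act \<alpha> g \<phi> x"
proof -
  have "\<phi> (\<alpha> ^ k * (\<beta> * x)) = m * \<phi> (\<alpha> ^ k * x)" for k
    using assms[of "\<alpha> ^ k * x"] by (simp add: mult.left_commute)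
  then show ?thesis by (simp add: act_def sum_distrib_left mult.left_commute)
qed

text \<open>Multiplications by different elements commute, so splitting with respect to a new
  \<alpha> keeps the eigenvalues already obtained, by \<open>act_eigen\<close>. A list allows
  repeated components.\<close>

lemma simultaneous_eigen:
  fixes \<phi> :: "'k :: field_char_0 \<Rightarrow> 'o :: {alg_closed_field, field_char_0}"
  assumes "finite U" and lin: "rat_linear \<phi>"
    and alg: "\<And>\<alpha>::'k. \<exists>f::rat poly. f \<noteq> 0 \<and> poly (map_poly of_rat f) \<alpha> = 0"
  shows "\<exists>\<psi>s. (\<forall>\<psi>\<in>set \<psi>s. rat_linear \<psi> \<and> (\<forall>\<beta>\<in>U. \<exists>m. \<forall>x. \<psi> (\<beta> * x) = m * \<psi> x)) \<and>
              (\<forall>x. \<phi> x = (\<Sum>\<psi>\<leftarrow>\<psi>s. \<psi> x))"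
  using assms(1)
proof (induction U)
  case empty
  show ?case using lin by (intro exI[of _ "[\<phi>]"]) auto
next
  case (insert \<alpha> U)
  then obtain \<psi>s where \<psi>s: "\<forall>\<psi>\<in>set \<psi>s. rat_linear \<psi> \<and> (\<forall>\<beta>\<in>U. \<exists>m. \<forall>x. \<psi> (\<beta> * x) = m * \<psi> x)"
    "\<And>x. \<phi> x = (\<Sum>\<psi>\<leftarrow>\<psi>s. \<psi> x)" by blast
  let ?Q = "\<lambda>\<psi>. rat_linear \<psi> \<and> (\<forall>\<beta>\<in>U. \<exists>m. \<forall>x. \<psi> (\<beta> * x) = m * \<psi> x)"
  let ?Q' = "\<lambda>\<psi>. rat_linear \<psi> \<and> (\<forall>\<beta>\<in>insert \<alpha> U. \<exists>m. \<forall>x. \<psi> (\<beta> * x) = m * \<psi> x)"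
  have step: "\<exists>\<theta>s. (\<forall>\<theta>\<in>set \<theta>s. ?Q' \<theta>) \<and> (\<forall>x. \<psi> x = (\<Sum>\<theta>\<leftarrow>\<theta>s. \<theta> x))" if "?Q \<psi>" for \<psi> :: "'k \<Rightarrow> 'o"
  proof -
    have lin: "rat_linear \<psi>" using that by blast
    from eigen_split[OF lin alg[of \<alpha>]] obtain R L where RL: "finite R"
      "\<forall>x. \<psi> x = (\<Sum>\<rho>\<in>R. act \<alpha> (L \<rho>) \<psi> x)"
      "\<forall>\<rho>\<in>R. \<forall>x. act \<alpha> (L \<rho>) \<psi> (\<alpha> * x) = \<rho> * act \<alpha> (L \<rho>) \<psi> x"
      by (elim exE conjE)
    obtain rs where rs: "set rs = R" "distinct rs" using finite_distinct_list[OF RL(1)] by blast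
    have "?Q' (act \<alpha> (L \<rho>) \<psi>)" if "\<rho> \<in> R" for \<rho>
    proof (intro conjI ballI)
      show "rat_linear (act \<alpha> (L \<rho>) \<psi>)" by (rule act_rat_linear[OF lin])
      fix \<beta> assume "\<beta> \<in> insert \<alpha> U"
      then consider "\<beta> = \<alpha>" | "\<beta> \<in> U" by blast
      then show "\<exists>m. \<forall>x. act \<alpha> (L \<rho>) \<psi> (\<beta> * x) = m * act \<alpha> (L \<rho>) \<psi> x"
      proof cases
        case 1
        then show ?thesis using RL(3) that by blast
      next
        case 2
        then obtain m where "\<And>x. \<psi> (\<beta> * x) = m * \<psi> x" using \<open>?Q \<psi>\<close> by blast
        then show ?thesis using act_eigen[of \<psi> \<beta> m] by blast
      qed
    qed
    moreover have "\<psi> x = (\<Sum>\<theta>\<leftarrow>map (\<lambda>\<rho>. act \<alpha> (L \<rho>) \<psi>) rs. \<theta> x)" for x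
      unfolding map_map comp_def using RL(2)[rule_format, of x] rs by (simp add: sum_list_distinct_conv_sum_set)
    ultimately show ?thesis using rs by (intro exI[of _ "map (\<lambda>\<rho>. act \<alpha> (L \<rho>) \<psi>) rs"]) auto
  qed
  have "\<forall>\<psi>\<in>set \<psi>s. ?Q \<psi> \<Longrightarrow> \<exists>\<theta>s. (\<forall>\<theta>\<in>set \<theta>s. ?Q' \<theta>) \<and> (\<forall>x. (\<Sum>\<psi>\<leftarrow>\<psi>s. \<psi> x) = (\<Sum>\<theta>\<leftarrow>\<theta>s. \<theta> x))" for \<psi>s :: "('k \<Rightarrow> 'o) list"
  proof (induction \<psi>s)
    case Nil
    show ?case by (intro exI[of _ "[]"]) auto
  next
    case (Cons \<psi> \<psi>s)
    then obtain \<theta>s where \<theta>s: "\<forall>\<theta>\<in>set \<theta>s. ?Q' \<theta>" "\<And>x. (\<Sum>\<psi>\<leftarrow>\<psi>s. \<psi> x) = (\<Sum>\<theta>\<leftarrow>\<theta>s. \<theta> x)"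
      by (metis list.set_intros(2))
    obtain \<theta>s' where \<theta>s': "\<forall>\<theta>\<in>set \<theta>s'. ?Q' \<theta>" "\<And>x. \<psi> x = (\<Sum>\<theta>\<leftarrow>\<theta>s'. \<theta> x)"
      using step[of \<psi>] Cons.prems by (metis list.set_intros(1))
    have "\<forall>\<theta>\<in>set (\<theta>s' @ \<theta>s). ?Q' \<theta>" using \<theta>s(1) \<theta>s'(1) by auto
    moreover have "(\<Sum>\<psi>\<leftarrow>\<psi> # \<psi>s. \<psi> x) = (\<Sum>\<theta>\<leftarrow>\<theta>s' @ \<theta>s. \<theta> x)" for x
      using \<theta>s(2) \<theta>s'(2) by simp
    ultimately show ?case by blast
  qed
  from this[OF \<psi>s(1)] show ?case unfolding \<psi>s(2) .
qed

text \<open>A common eigenvector \<psi> for a spanning set is one for every multiplication, and the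
  eigenvalue of x is \<psi> x / \<psi> 1. Eigenvalues are additive and multiplicative in x, so they
  form a field embedding; components with \<psi> 1 = 0 vanish identically and are dropped.\<close>

theorem embedding_decomposition:
  fixes \<phi> :: "'k :: field_char_0 \<Rightarrow> 'o :: {alg_closed_field, field_char_0}"
  assumes nf: "number_field TYPE('k)" and lin: "rat_linear \<phi>"
  shows "\<exists>cs. (\<forall>(c, \<eta>)\<in>set cs. field_embedding \<eta>) \<and> (\<forall>x. \<phi> x = (\<Sum>(c, \<eta>)\<leftarrow>cs. c * \<eta> x))"
proof -
  obtain B :: "'k set" where B: "finite B" "rat_vs.span B = UNIV"
    using nf by (auto simp: number_field_def)
  obtain \<psi>s where \<psi>s: "\<forall>\<psi>\<in>set \<psi>s. rat_linear \<psi> \<and> (\<forall>\<beta>\<in>B. \<exists>m. \<forall>x. \<psi> (\<beta> * x) = m * \<psi> x)"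
    "\<And>x. \<phi> x = (\<Sum>\<psi>\<leftarrow>\<psi>s. \<psi> x)"
    using simultaneous_eigen[OF B(1) lin number_field_algebraic[OF nf]] by blast
  have all: "\<exists>m. \<forall>x. \<psi> (\<beta> * x) = m * \<psi> x" if \<psi>: "\<psi> \<in> set \<psi>s" for \<psi> \<beta>
  proof -
    have lin: "rat_linear \<psi>" using \<psi>s \<psi> by blast
    have "\<beta> \<in> rat_vs.span B" using B by simp
    then show ?thesis
    proof (induction rule: rat_vs.span_induct_alt)
      case base
      show ?case using rat_linear_0[OF lin] by (intro exI[of _ 0]) simp
    next
      case (step q b y)
      obtain m1 where "\<And>x. \<psi> (b * x) = m1 * \<psi> x" using \<psi>s \<psi> step(1) by blast
      moreover obtain m2 where "\<And>x. \<psi> (y * x) = m2 * \<psi> x" using step(2) by blast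
      ultimately have "\<psi> ((of_rat q * b + y) * x) = (of_rat q * m1 + m2) * \<psi> x" for x
        using lin by (simp add: rat_linear_def distrib_right mult.assoc)
      then show ?case by blast
    qed
  qed
  define h where "h \<psi> = (\<psi> 1, \<lambda>x. \<psi> x / \<psi> 1)" for \<psi> :: "'k \<Rightarrow> 'o"
  define cs where "cs = map h (filter (\<lambda>\<psi>. \<psi> 1 \<noteq> 0) \<psi>s)"
  have mu: "\<psi> (x * y) = \<psi> x / \<psi> 1 * \<psi> y" if \<psi>: "\<psi> \<in> set \<psi>s" "\<psi> 1 \<noteq> 0" for \<psi> x y
  proof -
    obtain m where m: "\<And>y. \<psi> (x * y) = m * \<psi> y" using all[OF \<psi>(1)] by blast
    then have "m = \<psi> x / \<psi> 1" using m[of 1] \<psi> by simp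
    then show ?thesis using m by simp
  qed
  have "field_embedding \<eta>" if mem: "(c, \<eta>) \<in> set cs" for c \<eta>
  proof -
    obtain \<psi> where \<psi>: "\<psi> \<in> set \<psi>s" "\<psi> 1 \<noteq> 0" "\<eta> = (\<lambda>x. \<psi> x / \<psi> 1)"
      using mem by (auto simp: cs_def h_def)
    have "rat_linear \<psi>" using \<psi> \<psi>s by blast
    then show ?thesis unfolding field_embedding_def \<psi>(3)
      using \<psi> mu[OF \<psi>(1,2)] by (auto simp: rat_linear_def add_divide_distrib)
  qed
  moreover have "\<phi> x = (\<Sum>(c, \<eta>)\<leftarrow>cs. c * \<eta> x)" for x
  proof -
    have z: "\<psi> x = 0" if "\<psi> \<in> set \<psi>s" "\<not> \<psi> 1 \<noteq> 0" for \<psi>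
      using all[OF that(1), of x] that(2) by (metis mult.right_neutral mult_zero_right)
    have "(\<Sum>(c, \<eta>)\<leftarrow>cs. c * \<eta> x) = (\<Sum>\<psi>\<leftarrow>filter (\<lambda>\<psi>. \<psi> 1 \<noteq> 0) \<psi>s. \<psi> x)"
      unfolding cs_def map_map comp_def h_def by (intro arg_cong[where f = sum_list] map_cong) auto
    also have "\<dots> = (\<Sum>\<psi>\<leftarrow>\<psi>s. \<psi> x)" by (rule sum_list_map_filter) (use z in auto)
    finally show ?thesis using \<psi>s(2) by simp
  qed
  ultimately show ?thesis by (intro exI[of _ cs]) auto
qed

section \<open>The fundamental identity for extensions\<close>

lemma number_field_basis:
  assumes "number_field TYPE('k :: field_char_0)"
  obtains B :: "'k :: field_char_0 set" where "finite B" "\<not> rat_vs.dependent B" "rat_vs.span B = UNIV"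
    "card B = global_degree TYPE('k)"
proof -
  obtain S :: "'k set" where S: "finite S" "rat_vs.span S = UNIV"
    using assms by (auto simp: number_field_def)
  obtain B :: "'k set" where B: "\<not> rat_vs.dependent B" "UNIV \<subseteq> rat_vs.span B"
    by (rule rat_vs.maximal_independent_subset[of UNIV])
  have "finite B" using rat_vs.independent_span_bound[OF S(1) B(1)] S(2) by auto
  moreover have sp: "rat_vs.span B = UNIV" using B(2) by auto
  moreover have "card B = global_degree TYPE('k)"
    unfolding global_degree_def using rat_vs.dim_eq_card[of B UNIV] B(1) sp by simp
  ultimately show thesis using that B(1) by blast
qed

lemma independent_card_le_global_degree:
  assumes "number_field TYPE('k :: field_char_0)" "\<not> rat_vs.dependent (S :: 'k :: field_char_0 set)"
  shows "finite S" "card S \<le> global_degree TYPE('k)"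
proof -
  obtain B :: "'k set" where "finite B" "rat_vs.span B = UNIV" "card B = global_degree TYPE('k)"
    using number_field_basis[OF assms(1)] by metis
  then show "finite S" "card S \<le> global_degree TYPE('k)"
    using rat_vs.independent_span_bound[of B S] assms(2) by auto
qed

definition lin_comb :: "('k :: field_char_0 \<Rightarrow> rat) \<Rightarrow> 'k set \<Rightarrow> 'k" where
  "lin_comb q E = (\<Sum>e\<in>E. of_rat (q e) * e)"

lemma lin_comb_scale: "lin_comb (\<lambda>e. r * q e) E = of_rat r * lin_comb q E"
  by (simp add: lin_comb_def sum_distrib_left of_rat_mult mult.assoc)

text \<open>A finite subset of the field that becomes a basis of the completion over the closure of
  the rationals, expressed without reference to the completion.\<close>

definition local_basis :: "('k :: field_char_0 \<Rightarrow> real) \<Rightarrow> 'k set \<Rightarrow> bool" where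
  "local_basis a E \<longleftrightarrow> finite E \<and>
     (\<exists>c>0. \<forall>q. \<forall>e\<in>E. c * a (of_rat (q e)) \<le> a (lin_comb q E)) \<and>
     (\<forall>x. \<forall>\<epsilon>>0. \<exists>q. a (x - lin_comb q E) < \<epsilon>)"

lemma bounded_below_independent:
  fixes a :: "'k :: field_char_0 \<Rightarrow> real"
  assumes "absolute_value a" "finite E" "c > 0" "\<And>q e. e \<in> E \<Longrightarrow> c * a (of_rat (q e)) \<le> a (lin_comb q E)"
  shows "\<not> rat_vs.dependent E"
proof
  interpret abs_value a by unfold_locales fact
  assume "rat_vs.dependent E"
  then obtain q v where q: "v \<in> E" "q v \<noteq> 0" "(\<Sum>v\<in>E. of_rat (q v) * v) = 0"
    using rat_vs.dependent_finite[OF assms(2)] by blast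
  have "c * a (of_rat (q v)) \<le> 0" using assms(4)[OF q(1), of q] q(3) by (simp add: lin_comb_def)
  moreover have "a (of_rat (q v)) > 0" using q(2) by simp
  ultimately show False using assms(3) by (simp add: mult_le_0_iff)
qed

text \<open>A set of largest size among those bounded below exists, since such sets are independent
  over \<rat>. If some x kept distance \<epsilon> from its span, adding x would preserve a lower
  bound and contradict the choice; hence the span is dense.\<close>

lemma local_basis_exists:
  fixes a :: "'k :: field_char_0 \<Rightarrow> real"
  assumes nf: "number_field TYPE('k)" and av: "absolute_value a"
  shows "\<exists>E. local_basis a E"
proof -
  interpret abs_value a by unfold_locales fact
  define good where "good E \<longleftrightarrow> finite E \<and> (\<exists>c>0. \<forall>q. \<forall>e\<in>E. c * a (of_rat (q e)) \<le> a (lin_comb q E))" for E :: "'k set"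
  have "good {}" by (auto simp: good_def intro: exI[of _ 1])
  moreover have "card E < Suc (global_degree TYPE('k))" if "good E" for E
    using that bounded_below_independent[OF av] independent_card_le_global_degree[OF nf]
    by (metis good_def less_Suc_eq_le)
  ultimately have "\<exists>E. good E \<and> (\<forall>F. good F \<longrightarrow> card F \<le> card E)"
    by (intro ex_has_greatest_nat) auto
  then obtain E where E: "good E" "\<And>F. good F \<Longrightarrow> card F \<le> card E" by blast
  have finE: "finite E" using E(1) by (simp add: good_def)
  obtain c where c: "c > 0" "\<And>q e. e \<in> E \<Longrightarrow> c * a (of_rat (q e)) \<le> a (lin_comb q E)"
    using E(1) by (auto simp: good_def)
  have "\<exists>q. a (x - lin_comb q E) < \<epsilon>" if eps: "\<epsilon> > 0" for x \<epsilon>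
  proof (rule ccontr)
    assume "\<not> ?thesis"
    then have far: "a (x - lin_comb q E) \<ge> \<epsilon>" for q by (meson not_le)
    have "x \<notin> E"
    proof
      assume "x \<in> E"
      then have "lin_comb (\<lambda>e. if e = x then 1 else 0) E = x"
        using finE by (simp add: lin_comb_def if_distrib[of of_rat] if_distrib[of "\<lambda>r. r * _"] cong: if_cong)
      then show False using far[of "\<lambda>e. if e = x then 1 else 0"] eps by simp
    qed
    \<comment> \<open>The coefficient of x is controlled by the distance \<epsilon>, and subtracting
      its term from the combination costs the factor \<open>1 + a x / \<epsilon>\<close> for the
      others.\<close>
    define c' where "c' = min \<epsilon> (c / (1 + a x / \<epsilon>))"
    have den: "1 + a x / \<epsilon> > 0" using eps by (simp add: add_pos_nonneg)
    have "c' > 0" using eps c(1) den by (auto simp: c'_def)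
    moreover have "c' * a (of_rat (q e)) \<le> a (lin_comb q (insert x E))" if e: "e \<in> insert x E" for q e
    proof -
      define z where "z = lin_comb q (insert x E)"
      define y where "y = lin_comb q E"
      have z: "z = of_rat (q x) * x + y" using \<open>x \<notin> E\<close> finE by (simp add: z_def y_def lin_comb_def)
      have 1: "\<epsilon> * a (of_rat (q x)) \<le> a z"
      proof (cases "q x = 0")
        case False
        have "z = of_rat (q x) * (x - lin_comb (\<lambda>e. - inverse (q x) * q e) E)"
          unfolding z y_def lin_comb_scale using False by (simp add: of_rat_minus of_rat_inverse algebra_simps)
        then have "a z = a (of_rat (q x)) * a (x - lin_comb (\<lambda>e. - inverse (q x) * q e) E)" by (simp only: mult)
        then show ?thesis using mult_left_mono[OF far nonneg] by (simp only: mult.commute)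
      qed simp
      have 2: "a y \<le> a z * (1 + a x / \<epsilon>)"
      proof -
        have "a y \<le> a z + a (of_rat (q x)) * a x" using diff[of z "of_rat (q x) * x"] by (simp add: z mult)
        also have "a (of_rat (q x)) * a x \<le> (a z / \<epsilon>) * a x" using 1 eps by (intro mult_right_mono) (auto simp: field_simps)
        finally show ?thesis by (simp add: algebra_simps)
      qed
      show ?thesis
      proof (cases "e = x")
        case True
        have "c' * a (of_rat (q e)) \<le> \<epsilon> * a (of_rat (q x))" unfolding True by (intro mult_right_mono) (auto simp: c'_def)
        then show ?thesis using 1 by (simp add: z_def)
      next
        case False
        then have "c * a (of_rat (q e)) \<le> a z * (1 + a x / \<epsilon>)" using c(2)[of e q] e 2 by (auto simp: y_def)
        then have "c / (1 + a x / \<epsilon>) * a (of_rat (q e)) \<le> a z" using den by (simp add: field_simps)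
        moreover have "c' * a (of_rat (q e)) \<le> c / (1 + a x / \<epsilon>) * a (of_rat (q e))" by (intro mult_right_mono) (auto simp: c'_def)
        ultimately show ?thesis by (simp add: z_def)
      qed
    qed
    ultimately have "good (insert x E)" using finE by (auto simp: good_def)
    then show False using E(2)[of "insert x E"] \<open>x \<notin> E\<close> finE by simp
  qed
  then show ?thesis using finE c unfolding local_basis_def by blast
qed

lemma local_basis_nonempty:
  assumes "absolute_value a" "local_basis a E" shows "E \<noteq> {}"
proof
  interpret abs_value a by unfold_locales fact
  assume "E = {}"
  then have "\<exists>q. a (1 - lin_comb q {}) < 1" using assms(2) by (auto simp: local_basis_def)
  then show False by (simp add: lin_comb_def)
qed

section \<open>Weak approximation for extensions of one absolute value\<close>

context abs_value
begin

text \<open>y^n / (1 + y^n) acts as a switch: it tends to 0 at absolute values where y is below 1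
  and, by \<open>expand_tendsto\<close>, to 1 where y is above 1.\<close>

lemma contract_tendsto:
  assumes "a y < 1" shows "(\<lambda>n. a (y ^ n / (1 + y ^ n))) \<longlonglongrightarrow> 0"
proof (rule tendsto_sandwich[of "\<lambda>_. 0" _ _ "\<lambda>n. a y ^ n / (1 - a y ^ n)"])
  have lim: "(\<lambda>n. a y ^ n) \<longlonglongrightarrow> 0" using assms by (intro LIMSEQ_power_zero) auto
  have "(\<lambda>n. a y ^ n / (1 - a y ^ n)) \<longlonglongrightarrow> 0 / (1 - 0)" by (intro tendsto_intros lim) auto
  then show "(\<lambda>n. a y ^ n / (1 - a y ^ n)) \<longlonglongrightarrow> 0" by simp
  show "\<forall>\<^sub>F n in sequentially. a (y ^ n / (1 + y ^ n)) \<le> a y ^ n / (1 - a y ^ n)"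
    using eventually_gt_at_top[of 0]
  proof eventually_elim
    case (elim n)
    then have p: "a y ^ n < 1" using assms by (simp add: power_less_one_iff)
    have "1 - a y ^ n \<le> a (1 + y ^ n)" using diff[of "1 + y ^ n" "y ^ n"] by (simp add: power)
    then show ?case unfolding divide power using p by (intro divide_left_mono mult_pos_pos) auto
  qed
qed auto

lemma expand_tendsto:
  assumes "a y > 1" shows "(\<lambda>n. a (y ^ n / (1 + y ^ n) - 1)) \<longlonglongrightarrow> 0"
proof (rule tendsto_sandwich[of "\<lambda>_. 0" _ _ "\<lambda>n. (1 / a y) ^ n / (1 - (1 / a y) ^ n)"])
  have lim: "(\<lambda>n. (1 / a y) ^ n) \<longlonglongrightarrow> 0" using assms by (intro LIMSEQ_power_zero) (auto simp: divide_simps)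
  have "(\<lambda>n. (1 / a y) ^ n / (1 - (1 / a y) ^ n)) \<longlonglongrightarrow> 0 / (1 - 0)" by (intro tendsto_intros lim) auto
  then show "(\<lambda>n. (1 / a y) ^ n / (1 - (1 / a y) ^ n)) \<longlonglongrightarrow> 0" by simp
  show "\<forall>\<^sub>F n in sequentially. a (y ^ n / (1 + y ^ n) - 1) \<le> (1 / a y) ^ n / (1 - (1 / a y) ^ n)"
    using eventually_gt_at_top[of 0]
  proof eventually_elim
    case (elim n)
    then have p: "a y ^ n > 1" using assms by (simp add: one_less_power)
    have le: "a y ^ n - 1 \<le> a (1 + y ^ n)" using diff[of "1 + y ^ n" 1] by (simp add: power)
    then have "a (1 + y ^ n) > 0" using p by linarith
    then have nz: "1 + y ^ n \<noteq> 0" by (rule iffD1[OF pos_iff])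
    then have "y ^ n / (1 + y ^ n) - 1 = - (1 / (1 + y ^ n))" by (simp add: field_simps)
    then have "a (y ^ n / (1 + y ^ n) - 1) = 1 / a (1 + y ^ n)" by (simp only: minus divide one)
    moreover have "1 / (a y ^ n - 1) = (1 / a y) ^ n / (1 - (1 / a y) ^ n)"
      using p assms by (auto simp: power_one_over field_simps)
    ultimately show ?case using le p by (metis frac_le diff_gt_0_iff_gt order_refl zero_le_one)
  qed
qed auto

end

text \<open>The two absolute values agree on \<rat>, so a rational factor shifts both logarithms by
  the same amount. If the values at x differ, a high power of x makes the logarithmic gap exceed ln
  (u r), and a power of r then moves 0 into the gap.\<close>

lemma separate_two:
  fixes v w :: "'k :: field_char_0 \<Rightarrow> real"
  assumes v: "absolute_value v" "\<And>q. v (of_rat q) = u q" and w: "absolute_value w" "\<And>q. w (of_rat q) = u q"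
    and u: "\<exists>q. q \<noteq> 0 \<and> u q \<noteq> 1" and "v \<noteq> w"
  shows "\<exists>y. v y > 1 \<and> w y < 1"
proof -
  interpret v: abs_value v by unfold_locales fact
  interpret w: abs_value w by unfold_locales fact
  obtain r where r: "u r > 1"
  proof -
    obtain q where q: "q \<noteq> 0" "u q \<noteq> 1" using u by blast
    have pos: "u q > 0" using v(2)[of q] q by (metis of_rat_eq_0_iff v.pos)
    have "u (inverse q) = inverse (u q)" using v.inverse[of "of_rat q"] v(2) by (metis of_rat_inverse)
    then show thesis using that[of q] that[of "inverse q"] q pos
      by (metis less_le not_less one_less_inverse_iff)
  qed
  have main: "\<exists>y. a y < 1 \<and> b y > 1" if a: "absolute_value a" "\<And>q. a (of_rat q) = u q" and b: "absolute_value b" "\<And>q. b (of_rat q) = u q"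
    and less: "a x < b x" for a b :: "'k \<Rightarrow> real" and x
  proof -
    interpret a: abs_value a by unfold_locales fact
    interpret b: abs_value b by unfold_locales fact
    have x0: "x \<noteq> 0" using less by auto
    have pos: "a x > 0" "b x > 0" using x0 by auto
    define L where "L = ln (u r)"
    have L: "L > 0" using r by (simp add: L_def)
    have "ln (b x) - ln (a x) > 0" using less pos by simp
    then obtain m :: nat where m: "real m * (ln (b x) - ln (a x)) > L"
      using reals_Archimedean3 by metis
    \<comment> \<open>The floor plus 1 places \<open>k * L\<close> strictly between
      \<open>m * ln (a x)\<close> and \<open>m * ln (b x)\<close>.\<close>
    define k where "k = \<lfloor>real m * ln (a x) / L\<rfloor> + 1"
    have k1: "real m * ln (a x) < of_int k * L"
    proof -
      have "real m * ln (a x) / L < of_int k" unfolding k_def by linarith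
      then show ?thesis using L by (simp add: field_simps)
    qed
    have k2: "of_int k * L < real m * ln (b x)"
    proof -
      have "of_int k \<le> real m * ln (a x) / L + 1" by (simp add: k_def)
      then have "of_int k * L \<le> real m * ln (a x) + L" using L by (simp add: field_simps)
      then show ?thesis using m by (simp add: algebra_simps)
    qed
    define y where "y = x ^ m * of_rat (r powi (- k))"
    have r0: "r \<noteq> 0" using r a(2)[of r] by auto
    have powi: "u (r powi j) = u r powi j" for j
    proof -
      have "a (z powi j) = a z powi j" for z by (simp add: power_int_def a.power a.inverse)
      moreover have "of_rat (r powi j) = (of_rat r powi j :: 'k)"
        by (simp add: power_int_def of_rat_power of_rat_inverse)
      ultimately show ?thesis using a(2) by metis
    qed
    have ln_y: "ln (c y) = real m * ln (c x) - of_int k * L" "c y > 0"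
      if "absolute_value c" "\<And>q. c (of_rat q) = u q" for c :: "'k \<Rightarrow> real"
    proof -
      interpret c: abs_value c by unfold_locales fact
      have cy: "c y = c x ^ m * u r powi (- k)" by (simp add: y_def c.mult c.power that powi)
      have "c x > 0" using x0 by simp
      then show "c y > 0" unfolding cy using r by simp
      have "u r powi (-k) = u r powr of_int (- k)" using powr_real_of_int'[of "u r" "- k"] r by simp
      then show "ln (c y) = real m * ln (c x) - of_int k * L"
        unfolding cy using \<open>c x > 0\<close> r by (simp add: ln_mult ln_realpow ln_powr L_def)
    qed
    have "ln (a y) < 0" "ln (b y) > 0" using ln_y[OF a] ln_y[OF b] k1 k2 by auto
    then have "a y < 1" "b y > 1" using ln_y(2)[OF a] ln_y(2)[OF b] by (auto simp: ln_less_zero_iff)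
    then show ?thesis by blast
  qed
  obtain x where "v x \<noteq> w x" using \<open>v \<noteq> w\<close> by auto
  then consider "v x < w x" | "w x < v x" by linarith
  then show ?thesis
  proof cases
    case 1
    obtain y where y: "v y < 1" "w y > 1" using main[OF v w 1] by blast
    have "y \<noteq> 0" using y by auto
    then have "v (inverse y) > 1" "w (inverse y) < 1"
      using y by (auto simp: v.inverse w.inverse one_less_inverse_iff inverse_less_1_iff)
    then show ?thesis by blast
  next
    case 2
    then show ?thesis using main[OF w v 2] by blast
  qed
qed

text \<open>In the induction step y separates v from the old members and z separates v from the new
  w. If w y \<le> 1, a large power of y times z serves. Otherwise powers of y would spoil w, and the
  switch y^n / (1 + y^n), which tends to 1 at both v and w, takes their place.\<close>

lemma separate_many:
  fixes v :: "'k :: field_char_0 \<Rightarrow> real"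
  assumes v: "absolute_value v" "\<And>q. v (of_rat q) = u q"
    and u: "\<exists>q. q \<noteq> 0 \<and> u q \<noteq> 1"
    and W: "finite W" "\<And>w. w \<in> W \<Longrightarrow> absolute_value w \<and> (\<forall>q. w (of_rat q) = u q) \<and> w \<noteq> v"
  shows "\<exists>y. v y > 1 \<and> (\<forall>w\<in>W. w y < 1)"
  using W
proof (induction W)
  case empty
  obtain q where q: "q \<noteq> 0" "u q \<noteq> 1" using u by blast
  interpret v: abs_value v by unfold_locales fact
  have "v (of_rat q) > 0" using q by simp
  moreover have "v (of_rat q) \<noteq> 1" using q v by simp
  ultimately have "v (of_rat q) > 1 \<or> v (inverse (of_rat q)) > 1"
    by (auto simp: v.inverse one_less_inverse_iff)
  then show ?case by blast
next
  case (insert w W)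
  interpret v: abs_value v by unfold_locales fact
  have w: "absolute_value w" "\<And>q. w (of_rat q) = u q" "v \<noteq> w" using insert.prems by auto
  interpret w: abs_value w by unfold_locales fact
  obtain y where y: "v y > 1" "\<And>x. x \<in> W \<Longrightarrow> x y < 1" using insert by auto
  obtain z where z: "v z > 1" "w z < 1" using separate_two[OF v w(1,2) u w(3)] by blast
  show ?case
  proof (cases "w y \<le> 1")
    case True
    have "\<forall>\<^sub>F n in sequentially. \<forall>x\<in>W. x (y ^ n * z) < 1"
      unfolding eventually_ball_finite_distrib[OF insert.hyps(1)]
    proof
      fix x assume x: "x \<in> W"
      then interpret x: abs_value x using insert.prems by unfold_locales auto
      have "(\<lambda>n. x y ^ n * x z) \<longlonglongrightarrow> 0 * x z"
        using y(2)[OF x] by (intro tendsto_intros LIMSEQ_power_zero) auto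
      then show "\<forall>\<^sub>F n in sequentially. x (y ^ n * z) < 1"
        by (intro order_tendstoD) (auto simp: x.mult x.power)
    qed
    then obtain n where n: "\<And>x. x \<in> W \<Longrightarrow> x (y ^ n * z) < 1" by (auto simp: eventually_sequentially)
    have "1 * 1 < v y ^ n * v z" using y(1) z(1) by (intro mult_le_less_imp_less) auto
    moreover have "w y ^ n * w z < 1 * 1"
    proof -
      have "w y ^ n * w z \<le> 1 * w z" using True by (intro mult_right_mono power_le_one) auto
      then show ?thesis using z by simp
    qed
    ultimately show ?thesis using n by (intro exI[of _ "y ^ n * z"]) (auto simp: v.mult v.power w.mult w.power)
  next
    case False
    define t where "t n = y ^ n / (1 + y ^ n)" for n
    have lim1: "(\<lambda>n. x (t n * z)) \<longlonglongrightarrow> x z" if "absolute_value x" "x y > 1" for x :: "'k \<Rightarrow> real"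
    proof -
      interpret x: abs_value x by unfold_locales fact
      have "(\<lambda>n. x (t n - 1) * x z) \<longlonglongrightarrow> 0 * x z"
        unfolding t_def using that by (intro tendsto_intros x.expand_tendsto)
      then have "(\<lambda>n. x (t n * z) - x z) \<longlonglongrightarrow> 0"
        by (rule Lim_null_comparison[rotated, OF tendsto_eq_rhs])
           (use x.abs_diff_le[of "t _ * z" z] in \<open>auto simp: x.mult[symmetric] algebra_simps\<close>)
      then show ?thesis by (simp add: LIM_zero_iff)
    qed
    have "\<forall>\<^sub>F n in sequentially. \<forall>x\<in>W. x (t n * z) < 1"
      unfolding eventually_ball_finite_distrib[OF insert.hyps(1)]
    proof
      fix x assume x: "x \<in> W"
      then interpret x: abs_value x using insert.prems by unfold_locales auto
      have "(\<lambda>n. x (t n) * x z) \<longlonglongrightarrow> 0 * x z"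
        unfolding t_def using y(2)[OF x] by (intro tendsto_intros x.contract_tendsto)
      then show "\<forall>\<^sub>F n in sequentially. x (t n * z) < 1"
        by (intro order_tendstoD) (auto simp: x.mult)
    qed
    moreover have "\<forall>\<^sub>F n in sequentially. v (t n * z) > 1"
      using lim1[OF v(1) y(1)] z(1) by (rule order_tendstoD)
    moreover have "\<forall>\<^sub>F n in sequentially. w (t n * z) < 1"
      using lim1[OF w(1)] False z(2) by (intro order_tendstoD) auto
    ultimately have "\<forall>\<^sub>F n in sequentially. v (t n * z) > 1 \<and> (\<forall>x\<in>insert w W. x (t n * z) < 1)"
      by eventually_elim auto
    then show ?thesis by (auto simp: eventually_sequentially)
  qed
qed

lemma weak_approximation:
  fixes v :: "'k :: field_char_0 \<Rightarrow> real"
  assumes v: "absolute_value v" "\<And>q. v (of_rat q) = u q"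
    and u: "\<exists>q. q \<noteq> 0 \<and> u q \<noteq> 1"
    and W: "finite W" "\<And>w. w \<in> W \<Longrightarrow> absolute_value w \<and> (\<forall>q. w (of_rat q) = u q) \<and> w \<noteq> v"
    and \<epsilon>: "\<epsilon> > 0"
  shows "\<exists>y. v (y - 1) < \<epsilon> \<and> (\<forall>w\<in>W. w y < \<epsilon>)"
proof -
  interpret v: abs_value v by unfold_locales fact
  obtain y where y: "v y > 1" "\<And>w. w \<in> W \<Longrightarrow> w y < 1" using separate_many[OF v u W] by blast
  have "\<forall>\<^sub>F n in sequentially. \<forall>w\<in>W. w (y ^ n / (1 + y ^ n)) < \<epsilon>"
    unfolding eventually_ball_finite_distrib[OF W(1)]
  proof
    fix w assume w: "w \<in> W"
    then interpret w: abs_value w using W by unfold_locales auto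
    show "\<forall>\<^sub>F n in sequentially. w (y ^ n / (1 + y ^ n)) < \<epsilon>"
      using w.contract_tendsto[OF y(2)[OF w]] \<epsilon> by (rule order_tendstoD)
  qed
  moreover have "\<forall>\<^sub>F n in sequentially. v (y ^ n / (1 + y ^ n) - 1) < \<epsilon>"
    using v.expand_tendsto[OF y(1)] \<epsilon> by (rule order_tendstoD)
  ultimately have "\<forall>\<^sub>F n in sequentially. v (y ^ n / (1 + y ^ n) - 1) < \<epsilon> \<and> (\<forall>w\<in>W. w (y ^ n / (1 + y ^ n)) < \<epsilon>)"
    by eventually_elim auto
  then show ?thesis by (auto simp: eventually_sequentially)
qed

text \<open>For \<open>e \<in> E v\<close> choose \<open>\<omega> (v, e)\<close> close to \<open>e\<close> at \<open>v\<close> and close to 0 at the other members of \<open>V\<close>.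
  These elements are linearly independent over \<open>\<rat>\<close>, which bounds the sum of the local degrees.\<close>

locale block_system =
  fixes u :: "rat \<Rightarrow> real" and V :: "('k :: field_char_0 \<Rightarrow> real) set" and E :: "('k \<Rightarrow> real) \<Rightarrow> 'k set"
  assumes nf: "number_field TYPE('k)"
    and fin: "finite V"
    and av: "\<And>v. v \<in> V \<Longrightarrow> absolute_value v"
    and ext: "\<And>v q. v \<in> V \<Longrightarrow> v (of_rat q) = u q"
    and nontriv: "\<exists>q. q \<noteq> 0 \<and> u q \<noteq> 1"
    and basis: "\<And>v. v \<in> V \<Longrightarrow> local_basis v (E v)"
begin

definition idx :: "(('k \<Rightarrow> real) \<times> 'k) set" where "idx = Sigma V E"

lemma finE: "v \<in> V \<Longrightarrow> finite (E v)"
  using basis by (simp add: local_basis_def)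

lemma fin_idx: "finite idx"
  using fin finE by (simp add: idx_def)

lemma card_idx: "card idx = (\<Sum>v\<in>V. card (E v))"
  using fin finE by (simp add: idx_def)

lemma u_nonneg: "v \<in> V \<Longrightarrow> u q \<ge> 0"
  using ext[of v q] abs_value.nonneg[OF abs_value.intro[OF av]] by metis

lemma uniform_bound: "\<exists>c>0. \<forall>v\<in>V. \<forall>q. \<forall>e\<in>E v. c * u (q e) \<le> v (lin_comb q (E v))"
proof (cases "V = {}")
  case False
  have "\<forall>v\<in>V. \<exists>c>0. \<forall>q. \<forall>e\<in>E v. c * u (q e) \<le> v (lin_comb q (E v))"
    using basis ext unfolding local_basis_def by metis
  then obtain C where C: "\<And>v. v \<in> V \<Longrightarrow> C v > 0" "\<And>v q e. v \<in> V \<Longrightarrow> e \<in> E v \<Longrightarrow> C v * u (q e) \<le> v (lin_comb q (E v))"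
    by metis
  define c where "c = Min (C ` V)"
  have "c > 0" using C(1) fin False by (simp add: c_def)
  moreover have "c * u (q e) \<le> v (lin_comb q (E v))" if "v \<in> V" "e \<in> E v" for v q e
  proof -
    have "c \<le> C v" using that fin by (simp add: c_def)
    then have "c * u (q e) \<le> C v * u (q e)" using u_nonneg[OF that(1)] by (rule mult_right_mono)
    then show ?thesis using C(2)[OF that, of q] by linarith
  qed
  ultimately show ?thesis by blast
qed (auto intro: exI[of _ 1])

definition near :: "(('k \<Rightarrow> real) \<times> 'k \<Rightarrow> 'k) \<Rightarrow> real \<Rightarrow> bool" where
  "near \<omega> \<delta> \<longleftrightarrow> (\<forall>(v, e)\<in>idx. v (\<omega> (v, e) - e) < \<delta> \<and> (\<forall>v'\<in>V. v' \<noteq> v \<longrightarrow> v' (\<omega> (v, e)) < \<delta>))"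

lemma near_exists:
  assumes "\<delta> > 0" shows "\<exists>\<omega>. near \<omega> \<delta>"
proof -
  have "\<forall>i\<in>idx. \<exists>z. fst i (z - snd i) < \<delta> \<and> (\<forall>v'\<in>V. v' \<noteq> fst i \<longrightarrow> v' z < \<delta>)"
  proof
    fix i assume "i \<in> idx"
    then obtain v e where i: "i = (v, e)" "v \<in> V" "e \<in> E v" by (auto simp: idx_def)
    \<comment> \<open>Exceeds the value of e at every member of V, so a precision \<delta> / M for y
      becomes \<delta> for y * e.\<close>
    define M where "M = 1 + (\<Sum>v'\<in>V. v' e)"
    have nn: "v' e \<ge> 0" if "v' \<in> V" for v' using abs_value.nonneg[OF abs_value.intro[OF av[OF that]]] .
    have M: "v' e < M" if "v' \<in> V" for v' using member_le_sum[of v' V "\<lambda>v'. v' e"] nn that fin by (simp add: M_def)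
    have M0: "M > 0" using M[OF i(2)] nn[OF i(2)] by linarith
    have "\<exists>y. v (y - 1) < \<delta> / M \<and> (\<forall>w\<in>V - {v}. w y < \<delta> / M)"
      by (rule weak_approximation[where u = u, OF av[OF i(2)] ext[OF i(2)] nontriv])
         (use fin av ext assms M0 in auto)
    then obtain y where y: "v (y - 1) < \<delta> / M" "\<And>w. w \<in> V - {v} \<Longrightarrow> w y < \<delta> / M" by blast
    have small: "w (z * e) < \<delta>" if "w \<in> V" "w z < \<delta> / M" for w z
    proof -
      interpret w: abs_value w by unfold_locales (rule av[OF that(1)])
      have "w (z * e) = w z * w e" by (rule w.mult)
      also have "\<dots> \<le> (\<delta> / M) * w e" using that by (intro mult_right_mono) auto
      also have "\<dots> < (\<delta> / M) * M" using M[OF that(1)] M0 assms by (intro mult_strict_left_mono) auto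
      finally show ?thesis using M0 by simp
    qed
    have "v (y * e - e) < \<delta>" using small[of v "y - 1", OF i(2) y(1)] by (simp add: algebra_simps)
    moreover have "v' (y * e) < \<delta>" if "v' \<in> V" "v' \<noteq> v" for v'
      by (rule small) (use that y(2) in auto)
    ultimately show "\<exists>z. fst i (z - snd i) < \<delta> \<and> (\<forall>v'\<in>V. v' \<noteq> fst i \<longrightarrow> v' z < \<delta>)"
      using i by (intro exI[of _ "y * e"]) auto
  qed
  then obtain \<omega> where "\<forall>i\<in>idx. fst i (\<omega> i - snd i) < \<delta> \<and> (\<forall>v'\<in>V. v' \<noteq> fst i \<longrightarrow> v' (\<omega> i) < \<delta>)"
    by metis
  then have "near \<omega> \<delta>" unfolding near_def by auto
  then show ?thesis by blast
qed

definition comb :: "(('k \<Rightarrow> real) \<times> 'k \<Rightarrow> 'k) \<Rightarrow> (('k \<Rightarrow> real) \<times> 'k \<Rightarrow> rat) \<Rightarrow> 'k" where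
  "comb \<omega> q = (\<Sum>i\<in>idx. of_rat (q i) * \<omega> i)"

lemma comb_add: "comb \<omega> (\<lambda>i. q i + r i) = comb \<omega> q + comb \<omega> r"
  by (simp add: comb_def of_rat_add distrib_right sum.distrib)

text \<open>Replacing \<open>\<omega> (v', e)\<close> by e for v' = v and by 0 otherwise leaves
  exactly the local combination of the block of v; every replacement costs at most \<delta> times
  the size of the coefficient.\<close>

lemma perturb:
  assumes near: "near \<omega> \<delta>" and M: "\<And>i. i \<in> idx \<Longrightarrow> u (q i) \<le> M" and v: "v \<in> V"
  shows "v (comb \<omega> q - lin_comb (\<lambda>e. q (v, e)) (E v)) \<le> real (card idx) * \<delta> * M"
proof -
  interpret v: abs_value v by unfold_locales (rule av[OF v])
  have "lin_comb (\<lambda>e. q (v, e)) (E v) = (\<Sum>v'\<in>V. if v' = v then \<Sum>e\<in>E v'. of_rat (q (v', e)) * e else 0)"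
    using v fin by (simp add: lin_comb_def)
  also have "\<dots> = (\<Sum>v'\<in>V. \<Sum>e\<in>E v'. of_rat (q (v', e)) * (if v' = v then e else 0))"
    by (intro sum.cong) auto
  also have "\<dots> = (\<Sum>(v', e)\<in>idx. of_rat (q (v', e)) * (if v' = v then e else 0))"
    unfolding idx_def using fin finE by (intro sum.Sigma) auto
  finally have eq: "comb \<omega> q - lin_comb (\<lambda>e. q (v, e)) (E v) =
      (\<Sum>(v', e)\<in>idx. of_rat (q (v', e)) * (\<omega> (v', e) - (if v' = v then e else 0)))"
    by (simp add: comb_def case_prod_beta sum_subtractf algebra_simps)
  have "v (comb \<omega> q - lin_comb (\<lambda>e. q (v, e)) (E v)) \<le>
      (\<Sum>i\<in>idx. v (case i of (v', e) \<Rightarrow> of_rat (q (v', e)) * (\<omega> (v', e) - (if v' = v then e else 0))))"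
    unfolding eq by (rule v.sum_le)
  also have "\<dots> \<le> (\<Sum>i\<in>idx. \<delta> * M)"
  proof (rule sum_mono)
    fix i assume i: "i \<in> idx"
    obtain v' e where ve: "i = (v', e)" by force
    have "v (\<omega> (v', e) - (if v' = v then e else 0)) \<le> \<delta>"
    proof (cases "v' = v")
      case False
      then have "v (\<omega> (v', e)) < \<delta>" using near i v unfolding near_def ve by fast
      then show ?thesis using False by simp
    qed (use near i ve in \<open>auto simp: near_def\<close>)
    then have "u (q i) * v (\<omega> (v', e) - (if v' = v then e else 0)) \<le> M * \<delta>"
      using M[OF i] u_nonneg[OF v, of "q i"] by (intro mult_mono) auto
    then show "v (case i of (v', e) \<Rightarrow> of_rat (q (v', e)) * (\<omega> (v', e) - (if v' = v then e else 0))) \<le> \<delta> * M"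
      by (simp add: ve v.mult ext[OF v] mult.commute)
  qed
  finally show ?thesis by simp
qed

lemma u_one: "v \<in> V \<Longrightarrow> u 1 = 1"
  using ext[of v 1] abs_value.one[OF abs_value.intro[OF av]] by (metis of_rat_1)

context
  fixes c \<delta> :: real and \<omega> :: "('k \<Rightarrow> real) \<times> 'k \<Rightarrow> 'k"
  assumes c: "c > 0" "\<And>v q e. v \<in> V \<Longrightarrow> e \<in> E v \<Longrightarrow> c * u (q e) \<le> v (lin_comb q (E v))"
    and near: "near \<omega> \<delta>" and \<delta>: "\<delta> * real (card idx) \<le> c / 8" "\<delta> > 0"
begin

text \<open>At the place whose block contains the largest coefficient the local basis gives c times
  that coefficient, and the perturbation error cannot consume more than half of it. The place
  depends on q.\<close>

lemma comb_lower:
  assumes i: "i \<in> idx"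
  shows "\<exists>v\<in>V. c / 2 * u (q i) \<le> v (comb \<omega> q)"
proof -
  define M where "M = Max ((\<lambda>i. u (q i)) ` idx)"
  have "M \<in> (\<lambda>i. u (q i)) ` idx" unfolding M_def using fin_idx i by (intro Max_in) auto
  then obtain v e where ve: "(v, e) \<in> idx" "M = u (q (v, e))" by auto
  have M: "u (q j) \<le> M" if "j \<in> idx" for j unfolding M_def using that fin_idx by (intro Max_ge) auto
  have v: "v \<in> V" "e \<in> E v" using ve by (auto simp: idx_def)
  interpret v: abs_value v by unfold_locales (rule av[OF v(1)])
  have "c * M \<le> v (lin_comb (\<lambda>e. q (v, e)) (E v))" using c(2)[OF v, of "\<lambda>e. q (v, e)"] ve by simp
  also have "\<dots> \<le> v (comb \<omega> q) + v (comb \<omega> q - lin_comb (\<lambda>e. q (v, e)) (E v))"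
    using v.diff[of "comb \<omega> q" "comb \<omega> q - lin_comb (\<lambda>e. q (v, e)) (E v)"] by simp
  also have "v (comb \<omega> q - lin_comb (\<lambda>e. q (v, e)) (E v)) \<le> real (card idx) * \<delta> * M"
    by (rule perturb[OF near M v(1)])
  also have "real (card idx) * \<delta> * M \<le> c / 2 * M"
    using \<delta> c(1) u_nonneg[OF v(1)] unfolding ve(2) by (intro mult_right_mono) (auto simp: mult.commute)
  finally have "c / 2 * M \<le> v (comb \<omega> q)" by simp
  moreover have "c / 2 * u (q i) \<le> c / 2 * M" using M[OF i] c(1) by (intro mult_left_mono) auto
  ultimately show ?thesis using v by force
qed

lemma comb_eq_0:
  assumes "comb \<omega> q = 0" "i \<in> idx" shows "q i = 0"
proof -
  obtain v where v: "v \<in> V" "c / 2 * u (q i) \<le> v (comb \<omega> q)" using comb_lower[OF assms(2)] by blast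
  interpret v: abs_value v by unfold_locales (rule av[OF v(1)])
  have "u (q i) \<le> 0" using v(2) c(1) assms by (simp add: mult_le_0_iff)
  then have "v (of_rat (q i)) = 0" using ext[OF v(1)] u_nonneg[OF v(1)] by (metis order_antisym)
  then show ?thesis by simp
qed

lemma inj_near: "inj_on \<omega> idx"
proof (rule inj_onI, rule ccontr)
  fix i j assume ij: "i \<in> idx" "j \<in> idx" "\<omega> i = \<omega> j" "i \<noteq> j"
  define q where "q k = (if k = i then 1 else if k = j then -1 else 0 :: rat)" for k
  have "comb \<omega> q = (\<Sum>k\<in>{i, j}. of_rat (q k) * \<omega> k)"
    unfolding comb_def using ij fin_idx by (intro sum.mono_neutral_right) (auto simp: q_def)
  also have "\<dots> = 0" using ij by (simp add: q_def)
  finally show False using comb_eq_0[of q i] ij by (simp add: q_def)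
qed

lemma independent_near: "\<not> rat_vs.dependent (\<omega> ` idx)"
proof
  assume "rat_vs.dependent (\<omega> ` idx)"
  then obtain r w where r: "w \<in> \<omega> ` idx" "r w \<noteq> 0" "(\<Sum>w\<in>\<omega> ` idx. of_rat (r w) * w) = 0"
    using rat_vs.dependent_finite[of "\<omega> ` idx"] fin_idx by blast
  have "comb \<omega> (\<lambda>i. r (\<omega> i)) = 0"
    using r(3) by (simp add: comb_def sum.reindex[OF inj_near])
  then show False using comb_eq_0[of "\<lambda>i. r (\<omega> i)"] r by blast
qed

lemma card_idx_le: "card idx \<le> global_degree TYPE('k)"
  using independent_card_le_global_degree[OF nf independent_near] card_image[OF inj_near] by simp

text \<open>Local approximations at the individual v are chosen independently and glued with
  \<omega>. One quarter of M is lost locally and one quarter by the perturbation.\<close>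

lemma approximate_half:
  assumes M: "M > 0" "\<And>v. v \<in> V \<Longrightarrow> v x \<le> M"
  shows "\<exists>q. \<forall>v\<in>V. v (x - comb \<omega> q) \<le> M / 2"
proof -
  have "\<forall>v\<in>V. \<exists>q. v (x - lin_comb q (E v)) < M / 4"
  proof
    fix v assume "v \<in> V"
    then show "\<exists>q. v (x - lin_comb q (E v)) < M / 4"
      using basis[of v] M(1) unfolding local_basis_def by (meson divide_pos_pos zero_less_numeral)
  qed
  then obtain Q where Q: "\<And>v. v \<in> V \<Longrightarrow> v (x - lin_comb (Q v) (E v)) < M / 4" by metis
  define q where "q i = Q (fst i) (snd i)" for i
  have "v (x - comb \<omega> q) \<le> M / 2" if v: "v \<in> V" for v
  proof -
    interpret v: abs_value v by unfold_locales (rule av[OF v])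
    \<comment> \<open>The local combinations have size at most 2 M; the lower bound of the local
      basis converts this into the coefficient bound that \<open>perturb\<close> asks for.\<close>
    have small: "u (q i) \<le> 2 * M / c" if mem: "i \<in> idx" for i
    proof -
      obtain v e where i: "i = (v, e)" "v \<in> V" "e \<in> E v" using mem by (auto simp: idx_def)
      interpret v: abs_value v by unfold_locales (rule av[OF i(2)])
      have "c * u (q i) \<le> v (lin_comb (Q v) (E v))" using c(2)[OF i(2,3)] by (simp add: q_def i)
      also have "\<dots> \<le> v x + v (x - lin_comb (Q v) (E v))" using v.diff[of x "x - lin_comb (Q v) (E v)"] by simp
      also have "\<dots> \<le> 2 * M" using Q[OF i(2)] M(2)[OF i(2)] M(1) by linarith
      finally show ?thesis using c(1) by (simp add: field_simps)
    qed
    from perturb[OF near small v] have "v (comb \<omega> q - lin_comb (\<lambda>e. q (v, e)) (E v)) \<le> (\<delta> * real (card idx)) * (2 * M / c)"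
      by (simp add: mult_ac)
    also have "\<dots> \<le> (c / 8) * (2 * M / c)" using \<delta> M(1) c(1) by (intro mult_right_mono) auto
    also have "\<dots> = M / 4" using c(1) by simp
    finally have 1: "v (comb \<omega> q - lin_comb (Q v) (E v)) \<le> M / 4" by (simp add: q_def)
    have "x - comb \<omega> q = (x - lin_comb (Q v) (E v)) - (comb \<omega> q - lin_comb (Q v) (E v))" by simp
    then have "v (x - comb \<omega> q) \<le> v (x - lin_comb (Q v) (E v)) + v (comb \<omega> q - lin_comb (Q v) (E v))"
      using v.diff by metis
    then show ?thesis using 1 Q[OF v] by linarith
  qed
  then show ?thesis by blast
qed

text \<open>Halving the remainder repeatedly brings rational combinations of the \<omega> i
  arbitrarily close to x at all places at once.\<close>

lemma approximate_power:
  assumes M: "M > 0" "\<And>v. v \<in> V \<Longrightarrow> v x \<le> M"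
  shows "\<exists>q. \<forall>v\<in>V. v (x - comb \<omega> q) \<le> M / 2 ^ n"
proof (induction n)
  case 0
  show ?case using M by (intro exI[of _ "\<lambda>_. 0"]) (auto simp: comb_def)
next
  case (Suc n)
  then obtain q where q: "\<forall>v\<in>V. v (x - comb \<omega> q) \<le> M / 2 ^ n" by blast
  then obtain r where r: "\<forall>v\<in>V. v (x - comb \<omega> q - comb \<omega> r) \<le> M / 2 ^ n / 2"
    using approximate_half[of "M / 2 ^ n" "x - comb \<omega> q"] M(1) by auto
  then show ?case
    by (intro exI[of _ "\<lambda>i. q i + r i"]) (auto simp: comb_add diff_diff_eq mult.commute)
qed

text \<open>Density does not yet give equality, as \<rat> is not complete. A \<rat>-linear form that
  is 1 at a missing x and 0 on the span still takes the value 1 at the error of any approximation of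
  x, but by \<open>bound\<close> it must become small there.\<close>

lemma span_near:
  assumes bound: "\<And>f :: 'k \<Rightarrow> rat. rat_linear f \<Longrightarrow> \<exists>C. \<forall>x. \<exists>v\<in>V. u (f x) \<le> C * v x"
  shows "rat_vs.span (\<omega> ` idx) = UNIV"
proof (rule ccontr)
  assume "\<not> ?thesis"
  then obtain x where x: "x \<notin> rat_vs.span (\<omega> ` idx)" by blast
  define S where "S = insert x (\<omega> ` idx)"
  have S: "\<not> rat_vs.dependent S"
    unfolding S_def using x independent_near by (rule rat_vs.independent_insertI)
  define B where "B = rat_vs.extend_basis S"
  have B: "\<not> rat_vs.dependent B" "rat_vs.span B = UNIV" "S \<subseteq> B"
    unfolding B_def using rat_vs.independent_extend_basis[OF S] rat_vs.span_extend_basis[OF S]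
      rat_vs.extend_basis_superset[OF S] by simp_all
  define f where "f y = rat_vs.representation B y x" for y
  have f: "rat_linear f" unfolding rat_linear_def f_def
    using B by (auto simp: rat_vs.representation_add rat_vs.representation_scale)
  have "x \<in> B" using B(3) by (simp add: S_def)
  then have fx: "f x = 1" unfolding f_def by (subst rat_vs.representation_basis[OF B(1)]) simp_all
  have f\<omega>: "f (\<omega> i) = 0" if "i \<in> idx" for i
  proof -
    have "\<omega> i \<in> rat_vs.span (\<omega> ` idx)" using that by (intro rat_vs.span_base) simp
    then have "\<omega> i \<noteq> x" using x by metis
    moreover have "\<omega> i \<in> B" using B(3) that by (auto simp: S_def)
    ultimately show ?thesis unfolding f_def by (subst rat_vs.representation_basis[OF B(1)]) simp_all
  qed
  have fc: "f (comb \<omega> q) = 0" for q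
  proof -
    have "f (comb \<omega> q) = (\<Sum>i\<in>idx. f (of_rat (q i) * \<omega> i))" unfolding comb_def by (rule rat_linear_sum[OF f])
    also have "\<dots> = (\<Sum>i\<in>idx. 0)" using f f\<omega> by (intro sum.cong) (auto simp: rat_linear_def)
    finally show ?thesis by simp
  qed
  obtain C where C: "\<And>y. \<exists>v\<in>V. u (f y) \<le> C * v y" using bound[OF f] by blast
  have nn: "v y \<ge> 0" if "v \<in> V" for v y using abs_value.nonneg[OF abs_value.intro[OF av[OF that]]] .
  define M where "M = 1 + (\<Sum>v\<in>V. v x)"
  have M: "v x \<le> M" if "v \<in> V" for v using member_le_sum[of v V "\<lambda>v. v x"] nn that fin by (simp add: M_def)
  have M0: "M > 0" using sum_nonneg[of V "\<lambda>v. v x"] nn by (simp add: M_def add_pos_nonneg)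
  obtain n where n: "\<bar>C\<bar> * M < 2 ^ n" using real_arch_pow[of 2 "\<bar>C\<bar> * M"] by auto
  have "\<exists>q. \<forall>v\<in>V. v (x - comb \<omega> q) \<le> M / 2 ^ n"
    by (rule approximate_power) (use M0 M in auto)
  then obtain q where q: "\<forall>v\<in>V. v (x - comb \<omega> q) \<le> M / 2 ^ n" by blast
  have "f (x - comb \<omega> q) = 1"
  proof -
    have "f x = f (x - comb \<omega> q) + f (comb \<omega> q)" using f unfolding rat_linear_def by (metis diff_add_cancel)
    then show ?thesis using fx fc by simp
  qed
  then obtain v where v: "v \<in> V" "u 1 \<le> C * v (x - comb \<omega> q)" using C by metis
  have "C * v (x - comb \<omega> q) \<le> \<bar>C\<bar> * (M / 2 ^ n)"
    using q v nn by (intro mult_mono) auto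
  also have "\<dots> < 1" using n by (simp add: field_simps)
  finally show False using v u_one by simp
qed

text \<open>This makes the row of index (v, e) of the multiplication matrix of x comparable to
  \<open>v x\<close>, with an error that vanishes with \<delta>. The product of x and
  \<open>\<omega> (v, e)\<close> has size about \<open>v x\<close> at v and at most S \<delta>
  elsewhere, and its coefficients are governed by these sizes.\<close>

lemma row_bound:
  assumes i: "(v, e) \<in> idx" and A: "v e \<le> A" and S: "\<And>v'. v' \<in> V \<Longrightarrow> v' x \<le> S" "S \<ge> 0"
    and \<delta>1: "\<delta> \<le> 1" and eq: "x * \<omega> (v, e) = comb \<omega> q" and j: "j \<in> idx"
    and K: "K = S + real (card idx) * (2 / c * (S * (A + 1)))"
  shows "c * u (q j) \<le> A * v x + K * \<delta>"
proof -
  have v: "v \<in> V" "e \<in> E v" using i by (auto simp: idx_def)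
  interpret v: abs_value v by unfold_locales (rule av[OF v(1)])
  have A0: "A \<ge> 0" using A v.nonneg[of e] by linarith
  have we: "v (\<omega> (v, e)) \<le> A + \<delta>"
  proof -
    have "v (\<omega> (v, e) - e) < \<delta>" using near i by (auto simp: near_def)
    then show ?thesis using v.add[of "\<omega> (v, e) - e" e] A by simp
  qed
  have wo: "v' (\<omega> (v, e)) < \<delta>" if "v' \<in> V" "v' \<noteq> v" for v' using near i that by (auto simp: near_def)
  have w1: "v' (\<omega> (v, e)) \<le> A + 1" if "v' \<in> V" for v'
    using we wo[OF that] \<delta>1 A0 by (cases "v' = v") auto
  \<comment> \<open>A crude bound for the coefficients, independent of \<delta>, has to come first:
    the perturbation error is measured by the largest coefficient.\<close>
  have K1: "u (q j) \<le> 2 / c * (S * (A + 1))" if j: "j \<in> idx" for j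
  proof -
    obtain v' where v': "v' \<in> V" "c / 2 * u (q j) \<le> v' (comb \<omega> q)" using comb_lower[OF j] by blast
    interpret v': abs_value v' by unfold_locales (rule av[OF v'(1)])
    have "v' (comb \<omega> q) = v' x * v' (\<omega> (v, e))" unfolding eq[symmetric] by (rule v'.mult)
    also have "\<dots> \<le> S * (A + 1)" using S w1 v'(1) by (intro mult_mono) auto
    finally have "c / 2 * u (q j) \<le> S * (A + 1)" using v' by linarith
    then show ?thesis using c(1) by (simp add: field_simps)
  qed
  obtain v' e' where j': "j = (v', e')" "v' \<in> V" "e' \<in> E v'" using j by (auto simp: idx_def)
  interpret v': abs_value v' by unfold_locales (rule av[OF j'(2)])
  have "c * u (q j) \<le> v' (lin_comb (\<lambda>e. q (v', e)) (E v'))" using c(2)[OF j'(2,3), of "\<lambda>e. q (v', e)"] by (simp add: j')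
  also have "\<dots> \<le> v' (comb \<omega> q) + v' (comb \<omega> q - lin_comb (\<lambda>e. q (v', e)) (E v'))"
    using v'.diff[of "comb \<omega> q" "comb \<omega> q - lin_comb (\<lambda>e. q (v', e)) (E v')"] by simp
  also have "v' (comb \<omega> q) = v' x * v' (\<omega> (v, e))" unfolding eq[symmetric] by (rule v'.mult)
  also have "v' (comb \<omega> q - lin_comb (\<lambda>e. q (v', e)) (E v')) \<le> real (card idx) * \<delta> * (2 / c * (S * (A + 1)))"
    by (rule perturb[OF near K1 j'(2)])
  also have "v' x * v' (\<omega> (v, e)) \<le> A * v x + S * \<delta>"
  proof (cases "v' = v")
    case True
    have "v x * v (\<omega> (v, e)) \<le> v x * (A + \<delta>)" using we by (intro mult_left_mono) auto
    also have "\<dots> \<le> A * v x + S * \<delta>" using S(1)[OF v(1)] \<delta>(2) by (simp add: algebra_simps mult_left_mono)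
    finally show ?thesis using True by simp
  next
    case False
    have "v' x * v' (\<omega> (v, e)) \<le> S * \<delta>" using wo[OF j'(2) False] S j'(2) by (intro mult_mono) auto
    then show ?thesis using A0 by (simp add: add_increasing)
  qed
  finally show ?thesis unfolding K by (simp add: algebra_simps)
qed

end

theorem sum_local_degrees_le: "(\<Sum>v\<in>V. card (E v)) \<le> global_degree TYPE('k)"
proof -
  obtain c where c: "c > 0" "\<And>v q e. v \<in> V \<Longrightarrow> e \<in> E v \<Longrightarrow> c * u (q e) \<le> v (lin_comb q (E v))"
    using uniform_bound by blast
  define \<delta> where "\<delta> = c / (8 * (real (card idx) + 1))"
  have \<delta>: "\<delta> > 0" using c by (simp add: \<delta>_def)
  then obtain \<omega> where \<omega>: "near \<omega> \<delta>" using near_exists by blast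
  have "\<delta> * real (card idx) \<le> c / 8" using c by (simp add: \<delta>_def field_simps)
  then show ?thesis unfolding card_idx[symmetric]
    by (intro card_idx_le[where c = c and \<delta> = \<delta> and \<omega> = \<omega>]) (use c \<delta> \<omega> in auto)
qed

end

section \<open>Multiplication matrices and the field norm\<close>

definition basis_list :: "'k :: field_char_0 list \<Rightarrow> bool" where
  "basis_list ws \<longleftrightarrow> distinct ws \<and> \<not> rat_vs.dependent (set ws) \<and> rat_vs.span (set ws) = UNIV"

definition coord :: "'k :: field_char_0 list \<Rightarrow> 'k \<Rightarrow> nat \<Rightarrow> rat" where
  "coord ws x j = rat_vs.representation (set ws) x (ws ! j)"

lemma sum_set_nth: "distinct ws \<Longrightarrow> (\<Sum>w\<in>set ws. f w) = (\<Sum>j<length ws. f (ws ! j))"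
  using sum.reindex_bij_betw[OF bij_betw_nth, of ws "{..<length ws}" "set ws" f] by simp

lemma coord_expand:
  assumes "basis_list ws" shows "(\<Sum>j<length ws. of_rat (coord ws x j) * ws ! j) = x"
proof -
  have "(\<Sum>w\<in>set ws. of_rat (rat_vs.representation (set ws) x w) * w) = x"
    using assms by (intro rat_vs.sum_representation_eq) (auto simp: basis_list_def)
  then show ?thesis using assms by (simp add: basis_list_def sum_set_nth coord_def)
qed

lemma coord_unique:
  assumes ws: "basis_list ws" and eq: "(\<Sum>j<length ws. of_rat (p j) * ws ! j) = (\<Sum>j<length ws. of_rat (q j) * ws ! j)"
    and i: "i < length ws"
  shows "p i = q i"
proof -
  have d: "distinct ws" and ind: "\<not> rat_vs.dependent (set ws)" using ws by (auto simp: basis_list_def)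
  define r where "r w = p (THE j. j < length ws \<and> ws ! j = w) - q (THE j. j < length ws \<and> ws ! j = w)" for w
  have r: "r (ws ! j) = p j - q j" if "j < length ws" for j
  proof -
    have "(THE k. k < length ws \<and> ws ! k = ws ! j) = j"
      by (rule the_equality) (use that d in \<open>auto simp: nth_eq_iff_index_eq\<close>)
    then show ?thesis by (simp add: r_def)
  qed
  have "(\<Sum>w\<in>set ws. of_rat (r w) * w) = (\<Sum>j<length ws. of_rat (p j) * ws ! j - of_rat (q j) * ws ! j)"
    unfolding sum_set_nth[OF d] by (intro sum.cong) (auto simp: r of_rat_diff left_diff_distrib)
  also have "\<dots> = 0" using eq by (simp add: sum_subtractf)
  finally have "r (ws ! i) = 0"
    using rat_vs.dependent_finite[of "set ws"] ind i by (metis List.finite_set nth_mem)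
  then show ?thesis using r[OF i] by simp
qed

text \<open>Row i holds the coordinates of \<open>x * ws ! i\<close>, so products of matrices appear
  in reverse order; the determinant is the same as in the column convention.\<close>

definition mult_mat :: "'k :: field_char_0 list \<Rightarrow> 'k \<Rightarrow> rat mat" where
  "mult_mat ws x = mat (length ws) (length ws) (\<lambda>(i, j). coord ws (x * ws ! i) j)"

lemma mult_mat_carrier [simp]: "mult_mat ws x \<in> carrier_mat (length ws) (length ws)"
  by (simp add: mult_mat_def)

lemma mult_mat_index: "i < length ws \<Longrightarrow> j < length ws \<Longrightarrow> mult_mat ws x $$ (i, j) = coord ws (x * ws ! i) j"
  by (simp add: mult_mat_def)

lemma mult_mat_mult:
  assumes ws: "basis_list ws"
  shows "mult_mat ws (x * y) = mult_mat ws y * mult_mat ws x"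
proof (rule eq_matI)
  let ?n = "length ws"
  fix i j assume "i < dim_row (mult_mat ws y * mult_mat ws x)" "j < dim_col (mult_mat ws y * mult_mat ws x)"
  then have ij: "i < ?n" "j < ?n" by (auto simp: mult_mat_def)
  define p where "p k = (\<Sum>l<?n. coord ws (y * ws ! i) l * coord ws (x * ws ! l) k)" for k
  have "(\<Sum>k<?n. of_rat (p k) * ws ! k) = (\<Sum>k<?n. \<Sum>l<?n. of_rat (coord ws (y * ws ! i) l) * (of_rat (coord ws (x * ws ! l) k) * ws ! k))"
    by (simp add: p_def of_rat_sum of_rat_mult sum_distrib_right mult.assoc)
  also have "\<dots> = (\<Sum>l<?n. of_rat (coord ws (y * ws ! i) l) * (\<Sum>k<?n. of_rat (coord ws (x * ws ! l) k) * ws ! k))"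
    by (subst sum.swap) (simp add: sum_distrib_left)
  also have "\<dots> = (\<Sum>l<?n. x * (of_rat (coord ws (y * ws ! i) l) * ws ! l))"
    by (simp only: coord_expand[OF ws] mult.left_commute)
  also have "\<dots> = x * (\<Sum>l<?n. of_rat (coord ws (y * ws ! i) l) * ws ! l)"
    by (rule sum_distrib_left[symmetric])
  also have "\<dots> = (\<Sum>k<?n. of_rat (coord ws (x * y * ws ! i) k) * ws ! k)"
    by (simp only: coord_expand[OF ws] mult.assoc)
  finally have "p j = coord ws (x * y * ws ! i) j" by (rule coord_unique[OF ws]) (rule ij)
  moreover have "(mult_mat ws y * mult_mat ws x) $$ (i, j) = p j"
    using ij by (simp add: mult_mat_def p_def scalar_prod_def lessThan_atLeast0)
  ultimately show "mult_mat ws (x * y) $$ (i, j) = (mult_mat ws y * mult_mat ws x) $$ (i, j)"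
    using ij by (simp add: mult_mat_index)
qed (simp_all add: mult_mat_def)

lemma coord_nth:
  assumes ws: "basis_list ws" and "i < length ws" "j < length ws"
  shows "coord ws (ws ! i) j = (if j = i then 1 else 0)"
proof (rule coord_unique[OF ws _ assms(3)])
  show "(\<Sum>j<length ws. of_rat (coord ws (ws ! i) j) * ws ! j) = (\<Sum>j<length ws. of_rat (if j = i then 1 else 0) * ws ! j)"
    unfolding coord_expand[OF ws] using assms(2)
    by (simp add: if_distrib[of of_rat] if_distrib[of "\<lambda>r. r * _"] cong: if_cong)
qed

lemma mult_mat_one:
  assumes ws: "basis_list ws" shows "mult_mat ws 1 = 1\<^sub>m (length ws)"
  by (rule eq_matI) (auto simp: mult_mat_def coord_nth[OF ws])

text \<open>The coordinate matrices between the two bases satisfy P Q = 1, and multiplication by x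
  does not depend on coordinates, so P conjugates one matrix into the other.\<close>

lemma det_mult_mat_basis_change:
  assumes ws: "basis_list ws" and bs: "basis_list bs" and len: "length ws = length bs"
  shows "Determinant.det (mult_mat ws x) = Determinant.det (mult_mat bs x)"
proof -
  let ?n = "length bs"
  define P where "P = mat ?n ?n (\<lambda>(i, j). coord bs (ws ! i) j)"
  define Q where "Q = mat ?n ?n (\<lambda>(i, j). coord ws (bs ! i) j)"
  have [simp]: "P \<in> carrier_mat ?n ?n" "Q \<in> carrier_mat ?n ?n" by (simp_all add: P_def Q_def)
  have [simp]: "mult_mat ws x \<in> carrier_mat ?n ?n" using mult_mat_carrier[of ws x] len by simp
  have PQ: "P * Q = 1\<^sub>m ?n"
  proof (rule eq_matI)
    fix i j assume "i < dim_row (1\<^sub>m ?n :: rat mat)" "j < dim_col (1\<^sub>m ?n :: rat mat)"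
    then have ij: "i < ?n" "j < ?n" by auto
    define p where "p k = (\<Sum>l<?n. coord bs (ws ! i) l * coord ws (bs ! l) k)" for k
    have "(\<Sum>k<?n. of_rat (p k) * ws ! k) = (\<Sum>k<?n. \<Sum>l<?n. of_rat (coord bs (ws ! i) l) * (of_rat (coord ws (bs ! l) k) * ws ! k))"
      by (simp add: p_def of_rat_sum of_rat_mult sum_distrib_right mult.assoc)
    also have "\<dots> = (\<Sum>l<?n. of_rat (coord bs (ws ! i) l) * (\<Sum>k<?n. of_rat (coord ws (bs ! l) k) * ws ! k))"
      by (subst sum.swap) (simp add: sum_distrib_left)
    also have "\<dots> = ws ! i" by (simp add: coord_expand[OF ws, unfolded len] coord_expand[OF bs])
    also have "\<dots> = (\<Sum>k<?n. of_rat (coord ws (ws ! i) k) * ws ! k)"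
      by (simp add: coord_expand[OF ws, unfolded len])
    finally have "p j = coord ws (ws ! i) j"
      using coord_unique[OF ws, of p "coord ws (ws ! i)" j] ij len by simp
    then show "(P * Q) $$ (i, j) = 1\<^sub>m ?n $$ (i, j)"
      using ij len coord_nth[OF ws, of i j] by (simp add: P_def Q_def p_def scalar_prod_def lessThan_atLeast0)
  qed (simp_all add: P_def Q_def)
  have comm: "mult_mat ws x * P = P * mult_mat bs x"
  proof (rule eq_matI)
    fix i j assume "i < dim_row (P * mult_mat bs x)" "j < dim_col (P * mult_mat bs x)"
    then have ij: "i < ?n" "j < ?n" by (auto simp: P_def mult_mat_def)
    define p where "p k = (\<Sum>l<?n. coord ws (x * ws ! i) l * coord bs (ws ! l) k)" for k
    define q where "q k = (\<Sum>l<?n. coord bs (ws ! i) l * coord bs (x * bs ! l) k)" for k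
    have "(\<Sum>k<?n. of_rat (p k) * bs ! k) = (\<Sum>k<?n. \<Sum>l<?n. of_rat (coord ws (x * ws ! i) l) * (of_rat (coord bs (ws ! l) k) * bs ! k))"
      by (simp add: p_def of_rat_sum of_rat_mult sum_distrib_right mult.assoc)
    also have "\<dots> = (\<Sum>l<?n. of_rat (coord ws (x * ws ! i) l) * (\<Sum>k<?n. of_rat (coord bs (ws ! l) k) * bs ! k))"
      by (subst sum.swap) (simp add: sum_distrib_left)
    also have "\<dots> = x * ws ! i" by (simp add: coord_expand[OF ws, unfolded len] coord_expand[OF bs])
    finally have p: "(\<Sum>k<?n. of_rat (p k) * bs ! k) = x * ws ! i" .
    have "(\<Sum>k<?n. of_rat (q k) * bs ! k) = (\<Sum>k<?n. \<Sum>l<?n. of_rat (coord bs (ws ! i) l) * (of_rat (coord bs (x * bs ! l) k) * bs ! k))"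
      by (simp add: q_def of_rat_sum of_rat_mult sum_distrib_right mult.assoc)
    also have "\<dots> = (\<Sum>l<?n. of_rat (coord bs (ws ! i) l) * (\<Sum>k<?n. of_rat (coord bs (x * bs ! l) k) * bs ! k))"
      by (subst sum.swap) (simp add: sum_distrib_left)
    also have "\<dots> = (\<Sum>l<?n. x * (of_rat (coord bs (ws ! i) l) * bs ! l))"
      by (simp only: coord_expand[OF bs] mult.left_commute)
    also have "\<dots> = x * (\<Sum>l<?n. of_rat (coord bs (ws ! i) l) * bs ! l)"
      by (rule sum_distrib_left[symmetric])
    also have "\<dots> = x * ws ! i" by (simp add: coord_expand[OF bs])
    finally have "p j = q j" using p coord_unique[OF bs, of p q j] ij by simp
    then show "(mult_mat ws x * P) $$ (i, j) = (P * mult_mat bs x) $$ (i, j)"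
      using ij len by (simp add: P_def mult_mat_def p_def q_def scalar_prod_def lessThan_atLeast0)
  qed (simp_all add: P_def mult_mat_def len)
  have "Determinant.det P * Determinant.det Q = 1" using PQ by (metis \<open>P \<in> _\<close> \<open>Q \<in> _\<close> det_mult det_one)
  then have "Determinant.det P \<noteq> 0" by auto
  moreover have "Determinant.det (mult_mat ws x * P) = Determinant.det (mult_mat ws x) * Determinant.det P"
    by (rule det_mult[of _ "length bs"]) simp_all
  moreover have "Determinant.det (P * mult_mat bs x) = Determinant.det P * Determinant.det (mult_mat bs x)"
    by (rule det_mult[of _ "length bs"]) simp_all
  ultimately show ?thesis unfolding comm by (metis mult.commute mult_right_cancel)
qed

text \<open>The choice of basis does not matter, by \<open>field_norm_eq\<close>. This freedom is
  essential later: the norm of x is estimated in a basis that is chosen after x.\<close>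

definition field_norm :: "'k :: field_char_0 \<Rightarrow> rat" where
  "field_norm x = Determinant.det (mult_mat (SOME ws. basis_list ws) x)"

lemma basis_list_exists:
  assumes "number_field TYPE('k :: field_char_0)"
  shows "\<exists>ws :: 'k :: field_char_0 list. basis_list ws"
proof -
  obtain B :: "'k set" where "finite B" "\<not> rat_vs.dependent B" "rat_vs.span B = UNIV"
    using number_field_basis[OF assms] by metis
  moreover obtain ws where "set ws = B" "distinct ws" using finite_distinct_list[OF \<open>finite B\<close>] by blast
  ultimately show ?thesis unfolding basis_list_def by blast
qed

lemma basis_list_length:
  assumes "basis_list (ws :: 'k :: field_char_0 list)"
  shows "length ws = global_degree TYPE('k)"
  unfolding global_degree_def using assms rat_vs.dim_eq_card[of "set ws" UNIV]
  by (auto simp: basis_list_def distinct_card)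

lemma field_norm_eq:
  assumes "basis_list ws" shows "field_norm x = Determinant.det (mult_mat ws x)"
proof -
  have b: "basis_list (SOME ws :: 'a list. basis_list ws)" using assms by (rule someI)
  show ?thesis unfolding field_norm_def
    by (rule det_mult_mat_basis_change[OF b assms]) (simp only: basis_list_length[OF b] basis_list_length[OF assms])
qed

lemma field_norm_mult:
  assumes "number_field TYPE('k :: field_char_0)"
  shows "field_norm (x * y :: 'k :: field_char_0) = field_norm x * field_norm y"
proof -
  obtain ws :: "'k list" where ws: "basis_list ws" using basis_list_exists[OF assms] by blast
  show ?thesis unfolding field_norm_eq[OF ws] mult_mat_mult[OF ws]
    by (subst det_mult[of _ "length ws"]) (auto simp: mult.commute)
qed

lemma field_norm_one:
  assumes "number_field TYPE('k :: field_char_0)"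
  shows "field_norm (1 :: 'k :: field_char_0) = 1"
proof -
  obtain ws :: "'k list" where ws: "basis_list ws" using basis_list_exists[OF assms] by blast
  show ?thesis unfolding field_norm_eq[OF ws] mult_mat_one[OF ws] by simp
qed

lemma field_norm_power:
  assumes "number_field TYPE('k :: field_char_0)"
  shows "field_norm (x ^ n :: 'k :: field_char_0) = field_norm x ^ n"
  by (induction n) (simp_all add: field_norm_one[OF assms] field_norm_mult[OF assms])

lemma field_norm_nonzero:
  assumes "number_field TYPE('k :: field_char_0)" "x \<noteq> (0 :: 'k :: field_char_0)"
  shows "field_norm x \<noteq> 0"
proof
  assume "field_norm x = 0"
  then have "field_norm (x * inverse x) = 0" by (simp add: field_norm_mult[OF assms(1)])
  then show False using assms by (simp add: field_norm_one)
qed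

text \<open>Every Leibniz term contains one entry from each row and one from each column, so all n!
  terms share one bound; in the ultrametric case only the largest counts. The row factors will carry
  norms, the column factors the smallness of a single column.\<close>

lemma (in abs_value) det_le_rows_columns:
  assumes A: "A \<in> carrier_mat n n" and le: "\<And>i j. i < n \<Longrightarrow> j < n \<Longrightarrow> a (A $$ (i, j)) \<le> r i * s j"
  shows "a (Determinant.det A) \<le> fact n * ((\<Prod>i<n. r i) * (\<Prod>j<n. s j))"
    and "(\<And>x y. a (x + y) \<le> max (a x) (a y)) \<Longrightarrow> (\<And>i. i < n \<Longrightarrow> r i \<ge> 0) \<Longrightarrow> (\<And>i. i < n \<Longrightarrow> s i \<ge> 0) \<Longrightarrow>
      a (Determinant.det A) \<le> (\<Prod>i<n. r i) * (\<Prod>j<n. s j)"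
proof -
  have term_le: "a (signof p * (\<Prod>i=0..<n. A $$ (i, p i))) \<le> (\<Prod>i<n. r i) * (\<Prod>j<n. s j)" if p: "p permutes {0..<n}" for p
  proof -
    have "a (signof p) = 1" by (simp add: sign_def)
    then have "a (signof p * (\<Prod>i=0..<n. A $$ (i, p i))) = (\<Prod>i<n. a (A $$ (i, p i)))"
      by (simp add: mult prod lessThan_atLeast0)
    also have "\<dots> \<le> (\<Prod>i<n. r i * s (p i))"
      using permutes_in_image[OF p] by (intro prod_mono) (auto intro!: le)
    also have "\<dots> = (\<Prod>i<n. r i) * (\<Prod>i<n. s (p i))" by (rule prod.distrib)
    also have "(\<Prod>i<n. s (p i)) = (\<Prod>j<n. s j)"
      using permutes_imp_bij[OF p] by (intro prod.reindex_bij_betw) (simp add: lessThan_atLeast0)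
    finally show ?thesis .
  qed
  have "a (Determinant.det A) \<le> (\<Sum>p\<in>{p. p permutes {0..<n}}. a (signof p * (\<Prod>i=0..<n. A $$ (i, p i))))"
    unfolding det_def'[OF A] by (rule sum_le)
  also have "\<dots> \<le> (\<Sum>p\<in>{p. p permutes {0..<n}}. (\<Prod>i<n. r i) * (\<Prod>j<n. s j))"
    by (rule sum_mono) (use term_le in auto)
  also have "\<dots> = fact n * ((\<Prod>i<n. r i) * (\<Prod>j<n. s j))" using card_permutations[of "{0..<n}" n] by simp
  finally show "a (Determinant.det A) \<le> fact n * ((\<Prod>i<n. r i) * (\<Prod>j<n. s j))" .
  assume um: "\<And>x y. a (x + y) \<le> max (a x) (a y)" and nn: "\<And>i. i < n \<Longrightarrow> r i \<ge> 0" "\<And>i. i < n \<Longrightarrow> s i \<ge> 0"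
  show "a (Determinant.det A) \<le> (\<Prod>i<n. r i) * (\<Prod>j<n. s j)"
    unfolding det_def'[OF A]
    by (rule ultrametric_sum[OF um]) (use term_le nn in \<open>auto intro!: mult_nonneg_nonneg prod_nonneg\<close>)
qed

lemma (in abs_value) det_le:
  assumes "A \<in> carrier_mat n n" "\<And>i j. i < n \<Longrightarrow> j < n \<Longrightarrow> a (A $$ (i, j)) \<le> r i"
  shows "a (Determinant.det A) \<le> fact n * (\<Prod>i<n. r i)"
  using det_le_rows_columns(1)[OF assms(1), of r "\<lambda>_. 1"] assms(2) by simp

text \<open>The boundedness of linear forms makes the elements \<open>\<omega> (v, e)\<close> a basis, and in that basis
  multiplication by \<open>x\<close> is nearly block diagonal at \<open>u\<close>.\<close>

locale complete_block_system = block_system u V E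
  for u and V :: "('k :: field_char_0 \<Rightarrow> real) set" and E +
  assumes bound: "\<And>f :: 'k \<Rightarrow> rat. rat_linear f \<Longrightarrow> \<exists>C. \<forall>x. \<exists>v\<in>V. u (f x) \<le> C * v x"
    and u_av: "absolute_value u"
begin

lemma basis_list_near:
  assumes c: "c > 0" "\<And>v q e. v \<in> V \<Longrightarrow> e \<in> E v \<Longrightarrow> c * u (q e) \<le> v (lin_comb q (E v))"
    and \<omega>: "near \<omega> \<delta>" and \<delta>: "\<delta> * real (card idx) \<le> c / 8" "\<delta> > 0"
    and "is": "set is = idx" "distinct is"
  shows "basis_list (map \<omega> is)"
proof -
  have "inj_on \<omega> idx" by (rule inj_near[where c = c and \<delta> = \<delta>]) (use c \<omega> \<delta> in auto)
  moreover have "\<not> rat_vs.dependent (\<omega> ` idx)" by (rule independent_near[where c = c and \<delta> = \<delta>]) (use c \<omega> \<delta> in auto)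
  moreover have "rat_vs.span (\<omega> ` idx) = UNIV" by (rule span_near[where c = c and \<delta> = \<delta>]) (use c \<omega> \<delta> bound in auto)
  ultimately show ?thesis using "is" by (simp add: basis_list_def distinct_map)
qed

lemma near_exists_small:
  assumes "c > 0" "m > 0"
  obtains \<omega> \<delta> where "near \<omega> \<delta>" "\<delta> * real (card idx) \<le> c / 8" "\<delta> > 0" "\<delta> \<le> 1" "\<delta> \<le> m"
proof -
  define \<delta> where "\<delta> = min (min 1 m) (c / (8 * (real (card idx) + 1)))"
  have \<delta>: "\<delta> > 0" using assms by (simp add: \<delta>_def)
  have "\<delta> * real (card idx) \<le> c / (8 * (real (card idx) + 1)) * real (card idx)"
    by (intro mult_right_mono) (auto simp: \<delta>_def)
  also have "\<dots> \<le> c / 8" using assms by (simp add: field_simps)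
  finally show thesis using that near_exists[OF \<delta>] \<delta> by (auto simp: \<delta>_def)
qed

theorem sum_local_degrees: "(\<Sum>v\<in>V. card (E v)) = global_degree TYPE('k)"
proof -
  obtain c where c: "c > 0" "\<And>v q e. v \<in> V \<Longrightarrow> e \<in> E v \<Longrightarrow> c * u (q e) \<le> v (lin_comb q (E v))"
    using uniform_bound by blast
  obtain \<omega> \<delta> where \<omega>: "near \<omega> \<delta>" "\<delta> * real (card idx) \<le> c / 8" "\<delta> > 0"
    by (rule near_exists_small[of c 1]) (use c in auto)
  obtain "is" where "is": "set is = idx" "distinct is" using finite_distinct_list[OF fin_idx] by blast
  have "basis_list (map \<omega> is)" by (rule basis_list_near[OF c(1) _ \<omega> "is"]) (use c in auto)
  from basis_list_length[OF this] show ?thesis using "is" by (simp add: card_idx[symmetric] distinct_card[symmetric])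
qed

text \<open>In a basis near the local bases, row (v, e) of the multiplication matrix is at most a
  constant times \<open>v x\<close>, and each v contributes \<open>card (E v)\<close> rows. The
  basis depends on x, as \<delta> must be small against all \<open>v x\<close>, but the constant
  does not.\<close>

lemma norm_le: "\<exists>C. \<forall>x. x \<noteq> 0 \<longrightarrow> u (field_norm x) \<le> C * (\<Prod>v\<in>V. v x ^ card (E v))"
proof -
  interpret u: abs_value u by unfold_locales (rule u_av)
  obtain c where c: "c > 0" "\<And>v q e. v \<in> V \<Longrightarrow> e \<in> E v \<Longrightarrow> c * u (q e) \<le> v (lin_comb q (E v))"
    using uniform_bound by blast
  define A where "A = (\<Sum>i\<in>idx. fst i (snd i))"
  have nn: "v y \<ge> 0" if "v \<in> V" for v y using abs_value.nonneg[OF abs_value.intro[OF av[OF that]]] .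
  have A: "v e \<le> A" if "(v, e) \<in> idx" for v e
    using member_le_sum[of "(v, e)" idx "\<lambda>i. fst i (snd i)"] that fin_idx nn by (auto simp: A_def idx_def)
  have A0: "A \<ge> 0" unfolding A_def by (intro sum_nonneg) (use nn in \<open>auto simp: idx_def\<close>)
  obtain "is" where "is": "set is = idx" "distinct is" using finite_distinct_list[OF fin_idx] by blast
  define D where "D = length is"
  have D: "D = card idx" using "is" by (simp add: D_def distinct_card[symmetric])
  have main: "u (field_norm x) \<le> (fact D * ((A + 1) / c) ^ D) * (\<Prod>v\<in>V. v x ^ card (E v))" if x: "x \<noteq> 0" for x
  proof -
    define S where "S = (\<Sum>v\<in>V. v x)"
    have S: "v x \<le> S" if "v \<in> V" for v using member_le_sum[of v V "\<lambda>v. v x"] that nn fin by (simp add: S_def)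
    have S0: "S \<ge> 0" unfolding S_def by (intro sum_nonneg) (use nn in auto)
    define K where "K = S + real (card idx) * (2 / c * (S * (A + 1)))"
    have K0: "K \<ge> 0" unfolding K_def using S0 A0 c(1) by (intro add_nonneg_nonneg mult_nonneg_nonneg) auto
    \<comment> \<open>With \<delta> at most \<open>m / (K + 1)\<close> the error K \<delta> can be
      absorbed into every \<open>v x\<close>.\<close>
    have "\<exists>m>0. \<forall>v\<in>V. m \<le> v x"
    proof (cases "V = {}")
      case False
      then show ?thesis using fin abs_value.pos[OF abs_value.intro[OF av] x]
        by (intro exI[of _ "Min ((\<lambda>v. v x) ` V)"]) auto
    qed (auto intro: exI[of _ 1])
    then obtain m where m: "m > 0" "\<And>v. v \<in> V \<Longrightarrow> m \<le> v x" by blast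
    have m': "m / (K + 1) > 0" using m K0 by simp
    obtain \<omega> \<delta> where \<omega>: "near \<omega> \<delta>" "\<delta> * real (card idx) \<le> c / 8" "\<delta> > 0" "\<delta> \<le> 1" "\<delta> \<le> m / (K + 1)"
      using near_exists_small[OF c(1) m'] by metis
    have K\<delta>: "K * \<delta> \<le> m"
    proof -
      have "K * \<delta> \<le> K * (m / (K + 1))" using \<omega> K0 by (intro mult_left_mono) auto
      also have "\<dots> \<le> m" using K0 m by (simp add: field_simps)
      finally show ?thesis .
    qed
    define ws where "ws = map \<omega> is"
    have ws: "basis_list ws" unfolding ws_def by (rule basis_list_near[OF c(1) _ \<omega>(1-3) "is"]) (use c in auto)
    have lws: "length ws = D" by (simp add: ws_def D_def)
    have inj: "inj_on \<omega> idx" using ws "is" by (simp add: basis_list_def ws_def distinct_map)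
    have entry: "u (mult_mat ws x $$ (i, j)) \<le> (A + 1) / c * fst (is ! i) x" if ij: "i < D" "j < D" for i j
    proof -
      obtain v e where ve: "is ! i = (v, e)" by force
      have mem: "(v, e) \<in> idx" "is ! j \<in> idx" using ij "is" ve by (metis D_def nth_mem)+
      have v: "v \<in> V" using mem by (simp add: idx_def)
      define q where "q k = rat_vs.representation (set ws) (x * ws ! i) (\<omega> k)" for k
      have "comb \<omega> q = (\<Sum>w\<in>\<omega> ` idx. of_rat (rat_vs.representation (set ws) (x * ws ! i) w) * w)"
        by (simp add: comb_def q_def sum.reindex[OF inj])
      also have "\<omega> ` idx = set ws" using "is" by (simp add: ws_def)
      also have "(\<Sum>w\<in>set ws. of_rat (rat_vs.representation (set ws) (x * ws ! i) w) * w) = x * ws ! i"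
        using ws by (intro rat_vs.sum_representation_eq) (auto simp: basis_list_def)
      also have "ws ! i = \<omega> (v, e)" using ij ve by (simp add: ws_def D_def)
      finally have eq: "x * \<omega> (v, e) = comb \<omega> q" by simp
      have "c * u (q (is ! j)) \<le> A * v x + K * \<delta>"
        by (rule row_bound[OF c(1) _ \<omega>(1-3) mem(1) A[OF mem(1)] _ S0 \<omega>(4) eq mem(2) K_def])
           (use c S in auto)
      also have "\<dots> \<le> (A + 1) * v x" using K\<delta> m(2)[OF v] by (simp add: algebra_simps)
      finally have "u (q (is ! j)) \<le> (A + 1) / c * v x" using c(1) by (simp add: field_simps)
      moreover have "q (is ! j) = mult_mat ws x $$ (i, j)"
        using ij lws by (simp add: mult_mat_index coord_def q_def) (simp add: ws_def D_def)
      ultimately show ?thesis by (simp add: ve)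
    qed
    have "u (Determinant.det (mult_mat ws x)) \<le> fact D * (\<Prod>i<D. (A + 1) / c * fst (is ! i) x)"
      by (rule u.det_le[OF _ entry]) (use mult_mat_carrier[of ws x] lws in auto)
    also have "(\<Prod>i<D. (A + 1) / c * fst (is ! i) x) = ((A + 1) / c) ^ D * (\<Prod>i<D. fst (is ! i) x)"
      by (simp only: prod.distrib prod_constant card_lessThan)
    also have "(\<Prod>i<D. fst (is ! i) x) = (\<Prod>k\<in>idx. fst k x)"
      using prod.reindex_bij_betw[OF bij_betw_nth[OF "is"(2) refl refl], of "\<lambda>k. fst k x"] "is" by (simp add: D_def)
    also have "\<dots> = (\<Prod>(v, e)\<in>idx. v x)" by (simp add: case_prod_beta)
    also have "\<dots> = (\<Prod>v\<in>V. \<Prod>e\<in>E v. v x)" unfolding idx_def using fin finE by (intro prod.Sigma[symmetric]) auto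
    finally show ?thesis by (simp add: field_norm_eq[OF ws] mult.assoc)
  qed
  show ?thesis by (rule exI[of _ "fact D * ((A + 1) / c) ^ D"]) (use main in blast)
qed

text \<open>The unknown constant in \<open>norm_le\<close> disappears on passing to powers of \<open>x\<close>; the reverse inequality
  is the same bound for \<open>1 / x\<close>.\<close>

theorem norm_eq:
  assumes "x \<noteq> 0" shows "u (field_norm x) = (\<Prod>v\<in>V. v x ^ card (E v))"
proof -
  interpret u: abs_value u by unfold_locales (rule u_av)
  obtain C where C: "\<And>x. x \<noteq> 0 \<Longrightarrow> u (field_norm x) \<le> C * (\<Prod>v\<in>V. v x ^ card (E v))" using norm_le by blast
  have pos: "(\<Prod>v\<in>V. v x ^ card (E v)) > 0" if "x \<noteq> 0" for x
    using abs_value.pos[OF abs_value.intro[OF av] that] by (intro prod_pos) auto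
  have le: "u (field_norm x) \<le> (\<Prod>v\<in>V. v x ^ card (E v))" if x: "x \<noteq> 0" for x
  proof (rule powers_bound_imp_le)
    fix n :: nat
    have "u (field_norm x) ^ n = u (field_norm (x ^ n))" by (simp add: field_norm_power[OF nf] u.power)
    also have "\<dots> \<le> C * (\<Prod>v\<in>V. v (x ^ n) ^ card (E v))" using x by (intro C) auto
    also have "(\<Prod>v\<in>V. v (x ^ n) ^ card (E v)) = (\<Prod>v\<in>V. v x ^ card (E v)) ^ n"
      unfolding prod_power_distrib
      by (intro prod.cong refl) (simp add: abs_value.power[OF abs_value.intro[OF av]] power_mult[symmetric] mult.commute)
    also have "C * \<dots> \<le> (\<bar>C\<bar> * (real n + 1)) * (\<Prod>v\<in>V. v x ^ card (E v)) ^ n"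
    proof (intro mult_right_mono)
      have "C \<le> \<bar>C\<bar> * 1" by simp
      also have "\<dots> \<le> \<bar>C\<bar> * (real n + 1)" by (intro mult_left_mono) auto
      finally show "C \<le> \<bar>C\<bar> * (real n + 1)" .
    qed (use pos[OF x] in auto)
    finally show "u (field_norm x) ^ n \<le> \<bar>C\<bar> * (real n + 1) * (\<Prod>v\<in>V. v x ^ card (E v)) ^ n" .
  qed (use pos[OF x] in auto)
  have inv: "(\<Prod>v\<in>V. v (inverse x) ^ card (E v)) = inverse (\<Prod>v\<in>V. v x ^ card (E v))"
    unfolding prod_inversef[symmetric] comp_def
    by (intro prod.cong refl) (simp add: abs_value.inverse[OF abs_value.intro[OF av]] power_inverse)
  have "u (field_norm x) * u (field_norm (inverse x)) = 1"
    using assms by (simp add: u.mult[symmetric] field_norm_mult[OF nf, symmetric] field_norm_one[OF nf])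
  moreover have "u (field_norm x) * u (field_norm (inverse x)) \<le> u (field_norm x) * inverse (\<Prod>v\<in>V. v x ^ card (E v))"
    using le[of "inverse x"] assms unfolding inv by (intro mult_left_mono) auto
  ultimately have "1 \<le> u (field_norm x) * inverse (\<Prod>v\<in>V. v x ^ card (E v))" by simp
  then have "(\<Prod>v\<in>V. v x ^ card (E v)) \<le> u (field_norm x)" using pos[OF assms] by (simp add: field_simps)
  then show ?thesis using le[OF assms] by simp
qed

text \<open>The local degrees over V already add up to the global degree. A further extension would
  contribute at least 1 more, against the inequality for the enlarged set.\<close>

theorem extension_in_V:
  assumes a: "absolute_value a" "\<And>q. a (of_rat q) = u q"
  shows "a \<in> V"
proof (rule ccontr)
  assume no: "a \<notin> V"
  obtain F where F: "local_basis a F" using local_basis_exists[OF nf a(1)] by blast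
  have Fc: "card F > 0" using local_basis_nonempty[OF a(1) F] F by (simp add: local_basis_def card_gt_0_iff)
  interpret b: block_system u "insert a V" "E(a := F)"
    using nf fin av ext nontriv basis a F by unfold_locales auto
  have "(\<Sum>v\<in>V. card ((E(a := F)) v)) = (\<Sum>v\<in>V. card (E v))" using no by (intro sum.cong) auto
  then have "card F + (\<Sum>v\<in>V. card (E v)) \<le> global_degree TYPE('k)"
    using b.sum_local_degrees_le no fin by simp
  then show False using sum_local_degrees Fc by simp
qed

end

section \<open>Completions\<close>

context abs_value
begin

definition cauchy_seq :: "(nat \<Rightarrow> 'k) \<Rightarrow> bool" where
  "cauchy_seq f \<longleftrightarrow> (\<forall>\<epsilon>>0. \<exists>N. \<forall>m\<ge>N. \<forall>n\<ge>N. a (f m - f n) < \<epsilon>)"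

lemma Metric_space: "Metric_space UNIV (\<lambda>x y. a (x - y))"
proof
  fix x y z show "a (x - z) \<le> a (x - y) + a (y - z)" using add[of "x - y" "y - z"] by simp
qed (auto simp: minus_commute)

lemma carrier_cauchy_ring: "f \<in> carrier (cauchy_ring a) \<longleftrightarrow> cauchy_seq f"
  unfolding cauchy_ring_def cauchy_seq_def Metric_space.MCauchy_def[OF Metric_space] by simp

lemma cauchy_const: "cauchy_seq (\<lambda>_. x)"
  by (simp add: cauchy_seq_def)

lemma cauchy_add: assumes "cauchy_seq f" "cauchy_seq g" shows "cauchy_seq (\<lambda>n. f n + g n)"
  unfolding cauchy_seq_def
proof (intro allI impI)
  fix \<epsilon> :: real assume "\<epsilon> > 0"
  then have e: "\<epsilon> / 2 > 0" by simp
  obtain N1 where N1: "\<And>m n. m \<ge> N1 \<Longrightarrow> n \<ge> N1 \<Longrightarrow> a (f m - f n) < \<epsilon> / 2" using assms(1) e unfolding cauchy_seq_def by meson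
  obtain N2 where N2: "\<And>m n. m \<ge> N2 \<Longrightarrow> n \<ge> N2 \<Longrightarrow> a (g m - g n) < \<epsilon> / 2" using assms(2) e unfolding cauchy_seq_def by meson
  have "a (f m + g m - (f n + g n)) < \<epsilon>" if "m \<ge> max N1 N2" "n \<ge> max N1 N2" for m n
    using add[of "f m - f n" "g m - g n"] N1[of m n] N2[of m n] that by (simp add: algebra_simps)
  then show "\<exists>N. \<forall>m\<ge>N. \<forall>n\<ge>N. a (f m + g m - (f n + g n)) < \<epsilon>" by blast
qed

lemma cauchy_minus: "cauchy_seq f \<Longrightarrow> cauchy_seq (\<lambda>n. - f n)"
  unfolding cauchy_seq_def by (simp add: minus_commute)

lemma cauchy_bounded: assumes "cauchy_seq f" obtains C where "C > 0" "\<And>n. a (f n) \<le> C"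
proof -
  obtain N where N: "\<And>m n. m \<ge> N \<Longrightarrow> n \<ge> N \<Longrightarrow> a (f m - f n) < 1"
    using assms[unfolded cauchy_seq_def, rule_format, of 1] by auto
  define C where "C = 1 + (\<Sum>n\<le>N. a (f n))"
  have le: "a (f n) \<le> (\<Sum>n\<le>N. a (f n))" if "n \<le> N" for n
    using member_le_sum[of n "{..N}" "\<lambda>n. a (f n)"] that by simp
  have "a (f n) \<le> C" for n
  proof (cases "n \<le> N")
    case True
    then show ?thesis using le[OF True] by (simp add: C_def)
  next
    case False
    then show ?thesis using N[of n N] add[of "f n - f N" "f N"] le[of N] by (simp add: C_def)
  qed
  moreover have "C > 0" by (simp add: C_def add_pos_nonneg sum_nonneg)
  ultimately show thesis using that by blast
qed

lemma cauchy_mult: assumes "cauchy_seq f" "cauchy_seq g" shows "cauchy_seq (\<lambda>n. f n * g n)"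
  unfolding cauchy_seq_def
proof (intro allI impI)
  fix \<epsilon> :: real assume e: "\<epsilon> > 0"
  obtain C where C: "C > 0" "\<And>n. a (f n) \<le> C" using cauchy_bounded[OF assms(1)] by blast
  obtain D where D: "D > 0" "\<And>n. a (g n) \<le> D" using cauchy_bounded[OF assms(2)] by blast
  obtain N1 where N1: "\<And>m n. m \<ge> N1 \<Longrightarrow> n \<ge> N1 \<Longrightarrow> a (f m - f n) < \<epsilon> / (2 * D)"
    using assms(1) e D unfolding cauchy_seq_def by (meson divide_pos_pos mult_pos_pos zero_less_numeral)
  obtain N2 where N2: "\<And>m n. m \<ge> N2 \<Longrightarrow> n \<ge> N2 \<Longrightarrow> a (g m - g n) < \<epsilon> / (2 * C)"
    using assms(2) e C unfolding cauchy_seq_def by (meson divide_pos_pos mult_pos_pos zero_less_numeral)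
  have "a (f m * g m - f n * g n) < \<epsilon>" if "m \<ge> max N1 N2" "n \<ge> max N1 N2" for m n
  proof -
    have "f m * g m - f n * g n = f m * (g m - g n) + (f m - f n) * g n" by (simp add: algebra_simps)
    then have "a (f m * g m - f n * g n) \<le> a (f m) * a (g m - g n) + a (f m - f n) * a (g n)"
      by (metis add mult)
    also have "a (f m) * a (g m - g n) \<le> C * a (g m - g n)" using C by (intro mult_right_mono) auto
    also have "C * a (g m - g n) < C * (\<epsilon> / (2 * C))" using N2 that C by (intro mult_strict_left_mono) auto
    also have "a (f m - f n) * a (g n) \<le> \<epsilon> / (2 * D) * D"
      using N1[of m n] that D e by (intro mult_mono) (auto intro: less_imp_le)
    finally show ?thesis using C D by simp
  qed
  then show "\<exists>N. \<forall>m\<ge>N. \<forall>n\<ge>N. a (f m * g m - f n * g n) < \<epsilon>" by blast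
qed

lemma null_cauchy: assumes "f \<in> null_seqs a" shows "cauchy_seq f"
  unfolding cauchy_seq_def
proof (intro allI impI)
  fix \<epsilon> :: real assume "\<epsilon> > 0"
  moreover have "(\<lambda>n. a (f n)) \<longlonglongrightarrow> 0" using assms by (simp add: null_seqs_def)
  ultimately have "\<forall>\<^sub>F n in sequentially. a (f n) < \<epsilon> / 2" by (intro order_tendstoD) auto
  then obtain N where N: "\<And>n. n \<ge> N \<Longrightarrow> a (f n) < \<epsilon> / 2" by (auto simp: eventually_sequentially)
  have "a (f m - f n) < \<epsilon>" if "m \<ge> N" "n \<ge> N" for m n using diff[of "f m" "f n"] N[of m] N[of n] that by simp
  then show "\<exists>N. \<forall>m\<ge>N. \<forall>n\<ge>N. a (f m - f n) < \<epsilon>" by blast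
qed

lemma nullI: "(\<And>n. a (f n) \<le> g n) \<Longrightarrow> g \<longlonglongrightarrow> 0 \<Longrightarrow> f \<in> null_seqs a"
  unfolding null_seqs_def using tendsto_sandwich[of "\<lambda>_. 0" "\<lambda>n. a (f n)" sequentially g 0] by simp

lemma null_add: assumes "f \<in> null_seqs a" "g \<in> null_seqs a" shows "(\<lambda>n. f n + g n) \<in> null_seqs a"
proof (rule nullI)
  show "a (f n + g n) \<le> a (f n) + a (g n)" for n by (rule add)
  show "(\<lambda>n. a (f n) + a (g n)) \<longlonglongrightarrow> 0" using tendsto_add[of _ 0 _ _ 0] assms by (fastforce simp: null_seqs_def)
qed

lemma null_minus: "f \<in> null_seqs a \<Longrightarrow> (\<lambda>n. - f n) \<in> null_seqs a"
  by (simp add: null_seqs_def)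

lemma null_mult: assumes "f \<in> null_seqs a" "cauchy_seq g" shows "(\<lambda>n. g n * f n) \<in> null_seqs a"
proof -
  obtain C where C: "C > 0" "\<And>n. a (g n) \<le> C" using cauchy_bounded[OF assms(2)] by blast
  show ?thesis
  proof (rule nullI)
    show "a (g n * f n) \<le> C * a (f n)" for n unfolding mult using C by (intro mult_right_mono) auto
    show "(\<lambda>n. C * a (f n)) \<longlonglongrightarrow> 0" using assms(1) tendsto_mult_right_zero by (auto simp: null_seqs_def)
  qed
qed

lemma cring_cauchy_ring: "cring (cauchy_ring a)"
proof (rule cringI)
  show "abelian_group (cauchy_ring a)"
  proof (rule abelian_groupI)
    fix f assume "f \<in> carrier (cauchy_ring a)"
    then show "\<exists>g\<in>carrier (cauchy_ring a). g \<oplus>\<^bsub>cauchy_ring a\<^esub> f = \<zero>\<^bsub>cauchy_ring a\<^esub>"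
      by (intro bexI[of _ "\<lambda>n. - f n"]) (auto simp: carrier_cauchy_ring cauchy_minus, auto simp: cauchy_ring_def)
  qed (auto simp: carrier_cauchy_ring, auto simp: cauchy_ring_def cauchy_const cauchy_add algebra_simps)
  show "comm_monoid (cauchy_ring a)"
    by (rule comm_monoidI) (auto simp: carrier_cauchy_ring, auto simp: cauchy_ring_def cauchy_const cauchy_mult algebra_simps)
qed (auto simp: cauchy_ring_def algebra_simps)

lemma ideal_null_seqs: "ideal (null_seqs a) (cauchy_ring a)"
proof (rule idealI)
  interpret cring "cauchy_ring a" by (rule cring_cauchy_ring)
  show "ring (cauchy_ring a)" by (rule ring_axioms)
  have m_inv: "inv\<^bsub>add_monoid (cauchy_ring a)\<^esub> f = (\<lambda>n. - f n)" if "f \<in> carrier (cauchy_ring a)" for f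
  proof -
    have "(\<lambda>n. - f n) \<in> carrier (cauchy_ring a)" using that by (simp add: carrier_cauchy_ring cauchy_minus)
    moreover have "(\<lambda>n. - f n) \<oplus>\<^bsub>cauchy_ring a\<^esub> f = \<zero>\<^bsub>cauchy_ring a\<^esub>" by (simp add: cauchy_ring_def)
    ultimately show ?thesis using minus_equality[of "\<lambda>n. - f n" f] that by (simp add: a_inv_def)
  qed
  show "subgroup (null_seqs a) (add_monoid (cauchy_ring a))"
  proof
    show "null_seqs a \<subseteq> carrier (add_monoid (cauchy_ring a))" by (auto simp: carrier_cauchy_ring null_cauchy)
    show "\<And>x y. x \<in> null_seqs a \<Longrightarrow> y \<in> null_seqs a \<Longrightarrow> x \<otimes>\<^bsub>add_monoid (cauchy_ring a)\<^esub> y \<in> null_seqs a"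
      using null_add by (simp add: cauchy_ring_def)
    show "\<one>\<^bsub>add_monoid (cauchy_ring a)\<^esub> \<in> null_seqs a" by (simp add: cauchy_ring_def null_seqs_def)
    show "inv\<^bsub>add_monoid (cauchy_ring a)\<^esub> x \<in> null_seqs a" if "x \<in> null_seqs a" for x
      using that m_inv[of x] null_minus by (simp add: carrier_cauchy_ring null_cauchy)
  qed
  fix f g assume "f \<in> null_seqs a" "g \<in> carrier (cauchy_ring a)"
  then have "(\<lambda>n. g n * f n) \<in> null_seqs a" using null_mult by (simp add: carrier_cauchy_ring)
  then show "g \<otimes>\<^bsub>cauchy_ring a\<^esub> f \<in> null_seqs a" "f \<otimes>\<^bsub>cauchy_ring a\<^esub> g \<in> null_seqs a"
    by (simp_all add: cauchy_ring_def mult.commute)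
qed

definition coset :: "(nat \<Rightarrow> 'k) \<Rightarrow> (nat \<Rightarrow> 'k) set" where
  "coset f = null_seqs a +>\<^bsub>cauchy_ring a\<^esub> f"

lemma coset_eq: "coset f = {g. (\<lambda>n. g n - f n) \<in> null_seqs a}"
proof -
  have "coset f = {(\<lambda>n. h n + f n) | h. h \<in> null_seqs a}"
    unfolding coset_def a_r_coset_def' by (auto simp: cauchy_ring_def)
  also have "\<dots> = {g. (\<lambda>n. g n - f n) \<in> null_seqs a}"
  proof (intro equalityI subsetI)
    fix g assume "g \<in> {g. (\<lambda>n. g n - f n) \<in> null_seqs a}"
    then show "g \<in> {(\<lambda>n. h n + f n) | h. h \<in> null_seqs a}" by (intro CollectI exI[of _ "\<lambda>n. g n - f n"]) auto
  qed auto
  finally show ?thesis .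
qed

lemma coset_eq_iff: "coset f = coset g \<longleftrightarrow> (\<lambda>n. f n - g n) \<in> null_seqs a"
proof
  assume "coset f = coset g"
  moreover have "f \<in> coset f" by (simp add: coset_eq null_seqs_def)
  ultimately show "(\<lambda>n. f n - g n) \<in> null_seqs a" by (auto simp: coset_eq)
next
  assume *: "(\<lambda>n. f n - g n) \<in> null_seqs a"
  have "(\<lambda>n. h n - f n) \<in> null_seqs a \<longleftrightarrow> (\<lambda>n. h n - g n) \<in> null_seqs a" for h
    using null_add[OF _ *, of "\<lambda>n. h n - f n"] null_add[OF _ null_minus[OF *], of "\<lambda>n. h n - g n"] by auto
  then show "coset f = coset g" by (auto simp: coset_eq)
qed

lemma coset_hom: "coset \<in> Ring.ring_hom (cauchy_ring a) (completion a)"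
proof -
  interpret ideal "null_seqs a" "cauchy_ring a" by (rule ideal_null_seqs)
  show ?thesis using rcos_ring_hom unfolding coset_def[abs_def] completion_def .
qed

lemma cring_completion: "cring (completion a)"
  unfolding completion_def using ideal.quotient_is_cring[OF ideal_null_seqs cring_cauchy_ring] .

lemma coset_ring_hom_cring: "ring_hom_cring (cauchy_ring a) (completion a) coset"
  unfolding coset_def[abs_def] completion_def
  by (rule ideal.rcos_ring_hom_cring[OF ideal_null_seqs cring_cauchy_ring])

lemma carrier_completion: "carrier (completion a) = {coset f | f. cauchy_seq f}"
  unfolding completion_def FactRing_def A_RCOSETS_def' coset_def
  by (auto simp: carrier_cauchy_ring)

lemma coset_closed [simp]: "cauchy_seq f \<Longrightarrow> coset f \<in> carrier (completion a)"
  by (auto simp: carrier_completion)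

lemma coset_add: "cauchy_seq f \<Longrightarrow> cauchy_seq g \<Longrightarrow> coset f \<oplus>\<^bsub>completion a\<^esub> coset g = coset (\<lambda>n. f n + g n)"
  using ring_hom_add[OF coset_hom, of f g] by (simp add: carrier_cauchy_ring) (simp add: cauchy_ring_def)

lemma coset_mult: "cauchy_seq f \<Longrightarrow> cauchy_seq g \<Longrightarrow> coset f \<otimes>\<^bsub>completion a\<^esub> coset g = coset (\<lambda>n. f n * g n)"
  using ring_hom_mult[OF coset_hom, of f g] by (simp add: carrier_cauchy_ring) (simp add: cauchy_ring_def)

lemma coset_one: "\<one>\<^bsub>completion a\<^esub> = coset (\<lambda>_. 1)"
  using ring_hom_one[OF coset_hom] by (simp add: cauchy_ring_def)

lemma coset_zero: "\<zero>\<^bsub>completion a\<^esub> = coset (\<lambda>_. 0)"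
proof -
  interpret ring_hom_cring "cauchy_ring a" "completion a" coset by (rule coset_ring_hom_cring)
  show ?thesis using hom_zero by (simp add: cauchy_ring_def)
qed

lemma coset_eq_zero: "coset f = \<zero>\<^bsub>completion a\<^esub> \<longleftrightarrow> f \<in> null_seqs a"
  by (simp add: coset_zero coset_eq_iff)

lemma embed_eq: "embed a x = coset (\<lambda>_. x)"
  by (simp add: embed_def coset_def)

lemma coset_uminus: assumes "cauchy_seq f" shows "\<ominus>\<^bsub>completion a\<^esub> coset f = coset (\<lambda>n. - f n)"
proof -
  interpret cring "completion a" by (rule cring_completion)
  show ?thesis
    using minus_equality[of "coset (\<lambda>n. - f n)" "coset f"] assms
    by (simp add: cauchy_minus coset_add coset_zero)
qed

text \<open>A Cauchy sequence that is not null is eventually bounded away from 0. Its finitely many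
  zero terms, where \<open>inverse\<close> returns 0, are harmless, because only the tail of the
  product has to equal 1.\<close>

lemma cauchy_inverse:
  assumes f: "cauchy_seq f" and nn: "f \<notin> null_seqs a"
  shows "cauchy_seq (\<lambda>n. inverse (f n))" "(\<lambda>n. f n * inverse (f n) - 1) \<in> null_seqs a"
proof -
  obtain c N0 where c: "c > 0" "\<And>n. n \<ge> N0 \<Longrightarrow> a (f n) \<ge> c"
  proof -
    have "\<exists>\<epsilon>>0. \<forall>N. \<exists>n\<ge>N. a (f n) \<ge> \<epsilon>"
    proof (rule ccontr)
      assume "\<not> ?thesis"
      then have "\<forall>\<epsilon>>0. \<exists>N. \<forall>n\<ge>N. norm (a (f n) - 0) < \<epsilon>" by (simp add: not_le) (meson not_le)
      then have "(\<lambda>n. a (f n)) \<longlonglongrightarrow> 0" unfolding LIMSEQ_iff .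
      then show False using nn by (simp add: null_seqs_def)
    qed
    then obtain \<epsilon> where e: "\<epsilon> > 0" "\<And>N. \<exists>n\<ge>N. a (f n) \<ge> \<epsilon>" by blast
    have "\<epsilon> / 2 > 0" using e by simp
    then obtain N where N: "\<And>m n. m \<ge> N \<Longrightarrow> n \<ge> N \<Longrightarrow> a (f m - f n) < \<epsilon> / 2" using f unfolding cauchy_seq_def by meson
    obtain m where m: "m \<ge> N" "a (f m) \<ge> \<epsilon>" using e by blast
    have "a (f n) \<ge> \<epsilon> / 2" if "n \<ge> N" for n
      using N[OF m(1) that] m(2) add[of "f m - f n" "f n"] by simp
    then show thesis using that[of "\<epsilon> / 2" N] e by simp
  qed
  show "cauchy_seq (\<lambda>n. inverse (f n))" unfolding cauchy_seq_def
  proof (intro allI impI)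
    fix \<epsilon> :: real assume "\<epsilon> > 0"
    then have "\<epsilon> * (c * c) > 0" using c by simp
    then obtain N where N: "\<And>m n. m \<ge> N \<Longrightarrow> n \<ge> N \<Longrightarrow> a (f m - f n) < \<epsilon> * (c * c)" using f unfolding cauchy_seq_def by meson
    have "a (inverse (f m) - inverse (f n)) < \<epsilon>" if "m \<ge> max N N0" "n \<ge> max N N0" for m n
    proof -
      have ge: "a (f m) \<ge> c" "a (f n) \<ge> c" using c(2) that by auto
      then have "a (f m) > 0" "a (f n) > 0" using c(1) by linarith+
      then have nz: "f m \<noteq> 0" "f n \<noteq> 0" by simp_all
      then have "inverse (f m) - inverse (f n) = (f n - f m) / (f m * f n)" by (simp add: field_simps)
      then have "a (inverse (f m) - inverse (f n)) = a (f n - f m) / (a (f m) * a (f n))" by (simp add: divide mult)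
      also have "\<dots> \<le> a (f n - f m) / (c * c)" using ge c(1) by (intro divide_left_mono mult_mono mult_pos_pos) auto
      also have "\<dots> < \<epsilon>" using N[of n m] that c(1) by (simp add: pos_divide_less_eq)
      finally show ?thesis .
    qed
    then show "\<exists>N. \<forall>m\<ge>N. \<forall>n\<ge>N. a (inverse (f m) - inverse (f n)) < \<epsilon>" by blast
  qed
  have "\<forall>\<^sub>F n in sequentially. a (f n * inverse (f n) - 1) = 0"
    using eventually_ge_at_top[of N0]
  proof eventually_elim
    case (elim n)
    then have "a (f n) > 0" using c(1) c(2)[OF elim] by linarith
    then have "f n \<noteq> 0" by simp
    then show ?case by simp
  qed
  then show "(\<lambda>n. f n * inverse (f n) - 1) \<in> null_seqs a"
    unfolding null_seqs_def by (intro CollectI tendsto_eventually)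
qed

lemma field_completion: "Ring.field (completion a)"
proof -
  interpret cring "completion a" by (rule cring_completion)
  show ?thesis
  proof (rule cring_fieldI2)
    show "\<zero>\<^bsub>completion a\<^esub> \<noteq> \<one>\<^bsub>completion a\<^esub>"
    proof
      assume "\<zero>\<^bsub>completion a\<^esub> = \<one>\<^bsub>completion a\<^esub>"
      then have "(\<lambda>_. 1) \<in> null_seqs a" by (metis coset_one coset_eq_zero)
      then show False by (simp add: null_seqs_def LIMSEQ_const_iff)
    qed
    fix x assume "x \<in> carrier (completion a)" "x \<noteq> \<zero>\<^bsub>completion a\<^esub>"
    then obtain f where f: "x = coset f" "cauchy_seq f" "f \<notin> null_seqs a"
      using coset_eq_zero by (auto simp: carrier_completion)
    show "\<exists>y\<in>carrier (completion a). x \<otimes>\<^bsub>completion a\<^esub> y = \<one>\<^bsub>completion a\<^esub>"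
      using cauchy_inverse[OF f(2,3)] f
      by (intro bexI[of _ "coset (\<lambda>n. inverse (f n))"]) (auto simp: coset_mult coset_one coset_eq_iff)
  qed
qed

lemma coset_inverse:
  assumes "cauchy_seq f" "f \<notin> null_seqs a"
  shows "inv\<^bsub>completion a\<^esub> coset f = coset (\<lambda>n. inverse (f n))"
proof -
  interpret cring "completion a" by (rule cring_completion)
  show ?thesis
    using cauchy_inverse[OF assms] assms
    by (intro comm_inv_char) (auto simp: coset_mult coset_one coset_eq_iff)
qed

lemma cauchy_abs_convergent:
  assumes "cauchy_seq f" shows "convergent (\<lambda>n. a (f n))"
proof -
  have "Cauchy (\<lambda>n. a (f n))"
  proof (rule CauchyI)
    fix \<epsilon> :: real assume "\<epsilon> > 0"
    then obtain N where N: "\<And>m n. m \<ge> N \<Longrightarrow> n \<ge> N \<Longrightarrow> a (f m - f n) < \<epsilon>" using assms unfolding cauchy_seq_def by meson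
    have "norm (a (f m) - a (f n)) < \<epsilon>" if "m \<ge> N" "n \<ge> N" for m n
      using abs_diff_le[of "f m" "f n"] N[OF that] by simp
    then show "\<exists>M. \<forall>m\<ge>M. \<forall>n\<ge>M. norm (a (f m) - a (f n)) < \<epsilon>" by blast
  qed
  then show ?thesis by (simp add: Cauchy_convergent_iff)
qed

text \<open>All members of a coset have the same limiting absolute value, which gives the definite
  description in \<open>completion_abs\<close> its meaning.\<close>

lemma completion_abs_coset:
  assumes "(\<lambda>n. a (f n)) \<longlonglongrightarrow> r" shows "completion_abs a (coset f) = r"
  unfolding completion_abs_def
proof (rule the_equality)
  have lim: "(\<lambda>n. a (g n)) \<longlonglongrightarrow> r" if "g \<in> coset f" for g
  proof -
    have n: "(\<lambda>n. a (g n - f n)) \<longlonglongrightarrow> 0" using that by (simp add: coset_eq null_seqs_def)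
    have "(\<lambda>n. a (g n) - a (f n)) \<longlonglongrightarrow> 0"
      by (rule Lim_null_comparison[OF _ n]) (auto simp: abs_diff_le)
    then have "(\<lambda>n. (a (g n) - a (f n)) + a (f n)) \<longlonglongrightarrow> 0 + r" by (intro tendsto_add assms)
    then show ?thesis by simp
  qed
  show "\<exists>g\<in>coset f. (\<lambda>n. a (g n)) \<longlonglongrightarrow> r"
    using assms by (intro bexI[of _ f]) (auto simp: coset_eq null_seqs_def)
  show "r' = r" if "\<exists>g\<in>coset f. (\<lambda>n. a (g n)) \<longlonglongrightarrow> r'" for r'
    using that lim LIMSEQ_unique by blast
qed

end

section \<open>The local degree as a dimension\<close>

context abs_value
begin

text \<open>Termwise counterpart of \<open>ring.combine\<close>, which stops at the end of the
  shorter list; cutting off excess coefficients and appending zeros therefore leave it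
  unchanged.\<close>

fun seq_comb :: "(nat \<Rightarrow> 'k) list \<Rightarrow> 'k list \<Rightarrow> nat \<Rightarrow> 'k" where
  "seq_comb (f # fs) (e # es) = (\<lambda>n. f n * e + seq_comb fs es n)"
| "seq_comb fs es = (\<lambda>n. 0)"

lemma cauchy_seq_comb: "(\<And>f. f \<in> set fs \<Longrightarrow> cauchy_seq f) \<Longrightarrow> cauchy_seq (seq_comb fs es)"
  by (induction fs es rule: seq_comb.induct) (auto intro!: cauchy_add cauchy_mult cauchy_const)

lemma combine_coset:
  assumes "\<And>f. f \<in> set fs \<Longrightarrow> cauchy_seq f"
  shows "ring.combine (completion a) (map coset fs) (map (embed a) es) = coset (seq_comb fs es)"
proof -
  interpret cring "completion a" by (rule cring_completion)
  show ?thesis using assms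
    by (induction fs es rule: seq_comb.induct)
       (simp_all add: embed_eq coset_mult coset_add cauchy_mult cauchy_const cauchy_seq_comb coset_zero)
qed

lemma seq_comb_nth: "length fs = length es \<Longrightarrow> seq_comb fs es n = (\<Sum>i<length es. (fs ! i) n * es ! i)"
proof (induction fs es rule: seq_comb.induct)
  case (1 f fs e es)
  then show ?case by (simp add: sum.lessThan_Suc_shift del: sum.lessThan_Suc)
qed auto

lemma seq_comb_take: "seq_comb (take (length es) fs) es = seq_comb fs es"
  by (induction fs es rule: seq_comb.induct) auto

lemma seq_comb_pad: "seq_comb (fs @ replicate k (\<lambda>_. 0)) es = seq_comb fs es"
proof (induction fs es rule: seq_comb.induct)
  case ("2_1" es)
  have "seq_comb (replicate k (\<lambda>_. 0)) es = (\<lambda>_. 0)"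
  proof (induction k arbitrary: es)
    case (Suc k)
    then show ?case by (cases es) auto
  qed auto
  then show ?case by simp
qed auto

end

lemma subfield_rat_closure:
  fixes a :: "'k :: field_char_0 \<Rightarrow> real"
  assumes "absolute_value a"
  shows "subfield (rat_closure a) (completion a)"
proof -
  interpret abs_value a by unfold_locales fact
  interpret Ring.field "completion a" by (rule field_completion)
  have mem: "x \<in> rat_closure a \<longleftrightarrow> (\<exists>f. x = coset f \<and> cauchy_seq f \<and> range f \<subseteq> \<rat>)" for x
    by (auto simp: rat_closure_def coset_def carrier_cauchy_ring)
  show ?thesis
  proof (rule subfieldI'[OF subringI])
    show "rat_closure a \<subseteq> carrier (completion a)" by (auto simp: mem)
    show "\<one>\<^bsub>completion a\<^esub> \<in> rat_closure a"
      unfolding mem by (intro exI[of _ "\<lambda>_. 1"]) (auto simp: coset_one cauchy_const)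
    fix x assume "x \<in> rat_closure a"
    then obtain f where f: "x = coset f" "cauchy_seq f" "range f \<subseteq> \<rat>" by (auto simp: mem)
    show "\<ominus>\<^bsub>completion a\<^esub> x \<in> rat_closure a"
      unfolding mem using f by (intro exI[of _ "\<lambda>n. - f n"]) (auto simp: coset_uminus cauchy_minus image_subset_iff)
    fix y assume "y \<in> rat_closure a"
    then obtain g where g: "y = coset g" "cauchy_seq g" "range g \<subseteq> \<rat>" by (auto simp: mem)
    show "x \<otimes>\<^bsub>completion a\<^esub> y \<in> rat_closure a"
      unfolding mem using f g by (intro exI[of _ "\<lambda>n. f n * g n"]) (auto simp: coset_mult cauchy_mult image_subset_iff)
    show "x \<oplus>\<^bsub>completion a\<^esub> y \<in> rat_closure a"
      unfolding mem using f g by (intro exI[of _ "\<lambda>n. f n + g n"]) (auto simp: coset_add cauchy_add image_subset_iff)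
  next
    fix x assume "x \<in> rat_closure a - {\<zero>\<^bsub>completion a\<^esub>}"
    then obtain f where f: "x = coset f" "cauchy_seq f" "range f \<subseteq> \<rat>" "f \<notin> null_seqs a"
      using coset_eq_zero by (auto simp: mem)
    show "inv\<^bsub>completion a\<^esub> x \<in> rat_closure a"
      unfolding mem using f by (intro exI[of _ "\<lambda>n. inverse (f n)"]) (auto simp: coset_inverse cauchy_inverse image_subset_iff)
  qed
qed

text \<open>The lower bound of a local basis serves twice: null combinations have null coefficient
  sequences, which is independence over the closure of \<rat>, and Cauchy combinations have Cauchy
  coefficient sequences, which together with density gives spanning.\<close>

theorem local_degree_eq:
  fixes a :: "'k :: field_char_0 \<Rightarrow> real"
  assumes av: "absolute_value a" and E: "local_basis a E"
  shows "local_degree a = card E"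
proof -
  interpret abs_value a by unfold_locales fact
  interpret Ring.field "completion a" by (rule field_completion)
  have sf: "subfield (rat_closure a) (completion a)" by (rule subfield_rat_closure[OF av])
  have mem: "x \<in> rat_closure a \<longleftrightarrow> (\<exists>f. x = coset f \<and> cauchy_seq f \<and> range f \<subseteq> \<rat>)" for x
    by (auto simp: rat_closure_def coset_def carrier_cauchy_ring)
  have finE: "finite E" using E by (simp add: local_basis_def)
  obtain c where c: "c > 0" "\<And>q e. e \<in> E \<Longrightarrow> c * a (of_rat (q e)) \<le> a (lin_comb q E)"
    using E by (auto simp: local_basis_def)
  obtain es where es: "set es = E" "distinct es" using finite_distinct_list[OF finE] by blast
  define Us where "Us = map (embed a) es"
  have Us: "set Us \<subseteq> carrier (completion a)" by (auto simp: Us_def embed_eq cauchy_const)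
  have lin_comb_nth: "lin_comb q E = (\<Sum>i<length es. of_rat (q (es ! i)) * es ! i)" for q
    unfolding lin_comb_def es(1)[symmetric]
    using sum.reindex_bij_betw[OF bij_betw_nth[OF es(2) refl refl], of "\<lambda>e. of_rat (q e) * e"] by simp
  have lower: "c * a (of_rat (q i)) \<le> a (\<Sum>i<length es. of_rat (q i) * es ! i)" if i: "i < length es" for q i
  proof -
    define q' where "q' e = q (THE j. j < length es \<and> es ! j = e)" for e
    have q': "q' (es ! j) = q j" if "j < length es" for j
    proof -
      have "(THE k. k < length es \<and> es ! k = es ! j) = j"
        by (rule the_equality) (use that es in \<open>auto simp: nth_eq_iff_index_eq\<close>)
      then show ?thesis by (simp add: q'_def)
    qed
    have "(\<Sum>i<length es. of_rat (q i) * es ! i) = lin_comb q' E"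
      unfolding lin_comb_nth by (intro sum.cong) (auto simp: q')
    moreover have "c * a (of_rat (q' (es ! i))) \<le> a (lin_comb q' E)" using i es by (intro c(2)) auto
    ultimately show ?thesis using q'[OF i] by simp
  qed
  have ind: "independent (rat_closure a) Us"
  proof (rule trivial_combine_imp_independent[OF sf Us])
    fix Ks assume Ks: "set Ks \<subseteq> rat_closure a" and zero: "combine Ks Us = \<zero>\<^bsub>completion a\<^esub>"
    have "\<forall>x\<in>set Ks. \<exists>f. x = coset f \<and> cauchy_seq f \<and> range f \<subseteq> \<rat>" using Ks mem by blast
    then obtain F where F: "\<And>x. x \<in> set Ks \<Longrightarrow> x = coset (F x) \<and> cauchy_seq (F x) \<and> range (F x) \<subseteq> \<rat>" by metis
    define fs where "fs = map F Ks"
    have KsF: "Ks = map coset fs" using F by (auto simp: fs_def intro!: map_idI[symmetric] simp del: map_idI)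
    have fsc: "cauchy_seq f" "range f \<subseteq> \<rat>" if "f \<in> set fs" for f using F that by (auto simp: fs_def)
    have "combine (map coset fs) (map (embed a) es) = coset (seq_comb fs es)"
      by (rule combine_coset) (rule fsc(1))
    then have null: "seq_comb fs es \<in> null_seqs a"
      using zero unfolding KsF Us_def by (metis coset_eq_zero)
    \<comment> \<open>Coefficient lists of any length occur here, so the list is brought to the
      length of \<open>es\<close>; missing coefficients become 0 and the combination stays the
      same.\<close>
    define gs where "gs = take (length es) (fs @ replicate (length es) (\<lambda>_. 0))"
    have lgs: "length gs = length es" by (simp add: gs_def)
    have gsr: "range g \<subseteq> \<rat>" if "g \<in> set gs" for g
      using fsc(2) that set_take_subset[of "length es" "fs @ replicate (length es) (\<lambda>_. 0)"]
      by (force simp: gs_def)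
    have sc: "seq_comb gs es = seq_comb fs es" by (simp add: gs_def seq_comb_take seq_comb_pad)
    have gnull: "gs ! i \<in> null_seqs a" if i: "i < length es" for i
    proof (rule nullI)
      show "a ((gs ! i) n) \<le> a (seq_comb gs es n) / c" for n
      proof -
        have "\<exists>q. (gs ! j) n = of_rat q" if "j < length es" for j
          using gsr[of "gs ! j"] that lgs by (metis Rats_cases nth_mem rangeI subsetD)
        then obtain q where q: "\<And>j. j < length es \<Longrightarrow> (gs ! j) n = of_rat (q j)" by metis
        have "seq_comb gs es n = (\<Sum>i<length es. of_rat (q i) * es ! i)"
          unfolding seq_comb_nth[OF lgs] using q by simp
        then show ?thesis using lower[OF i, of q] q[OF i] c(1) by (simp add: field_simps)
      qed
      have "(\<lambda>n. a (seq_comb gs es n) / c) \<longlonglongrightarrow> 0 / c"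
        using null unfolding sc null_seqs_def by (intro tendsto_divide tendsto_const) (use c in auto)
      then show "(\<lambda>n. a (seq_comb gs es n) / c) \<longlonglongrightarrow> 0" by simp
    qed
    show "set (take (length Us) Ks) \<subseteq> {\<zero>\<^bsub>completion a\<^esub>}"
    proof
      fix x assume "x \<in> set (take (length Us) Ks)"
      then obtain i where i: "i < length es" "i < length Ks" "x = Ks ! i"
        by (auto simp: in_set_conv_nth Us_def)
      have "gs ! i = fs ! i" using i by (simp add: gs_def nth_append fs_def)
      then have "x = coset (gs ! i)" using i KsF by (metis length_map nth_map)
      then show "x \<in> {\<zero>\<^bsub>completion a\<^esub>}" using gnull[OF i(1)] by (simp add: coset_eq_zero)
    qed
  qed
  have span: "Span (rat_closure a) Us = carrier (completion a)"
  proof (rule antisym)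
    show "Span (rat_closure a) Us \<subseteq> carrier (completion a)"
      using Span_in_carrier[OF subfieldE(3)[OF sf] Us] .
    show "carrier (completion a) \<subseteq> Span (rat_closure a) Us"
    proof
      fix x assume "x \<in> carrier (completion a)"
      then obtain f where f: "x = coset f" "cauchy_seq f" by (auto simp: carrier_completion)
      \<comment> \<open>The n-th term is approximated within 1 / (n + 1), so the combinations
        represent the same element as f.\<close>
      have "\<forall>n. \<exists>q. a (f n - lin_comb q E) < 1 / (real n + 1)"
        using E unfolding local_basis_def by simp
      then obtain Q where Q: "\<And>n. a (f n - lin_comb (Q n) E) < 1 / (real n + 1)" by metis
      define g where "g i n = (of_rat (Q n (es ! i)) :: 'k)" for i n
      define h where "h n = lin_comb (Q n) E" for n
      have hnull: "(\<lambda>n. f n - h n) \<in> null_seqs a"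
      proof (rule nullI)
        show "a (f n - h n) \<le> 1 / (real n + 1)" for n using Q[of n] by (simp add: h_def)
        show "(\<lambda>n. 1 / (real n + 1)) \<longlonglongrightarrow> 0" using LIMSEQ_inverse_real_of_nat by (simp add: inverse_eq_divide add.commute)
      qed
      have hc: "cauchy_seq h"
        using cauchy_add[OF f(2) cauchy_minus[OF null_cauchy[OF hnull]]] by simp
      have gc: "cauchy_seq (g i)" if i: "i < length es" for i
        unfolding cauchy_seq_def
      proof (intro allI impI)
        fix \<epsilon> :: real assume "\<epsilon> > 0"
        then have "c * \<epsilon> > 0" using c by simp
        then obtain N where N: "\<And>m n. m \<ge> N \<Longrightarrow> n \<ge> N \<Longrightarrow> a (h m - h n) < c * \<epsilon>" using hc unfolding cauchy_seq_def by meson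
        have "a (g i m - g i n) < \<epsilon>" if "m \<ge> N" "n \<ge> N" for m n
        proof -
          have "h m - h n = (\<Sum>i<length es. of_rat (Q m (es ! i) - Q n (es ! i)) * es ! i)"
            by (simp add: h_def lin_comb_nth sum_subtractf of_rat_diff left_diff_distrib)
          then have "c * a (g i m - g i n) \<le> a (h m - h n)"
            using lower[OF i, of "\<lambda>i. Q m (es ! i) - Q n (es ! i)"] by (simp add: g_def of_rat_diff)
          also have "\<dots> < c * \<epsilon>" using N that by blast
          finally show ?thesis using c(1) by simp
        qed
        then show "\<exists>N. \<forall>m\<ge>N. \<forall>n\<ge>N. a (g i m - g i n) < \<epsilon>" by blast
      qed
      define fs where "fs = map g [0..<length es]"
      have fsc: "cauchy_seq f" if "f \<in> set fs" for f using that gc by (auto simp: fs_def)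
      have "seq_comb fs es = h"
        by (rule ext, subst seq_comb_nth) (simp_all add: fs_def g_def h_def lin_comb_nth)
      moreover have "combine (map coset fs) (map (embed a) es) = coset (seq_comb fs es)"
        by (rule combine_coset) (rule fsc)
      ultimately have "x = combine (map coset fs) Us"
        using f hnull by (simp add: Us_def coset_eq_iff)
      moreover have "set (map coset fs) \<subseteq> rat_closure a"
      proof
        fix y assume "y \<in> set (map coset fs)"
        then obtain i where "i < length es" "y = coset (g i)" by (auto simp: fs_def)
        then show "y \<in> rat_closure a" unfolding mem using gc by (intro exI[of _ "g i"]) (auto simp: g_def)
      qed
      ultimately show "x \<in> Span (rat_closure a) Us"
        unfolding Span_eq_combine_set[OF sf Us] by blast
    qed
  qed
  have "dimension (length Us) (rat_closure a) (carrier (completion a))"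
    using dimensionI[OF sf ind span] .
  then have "dim (rat_closure a) (carrier (completion a)) = length Us"
    unfolding dim_def using dimension_is_inj[OF sf] by (intro the_equality) auto
  then show ?thesis using distinct_card[OF es(2)] es(1) by (simp add: local_degree_def Us_def)
qed

section \<open>Polynomial values in the completion\<close>

context abs_value
begin

fun horner :: "'k list \<Rightarrow> 'k \<Rightarrow> 'k" where
  "horner [] x = 0"
| "horner (c # cs) x = c * x ^ length cs + horner cs x"

lemma horner_append: "horner (cs @ [c]) x = x * horner cs x + c"
  by (induction cs) (simp_all add: algebra_simps)

lemma horner_rev_coeffs: "horner (rev (Polynomial.coeffs P)) x = poly P x"
proof (induction P)
  case (pCons c P)
  then have "Polynomial.coeffs (pCons c P) = c # Polynomial.coeffs P" by (auto simp: cCons_def)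
  then show ?case using pCons by (simp add: horner_append algebra_simps)
qed auto

lemma cauchy_power: "cauchy_seq f \<Longrightarrow> cauchy_seq (\<lambda>n. f n ^ k)"
  by (induction k) (simp_all add: cauchy_const cauchy_mult)

lemma coset_power: "cauchy_seq f \<Longrightarrow> coset f [^]\<^bsub>completion a\<^esub> k = coset (\<lambda>n. f n ^ k)" for k :: nat
proof -
  interpret cring "completion a" by (rule cring_completion)
  assume "cauchy_seq f"
  then show ?thesis
    by (induction k) (simp_all add: coset_one coset_mult cauchy_power mult.commute)
qed

lemma cauchy_horner: "cauchy_seq f \<Longrightarrow> cauchy_seq (\<lambda>n. horner cs (f n))"
  by (induction cs) (auto intro!: cauchy_add cauchy_mult cauchy_const cauchy_power)

lemma eval_horner:
  assumes "cauchy_seq f"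
  shows "ring.eval (completion a) (map (embed a) cs) (coset f) = coset (\<lambda>n. horner cs (f n))"
proof -
  interpret cring "completion a" by (rule cring_completion)
  show ?thesis using assms
    by (induction cs)
       (simp_all add: coset_zero embed_eq coset_power coset_mult coset_add cauchy_const cauchy_power cauchy_mult cauchy_horner)
qed

lemma eval_coset:
  assumes "cauchy_seq f"
  shows "ring.eval (completion a) (map (embed a) (rev (Polynomial.coeffs P))) (coset f) = coset (\<lambda>n. poly P (f n))"
  unfolding eval_horner[OF assms] horner_rev_coeffs ..

lemma cauchy_poly: "cauchy_seq f \<Longrightarrow> cauchy_seq (\<lambda>n. poly P (f n))"
  using cauchy_horner[of f "rev (Polynomial.coeffs P)"] by (simp add: horner_rev_coeffs)

lemma subfield_base: "subfield (range (embed a)) (completion a)"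
proof -
  interpret Ring.field "completion a" by (rule field_completion)
  show ?thesis
  proof (rule subfieldI'[OF subringI])
    show "range (embed a) \<subseteq> carrier (completion a)" by (auto simp: embed_eq cauchy_const)
    show "\<one>\<^bsub>completion a\<^esub> \<in> range (embed a)" by (auto simp: coset_one embed_eq)
    fix x assume "x \<in> range (embed a)"
    then obtain b where b: "x = coset (\<lambda>_. b)" by (auto simp: embed_eq)
    show "\<ominus>\<^bsub>completion a\<^esub> x \<in> range (embed a)" unfolding b coset_uminus[OF cauchy_const] by (auto simp: embed_eq)
    fix y assume "y \<in> range (embed a)"
    then obtain d where d: "y = coset (\<lambda>_. d)" by (auto simp: embed_eq)
    show "x \<otimes>\<^bsub>completion a\<^esub> y \<in> range (embed a)"
      unfolding b d coset_mult[OF cauchy_const cauchy_const] by (auto simp: embed_eq)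
    show "x \<oplus>\<^bsub>completion a\<^esub> y \<in> range (embed a)"
      unfolding b d coset_add[OF cauchy_const cauchy_const] by (auto simp: embed_eq)
  next
    fix x assume x: "x \<in> range (embed a) - {\<zero>\<^bsub>completion a\<^esub>}"
    then obtain b where b: "x = coset (\<lambda>_. b)" by (auto simp: embed_eq)
    have "(\<lambda>_. b) \<notin> null_seqs a" using x b coset_eq_zero by auto
    then show "inv\<^bsub>completion a\<^esub> x \<in> range (embed a)"
      unfolding b by (subst coset_inverse) (auto simp: cauchy_const embed_eq)
  qed
qed

text \<open>\<open>embed\<close> is injective, so the embedded coefficient list keeps a nonzero
  leading coefficient and its length. It is thus an annihilating polynomial over the base field, and
  \<open>Irr\<close> divides it, which bounds the degree.\<close>

lemma root_imp_algebraic: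
  assumes f: "cauchy_seq f" and P: "P \<noteq> 0" and root: "(\<lambda>n. poly P (f n)) \<in> null_seqs a"
  shows "ring.algebraic (completion a) (range (embed a)) (coset f)"
    "Polynomials.degree (ring.Irr (completion a) (range (embed a)) (coset f)) \<le> Polynomial.degree P"
proof -
  interpret Ring.field "completion a" by (rule field_completion)
  let ?K = "range (embed a)"
  define p where "p = map (embed a) (rev (Polynomial.coeffs P))"
  have sf: "subfield ?K (completion a)" by (rule subfield_base)
  have ne: "Polynomial.coeffs P \<noteq> []" using P by simp
  have hd: "hd (rev (Polynomial.coeffs P)) \<noteq> 0" using ne P by (simp add: hd_rev last_coeffs_eq_coeff_degree)
  have pne: "p \<noteq> []" using ne by (simp add: p_def)
  have emb0: "embed a x = \<zero>\<^bsub>completion a\<^esub> \<longleftrightarrow> x = 0" for x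
    by (simp add: embed_eq coset_eq_zero null_seqs_def LIMSEQ_const_iff)
  have pc: "p \<in> carrier (univ_poly (completion a) ?K)"
    unfolding univ_poly_carrier[symmetric] polynomial_def
    using ne hd by (auto simp: p_def hd_map emb0)
  have ev: "eval p (coset f) = \<zero>\<^bsub>completion a\<^esub>"
    unfolding p_def eval_coset[OF f] using root by (simp add: coset_eq_zero)
  show alg: "ring.algebraic (completion a) ?K (coset f)"
    using algebraicI[OF pc pne ev] by (simp add: over_def)
  have alg': "(algebraic over ?K) (coset f)" using algebraicI[OF pc pne ev] .
  have cf: "coset f \<in> carrier (completion a)" using f by simp
  have "Polynomials.degree (Irr ?K (coset f)) \<le> Polynomials.degree p"
    by (rule pdivides_imp_degree_le[OF subfieldE(1)[OF sf] IrrE(1)[OF sf cf alg'] pc pne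
          Irr_minimal[OF sf cf alg' pc ev]])
  also have "\<dots> = Polynomial.degree P" by (simp add: p_def length_coeffs P)
  finally show "Polynomials.degree (Irr ?K (coset f)) \<le> Polynomial.degree P" .
qed

end

section \<open>Places of a number field and the product formula\<close>

lemma powr_subadditive:
  fixes x y s :: real
  assumes "x \<ge> 0" "y \<ge> 0" "0 < s" "s \<le> 1"
  shows "(x + y) powr s \<le> x powr s + y powr s"
proof (cases "x + y = 0")
  case False
  define z where "z = x + y"
  have z: "z > 0" using False assms by (simp add: z_def)
  have *: "t / z \<le> (t / z) powr s" if "0 \<le> t" "t \<le> z" for t
  proof (cases "t = 0")
    case False
    have "(t / z) powr 1 \<le> (t / z) powr s" using that z assms False by (intro powr_mono') auto
    then show ?thesis using that z False by simp
  qed simp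
  have "z powr s = z powr s * (x / z + y / z)" using z by (simp add: add_divide_distrib[symmetric] z_def)
  also have "\<dots> \<le> z powr s * ((x / z) powr s + (y / z) powr s)"
    using *[of x] *[of y] assms by (intro mult_left_mono add_mono) (auto simp: z_def)
  also have "\<dots> = x powr s + y powr s" using z assms by (simp add: powr_divide distrib_left)
  finally show ?thesis by (simp add: z_def)
qed (use assms in auto)

lemma absolute_value_powr:
  assumes "absolute_value a" "0 < s" "s \<le> 1"
  shows "absolute_value (\<lambda>x. a x powr s)"
proof -
  interpret abs_value a by unfold_locales fact
  show ?thesis unfolding absolute_value_def
  proof (intro conjI allI)
    fix x y
    show "a (x * y) powr s = a x powr s * a y powr s" by (simp add: mult powr_mult)
    have "a (x + y) powr s \<le> (a x + a y) powr s" using add assms by (intro powr_mono2) auto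
    also have "\<dots> \<le> a x powr s + a y powr s" using assms by (intro powr_subadditive) auto
    finally show "a (x + y) powr s \<le> a x powr s + a y powr s" .
  qed auto
qed

lemma absolute_value_powr_ultrametric:
  assumes "absolute_value a" "\<And>x y. a (x + y) \<le> max (a x) (a y)" "0 < s"
  shows "absolute_value (\<lambda>x. a x powr s)"
proof -
  interpret abs_value a by unfold_locales fact
  show ?thesis unfolding absolute_value_def
  proof (intro conjI allI)
    fix x y
    show "a (x * y) powr s = a x powr s * a y powr s" by (simp add: mult powr_mult)
    have "a (x + y) \<le> a x \<or> a (x + y) \<le> a y" using assms(2)[of x y] by (simp add: le_max_iff_disj)
    then have "a (x + y) powr s \<le> a x powr s \<or> a (x + y) powr s \<le> a y powr s"
      using assms(3) by (auto intro!: powr_mono2)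
    then show "a (x + y) powr s \<le> a x powr s + a y powr s"
      by (metis add_increasing add_increasing2 powr_ge_zero)
  qed auto
qed

text \<open>For an exponent above 1 the triangle inequality is not inherited. It is recovered from
  the values n^s at the integers: each term in the expansion of \<open>(x + y) ^ n\<close> has value
  at most the s-th power of (b x + b y)^n, and the factor n + 1 is removed by n-th roots.\<close>

lemma absolute_value_root:
  fixes a :: "'k :: field_char_0 \<Rightarrow> real"
  assumes "absolute_value a" "s > 0" and nat: "\<And>n::nat. a (of_nat n) = real n powr s"
  shows "absolute_value (\<lambda>x. a x powr (1 / s))"
proof -
  interpret abs_value a by unfold_locales fact
  define b where "b x = a x powr (1 / s)" for x
  have b: "b x \<ge> 0" "a x = b x powr s" for x using assms(2) by (auto simp: b_def powr_powr)
  have main: "b (x + y) \<le> b x + b y" for x y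
  proof (cases "x = 0 \<and> y = 0")
    case False
    define z where "z = b x + b y"
    have z: "z > 0" using False b(1)[of x] b(1)[of y] unfolding z_def b_def by (auto simp: add_pos_nonneg add_nonneg_pos)
    have "a (x + y) ^ n \<le> 1 * (real n + 1) * (z powr s) ^ n" for n
    proof -
      have "a (x + y) ^ n = a (\<Sum>k\<le>n. of_nat (n choose k) * x ^ k * y ^ (n - k))"
        by (simp add: power[symmetric] binomial_ring)
      also have "\<dots> \<le> (\<Sum>k\<le>n. a (of_nat (n choose k) * x ^ k * y ^ (n - k)))" by (rule sum_le)
      also have "\<dots> \<le> (\<Sum>k\<le>n. (z ^ n) powr s)"
      proof (rule sum_mono)
        fix k assume k: "k \<in> {..n}"
        have pw: "a t ^ m = (b t ^ m) powr s" for t m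
          by (induction m) (simp_all add: b(1) powr_mult b(2)[of t, symmetric])
        have "a (of_nat (n choose k) * x ^ k * y ^ (n - k)) = real (n choose k) powr s * a x ^ k * a y ^ (n - k)"
          by (simp add: mult power nat)
        also have "\<dots> = (real (n choose k) * b x ^ k * b y ^ (n - k)) powr s"
          unfolding pw using b(1) by (simp add: powr_mult)
        finally have eq: "a (of_nat (n choose k) * x ^ k * y ^ (n - k)) = (real (n choose k) * b x ^ k * b y ^ (n - k)) powr s" .
        have "real (n choose k) * b x ^ k * b y ^ (n - k) \<le> (\<Sum>k\<le>n. real (n choose k) * b x ^ k * b y ^ (n - k))"
          using b(1) k by (intro member_le_sum) auto
        also have "\<dots> = z ^ n" by (simp add: z_def binomial_ring)
        finally show "a (of_nat (n choose k) * x ^ k * y ^ (n - k)) \<le> (z ^ n) powr s"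
          unfolding eq using assms(2) b(1) by (intro powr_mono2) auto
      qed
      also have "\<dots> = 1 * (real n + 1) * (z ^ n) powr s" by simp
      also have "(z ^ n) powr s = (z powr s) ^ n" using z by (simp add: powr_realpow[symmetric] powr_powr mult.commute)
      finally show ?thesis .
    qed
    then have "a (x + y) \<le> z powr s" by (rule powers_bound_imp_le) (use z in auto)
    then have "a (x + y) powr (1 / s) \<le> (z powr s) powr (1 / s)" using assms(2) by (intro powr_mono2) auto
    then show ?thesis using z assms(2) by (simp add: b_def[symmetric] powr_powr z_def)
  qed (simp add: b_def)
  have "absolute_value b" unfolding absolute_value_def
    using main b(1) by (auto simp: b_def mult powr_mult)
  then show ?thesis by (simp add: b_def[abs_def])
qed

section \<open>Extensions of the absolute values of the rationals\<close>

definition rat_abs :: "rat \<Rightarrow> real" where "rat_abs x = real_of_rat \<bar>x\<bar>"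

definition rat_places :: "(rat \<Rightarrow> real) set" where
  "rat_places = insert rat_abs (padic_abs ` Collect Factorial_Ring.prime)"

text \<open>Extension is meant literally and not up to equivalence. Two different extensions of the
  same nontrivial \<open>u\<close> are then inequivalent, and exponents enter only with the
  normalization.\<close>

definition extensions :: "(rat \<Rightarrow> real) \<Rightarrow> ('k :: field_char_0 \<Rightarrow> real) set" where
  "extensions u = {v. absolute_value v \<and> (\<forall>q. v (of_rat q) = u q)}"

lemma rat_abs_of_nat [simp]: "rat_abs (of_nat n) = real n"
  by (simp add: rat_abs_def)

lemma rat_places_absolute_value: "u \<in> rat_places \<Longrightarrow> absolute_value u"
  using rat_abs_absolute_value padic_abs_absolute_value by (auto simp: rat_places_def rat_abs_def[abs_def])

lemma padic_abs_other_prime: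
  assumes "Factorial_Ring.prime p" "Factorial_Ring.prime q" "p \<noteq> q"
  shows "padic_abs p (of_nat q) = 1"
proof -
  have "\<not> p dvd q" using primes_dvd_imp_eq assms by blast
  then have "multiplicity p q = 0" by (rule not_dvd_imp_multiplicity_0)
  then show ?thesis using assms padic_abs_of_nat[of p q] by auto
qed

lemma padic_abs_of_nat_le:
  assumes "Factorial_Ring.prime p" shows "padic_abs p (of_nat n) \<le> 1"
proof (cases "n = 0")
  case False
  have "1 \<le> real p ^ multiplicity p n" using prime_ge_1_nat[OF assms] by (intro one_le_power) simp
  then show ?thesis unfolding padic_abs_of_nat[OF assms False] by (simp add: power_int_minus inverse_le_1_iff)
qed (simp add: padic_abs_def)

lemma rat_places_nontrivial: "u \<in> rat_places \<Longrightarrow> \<exists>q. q \<noteq> 0 \<and> u q \<noteq> 1"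
proof -
  assume "u \<in> rat_places"
  then consider "u = rat_abs" | p where "Factorial_Ring.prime p" "u = padic_abs p" by (auto simp: rat_places_def)
  then show ?thesis
  proof cases
    case 1
    then show ?thesis using rat_abs_of_nat[of 2] by (intro exI[of _ "of_nat 2"]) auto
  next
    case 2
    then show ?thesis using padic_abs_prime[of p] prime_gt_1_nat[of p] by (intro exI[of _ "of_nat p"]) auto
  qed
qed

text \<open>The number 2 detects \<open>rat_abs\<close>, the only member exceeding 1 at an integer;
  the prime p detects \<open>padic_abs p\<close>, the only member below 1 at p. The values at these
  numbers also determine the exponent.\<close>

lemma rat_places_powr_eq:
  assumes "u \<in> rat_places" "u' \<in> rat_places" "s > 0" "t > 0" and eq: "\<And>q. u' q powr t = u q powr s"
  shows "u' = u" "s = t"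
proof -
  have "u' = u \<and> s = t"
  proof -
    consider "u = rat_abs" | p where "Factorial_Ring.prime p" "u = padic_abs p" using assms(1) by (auto simp: rat_places_def)
    then show ?thesis
    proof cases
      case 1
      have "u' (of_nat 2) powr t = 2 powr s" using eq[of "of_nat 2"] 1 rat_abs_of_nat[of 2] by simp
      moreover have "(2::real) powr s > 1" using assms(3) by (simp add: gr_one_powr)
      ultimately have gt: "u' (of_nat 2) powr t > 1" by simp
      have "u' (of_nat 2) > 1"
      proof (rule ccontr)
        assume "\<not> u' (of_nat 2) > 1"
        then have "u' (of_nat 2) powr t \<le> 1"
          using assms(4) abs_value.nonneg[OF abs_value.intro[OF rat_places_absolute_value[OF assms(2)]]]
          by (intro powr_le1) auto
        then show False using gt by simp
      qed
      then have u': "u' = rat_abs" using assms(2) padic_abs_of_nat_le[of _ 2]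
        by (auto simp: rat_places_def not_less[symmetric] simp del: of_nat_numeral)
      then have "(2::real) powr t = 2 powr s" using eq[of "of_nat 2"] 1 rat_abs_of_nat[of 2] by simp
      then show ?thesis using u' 1 powr_inj[of 2 t s] by simp
    next
      case 2
      have p1: "real p > 1" using prime_gt_1_nat[OF 2(1)] by simp
      have e: "u' (of_nat p) powr t = (1 / real p) powr s" using eq[of "of_nat p"] 2 padic_abs_prime[OF 2(1)] by simp
      have "(1 / real p) powr s < 1 powr s" using p1 assms(3) by (intro powr_less_mono2) auto
      then have lt: "u' (of_nat p) \<noteq> 1" "\<not> u' (of_nat p) > 1"
        using e assms(4) gr_one_powr[of "u' (of_nat p)" t] by auto
      have u': "u' = padic_abs p"
        using assms(2) lt p1 padic_abs_other_prime[OF _ 2(1)] by (auto simp: rat_places_def)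
      then have "(1 / real p) powr t = (1 / real p) powr s" using e padic_abs_prime[OF 2(1)] by simp
      then have "s = t" using p1 powr_inj[of "1 / real p" t s] by simp
      then show ?thesis using u' 2 by simp
    qed
  qed
  then show "u' = u" "s = t" by auto
qed

definition some_basis :: "('k :: field_char_0 \<Rightarrow> real) \<Rightarrow> 'k set" where
  "some_basis v = (SOME E. local_basis v E)"

lemma some_basis: "number_field TYPE('k :: field_char_0) \<Longrightarrow> absolute_value (v :: 'k :: field_char_0 \<Rightarrow> real) \<Longrightarrow> local_basis v (some_basis v)"
  unfolding some_basis_def using local_basis_exists by (rule someI_ex)

lemma block_system_extensions:
  assumes "number_field TYPE('k :: field_char_0)" "u \<in> rat_places" "finite V" "V \<subseteq> extensions u"
  shows "block_system u (V :: ('k :: field_char_0 \<Rightarrow> real) set) some_basis"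
  using assms some_basis rat_places_nontrivial[OF assms(2)] by unfold_locales (auto simp: extensions_def)

lemma local_degree_pos:
  fixes a :: "'k :: field_char_0 \<Rightarrow> real"
  assumes "number_field TYPE('k)" "absolute_value a"
  shows "local_degree a > 0"
  using local_degree_eq[OF assms(2) some_basis[OF assms]] local_basis_nonempty[OF assms(2) some_basis[OF assms]]
    some_basis[OF assms] by (simp add: local_basis_def card_gt_0_iff)

lemma local_degree_le:
  assumes "number_field TYPE('k :: field_char_0)" "absolute_value (a :: 'k :: field_char_0 \<Rightarrow> real)"
  shows "local_degree a \<le> global_degree TYPE('k)"
proof -
  have E: "local_basis a (some_basis a)" by (rule some_basis[OF assms])
  then obtain c where "c > 0" "\<And>q e. e \<in> some_basis a \<Longrightarrow> c * a (of_rat (q e)) \<le> a (lin_comb q (some_basis a))" and fin: "finite (some_basis a)"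
    unfolding local_basis_def by blast
  then have "\<not> rat_vs.dependent (some_basis a)" by (intro bounded_below_independent[OF assms(2)]) auto
  from independent_card_le_global_degree(2)[OF assms(1) this] show ?thesis
    by (simp add: local_degree_eq[OF assms(2) E])
qed

text \<open>Every finite set of extensions satisfies the degree inequality with all summands at
  least 1, so its size is at most the degree of the field.\<close>

lemma finite_extensions:
  assumes nf: "number_field TYPE('k :: field_char_0)" and u: "u \<in> rat_places"
  shows "finite (extensions u :: ('k :: field_char_0 \<Rightarrow> real) set)"
proof (rule ccontr)
  assume "infinite (extensions u :: ('k \<Rightarrow> real) set)"
  then obtain V :: "('k \<Rightarrow> real) set" where V: "V \<subseteq> extensions u" "finite V" "card V = Suc (global_degree TYPE('k))"
    using infinite_arbitrarily_large by blast
  interpret block_system u V some_basis by (rule block_system_extensions[OF nf u V(2,1)])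
  have "card V = (\<Sum>v\<in>V. 1)" by simp
  also have "\<dots> \<le> (\<Sum>v\<in>V. card (some_basis v))"
  proof (rule sum_mono)
    fix v assume "v \<in> V"
    then show "1 \<le> card (some_basis v)"
      using local_degree_pos[OF nf av] local_degree_eq[OF av basis] by (metis Suc_leI One_nat_def)
  qed
  also have "\<dots> \<le> global_degree TYPE('k)" by (rule sum_local_degrees_le)
  finally show False using V by simp
qed

lemma field_embedding_0: "field_embedding \<eta> \<Longrightarrow> \<eta> 0 = 0"
  unfolding field_embedding_def by (metis add_cancel_right_left)

lemma field_embedding_eq_0:
  assumes "field_embedding \<eta>" shows "\<eta> x = 0 \<longleftrightarrow> x = 0"
proof
  assume "\<eta> x = 0"
  show "x = 0"
  proof (rule ccontr)
    assume "x \<noteq> 0"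
    then have "\<eta> x * \<eta> (inverse x) = 1" using assms unfolding field_embedding_def by (metis right_inverse)
    then show False using \<open>\<eta> x = 0\<close> by simp
  qed
qed (use field_embedding_0[OF assms] in simp)

lemma field_embedding_of_rat:
  assumes "field_embedding \<eta>" shows "\<eta> (of_rat q) = of_rat q"
proof -
  have nat: "\<eta> (of_nat n) = of_nat n" for n
    by (induction n) (use assms in \<open>auto simp: field_embedding_0 field_embedding_def\<close>)
  have minus: "\<eta> (- x) = - \<eta> x" for x
    using field_embedding_0[OF assms] assms unfolding field_embedding_def by (metis add_eq_0_iff)
  have int: "\<eta> (of_int k) = of_int k" for k
    by (cases k) (auto simp: nat minus simp del: of_nat_Suc)
  obtain m n where q: "n \<noteq> 0" "q = of_int m / of_int n" by (rule rat_cases_of_int)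
  have "\<eta> (of_rat q * of_int n) = \<eta> (of_int m)" using q by (simp add: of_rat_divide)
  then have "\<eta> (of_rat q) * of_int n = of_int m" using assms int by (simp add: field_embedding_def)
  then have "\<eta> (of_rat q) = of_int m / of_int n" using q(1) by (simp add: eq_divide_eq)
  also have "\<dots> = of_rat q" unfolding q(2) by (simp add: of_rat_divide)
  finally show ?thesis .
qed

definition embedding_values :: "('o :: field_char_0 \<Rightarrow> real) \<Rightarrow> ('k :: field_char_0 \<Rightarrow> real) set" where
  "embedding_values c = {\<lambda>x. c (\<eta> x) | \<eta>. field_embedding \<eta>}"

lemma embedding_values_subset:
  assumes "absolute_value c" "\<And>q. c (of_rat q) = u q"
  shows "embedding_values c \<subseteq> extensions u"
proof -
  interpret c: abs_value c by unfold_locales fact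
  show ?thesis
  proof
    fix v assume "v \<in> embedding_values c"
    then obtain \<eta> where \<eta>: "field_embedding \<eta>" "v = (\<lambda>x. c (\<eta> x))" by (auto simp: embedding_values_def)
    have "absolute_value v" unfolding absolute_value_def \<eta>(2)
      using \<eta>(1) field_embedding_eq_0[OF \<eta>(1)] c.mult c.add by (auto simp: field_embedding_def)
    then show "v \<in> extensions u" using \<eta> assms(2) by (simp add: extensions_def field_embedding_of_rat)
  qed
qed

text \<open>Provides the continuity of linear forms demanded by
  \<open>complete_block_system\<close>: f is a combination of field embeddings, so
  \<open>u (f x)\<close> is at most a constant times the largest of the values c (\<eta> x).\<close>

lemma embedding_values_bound:
  fixes c :: "'o :: {alg_closed_field, field_char_0} \<Rightarrow> real" and f :: "'k :: field_char_0 \<Rightarrow> rat"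
  assumes nf: "number_field TYPE('k)" and c: "absolute_value c" "\<And>q. c (of_rat q) = u q" and f: "rat_linear f"
    and ne: "embedding_values c \<noteq> ({} :: ('k \<Rightarrow> real) set)"
    and fin: "finite (embedding_values c :: ('k \<Rightarrow> real) set)"
  shows "\<exists>C. \<forall>x. \<exists>v\<in>embedding_values c. u (f x) \<le> C * v x"
proof -
  interpret c: abs_value c by unfold_locales fact
  have "rat_linear (\<lambda>x. of_rat (f x) :: 'o)" using f by (auto simp: rat_linear_def of_rat_add of_rat_mult)
  from embedding_decomposition[OF nf this] obtain cs :: "('o \<times> ('k \<Rightarrow> 'o)) list" where
    "(\<forall>(d, \<eta>)\<in>set cs. field_embedding \<eta>) \<and> (\<forall>x. of_rat (f x) = (\<Sum>(d, \<eta>)\<leftarrow>cs. d * \<eta> x))" by (rule exE)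
  note cs = conjunct1[OF this] conjunct2[OF this]
  define C where "C = (\<Sum>(d, \<eta>)\<leftarrow>cs. c d)"
  have "\<exists>v\<in>embedding_values c. u (f x) \<le> C * v x" for x
  proof -
    define M where "M = Max ((\<lambda>v. v x) ` (embedding_values c :: ('k \<Rightarrow> real) set))"
    have "M \<in> (\<lambda>v. v x) ` embedding_values c" unfolding M_def using ne fin by (intro Max_in) auto
    then obtain v where v: "v \<in> embedding_values c" "M = v x" by blast
    have M: "c (\<eta> x) \<le> M" if "field_embedding \<eta>" for \<eta>
      unfolding M_def using fin that by (intro Max_ge) (auto simp: embedding_values_def)
    have "c (\<Sum>(d, \<eta>)\<leftarrow>ds. d * \<eta> x) \<le> (\<Sum>(d, \<eta>)\<leftarrow>ds. c d) * M" if "\<forall>(d, \<eta>)\<in>set ds. field_embedding \<eta>" for ds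
      using that
    proof (induction ds)
      case (Cons p ds)
      obtain d \<eta> where p: "p = (d, \<eta>)" by force
      have "c (d * \<eta> x + (\<Sum>(d, \<eta>)\<leftarrow>ds. d * \<eta> x)) \<le> c (d * \<eta> x) + c (\<Sum>(d, \<eta>)\<leftarrow>ds. d * \<eta> x)" by (rule c.add)
      also have "c (d * \<eta> x) \<le> c d * M" unfolding c.mult using Cons.prems M p by (intro mult_left_mono) auto
      finally show ?case using Cons p by (simp add: algebra_simps)
    qed simp
    from this[OF cs(1)] have "c (of_rat (f x)) \<le> C * M" by (simp only: cs(2)[rule_format] C_def)
    then show ?thesis using v c(2) by auto
  qed
  then show ?thesis by blast
qed

text \<open>Without embeddings every decomposition would be empty and all \<rat>-linear maps into
  the field would vanish, including the coordinates of 1.\<close>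

lemma embedding_exists:
  assumes nf: "number_field TYPE('k :: field_char_0)"
  shows "\<exists>\<eta> :: 'k :: field_char_0 \<Rightarrow> 'o :: {alg_closed_field, field_char_0}. field_embedding \<eta>"
proof (rule ccontr)
  assume no: "\<not> ?thesis"
  obtain B :: "'k set" where B: "\<not> rat_vs.dependent B" "rat_vs.span B = UNIV" using number_field_basis[OF nf] by metis
  define f where "f b x = (of_rat (rat_vs.representation B x b) :: 'o)" for b x
  have lin: "rat_linear (f b)" for b
    using B by (auto simp: rat_linear_def f_def rat_vs.representation_add rat_vs.representation_scale of_rat_add of_rat_mult)
  have "f b x = 0" for b x
  proof -
    from embedding_decomposition[OF nf lin[of b]] obtain cs :: "('o \<times> ('k \<Rightarrow> 'o)) list" where
      "(\<forall>(d, \<eta>)\<in>set cs. field_embedding \<eta>) \<and> (\<forall>x. f b x = (\<Sum>(d, \<eta>)\<leftarrow>cs. d * \<eta> x))" by (rule exE)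
    note cs = conjunct1[OF this] conjunct2[OF this]
    have "cs = []" using cs(1) no by (cases cs) auto
    then show ?thesis using cs(2) by simp
  qed
  then have "rat_vs.representation B 1 b = 0" for b unfolding f_def by (metis of_rat_eq_0_iff)
  moreover have "(\<Sum>b\<in>{b. rat_vs.representation B 1 b \<noteq> 0}. of_rat (rat_vs.representation B 1 b) * b) = (1 :: 'k)"
    using B by (intro rat_vs.sum_nonzero_representation_eq) auto
  ultimately show False by simp
qed

lemma complete_block_embedding_values:
  fixes c :: "'o :: {alg_closed_field, field_char_0} \<Rightarrow> real"
  assumes nf: "number_field TYPE('k :: field_char_0)" and u: "u \<in> rat_places"
    and c: "absolute_value c" "\<And>q. c (of_rat q) = u q"
  shows "complete_block_system u (embedding_values c :: ('k :: field_char_0 \<Rightarrow> real) set) some_basis"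
proof -
  have sub: "(embedding_values c :: ('k \<Rightarrow> real) set) \<subseteq> extensions u" using embedding_values_subset[OF c] .
  have fin: "finite (embedding_values c :: ('k \<Rightarrow> real) set)" using finite_subset[OF sub finite_extensions[OF nf u]] .
  have ne: "embedding_values c \<noteq> ({} :: ('k \<Rightarrow> real) set)"
    using embedding_exists[OF nf, where 'o = 'o] by (auto simp: embedding_values_def)
  interpret block_system u "embedding_values c :: ('k \<Rightarrow> real) set" some_basis
    by (rule block_system_extensions[OF nf u fin sub])
  show ?thesis
    by unfold_locales (use embedding_values_bound[OF nf c _ ne fin] rat_places_absolute_value[OF u] in auto)
qed

lemma extensions_eq_embedding_values:
  fixes c :: "'o :: {alg_closed_field, field_char_0} \<Rightarrow> real"
  assumes nf: "number_field TYPE('k :: field_char_0)" and u: "u \<in> rat_places"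
    and c: "absolute_value c" "\<And>q. c (of_rat q) = u q"
  shows "extensions u = (embedding_values c :: ('k :: field_char_0 \<Rightarrow> real) set)"
    "(\<Sum>v\<in>(extensions u :: ('k \<Rightarrow> real) set). local_degree v) = global_degree TYPE('k)"
    "x \<noteq> (0 :: 'k) \<Longrightarrow> u (field_norm x) = (\<Prod>v\<in>extensions u. v x ^ local_degree v)"
proof -
  interpret complete_block_system u "embedding_values c :: ('k \<Rightarrow> real) set" some_basis
    by (rule complete_block_embedding_values[OF nf u c])
  show eq: "extensions u = (embedding_values c :: ('k \<Rightarrow> real) set)"
    using embedding_values_subset[OF c] extension_in_V by (auto simp: extensions_def)
  have ld: "local_degree v = card (some_basis v)" if "v \<in> embedding_values c" for v :: "'k \<Rightarrow> real"
    by (rule local_degree_eq[OF av[OF that] basis[OF that]])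
  show "(\<Sum>v\<in>(extensions u :: ('k \<Rightarrow> real) set). local_degree v) = global_degree TYPE('k)"
    unfolding eq using sum_local_degrees ld by simp
  show "u (field_norm x) = (\<Prod>v\<in>extensions u. v x ^ local_degree v)" if "x \<noteq> 0"
    unfolding eq using norm_eq[OF that] ld by simp
qed

lemma cmod_absolute_value: "absolute_value (cmod :: complex \<Rightarrow> real)"
  by (auto simp: absolute_value_def norm_mult norm_triangle_ineq)

lemma cmod_of_rat: "cmod (of_rat q) = rat_abs q"
proof -
  have "(of_rat q :: complex) = of_real (real_of_rat q)"
    by (induction q) (simp add: of_rat_rat)
  then show ?thesis by (simp add: rat_abs_def)
qed

text \<open>The auxiliary algebraically closed field disappears from the statement: it is \<complex>
  with the modulus for \<open>rat_abs\<close>, and the algebraic closure of \<rat> with the value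
  from \<open>padic_extension\<close> for a prime.\<close>

theorem extensions_degree_norm:
  assumes nf: "number_field TYPE('k :: field_char_0)" and u: "u \<in> rat_places"
  shows "(\<Sum>v\<in>(extensions u :: ('k :: field_char_0 \<Rightarrow> real) set). local_degree v) = global_degree TYPE('k)"
    "x \<noteq> (0 :: 'k) \<Longrightarrow> u (field_norm x) = (\<Prod>v\<in>extensions u. v x ^ local_degree v)"
proof -
  have "(\<Sum>v\<in>(extensions u :: ('k \<Rightarrow> real) set). local_degree v) = global_degree TYPE('k) \<and>
    (\<forall>x::'k. x \<noteq> 0 \<longrightarrow> u (field_norm x) = (\<Prod>v\<in>extensions u. v x ^ local_degree v))"
  proof (cases "u = rat_abs")
    case True
    then show ?thesis
      using extensions_eq_embedding_values(2,3)[OF nf u cmod_absolute_value] cmod_of_rat by simp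
  next
    case False
    then obtain p where p: "Factorial_Ring.prime p" "u = padic_abs p" using u by (auto simp: rat_places_def)
    have "\<exists>q::rat poly. q \<noteq> 0 \<and> poly (map_poly of_rat q) z = 0" for z :: "rat alg_closure"
    proof -
      obtain q :: "rat poly" where q: "q \<noteq> 0" "poly (map_poly to_ac q) z = 0" by (rule alg_closure_algebraic)
      have "(to_ac :: rat \<Rightarrow> rat alg_closure) = of_rat"
      proof
        fix r :: rat
        obtain m n where r: "n \<noteq> 0" "r = of_int m / of_int n" by (rule rat_cases_of_int)
        then show "to_ac r = (of_rat r :: rat alg_closure)" by (simp add: of_rat_divide)
      qed
      then show ?thesis using q by auto
    qed
    from padic_extension[OF p(1) this] obtain c :: "rat alg_closure \<Rightarrow> real"
      where c: "absolute_value c" "\<And>q. c (of_rat q) = padic_abs p q" by blast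
    then show ?thesis
      using extensions_eq_embedding_values(2,3)[OF nf u, of c] p by simp
  qed
  then show "(\<Sum>v\<in>(extensions u :: ('k \<Rightarrow> real) set). local_degree v) = global_degree TYPE('k)"
    "x \<noteq> (0 :: 'k) \<Longrightarrow> u (field_norm x) = (\<Prod>v\<in>extensions u. v x ^ local_degree v)" by auto
qed

lemma archimedean_extension:
  assumes nf: "number_field TYPE('k :: field_char_0)" and v: "v \<in> extensions rat_abs"
  shows "\<exists>\<eta>. field_embedding \<eta> \<and> v = (\<lambda>x :: 'k :: field_char_0. cmod (\<eta> x))"
proof -
  have "rat_abs \<in> rat_places" by (simp add: rat_places_def)
  from extensions_eq_embedding_values(1)[OF nf this cmod_absolute_value] cmod_of_rat v
  show ?thesis by (auto simp: embedding_values_def)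
qed

section \<open>The product formula over the rationals and finiteness of supports\<close>

lemma padic_abs_nat_ne_1: "Factorial_Ring.prime p \<Longrightarrow> n \<noteq> 0 \<Longrightarrow> padic_abs p (of_nat n) \<noteq> 1 \<Longrightarrow> p \<in> prime_factors n"
  using padic_abs_of_nat[of p n] by (cases "p dvd n") (auto simp: not_dvd_imp_multiplicity_0 in_prime_factors_iff)

lemma padic_abs_of_int: "Factorial_Ring.prime p \<Longrightarrow> padic_abs p (of_int m) = padic_abs p (of_nat (nat \<bar>m\<bar>))"
  by (rule abs_value.av_of_int) (simp add: abs_value_def padic_abs_absolute_value)

lemma padic_abs_divide: "Factorial_Ring.prime p \<Longrightarrow> padic_abs p (x / y) = padic_abs p x / padic_abs p y"
  by (rule abs_value.divide) (simp add: abs_value_def padic_abs_absolute_value)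

lemma padic_abs_eq_1:
  assumes p: "Factorial_Ring.prime p" and "m \<noteq> 0" "n \<noteq> 0" and "p \<notin> prime_factors (nat \<bar>m\<bar>)" "p \<notin> prime_factors (nat \<bar>n\<bar>)"
  shows "padic_abs p (of_int m / of_int n) = 1"
proof -
  have "padic_abs p (of_int m) = 1" "padic_abs p (of_int n) = 1"
    unfolding padic_abs_of_int[OF p] using padic_abs_nat_ne_1[OF p] assms by (metis nat_0_iff abs_le_zero_iff)+
  then show ?thesis by (simp add: padic_abs_divide[OF p])
qed

lemma finite_padic_ne_1:
  assumes "q \<noteq> 0" shows "finite {p. Factorial_Ring.prime p \<and> padic_abs p q \<noteq> 1}"
proof -
  obtain m n where q: "n \<noteq> 0" "q = of_int m / of_int n" by (rule rat_cases_of_int)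
  then have "m \<noteq> 0" using assms by auto
  then have "{p. Factorial_Ring.prime p \<and> padic_abs p q \<noteq> 1} \<subseteq> prime_factors (nat \<bar>m\<bar>) \<union> prime_factors (nat \<bar>n\<bar>)"
    using padic_abs_eq_1 q by blast
  then show ?thesis by (rule finite_subset) simp
qed

lemma rat_product_formula_nat:
  assumes "n \<noteq> 0" "finite S" "\<And>p. p \<in> S \<Longrightarrow> Factorial_Ring.prime p" "prime_factors n \<subseteq> S"
  shows "(\<Prod>p\<in>S. padic_abs p (of_nat n)) = inverse (real n)"
proof -
  have "(\<Prod>p\<in>S. padic_abs p (of_nat n)) = (\<Prod>p\<in>S. inverse (real (p ^ multiplicity p n)))"
    using assms by (intro prod.cong) (auto simp: padic_abs_of_nat power_int_minus)
  also have "\<dots> = inverse (real (\<Prod>p\<in>S. p ^ multiplicity p n))" by (simp add: prod_inversef[symmetric] comp_def)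
  also have "(\<Prod>p\<in>S. p ^ multiplicity p n) = (\<Prod>p\<in>prime_factors n. p ^ multiplicity p n)"
    using assms by (intro prod.mono_neutral_right) (auto simp: in_prime_factors_iff not_dvd_imp_multiplicity_0)
  also have "\<dots> = n" using prod_prime_factors[OF assms(1)] by simp
  finally show ?thesis .
qed

lemma rat_product_formula:
  assumes q: "q \<noteq> 0" and S: "finite S" "\<And>p. p \<in> S \<Longrightarrow> Factorial_Ring.prime p"
    "\<And>p. Factorial_Ring.prime p \<Longrightarrow> padic_abs p q \<noteq> 1 \<Longrightarrow> p \<in> S"
  shows "rat_abs q * (\<Prod>p\<in>S. padic_abs p q) = 1"
proof -
  obtain m n where mn: "n \<noteq> 0" "q = of_int m / of_int n" by (rule rat_cases_of_int)
  then have m: "m \<noteq> 0" using q by auto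
  define T where "T = S \<union> prime_factors (nat \<bar>m\<bar>) \<union> prime_factors (nat \<bar>n\<bar>)"
  have T: "finite T" "\<And>p. p \<in> T \<Longrightarrow> Factorial_Ring.prime p" using S by (auto simp: T_def)
  have "(\<Prod>p\<in>S. padic_abs p q) = (\<Prod>p\<in>T. padic_abs p q)"
    using S T by (intro prod.mono_neutral_left) (auto simp: T_def)
  also have "\<dots> = (\<Prod>p\<in>T. padic_abs p (of_nat (nat \<bar>m\<bar>)) / padic_abs p (of_nat (nat \<bar>n\<bar>)))"
    unfolding mn(2) by (intro prod.cong refl) (simp only: T(2) padic_abs_divide padic_abs_of_int)
  also have "\<dots> = inverse (real (nat \<bar>m\<bar>)) / inverse (real (nat \<bar>n\<bar>))"
    unfolding prod_dividef using m mn(1) T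
    by (subst (1 2) rat_product_formula_nat) (auto simp: T_def)
  finally have "(\<Prod>p\<in>S. padic_abs p q) = \<bar>of_int n\<bar> / \<bar>of_int m\<bar>" by (simp add: divide_inverse mult.commute)
  moreover have "rat_abs q = \<bar>of_int m\<bar> / \<bar>of_int n\<bar>" unfolding mn(2) rat_abs_def
    by (simp add: abs_divide of_rat_divide flip: of_int_abs)
  ultimately show ?thesis using m mn(1) by simp
qed

text \<open>If x had value above 1, the leading term of an equation whose coefficients have value 1
  or 0 would strictly dominate all others.\<close>

lemma (in abs_value) algebraic_le_1:
  assumes um: "\<And>x y. a (x + y) \<le> max (a x) (a y)"
    and f: "f \<noteq> (0 :: 'b :: zero poly)" "(\<Sum>i\<le>Polynomial.degree f. g (Polynomial.coeff f i) * x ^ i) = 0"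
    and one: "\<And>i. Polynomial.coeff f i \<noteq> 0 \<Longrightarrow> a (g (Polynomial.coeff f i)) = 1" and g0: "g 0 = 0"
  shows "a x \<le> 1"
proof (rule ccontr)
  assume "\<not> a x \<le> 1"
  then have x: "a x > 1" by simp
  define n where "n = Polynomial.degree f"
  have top: "a (g (Polynomial.coeff f n)) = 1" using one f by (simp add: n_def)
  have "(\<Sum>i\<le>n. g (Polynomial.coeff f i) * x ^ i) = (\<Sum>i<n. g (Polynomial.coeff f i) * x ^ i) + g (Polynomial.coeff f n) * x ^ n"
    by (simp add: lessThan_Suc_atMost[symmetric])
  then have "g (Polynomial.coeff f n) * x ^ n = - (\<Sum>i<n. g (Polynomial.coeff f i) * x ^ i)"
    using f(2) by (simp add: n_def eq_neg_iff_add_eq_0 add.commute)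
  then have "a (g (Polynomial.coeff f n) * x ^ n) = a (\<Sum>i<n. g (Polynomial.coeff f i) * x ^ i)" by simp
  then have eq: "a x ^ n = a (\<Sum>i<n. g (Polynomial.coeff f i) * x ^ i)" by (simp add: mult power top)
  show False
  proof (cases "n = 0")
    case True
    then show ?thesis using eq by simp
  next
    case False
    have "a (\<Sum>i<n. g (Polynomial.coeff f i) * x ^ i) \<le> a x ^ (n - 1)"
    proof (rule ultrametric_sum[OF um])
      fix i assume i: "i \<in> {..<n}"
      show "a (g (Polynomial.coeff f i) * x ^ i) \<le> a x ^ (n - 1)"
      proof (cases "Polynomial.coeff f i = 0")
        case False
        then show ?thesis using i x one by (simp add: mult power power_increasing)
      qed (simp add: g0)
    qed simp
    moreover have "a x ^ (n - 1) < a x ^ n" using x False by (intro power_strict_increasing) auto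
    ultimately show ?thesis using eq by simp
  qed
qed

lemma extension_padic_ultrametric:
  assumes "Factorial_Ring.prime p" "b \<in> extensions (padic_abs p)"
  shows "b (x + y) \<le> max (b x) (b y)"
proof -
  interpret b: abs_value b using assms by unfold_locales (simp add: extensions_def)
  show ?thesis
  proof (rule b.ultrametricI)
    fix n
    have "b (of_nat n) = padic_abs p (of_nat n)" using assms by (metis (mono_tags, lifting) extensions_def mem_Collect_eq of_rat_of_nat_eq)
    then show "b (of_nat n) \<le> 1" using padic_abs_of_nat_le[OF assms(1)] by simp
  qed
qed

lemma rat_poly_root_sum:
  "poly (map_poly of_rat f) x = (\<Sum>i\<le>Polynomial.degree f. of_rat (Polynomial.coeff f i) * x ^ i)"
  for x :: "'k :: field_char_0"
  by (simp add: poly_altdef degree_map_poly coeff_map_poly)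

text \<open>Only primes at which some nonzero coefficient of an annihilating rational polynomial has
  value different from 1 can be involved.\<close>

lemma finite_large_places:
  fixes x :: "'k :: field_char_0"
  assumes "number_field TYPE('k)"
  shows "finite {p. Factorial_Ring.prime p \<and> (\<exists>b\<in>extensions (padic_abs p). b x > 1)}"
proof -
  obtain f :: "rat poly" where f: "f \<noteq> 0" "poly (map_poly of_rat f) x = 0" using number_field_algebraic[OF assms] by blast
  define Bad where "Bad = (\<Union>i\<in>{i. i \<le> Polynomial.degree f \<and> Polynomial.coeff f i \<noteq> 0}. {p. Factorial_Ring.prime p \<and> padic_abs p (Polynomial.coeff f i) \<noteq> 1})"
  have "finite Bad" unfolding Bad_def by (intro finite_UN_I) (auto intro: finite_padic_ne_1)
  moreover have "{p. Factorial_Ring.prime p \<and> (\<exists>b\<in>extensions (padic_abs p). b x > 1)} \<subseteq> Bad"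
  proof
    fix p assume "p \<in> {p. Factorial_Ring.prime p \<and> (\<exists>b\<in>extensions (padic_abs p). b x > 1)}"
    then obtain b where p: "Factorial_Ring.prime p" and b: "b \<in> extensions (padic_abs p)" "b x > 1" by blast
    interpret b: abs_value b using b by unfold_locales (simp add: extensions_def)
    show "p \<in> Bad"
    proof (rule ccontr)
      assume "p \<notin> Bad"
      then have one: "padic_abs p (Polynomial.coeff f i) = 1" if "Polynomial.coeff f i \<noteq> 0" for i
        using that p le_degree[of f i] by (auto simp: Bad_def)
      have "b x \<le> 1"
      proof (rule b.algebraic_le_1[OF extension_padic_ultrametric[OF p b(1)] f(1)])
        show "(\<Sum>i\<le>Polynomial.degree f. of_rat (Polynomial.coeff f i) * x ^ i) = 0"
          using f(2) by (simp add: rat_poly_root_sum)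
      qed (use one b in \<open>auto simp: extensions_def\<close>)
      then show False using b by simp
    qed
  qed
  ultimately show ?thesis by (rule rev_finite_subset)
qed

lemma finite_nontrivial_places:
  fixes x :: "'k :: field_char_0"
  assumes nf: "number_field TYPE('k)" and x: "x \<noteq> 0"
  shows "finite {p. Factorial_Ring.prime p \<and> (\<exists>b\<in>extensions (padic_abs p). b x \<noteq> 1)}"
proof (rule finite_subset)
  show "finite ({p. Factorial_Ring.prime p \<and> (\<exists>b\<in>extensions (padic_abs p). b x > 1)} \<union>
      {p. Factorial_Ring.prime p \<and> (\<exists>b\<in>extensions (padic_abs p). b (inverse x) > 1)})"
    using finite_large_places[OF nf] by blast
  show "{p. Factorial_Ring.prime p \<and> (\<exists>b\<in>extensions (padic_abs p). b x \<noteq> 1)} \<subseteq>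
    {p. Factorial_Ring.prime p \<and> (\<exists>b\<in>extensions (padic_abs p). b x > 1)} \<union>
      {p. Factorial_Ring.prime p \<and> (\<exists>b\<in>extensions (padic_abs p). b (inverse x) > 1)}"
  proof
    fix p assume "p \<in> {p. Factorial_Ring.prime p \<and> (\<exists>b\<in>extensions (padic_abs p). b x \<noteq> 1)}"
    then obtain b where p: "Factorial_Ring.prime p" and b: "b \<in> extensions (padic_abs p)" "b x \<noteq> 1" by blast
    interpret b: abs_value b using b by unfold_locales (simp add: extensions_def)
    have "b x > 1 \<or> b (inverse x) > 1"
      using b(2) b.pos[OF x] by (auto simp: b.inverse one_less_inverse_iff)
    then show "p \<in> {p. Factorial_Ring.prime p \<and> (\<exists>b\<in>extensions (padic_abs p). b x > 1)} \<union>
      {p. Factorial_Ring.prime p \<and> (\<exists>b\<in>extensions (padic_abs p). b (inverse x) > 1)}" using p b by blast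
  qed
qed

section \<open>Places and their normalized representatives\<close>

definition place_of :: "('k :: field \<Rightarrow> real) \<Rightarrow> ('k \<Rightarrow> real) set" where
  "place_of b = av_equiv `` {b}"

lemma mem_place_of: "a \<in> place_of b \<longleftrightarrow> nontrivial_absolute_value b \<and> nontrivial_absolute_value a \<and> (\<exists>s>0. \<forall>x. a x = b x powr s)"
  by (auto simp: place_of_def av_equiv_def)

lemma nontrivial_nonneg: "nontrivial_absolute_value a \<Longrightarrow> a x \<ge> 0"
  by (simp add: nontrivial_absolute_value_def absolute_value_def)

lemma equiv_sym: assumes "(a, b) \<in> av_equiv" shows "(b, a) \<in> av_equiv"
proof -
  obtain s where s: "nontrivial_absolute_value a" "nontrivial_absolute_value b" "s > 0" "\<And>x. b x = a x powr s"
    using assms by (auto simp: av_equiv_def)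
  have "a x = b x powr (1 / s)" for x using s nontrivial_nonneg[OF s(1), of x] by (simp add: powr_powr)
  then show ?thesis using s unfolding av_equiv_def by (intro CollectI case_prodI conjI exI[of _ "1 / s"]) auto
qed

lemma equiv_trans: assumes "(a, b) \<in> av_equiv" "(b, c) \<in> av_equiv" shows "(a, c) \<in> av_equiv"
proof -
  obtain s where s: "nontrivial_absolute_value a" "s > 0" "\<And>x. b x = a x powr s" using assms by (auto simp: av_equiv_def)
  obtain t where t: "nontrivial_absolute_value c" "t > 0" "\<And>x. c x = b x powr t" using assms by (auto simp: av_equiv_def)
  have "c x = a x powr (s * t)" for x using s t by (simp add: powr_powr)
  then show ?thesis using s t unfolding av_equiv_def by (intro CollectI case_prodI conjI exI[of _ "s * t"]) auto
qed

lemma equiv_refl: "nontrivial_absolute_value a \<Longrightarrow> (a, a) \<in> av_equiv"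
  unfolding av_equiv_def by (auto simp: nontrivial_nonneg intro!: exI[of _ 1])

lemma place_of_eq: "(a, b) \<in> av_equiv \<Longrightarrow> place_of a = place_of b"
  unfolding place_of_def using equiv_sym equiv_trans by blast

lemma place_of_in_places: "nontrivial_absolute_value b \<Longrightarrow> place_of b \<in> places"
  unfolding places_def place_of_def by (rule quotientI) simp

lemma extension_of_nat: "b \<in> extensions u \<Longrightarrow> b (of_nat n) = u (of_nat n)"
  by (metis (mono_tags, lifting) extensions_def mem_Collect_eq of_rat_of_nat_eq)

lemma extension_nontrivial:
  assumes "u \<in> rat_places" "b \<in> extensions u" shows "nontrivial_absolute_value b"
proof -
  obtain q where "q \<noteq> 0" "u q \<noteq> 1" using rat_places_nontrivial[OF assms(1)] by blast
  then show ?thesis using assms(2) unfolding nontrivial_absolute_value_def extensions_def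
    by (intro conjI exI[of _ "of_rat q"]) auto
qed

text \<open>The restriction to \<rat> is nontrivial, since a trivial one would bound every algebraic
  element and its inverse by 1. Ostrowski's theorem identifies it up to an exponent s, and the power
  1 / s extends a standard absolute value. That this power is still an absolute value has a
  different reason in the two cases.\<close>

lemma places_cases:
  fixes v :: "('k :: field_char_0 \<Rightarrow> real) set"
  assumes nf: "number_field TYPE('k)" and v: "v \<in> places"
  obtains u b where "u \<in> rat_places" "b \<in> extensions u" "v = place_of b"
proof -
  obtain a where a: "nontrivial_absolute_value a" "v = place_of a"
    using v unfolding places_def place_of_def by (auto elim: quotientE)
  have av: "absolute_value a" using a by (simp add: nontrivial_absolute_value_def)
  interpret abs_value a by unfold_locales (rule av)
  define r where "r q = a (of_rat q)" for q
  have rav: "absolute_value r" unfolding absolute_value_def r_def by (auto simp: of_rat_mult of_rat_add mult add)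
  have "nontrivial_absolute_value r"
  proof (rule ccontr)
    assume "\<not> ?thesis"
    then have triv: "a (of_rat q) = 1" if "q \<noteq> 0" for q using that rav by (auto simp: nontrivial_absolute_value_def r_def)
    have "a (of_nat n) \<le> 1" for n using triv[of "of_nat n"] by (cases "n = 0") auto
    then have um: "a (x + y) \<le> max (a x) (a y)" for x y by (rule ultrametricI)
    have le: "a x \<le> 1" for x
    proof -
      obtain f :: "rat poly" where f: "f \<noteq> 0" "poly (map_poly of_rat f) x = 0" using number_field_algebraic[OF nf] by blast
      show ?thesis
        by (rule algebraic_le_1[OF um f(1), where g = of_rat]) (use f(2) triv in \<open>auto simp: rat_poly_root_sum\<close>)
    qed
    obtain x where x: "x \<noteq> 0" "a x \<noteq> 1" using a by (auto simp: nontrivial_absolute_value_def)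
    then have "a x > 1 \<or> a (inverse x) > 1" using pos[OF x(1)] by (auto simp: inverse one_less_inverse_iff)
    then show False using le by (meson not_le)
  qed
  from ostrowski_rat[OF this] show thesis
  proof (elim disjE exE conjE)
    fix s assume s: "s > 0" "\<forall>x. r x = real_of_rat \<bar>x\<bar> powr s"
    have nat: "a (of_nat n) = real n powr s" for n using s(2)[rule_format, of "of_nat n"] by (simp add: r_def)
    define b where "b x = a x powr (1 / s)" for x
    have "absolute_value b" unfolding b_def[abs_def] by (rule absolute_value_root[OF av s(1) nat])
    moreover have "b (of_rat q) = rat_abs q" for q
      using s by (simp add: b_def r_def[symmetric] rat_abs_def powr_powr)
    ultimately have b: "b \<in> extensions rat_abs" by (simp add: extensions_def)
    have rp: "rat_abs \<in> rat_places" by (simp add: rat_places_def)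
    have "(a, b) \<in> av_equiv" using a extension_nontrivial[OF rp b] s unfolding av_equiv_def
      by (intro CollectI case_prodI conjI exI[of _ "1 / s"]) (auto simp: b_def)
    then show thesis using that[OF rp b] place_of_eq a by metis
  next
    fix p s assume p: "Factorial_Ring.prime p" and s: "s > 0" "\<forall>x. r x = padic_abs p x powr s"
    have "a (of_nat n) \<le> 1" for n
      using s(2)[rule_format, of "of_nat n"] s(1) padic_abs_of_nat_le[OF p, of n]
        abs_value.nonneg[OF abs_value.intro[OF padic_abs_absolute_value[OF p]], of "of_nat n"]
      by (simp add: r_def powr_le1)
    then have um: "a (x + y) \<le> max (a x) (a y)" for x y by (rule ultrametricI)
    define b where "b x = a x powr (1 / s)" for x
    have "absolute_value b" unfolding b_def[abs_def] by (rule absolute_value_powr_ultrametric[OF av um]) (use s in simp)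
    moreover have "b (of_rat q) = padic_abs p q" for q
      using s abs_value.nonneg[OF abs_value.intro[OF padic_abs_absolute_value[OF p]], of q]
      by (simp add: b_def r_def[symmetric] powr_powr)
    ultimately have b: "b \<in> extensions (padic_abs p)" by (simp add: extensions_def)
    have rp: "padic_abs p \<in> rat_places" using p by (simp add: rat_places_def)
    have "(a, b) \<in> av_equiv" using a extension_nontrivial[OF rp b] s unfolding av_equiv_def
      by (intro CollectI case_prodI conjI exI[of _ "1 / s"]) (auto simp: b_def)
    then show thesis using that[OF rp b] place_of_eq a by metis
  qed
qed

text \<open>\<open>normalized\<close> refers to the local degree of the absolute value being
  normalized, so this degree has to be the same for all members of a place. A local basis remains
  one for every power.\<close>

lemma local_degree_powr:
  fixes a :: "'k :: field_char_0 \<Rightarrow> real"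
  assumes nf: "number_field TYPE('k)" and a: "absolute_value a" and s: "s > 0" and b: "absolute_value b" "\<And>x. b x = a x powr s"
  shows "local_degree b = local_degree a"
proof -
  interpret abs_value a by unfold_locales (rule a)
  define E where "E = some_basis a"
  have E: "local_basis a E" unfolding E_def by (rule some_basis[OF nf a])
  then obtain c where c: "c > 0" "\<And>q e. e \<in> E \<Longrightarrow> c * a (of_rat (q e)) \<le> a (lin_comb q E)" and fin: "finite E"
    and dense: "\<And>x \<epsilon>. \<epsilon> > 0 \<Longrightarrow> \<exists>q. a (x - lin_comb q E) < \<epsilon>"
    unfolding local_basis_def by blast
  have "c powr s * b (of_rat (q e)) \<le> b (lin_comb q E)" if "e \<in> E" for q e
  proof -
    have "(c * a (of_rat (q e))) powr s \<le> a (lin_comb q E) powr s"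
      using c(1) c(2)[OF that, of q] s by (intro powr_mono2) auto
    then show ?thesis using c(1) by (simp add: b powr_mult)
  qed
  moreover have "\<exists>q. b (x - lin_comb q E) < \<epsilon>" if "\<epsilon> > 0" for x \<epsilon>
  proof -
    obtain q where "a (x - lin_comb q E) < \<epsilon> powr (1 / s)" using dense[of "\<epsilon> powr (1 / s)" x] \<open>\<epsilon> > 0\<close> by auto
    then have "a (x - lin_comb q E) powr s < (\<epsilon> powr (1 / s)) powr s" using s by (intro powr_less_mono2) auto
    then show ?thesis using s \<open>\<epsilon> > 0\<close> by (auto simp: powr_powr b)
  qed
  ultimately have "local_basis b E" unfolding local_basis_def
    using fin c(1) by (intro conjI exI[of _ "c powr s"]) auto
  then show ?thesis using local_degree_eq[OF b(1)] local_degree_eq[OF a E] by simp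
qed

text \<open>Evaluates the definite description in \<open>place_abs\<close>. The exponent d_v / d of
  the extension b is at most 1 and so preserves the triangle inequality; within the place the
  exponent is determined by the value at 2 or at p.\<close>

lemma place_abs_place_of:
  fixes b :: "'k :: field_char_0 \<Rightarrow> real"
  assumes nf: "number_field TYPE('k)" and u: "u \<in> rat_places" and b: "b \<in> extensions u"
  shows "place_abs (place_of b) = (\<lambda>x. b x powr (real (local_degree b) / real (global_degree TYPE('k))))"
    "absolute_value (\<lambda>x. b x powr (real (local_degree b) / real (global_degree TYPE('k))))"
proof -
  define e where "e = real (local_degree b) / real (global_degree TYPE('k))"
  define a0 where "a0 x = b x powr e" for x
  have bav: "absolute_value b" and bq: "\<And>q. b (of_rat q) = u q" using b by (auto simp: extensions_def)
  have bnt: "nontrivial_absolute_value b" by (rule extension_nontrivial[OF u b])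
  interpret b: abs_value b by unfold_locales (rule bav)
  interpret u: abs_value u by unfold_locales (rule rat_places_absolute_value[OF u])
  have e: "e > 0" "e \<le> 1" using local_degree_pos[OF nf bav] local_degree_le[OF nf bav] by (auto simp: e_def)
  have a0av: "absolute_value a0" unfolding a0_def[abs_def] by (rule absolute_value_powr[OF bav e])
  have a0nt: "nontrivial_absolute_value a0"
  proof -
    obtain x where x: "x \<noteq> 0" "b x \<noteq> 1" using bnt by (auto simp: nontrivial_absolute_value_def)
    have "b x powr e \<noteq> b x powr 0" using x e b.pos[OF x(1)] powr_inj[of "b x" e 0] by simp
    then show ?thesis using x a0av b.pos[OF x(1)] unfolding nontrivial_absolute_value_def by (auto simp: a0_def)
  qed
  have a0_mem: "a0 \<in> place_of b" unfolding mem_place_of using bnt a0nt e by (auto simp: a0_def)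
  have cases: "(u = rat_abs) \<or> (\<exists>p. Factorial_Ring.prime p \<and> u = padic_abs p)" using u by (auto simp: rat_places_def)
  have lies: "u = padic_abs p" if l: "Factorial_Ring.prime p" "lies_above a p" "a \<in> place_of b" for a p
  proof -
    obtain s where s: "s > 0" "\<And>x. a x = b x powr s" using l(3) by (auto simp: mem_place_of)
    obtain t where t: "t > 0" "\<And>q. a (of_rat q) = padic_abs p q powr t" using l(2) by (auto simp: lies_above_def av_equiv_def)
    have "padic_abs p = u"
      by (rule rat_places_powr_eq(1)[OF u _ s(1) t(1)]) (use l(1) s t bq in \<open>auto simp: rat_places_def\<close>)
    then show ?thesis by simp
  qed
  have arch: "u = rat_abs" if l: "archimedean_av a" "a \<in> place_of b" for a
  proof (rule ccontr)
    assume "u \<noteq> rat_abs"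
    then obtain p where p: "Factorial_Ring.prime p" "u = padic_abs p" using cases by blast
    obtain s where s: "s > 0" "\<And>x. a x = b x powr s" "absolute_value a"
      using l(2) by (auto simp: mem_place_of nontrivial_absolute_value_def)
    interpret a: abs_value a by unfold_locales (rule s(3))
    obtain n where "a (of_nat n) > 1" using l(1) a.archimedean_iff by blast
    moreover have "a (of_nat n) \<le> 1" unfolding s(2) extension_of_nat[OF b] p(2)
      using padic_abs_of_nat_le[OF p(1), of n] s(1) u.nonneg[of "of_nat n"] p by (intro powr_le1) auto
    ultimately show False by simp
  qed
  have norm0: "normalized a0" unfolding normalized_def Let_def
  proof (intro conjI allI impI; (elim conjE)?)
    have ld: "local_degree a0 = local_degree b" by (rule local_degree_powr[OF nf bav e(1) a0av]) (simp add: a0_def)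
    show "a0 (of_nat p) = real p powr - (real (local_degree a0) / real (global_degree TYPE('k)))"
      if "Factorial_Ring.prime p" "lies_above a0 p" for p
    proof -
      have "u = padic_abs p" by (rule lies[OF that a0_mem])
      then have "b (of_nat p) = 1 / real p" using extension_of_nat[OF b] padic_abs_prime[OF that(1)] by simp
      then show ?thesis unfolding ld e_def[symmetric] a0_def using prime_gt_0_nat[OF that(1)]
        by (simp add: powr_divide powr_minus_divide)
    qed
    show "a0 (of_rat q) = real_of_rat \<bar>q\<bar> powr (real (local_degree a0) / real (global_degree TYPE('k)))"
      if "archimedean_av a0" for q
      using arch[OF that a0_mem] unfolding ld e_def[symmetric] by (simp add: a0_def bq rat_abs_def)
  qed
  have uniq: "a = a0" if l: "a \<in> place_of b \<and> normalized a" for a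
  proof -
    obtain s where s: "s > 0" "\<And>x. a x = b x powr s" "nontrivial_absolute_value a"
      using l by (auto simp: mem_place_of)
    then have aav: "absolute_value a" by (simp add: nontrivial_absolute_value_def)
    interpret a: abs_value a by unfold_locales (rule aav)
    have ld: "local_degree a = local_degree b" by (rule local_degree_powr[OF nf bav s(1) aav s(2)])
    have "s = e"
      using cases
    proof (elim disjE exE conjE)
      assume ur: "u = rat_abs"
      have 2: "b (of_nat 2) = 2" using extension_of_nat[OF b, of 2] ur rat_abs_of_nat[of 2] by simp
      have "a (of_nat 2) > 1" unfolding s(2) 2 using s(1) by (simp add: gr_one_powr)
      then have "archimedean_av a" using a.archimedean_iff by blast
      then have "a (of_rat 2) = real_of_rat \<bar>2\<bar> powr e"
        using l unfolding normalized_def Let_def ld e_def by blast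
      then have "(2::real) powr s = 2 powr e" using s(2)[of 2] 2 by simp
      then show ?thesis using powr_inj[of 2 s e] by simp
    next
      fix p assume p: "Factorial_Ring.prime p" "u = padic_abs p"
      have "nontrivial_absolute_value (padic_abs p)"
        using padic_abs_absolute_value[OF p(1)] rat_places_nontrivial[OF u] p(2) by (simp add: nontrivial_absolute_value_def)
      moreover have "nontrivial_absolute_value (\<lambda>q. a (of_rat q))"
      proof -
        have "absolute_value (\<lambda>q. a (of_rat q))" unfolding absolute_value_def by (auto simp: of_rat_mult of_rat_add a.mult a.add)
        moreover obtain q where q: "q \<noteq> 0" "u q \<noteq> 1" using rat_places_nontrivial[OF u] by blast
        then have "a (of_rat q) \<noteq> 1" unfolding s(2) bq using powr_inj[of "u q" s 0] u.pos[OF q(1)] s(1) by simp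
        ultimately show ?thesis using q(1) unfolding nontrivial_absolute_value_def by blast
      qed
      ultimately have "lies_above a p" unfolding lies_above_def av_equiv_def
        using s(1,2) bq p(2) by (intro CollectI case_prodI conjI exI[of _ s]) auto
      then have ap: "a (of_nat p) = real p powr (- e)"
        using l p(1) unfolding normalized_def Let_def ld e_def by blast
      have bp: "b (of_nat p) = 1 / real p" using extension_of_nat[OF b] p padic_abs_prime[OF p(1)] by simp
      have p1: "real p > 1" using prime_gt_1_nat[OF p(1)] by simp
      have "(1 / real p) powr s = real p powr (- s)" using p1 by (simp add: powr_divide powr_minus_divide)
      then have "real p powr (- s) = real p powr (- e)" using ap s(2)[of "of_nat p"] bp by simp
      then show ?thesis using powr_inj[of "real p" "- s" "- e"] p1 by simp
    qed
    then show ?thesis using s(2) by (auto simp: a0_def)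
  qed
  have "place_abs (place_of b) = a0" unfolding place_abs_def
    by (rule the_equality[where P = "\<lambda>a. a \<in> place_of b \<and> normalized a"])
       (rule conjI[OF a0_mem norm0], rule uniq)
  then show "place_abs (place_of b) = (\<lambda>x. b x powr (real (local_degree b) / real (global_degree TYPE('k))))"
    by (simp add: a0_def[abs_def] e_def)
  show "absolute_value (\<lambda>x. b x powr (real (local_degree b) / real (global_degree TYPE('k))))"
    using a0av by (simp add: a0_def[abs_def] e_def)
qed

definition base_values :: "('k :: field_char_0 \<Rightarrow> real) set" where
  "base_values = (\<Union>u\<in>rat_places. extensions u)"

lemma extensions_disjoint:
  assumes "b \<in> extensions u" "b \<in> extensions u'" shows "u = u'"
  using assms by (auto simp: extensions_def)

lemma inj_on_place_of: "inj_on place_of (base_values :: ('k :: field_char_0 \<Rightarrow> real) set)"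
proof (rule inj_onI)
  fix b c :: "'k \<Rightarrow> real" assume "b \<in> base_values" "c \<in> base_values" and eq: "place_of b = place_of c"
  then obtain u u' where u: "u \<in> rat_places" "b \<in> extensions u" and u': "u' \<in> rat_places" "c \<in> extensions u'"
    by (auto simp: base_values_def)
  have "c \<in> place_of c" using equiv_refl[OF extension_nontrivial[OF u']] by (simp add: place_of_def)
  then have "c \<in> place_of b" using eq by simp
  then obtain s where s: "s > 0" "\<And>x. c x = b x powr s" by (auto simp: mem_place_of)
  have "u' q powr 1 = u q powr s" for q
  proof -
    have "u' q = c (of_rat q)" "u q = b (of_rat q)" using u u' by (auto simp: extensions_def)
    then show ?thesis using s(2)[of "of_rat q"] by simp
  qed
  then have "s = 1" using rat_places_powr_eq(2)[OF u(1) u'(1) s(1), of 1] by simp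
  then show "b = c" using s(2) nontrivial_nonneg[OF extension_nontrivial[OF u]] by auto
qed

definition base_value :: "('k :: field_char_0 \<Rightarrow> real) set \<Rightarrow> 'k \<Rightarrow> real" where
  "base_value v = inv_into base_values place_of v"

definition weight :: "('k :: field_char_0 \<Rightarrow> real) set \<Rightarrow> real" where
  "weight v = real (local_degree (base_value v)) / real (global_degree TYPE('k))"

lemma base_value_place_of: "b \<in> base_values \<Longrightarrow> base_value (place_of b) = b"
  unfolding base_value_def by (rule inv_into_f_f[OF inj_on_place_of])

lemma places_eq:
  assumes nf: "number_field TYPE('k :: field_char_0)"
  shows "(places :: ('k :: field_char_0 \<Rightarrow> real) set set) = place_of ` base_values"
proof (intro equalityI subsetI)
  fix v :: "('k \<Rightarrow> real) set" assume "v \<in> places"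
  then obtain u b where "u \<in> rat_places" "b \<in> extensions u" "v = place_of b" using places_cases[OF nf] by metis
  then show "v \<in> place_of ` base_values" by (auto simp: base_values_def)
next
  fix v :: "('k \<Rightarrow> real) set" assume "v \<in> place_of ` base_values"
  then show "v \<in> places" using extension_nontrivial place_of_in_places by (auto simp: base_values_def)
qed

lemma place_abs_eq:
  assumes nf: "number_field TYPE('k :: field_char_0)" and b: "b \<in> base_values"
  shows "place_abs (place_of b) = (\<lambda>x :: 'k :: field_char_0. b x powr weight (place_of b))"
  using b place_abs_place_of[OF nf] unfolding weight_def base_value_place_of[OF b]
  by (auto simp: base_values_def)

lemma weight_pos:
  assumes nf: "number_field TYPE('k :: field_char_0)" and v: "v \<in> (places :: ('k :: field_char_0 \<Rightarrow> real) set set)"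
  shows "weight v > 0"
proof -
  obtain b where b: "b \<in> base_values" "v = place_of b" using v places_eq[OF nf] by blast
  have "absolute_value b" using b by (auto simp: base_values_def extensions_def)
  then show ?thesis using local_degree_pos[OF nf] local_degree_le[OF nf] unfolding weight_def b(2) base_value_place_of[OF b(1)]
    by (metis divide_pos_pos less_le_trans of_nat_0_less_iff)
qed

theorem place_abs_absolute_value:
  assumes nf: "number_field TYPE('k :: field_char_0)" and v: "v \<in> (places :: ('k :: field_char_0 \<Rightarrow> real) set set)"
  shows "absolute_value (place_abs v)"
proof -
  obtain u b where b: "u \<in> rat_places" "b \<in> extensions u" "v = place_of b" using places_cases[OF nf v] by metis
  show ?thesis using place_abs_place_of[OF nf b(1,2)] b(3) by simp
qed

section \<open>Archimedean places and the product formula\<close>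

definition arch_places :: "('k :: field_char_0 \<Rightarrow> real) set set" where
  "arch_places = place_of ` extensions rat_abs"

lemma arch_places_subset: "number_field TYPE('k :: field_char_0) \<Longrightarrow> arch_places \<subseteq> (places :: ('k :: field_char_0 \<Rightarrow> real) set set)"
  by (auto simp: places_eq arch_places_def base_values_def rat_places_def)

theorem arch_place_abs:
  assumes nf: "number_field TYPE('k :: field_char_0)" and v: "v \<in> (arch_places :: ('k :: field_char_0 \<Rightarrow> real) set set)"
  shows "\<exists>\<eta> :: 'k \<Rightarrow> complex. field_embedding \<eta> \<and> place_abs v = (\<lambda>x. cmod (\<eta> x) powr weight v)"
proof -
  obtain b where b: "b \<in> extensions rat_abs" "v = place_of b" using v by (auto simp: arch_places_def)
  obtain \<eta> :: "'k \<Rightarrow> complex" where "field_embedding \<eta>" "b = (\<lambda>x. cmod (\<eta> x))" using archimedean_extension[OF nf b(1)] by blast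
  moreover have "b \<in> base_values" using b by (auto simp: base_values_def rat_places_def)
  ultimately show ?thesis using place_abs_eq[OF nf, of b] b(2) by (intro exI[of _ \<eta>]) auto
qed

theorem sum_arch_weights:
  assumes nf: "number_field TYPE('k :: field_char_0)"
  shows "finite (arch_places :: ('k :: field_char_0 \<Rightarrow> real) set set)"
    "(\<Sum>v\<in>(arch_places :: ('k :: field_char_0 \<Rightarrow> real) set set). weight v) = 1"
proof -
  have rp: "rat_abs \<in> rat_places" by (simp add: rat_places_def)
  show "finite (arch_places :: ('k \<Rightarrow> real) set set)" unfolding arch_places_def using finite_extensions[OF nf rp] by simp
  have sub: "extensions rat_abs \<subseteq> (base_values :: ('k \<Rightarrow> real) set)" using rp by (auto simp: base_values_def)
  have "(\<Sum>v\<in>(arch_places :: ('k \<Rightarrow> real) set set). weight v) = (\<Sum>b\<in>extensions rat_abs. weight (place_of b :: ('k \<Rightarrow> real) set))"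
    unfolding arch_places_def by (subst sum.reindex[OF inj_on_subset[OF inj_on_place_of sub]]) simp
  also have "\<dots> = (\<Sum>b\<in>(extensions rat_abs :: ('k \<Rightarrow> real) set). real (local_degree b) / real (global_degree TYPE('k)))"
    using sub by (intro sum.cong refl) (auto simp: weight_def base_value_place_of)
  also have "\<dots> = real (\<Sum>b\<in>(extensions rat_abs :: ('k \<Rightarrow> real) set). local_degree b) / real (global_degree TYPE('k))"
    by (simp add: sum_divide_distrib)
  also have "\<dots> = 1"
  proof -
    obtain \<eta> :: "'k \<Rightarrow> complex" where "field_embedding \<eta>" using embedding_exists[OF nf, where 'o = complex] by blast
    then have "(\<lambda>x. cmod (\<eta> x)) \<in> extensions rat_abs"
      using embedding_values_subset[OF cmod_absolute_value cmod_of_rat] by (auto simp: embedding_values_def)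
    then have av: "absolute_value (\<lambda>x. cmod (\<eta> x))" by (simp add: extensions_def)
    have "global_degree TYPE('k) > 0"
      using local_degree_pos[OF nf av] local_degree_le[OF nf av] by linarith
    then show ?thesis by (simp add: extensions_degree_norm(1)[OF nf rp])
  qed
  finally show "(\<Sum>v\<in>(arch_places :: ('k \<Rightarrow> real) set set). weight v) = 1" .
qed

theorem nonarch_ultrametric:
  assumes nf: "number_field TYPE('k :: field_char_0)" and v: "v \<in> (places :: ('k :: field_char_0 \<Rightarrow> real) set set)" "v \<notin> arch_places"
  shows "place_abs v (x + y) \<le> max (place_abs v x) (place_abs v y)"
proof -
  obtain u b where b: "u \<in> rat_places" "b \<in> extensions u" "v = place_of b" using places_cases[OF nf v(1)] by metis
  then have "u \<noteq> rat_abs" using v(2) by (auto simp: arch_places_def)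
  then obtain p where p: "Factorial_Ring.prime p" "u = padic_abs p" using b(1) by (auto simp: rat_places_def)
  have bb: "b \<in> base_values" using b by (auto simp: base_values_def)
  have nn: "b z \<ge> 0" for z using nontrivial_nonneg[OF extension_nontrivial[OF b(1,2)]] .
  have "b (x + y) \<le> b x \<or> b (x + y) \<le> b y" using extension_padic_ultrametric[OF p(1), of b x y] b(2) p(2) by (auto simp: le_max_iff_disj)
  then show ?thesis
    unfolding b(3) place_abs_eq[OF nf bb] le_max_iff_disj
    using weight_pos[OF nf v(1)] nn b(3) by (auto intro!: powr_mono2)
qed

lemma prod_powr: "(\<And>i. i \<in> A \<Longrightarrow> f i \<ge> 0) \<Longrightarrow> (\<Prod>i\<in>A. f i powr r) = (\<Prod>i\<in>A. f i :: real) powr r"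
  by (induction A rule: infinite_finite_induct) (auto simp: powr_mult prod_nonneg)

theorem product_formula:
  fixes x :: "'k :: field_char_0"
  assumes nf: "number_field TYPE('k)" and x: "x \<noteq> 0"
  shows "finite {v \<in> places. place_abs v x \<noteq> 1}" "(\<Prod>v\<in>{v \<in> places. place_abs v x \<noteq> 1}. place_abs v x) = 1"
proof -
  let ?d = "real (global_degree TYPE('k))"
  \<comment> \<open>All primes at which x has an extension value, or its norm a value, different
    from 1. The same finite set then serves for the places and for the product formula over
    \<rat>.\<close>
  define S where "S = {p. Factorial_Ring.prime p \<and> (\<exists>b\<in>extensions (padic_abs p). b x \<noteq> 1)} \<union>
    {p. Factorial_Ring.prime p \<and> padic_abs p (field_norm x) \<noteq> 1}"
  have N: "field_norm x \<noteq> 0" by (rule field_norm_nonzero[OF nf x])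
  have S: "finite S" "\<And>p. p \<in> S \<Longrightarrow> Factorial_Ring.prime p"
    using finite_nontrivial_places[OF nf x] finite_padic_ne_1[OF N] by (auto simp: S_def)
  define U where "U = insert rat_abs (padic_abs ` S)"
  have U: "finite U" "U \<subseteq> rat_places" using S by (auto simp: U_def rat_places_def)
  define C where "C = (\<Union>u\<in>U. extensions u :: ('k \<Rightarrow> real) set)"
  have finC: "finite C" unfolding C_def using U finite_extensions[OF nf] by auto
  have C: "C \<subseteq> base_values" using U by (auto simp: C_def base_values_def)
  have pos: "b x > 0" if "b \<in> base_values" for b
    using that abs_value.pos[OF abs_value.intro x] by (auto simp: base_values_def extensions_def)
  have sub: "{v \<in> places. place_abs v x \<noteq> 1} \<subseteq> place_of ` C"
  proof
    fix v assume "v \<in> {v \<in> places. place_abs v x \<noteq> 1}"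
    then obtain u b where b: "u \<in> rat_places" "b \<in> extensions u" "v = place_of b" "place_abs v x \<noteq> 1"
      using places_cases[OF nf, of v] by (metis (mono_tags, lifting) mem_Collect_eq)
    have bb: "b \<in> base_values" using b by (auto simp: base_values_def)
    have "b x \<noteq> 1" using b(4) unfolding b(3) place_abs_eq[OF nf bb] by auto
    then have "u \<in> U" using b(1,2) by (auto simp: U_def rat_places_def S_def)
    then show "v \<in> place_of ` C" using b by (auto simp: C_def)
  qed
  then show fin: "finite {v \<in> places. place_abs v x \<noteq> 1}" using finC by (auto intro: finite_subset)
  have "(\<Prod>v\<in>{v \<in> places. place_abs v x \<noteq> 1}. place_abs v x) = (\<Prod>v\<in>place_of ` C. place_abs v x)"
  proof (rule prod.mono_neutral_left[OF _ sub])
    have "place_of ` C \<subseteq> places" unfolding places_eq[OF nf] using C by blast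
    then show "\<forall>v\<in>place_of ` C - {v \<in> places. place_abs v x \<noteq> 1}. place_abs v x = 1" by blast
  qed (use finC in simp)
  also have "\<dots> = (\<Prod>b\<in>C. place_abs (place_of b) x)"
    by (subst prod.reindex[OF inj_on_subset[OF inj_on_place_of C]]) simp
  also have "\<dots> = (\<Prod>b\<in>C. (b x ^ local_degree b) powr (1 / ?d))"
  proof (intro prod.cong refl)
    fix b assume "b \<in> C"
    then have bb: "b \<in> base_values" using C by blast
    then show "place_abs (place_of b) x = (b x ^ local_degree b) powr (1 / ?d)"
      using pos[OF bb] by (simp add: place_abs_eq[OF nf bb] weight_def base_value_place_of powr_realpow[symmetric] powr_powr)
  qed
  also have "\<dots> = (\<Prod>b\<in>C. b x ^ local_degree b) powr (1 / ?d)"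
    using pos C by (intro prod_powr zero_le_power less_imp_le) blast
  also have "(\<Prod>b\<in>C. b x ^ local_degree b) = (\<Prod>u\<in>U. \<Prod>b\<in>extensions u. b x ^ local_degree b)"
    unfolding C_def using U finite_extensions[OF nf] by (intro prod.UNION_disjoint) (auto dest: extensions_disjoint)
  also have "\<dots> = (\<Prod>u\<in>U. u (field_norm x))"
    using U by (intro prod.cong refl) (auto simp: extensions_degree_norm(2)[OF nf _ x])
  also have "\<dots> = rat_abs (field_norm x) * (\<Prod>u\<in>padic_abs ` S. u (field_norm x))"
  proof -
    have "rat_abs \<notin> padic_abs ` S"
    proof
      assume "rat_abs \<in> padic_abs ` S"
      then obtain p where p: "p \<in> S" "rat_abs = padic_abs p" by blast
      then have "real p = 1 / real p" using padic_abs_prime[OF S(2)[OF p(1)]] rat_abs_of_nat[of p] by simp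
      moreover have "real p > 1" using prime_gt_1_nat[OF S(2)[OF p(1)]] by simp
      ultimately show False using less_1_mult[of "real p" "real p"] by (simp add: field_simps)
    qed
    then show ?thesis using S by (simp add: U_def)
  qed
  also have "(\<Prod>u\<in>padic_abs ` S. u (field_norm x)) = (\<Prod>p\<in>S. padic_abs p (field_norm x))"
  proof (subst prod.reindex)
    show "inj_on padic_abs S"
    proof (rule inj_onI, rule ccontr)
      fix p q assume pq: "p \<in> S" "q \<in> S" "padic_abs p = padic_abs q" "p \<noteq> q"
      have "1 / real p = 1" using padic_abs_prime[OF S(2)[OF pq(1)]] padic_abs_other_prime[of q p] S(2) pq by simp
      then show False using prime_gt_1_nat[OF S(2)[OF pq(1)]] by simp
    qed
  qed simp
  also have "rat_abs (field_norm x) * \<dots> = 1"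
    by (rule rat_product_formula[OF N S]) (simp_all add: S_def)
  finally show "(\<Prod>v\<in>{v \<in> places. place_abs v x \<noteq> 1}. place_abs v x) = 1" by simp
qed

section \<open>Gauss norms and Gelfond's inequality\<close>

definition pnorm :: "('k :: zero \<Rightarrow> real) \<Rightarrow> 'k poly \<Rightarrow> real" where
  "pnorm a P = Max ((\<lambda>i. a (Polynomial.coeff P i)) ` {..Polynomial.degree P})"

context abs_value
begin

lemma pnorm_attained: "\<exists>i\<le>Polynomial.degree P. a (Polynomial.coeff P i) = pnorm a P"
proof -
  have "pnorm a P \<in> (\<lambda>i. a (Polynomial.coeff P i)) ` {..Polynomial.degree P}"
    unfolding pnorm_def by (rule Max_in) auto
  then show ?thesis by auto
qed

lemma pnorm_nonneg [simp]: "pnorm a P \<ge> 0"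
  using pnorm_attained[of P] by (metis nonneg)

lemma pnorm_ge: "a (Polynomial.coeff P i) \<le> pnorm a P"
proof (cases "i \<le> Polynomial.degree P")
  case True
  then show ?thesis unfolding pnorm_def by (intro Max_ge) auto
next
  case False
  then show ?thesis by (simp add: coeff_eq_0)
qed

lemma pnorm_le: "(\<And>i. a (Polynomial.coeff P i) \<le> M) \<Longrightarrow> pnorm a P \<le> M"
  using pnorm_attained[of P] by metis

lemma pnorm_pos:
  assumes "P \<noteq> 0" shows "pnorm a P > 0"
proof -
  have "a (Polynomial.lead_coeff P) > 0" using assms by simp
  then show ?thesis using pnorm_ge[of P "Polynomial.degree P"] by linarith
qed

lemma pnorm_const [simp]: "pnorm a [:c:] = a c"
  by (simp add: pnorm_def)

lemma pnorm_1 [simp]: "pnorm a 1 = 1"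
  using pnorm_const[of 1] by (simp add: one_pCons)

lemma pnorm_mult_le: "pnorm a (P * Q) \<le> real (Polynomial.degree Q + 1) * (pnorm a P * pnorm a Q)"
proof (rule pnorm_le)
  fix i
  have "Polynomial.coeff (P * Q) i = Polynomial.coeff (Q * P) i" by (simp add: mult.commute)
  also have "\<dots> = (\<Sum>j\<le>i. Polynomial.coeff Q j * Polynomial.coeff P (i - j))" by (simp add: Polynomial.coeff_mult)
  also have "\<dots> = (\<Sum>j\<in>{..i} \<inter> {..Polynomial.degree Q}. Polynomial.coeff Q j * Polynomial.coeff P (i - j))"
    by (intro sum.mono_neutral_right) (auto simp: coeff_eq_0)
  finally have "a (Polynomial.coeff (P * Q) i) \<le> (\<Sum>j\<in>{..i} \<inter> {..Polynomial.degree Q}. a (Polynomial.coeff Q j * Polynomial.coeff P (i - j)))"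
    by (simp add: sum_le)
  also have "\<dots> \<le> (\<Sum>j\<in>{..i} \<inter> {..Polynomial.degree Q}. pnorm a P * pnorm a Q)"
    unfolding mult by (intro sum_mono) (subst mult.commute, intro mult_mono pnorm_ge, auto)
  also have "\<dots> = real (card ({..i} \<inter> {..Polynomial.degree Q})) * (pnorm a P * pnorm a Q)" by simp
  also have "\<dots> \<le> real (Polynomial.degree Q + 1) * (pnorm a P * pnorm a Q)"
  proof (intro mult_right_mono)
    have "card ({..i} \<inter> {..Polynomial.degree Q}) \<le> card {..Polynomial.degree Q}" by (intro card_mono) auto
    then show "real (card ({..i} \<inter> {..Polynomial.degree Q})) \<le> real (Polynomial.degree Q + 1)" by simp
  qed simp
  finally show "a (Polynomial.coeff (P * Q) i) \<le> real (Polynomial.degree Q + 1) * (pnorm a P * pnorm a Q)" .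
qed

text \<open>The factor deg Q + 1 of \<open>pnorm_mult_le\<close> is at most 2^deg Q, which makes the
  constant multiplicative: it depends on the total degree and not on the number of factors.\<close>

lemma pnorm_prod_list_le:
  assumes "0 \<notin> set Qs"
  shows "pnorm a (prod_list Qs) \<le> 2 ^ Polynomial.degree (prod_list Qs) * (\<Prod>Q\<leftarrow>Qs. pnorm a Q)"
  using assms
proof (induction Qs)
  case (Cons Q Qs)
  have nz: "Q \<noteq> 0" "prod_list Qs \<noteq> 0" using Cons.prems by (auto simp: prod_list_zero_iff)
  have nat: "real (Polynomial.degree Q + 1) \<le> 2 ^ Polynomial.degree Q"
  proof -
    have "Polynomial.degree Q < 2 ^ Polynomial.degree Q" by (rule less_exp)
    then have "real (Polynomial.degree Q + 1) \<le> real (2 ^ Polynomial.degree Q)" by (simp only: of_nat_le_iff Suc_leI Suc_eq_plus1[symmetric])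
    then show ?thesis by simp
  qed
  have "pnorm a (Q * prod_list Qs) \<le> real (Polynomial.degree Q + 1) * (pnorm a (prod_list Qs) * pnorm a Q)"
    using pnorm_mult_le[of "prod_list Qs" Q] by (simp add: mult.commute)
  also have "\<dots> \<le> 2 ^ Polynomial.degree Q * ((2 ^ Polynomial.degree (prod_list Qs) * (\<Prod>Q\<leftarrow>Qs. pnorm a Q)) * pnorm a Q)"
    using Cons nat by (intro mult_mono mult_nonneg_nonneg) (auto intro!: prod_list_nonneg)
  also have "\<dots> = 2 ^ Polynomial.degree (Q * prod_list Qs) * (\<Prod>Q\<leftarrow>Q # Qs. pnorm a Q)"
    using nz by (simp add: degree_mult_eq power_add)
  finally show ?case by simp
qed simp

lemma strict_dominant:
  assumes um: "\<And>x y. a (x + y) \<le> max (a x) (a y)" and "a s < a t"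
  shows "a (t + s) = a t"
proof -
  have "a t \<le> max (a (t + s)) (a s)" using um[of "t + s" "- s"] by simp
  moreover have "a (t + s) \<le> max (a t) (a s)" by (rule um)
  ultimately show ?thesis using assms(2) by (auto simp: max_def split: if_splits)
qed

lemma ultrametric_sum_less:
  assumes um: "\<And>x y. a (x + y) \<le> max (a x) (a y)" and "finite A" "\<And>i. i \<in> A \<Longrightarrow> a (f i) < M" "M > 0"
  shows "a (sum f A) < M"
  using assms(2,3)
proof (induction A)
  case (insert i A)
  then have "a (f i) < M" "a (sum f A) < M" by auto
  then have "a (f i + sum f A) < M" using um[of "f i" "sum f A"] by (auto simp: max_def split: if_splits)
  then show ?case using insert.hyps by simp
qed (use assms in simp)

text \<open>At the sum of the least indices where P and Q attain their norms exactly one product has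
  maximal value, so the coefficient there attains the product of the norms.\<close>

lemma gauss_lemma:
  assumes um: "\<And>x y. a (x + y) \<le> max (a x) (a y)"
  shows "pnorm a (P * Q) = pnorm a P * pnorm a Q"
proof (cases "P = 0 \<or> Q = 0")
  case True
  then show ?thesis by (auto simp: pnorm_def)
next
  case False
  then have pos: "pnorm a P > 0" "pnorm a Q > 0" by (auto intro: pnorm_pos)
  show ?thesis
  proof (rule antisym)
    show "pnorm a (P * Q) \<le> pnorm a P * pnorm a Q"
      unfolding Polynomial.coeff_mult
      by (rule pnorm_le, unfold Polynomial.coeff_mult, rule ultrametric_sum[OF um])
         (auto simp: mult intro!: mult_mono pnorm_ge)
    define i where "i = (LEAST i. a (Polynomial.coeff P i) = pnorm a P)"
    define j where "j = (LEAST j. a (Polynomial.coeff Q j) = pnorm a Q)"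
    have i: "a (Polynomial.coeff P i) = pnorm a P" unfolding i_def by (rule LeastI_ex) (use pnorm_attained in blast)
    have j: "a (Polynomial.coeff Q j) = pnorm a Q" unfolding j_def by (rule LeastI_ex) (use pnorm_attained in blast)
    have il: "a (Polynomial.coeff P k) < pnorm a P" if "k < i" for k
      using not_less_Least[of k "\<lambda>i. a (Polynomial.coeff P i) = pnorm a P"] that pnorm_ge[of P k] unfolding i_def by (simp add: less_le)
    have jl: "a (Polynomial.coeff Q k) < pnorm a Q" if "k < j" for k
      using not_less_Least[of k "\<lambda>j. a (Polynomial.coeff Q j) = pnorm a Q"] that pnorm_ge[of Q k] unfolding j_def by (simp add: less_le)
    let ?t = "\<lambda>k. Polynomial.coeff P k * Polynomial.coeff Q (i + j - k)"
    have "Polynomial.coeff (P * Q) (i + j) = ?t i + (\<Sum>k\<in>{..i+j}-{i}. ?t k)"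
      unfolding Polynomial.coeff_mult by (rule sum.remove) auto
    moreover have "a (\<Sum>k\<in>{..i+j}-{i}. ?t k) < pnorm a P * pnorm a Q"
    proof (rule ultrametric_sum_less[OF um])
      fix k assume k: "k \<in> {..i+j}-{i}"
      then consider "k < i" | "i + j - k < j" "k \<le> i + j" by force
      then show "a (?t k) < pnorm a P * pnorm a Q"
      proof cases
        case 1
        have "a (Polynomial.coeff P k) * a (Polynomial.coeff Q (i + j - k)) \<le> a (Polynomial.coeff P k) * pnorm a Q"
          by (intro mult_left_mono pnorm_ge) auto
        also have "\<dots> < pnorm a P * pnorm a Q" using il[OF 1] pos by simp
        finally show ?thesis by (simp add: mult)
      next
        case 2
        have "a (Polynomial.coeff P k) * a (Polynomial.coeff Q (i + j - k)) \<le> pnorm a P * a (Polynomial.coeff Q (i + j - k))"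
          by (intro mult_right_mono pnorm_ge) auto
        also have "\<dots> < pnorm a P * pnorm a Q" using jl[OF 2(1)] pos by simp
        finally show ?thesis by (simp add: mult)
      qed
    qed (use pos in auto)
    moreover have "a (?t i) = pnorm a P * pnorm a Q" by (simp add: mult i j)
    ultimately have "a (Polynomial.coeff (P * Q) (i + j)) = pnorm a P * pnorm a Q"
      using strict_dominant[OF um] by metis
    then show "pnorm a P * pnorm a Q \<le> pnorm a (P * Q)" using pnorm_ge by metis
  qed
qed

lemma gauss_lemma_prod_list:
  assumes um: "\<And>x y. a (x + y) \<le> max (a x) (a y)"
  shows "pnorm a (prod_list Qs) = (\<Prod>Q\<leftarrow>Qs. pnorm a Q)"
  by (induction Qs) (simp_all add: gauss_lemma[OF um])

end

section \<open>Mahler measure and Gelfond's inequality over the complex numbers\<close>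

definition l2sq :: "complex poly \<Rightarrow> real" where
  "l2sq P = (\<Sum>i\<le>Polynomial.degree P. (cmod (Polynomial.coeff P i))\<^sup>2)"

lemma l2sq_eq: "Polynomial.degree P \<le> N \<Longrightarrow> l2sq P = (\<Sum>i\<le>N. (cmod (Polynomial.coeff P i))\<^sup>2)"
  unfolding l2sq_def by (intro sum.mono_neutral_left) (auto simp: coeff_eq_0)

lemma cmod_diff_squared: "(cmod (z - w))\<^sup>2 = (cmod z)\<^sup>2 + (cmod w)\<^sup>2 - 2 * Re (z * cnj w)"
  by (simp only: cmod_power2) (simp add: power2_eq_square algebra_simps)

text \<open>Landau's device: replacing a root \<open>\<alpha>\<close> by its mirror image in the unit circle preserves the
  Euclidean norm of the coefficient vector.\<close>

lemma l2sq_flip: "l2sq ([:-\<alpha>, 1:] * Q) = l2sq ([:1, - cnj \<alpha>:] * Q)"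
proof -
  define n where "n = Polynomial.degree Q"
  define q where "q = Polynomial.coeff Q"
  have q0: "q (Suc n) = 0" by (simp add: q_def n_def coeff_eq_0)
  have dg: "Polynomial.degree ([:u, v:] * Q) \<le> Suc n" for u v :: complex
    using degree_mult_le[of "[:u, v:]" Q] degree_pCons_le[of u "[:v:]"] by (simp add: n_def)
  have c1: "Polynomial.coeff ([:u, v:] * Q) 0 = u * q 0" "Polynomial.coeff ([:u, v:] * Q) (Suc j) = v * q j + u * q (Suc j)" for u v :: complex and j
    by (simp_all add: q_def mult_pCons_left)
  have shift: "(\<Sum>j\<le>n. (cmod (q (Suc j)))\<^sup>2) + (cmod (q 0))\<^sup>2 = (\<Sum>j\<le>n. (cmod (q j))\<^sup>2)"
  proof -
    have "(\<Sum>j\<le>Suc n. (cmod (q j))\<^sup>2) = (cmod (q 0))\<^sup>2 + (\<Sum>j\<le>n. (cmod (q (Suc j)))\<^sup>2)" by (rule sum.atMost_Suc_shift)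
    then show ?thesis using q0 by simp
  qed
  have e1: "(cmod (q j - \<alpha> * q (Suc j)))\<^sup>2 = (cmod (q j))\<^sup>2 + (cmod \<alpha>)\<^sup>2 * (cmod (q (Suc j)))\<^sup>2 - 2 * Re (q j * cnj \<alpha> * cnj (q (Suc j)))" for j
    unfolding cmod_diff_squared by (simp add: norm_mult power_mult_distrib mult.assoc)
  have e2: "(cmod (q (Suc j) - cnj \<alpha> * q j))\<^sup>2 = (cmod (q (Suc j)))\<^sup>2 + (cmod \<alpha>)\<^sup>2 * (cmod (q j))\<^sup>2 - 2 * Re (q j * cnj \<alpha> * cnj (q (Suc j)))" for j
    unfolding cmod_diff_squared by (simp add: norm_mult power_mult_distrib algebra_simps)
  define cr where "cr = (\<Sum>j\<le>n. 2 * Re (q j * cnj \<alpha> * cnj (q (Suc j))))"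
  define T where "T = (\<Sum>j\<le>n. (cmod (q j))\<^sup>2)"
  define T' where "T' = (\<Sum>j\<le>n. (cmod (q (Suc j)))\<^sup>2)"
  have "l2sq ([:-\<alpha>, 1:] * Q) = (cmod \<alpha>)\<^sup>2 * (cmod (q 0))\<^sup>2 + (\<Sum>j\<le>n. (cmod (q j - \<alpha> * q (Suc j)))\<^sup>2)"
    unfolding l2sq_eq[OF dg] sum.atMost_Suc_shift c1 by (simp add: norm_mult power_mult_distrib)
  also have "\<dots> = (cmod \<alpha>)\<^sup>2 * (T' + (cmod (q 0))\<^sup>2) + T - cr"
    unfolding e1 by (simp add: sum.distrib sum_subtractf sum_distrib_left[symmetric] cr_def T_def T'_def algebra_simps)
  finally have 1: "l2sq ([:-\<alpha>, 1:] * Q) = (cmod \<alpha>)\<^sup>2 * T + T - cr" using shift by (simp add: T_def T'_def)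
  have "l2sq ([:1, - cnj \<alpha>:] * Q) = (cmod (q 0))\<^sup>2 + (\<Sum>j\<le>n. (cmod (q (Suc j) - cnj \<alpha> * q j))\<^sup>2)"
    unfolding l2sq_eq[OF dg] sum.atMost_Suc_shift c1 by (simp add: add.commute)
  also have "\<dots> = (T' + (cmod (q 0))\<^sup>2) + (cmod \<alpha>)\<^sup>2 * T - cr"
    unfolding e2 by (simp add: sum.distrib sum_subtractf sum_distrib_left[symmetric] cr_def T_def T'_def algebra_simps)
  finally show ?thesis using 1 shift by (simp add: T_def T'_def)
qed

definition mahler :: "complex poly \<Rightarrow> real" where
  "mahler P = cmod (Polynomial.lead_coeff P) * (\<Prod>\<alpha>\<in>#proots P. max 1 (cmod \<alpha>))"

lemma mahler_nonneg: "mahler P \<ge> 0"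
proof -
  have "(\<Prod>\<alpha>\<in>#A. max 1 (cmod \<alpha>)) \<ge> 0" for A by (induction A) (auto intro!: mult_nonneg_nonneg)
  then show ?thesis by (simp add: mahler_def)
qed

lemma mahler_mult: "P \<noteq> 0 \<Longrightarrow> Q \<noteq> 0 \<Longrightarrow> mahler (P * Q) = mahler P * mahler Q"
  by (simp add: mahler_def lead_coeff_mult proots_mult norm_mult mult_ac)

lemma complex_poly_split:
  assumes "P \<noteq> (0 :: complex poly)"
  shows "P = Polynomial.smult (Polynomial.lead_coeff P) (\<Prod>\<alpha>\<in>#proots P. [:-\<alpha>, 1:])"
proof -
  obtain A where A: "P = Polynomial.smult (Polynomial.lead_coeff P) (\<Prod>x\<in>#A. [:-x, 1:])"
    using alg_closed_imp_factorization[OF assms] by metis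
  have "proots (\<Prod>x\<in>#A. [:-x, 1:]) = A"
  proof (induction A)
    case (add x A)
    have "(\<Prod>x\<in>#A. [:-x, 1:]) \<noteq> 0" by (auto simp: prod_mset_zero_iff)
    then show ?case using add by (simp add: proots_mult del: mult_pCons_left)
  qed simp
  then have "proots P = A" using assms by (subst A) simp
  then show ?thesis using A by simp
qed

interpretation cmod: abs_value cmod
  by unfold_locales (auto simp: absolute_value_def norm_mult norm_triangle_ineq)

lemma pnorm_linear_mult: "pnorm cmod ([:-\<alpha>, 1:] * Q) \<le> (1 + cmod \<alpha>) * pnorm cmod Q"
proof (rule cmod.pnorm_le)
  fix i
  have "cmod (Polynomial.coeff ([:-\<alpha>, 1:] * Q) i) \<le> pnorm cmod Q + cmod \<alpha> * pnorm cmod Q"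
  proof (cases i)
    case 0
    have "cmod \<alpha> * cmod (Polynomial.coeff Q 0) \<le> cmod \<alpha> * pnorm cmod Q" by (intro mult_left_mono cmod.pnorm_ge) auto
    then show ?thesis unfolding 0 by (simp add: norm_mult add_increasing)
  next
    case (Suc j)
    have "cmod (Polynomial.coeff Q j - \<alpha> * Polynomial.coeff Q (Suc j)) \<le> cmod (Polynomial.coeff Q j) + cmod \<alpha> * cmod (Polynomial.coeff Q (Suc j))"
      using norm_triangle_ineq4[of "Polynomial.coeff Q j" "\<alpha> * Polynomial.coeff Q (Suc j)"] by (simp add: norm_mult)
    also have "\<dots> \<le> pnorm cmod Q + cmod \<alpha> * pnorm cmod Q" by (intro add_mono mult_left_mono cmod.pnorm_ge) auto
    finally show ?thesis unfolding Suc by simp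
  qed
  then show "cmod (Polynomial.coeff ([:-\<alpha>, 1:] * Q) i) \<le> (1 + cmod \<alpha>) * pnorm cmod Q" by (simp add: algebra_simps)
qed

lemma degree_prod_linear: "Polynomial.degree (\<Prod>\<alpha>\<in>#A. [:-\<alpha>, 1:] :: complex poly) = size A"
proof (induction A)
  case (add x A)
  have "(\<Prod>x\<in>#A. [:-x, 1:]) \<noteq> (0 :: complex poly)" by (auto simp: prod_mset_zero_iff)
  then show ?case using add by (simp add: degree_mult_eq del: mult_pCons_left)
qed simp

lemma size_proots: "P \<noteq> (0 :: complex poly) \<Longrightarrow> size (proots P) = Polynomial.degree P"
  using complex_poly_split[of P] degree_prod_linear[of "proots P"] by (metis degree_smult_eq leading_coeff_0_iff)

text \<open>Each linear factor multiplies the largest coefficient by at most 1 + |\<alpha>|, which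
  is at most 2 max(1, |\<alpha>|).\<close>

lemma pnorm_le_mahler:
  assumes "P \<noteq> 0" shows "pnorm cmod P \<le> 2 ^ Polynomial.degree P * mahler P"
proof -
  have "pnorm cmod (Polynomial.smult c (\<Prod>\<alpha>\<in>#A. [:-\<alpha>, 1:])) \<le> 2 ^ size A * (cmod c * (\<Prod>\<alpha>\<in>#A. max 1 (cmod \<alpha>)))" for c A
  proof (induction A)
    case (add \<alpha> A)
    have "pnorm cmod (Polynomial.smult c (\<Prod>\<alpha>\<in>#add_mset \<alpha> A. [:-\<alpha>, 1:])) = pnorm cmod ([:-\<alpha>, 1:] * Polynomial.smult c (\<Prod>\<alpha>\<in>#A. [:-\<alpha>, 1:]))"
      by (simp only: image_mset_add_mset prod_mset.add_mset mult_smult_right)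
    also have "\<dots> \<le> (1 + cmod \<alpha>) * pnorm cmod (Polynomial.smult c (\<Prod>\<alpha>\<in>#A. [:-\<alpha>, 1:]))" by (rule pnorm_linear_mult)
    also have "\<dots> \<le> (2 * max 1 (cmod \<alpha>)) * (2 ^ size A * (cmod c * (\<Prod>\<alpha>\<in>#A. max 1 (cmod \<alpha>))))"
      by (intro mult_mono add) auto
    finally show ?case by (simp add: mult_ac)
  qed simp
  from this[of "Polynomial.lead_coeff P" "proots P"] show ?thesis
    using complex_poly_split[OF assms] size_proots[OF assms] by (simp add: mahler_def)
qed

text \<open>Landau's inequality. Reflecting all roots outside the unit circle keeps the Euclidean
  norm, and the leading coefficient of the reflected polynomial has modulus \<open>mahler P\<close>;
  a single coefficient is at most the Euclidean norm.\<close>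

lemma mahler_le:
  assumes "P \<noteq> 0" shows "mahler P \<le> sqrt (real (Polynomial.degree P + 1)) * pnorm cmod P"
proof -
  define F where "F A = (\<Prod>\<alpha>\<in>#A. if cmod \<alpha> \<le> 1 then [:-\<alpha>, 1:] else [:1, - cnj \<alpha>:])" for A
  have flip: "l2sq (R * (\<Prod>\<alpha>\<in>#A. [:-\<alpha>, 1:])) = l2sq (R * F A)" for R A
  proof (induction A arbitrary: R)
    case (add \<alpha> A)
    have "l2sq (R * (\<Prod>\<alpha>\<in>#add_mset \<alpha> A. [:-\<alpha>, 1:])) = l2sq ((R * [:-\<alpha>, 1:]) * (\<Prod>\<alpha>\<in>#A. [:-\<alpha>, 1:]))"
      by (simp only: image_mset_add_mset prod_mset.add_mset mult.assoc)
    also have "\<dots> = l2sq ([:-\<alpha>, 1:] * (R * F A))" unfolding add by (simp only: mult.assoc mult.commute mult.left_commute)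
    also have "\<dots> = l2sq ((if cmod \<alpha> \<le> 1 then [:-\<alpha>, 1:] else [:1, - cnj \<alpha>:]) * (R * F A))"
      using l2sq_flip[of \<alpha> "R * F A"] by (cases "cmod \<alpha> \<le> 1") (simp_all del: mult_pCons_left)
    also have "\<dots> = l2sq (R * F (add_mset \<alpha> A))"
      unfolding F_def by (simp only: image_mset_add_mset prod_mset.add_mset mult.left_commute)
    finally show ?case .
  qed (simp add: F_def)
  have lead: "cmod (Polynomial.lead_coeff (F A)) = (\<Prod>\<alpha>\<in>#A. max 1 (cmod \<alpha>))" for A
  proof (induction A)
    case (add \<alpha> A)
    have "cmod (Polynomial.lead_coeff (if cmod \<alpha> \<le> 1 then [:-\<alpha>, 1:] else [:1, - cnj \<alpha>:])) = max 1 (cmod \<alpha>)"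
      by auto
    then show ?case using add unfolding F_def
      by (simp only: image_mset_add_mset prod_mset.add_mset lead_coeff_mult norm_mult)
  qed (simp add: F_def)
  have le: "(cmod (Polynomial.lead_coeff R))\<^sup>2 \<le> l2sq R" for R
    unfolding l2sq_def by (rule member_le_sum) auto
  have "(mahler P)\<^sup>2 = (cmod (Polynomial.lead_coeff ([:Polynomial.lead_coeff P:] * F (proots P))))\<^sup>2"
    by (simp only: lead_coeff_mult norm_mult lead mahler_def lead_coeff_pCons(2)[OF refl])
  also have "\<dots> \<le> l2sq ([:Polynomial.lead_coeff P:] * F (proots P))" by (rule le)
  also have "\<dots> = l2sq P" unfolding flip[symmetric] using complex_poly_split[OF assms] by simp
  also have "\<dots> \<le> (\<Sum>i\<le>Polynomial.degree P. (pnorm cmod P)\<^sup>2)"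
    unfolding l2sq_def by (intro sum_mono power_mono cmod.pnorm_ge) auto
  also have "\<dots> = (sqrt (real (Polynomial.degree P + 1)) * pnorm cmod P)\<^sup>2" by (simp add: power_mult_distrib)
  finally show ?thesis by (rule power2_le_imp_le) simp
qed

text \<open>The factor 2^d comes from bounding the factors by their Mahler measures, the square root
  from bounding the Mahler measure of the product by its largest coefficient.\<close>

definition gelfond_const :: "nat \<Rightarrow> real" where
  "gelfond_const d = 2 ^ d * sqrt (real (d + 1))"

lemma gelfond_complex:
  assumes "0 \<notin> set Qs"
  shows "(\<Prod>Q\<leftarrow>Qs. pnorm cmod Q) \<le> gelfond_const (Polynomial.degree (prod_list Qs)) * pnorm cmod (prod_list Qs)"
proof -
  have nz: "prod_list Qs \<noteq> 0" using assms by (auto simp: prod_list_zero_iff)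
  have "(\<Prod>Q\<leftarrow>Qs. pnorm cmod Q) \<le> 2 ^ Polynomial.degree (prod_list Qs) * mahler (prod_list Qs) \<and> mahler (prod_list Qs) \<ge> 0"
    using assms
  proof (induction Qs)
    case (Cons Q Qs)
    then have q: "Q \<noteq> 0" "prod_list Qs \<noteq> 0" by (auto simp: prod_list_zero_iff)
    have m0: "mahler Q \<ge> 0" by (rule mahler_nonneg)
    have IH: "(\<Prod>Q\<leftarrow>Qs. pnorm cmod Q) \<le> 2 ^ Polynomial.degree (prod_list Qs) * mahler (prod_list Qs)" "mahler (prod_list Qs) \<ge> 0"
      using Cons by auto
    have "pnorm cmod Q * (\<Prod>Q\<leftarrow>Qs. pnorm cmod Q) \<le> (2 ^ Polynomial.degree Q * mahler Q) * (2 ^ Polynomial.degree (prod_list Qs) * mahler (prod_list Qs))"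
      using IH m0 by (intro mult_mono pnorm_le_mahler q(1)) (auto intro!: prod_list_nonneg)
    then show ?case using q IH m0 by (simp add: mahler_mult degree_mult_eq power_add mult_ac)
  qed (simp add: mahler_def)
  then have "(\<Prod>Q\<leftarrow>Qs. pnorm cmod Q) \<le> 2 ^ Polynomial.degree (prod_list Qs) * mahler (prod_list Qs)" ..
  also have "2 ^ Polynomial.degree (prod_list Qs) * mahler (prod_list Qs) \<le>
    2 ^ Polynomial.degree (prod_list Qs) * (sqrt (real (Polynomial.degree (prod_list Qs) + 1)) * pnorm cmod (prod_list Qs))"
    by (intro mult_left_mono mahler_le nz) auto
  finally show ?thesis by (simp add: gelfond_const_def mult.assoc)
qed

section \<open>Heights and the assembly of local bounds\<close>

lemma poly_norm_eq: "poly_norm v P = pnorm (place_abs v) P"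
  by (simp add: poly_norm_def pnorm_def)

lemma place_abs_value: "number_field TYPE('k :: field_char_0) \<Longrightarrow> v \<in> (places :: ('k :: field_char_0 \<Rightarrow> real) set set) \<Longrightarrow> abs_value (place_abs v)"
  by (simp add: abs_value_def place_abs_absolute_value)

lemma poly_norm_pos:
  "number_field TYPE('k :: field_char_0) \<Longrightarrow> v \<in> (places :: ('k :: field_char_0 \<Rightarrow> real) set set) \<Longrightarrow> P \<noteq> 0 \<Longrightarrow> poly_norm v P > 0"
  unfolding poly_norm_eq by (rule abs_value.pnorm_pos[OF place_abs_value])

lemma finite_height_support:
  fixes P :: "'k :: field_char_0 poly"
  assumes nf: "number_field TYPE('k)" and P: "P \<noteq> 0"
  shows "finite {v \<in> places. poly_norm v P \<noteq> 1}"
proof (rule finite_subset)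
  show "finite (\<Union>i\<in>{i. i \<le> Polynomial.degree P \<and> Polynomial.coeff P i \<noteq> 0}. {v \<in> places. place_abs v (Polynomial.coeff P i) \<noteq> 1})"
    using product_formula(1)[OF nf] by auto
  show "{v \<in> places. poly_norm v P \<noteq> 1} \<subseteq> (\<Union>i\<in>{i. i \<le> Polynomial.degree P \<and> Polynomial.coeff P i \<noteq> 0}. {v \<in> places. place_abs v (Polynomial.coeff P i) \<noteq> 1})"
  proof
    fix v assume v: "v \<in> {v \<in> places. poly_norm v P \<noteq> 1}"
    then interpret abs_value "place_abs v" using place_abs_value[OF nf] by auto
    obtain i where i: "i \<le> Polynomial.degree P" "place_abs v (Polynomial.coeff P i) = pnorm (place_abs v) P" using pnorm_attained by blast
    have "Polynomial.coeff P i \<noteq> 0"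
    proof
      assume "Polynomial.coeff P i = 0"
      then show False using i(2) pnorm_pos[OF P] by simp
    qed
    then show "v \<in> (\<Union>i\<in>{i. i \<le> Polynomial.degree P \<and> Polynomial.coeff P i \<noteq> 0}. {v \<in> places. place_abs v (Polynomial.coeff P i) \<noteq> 1})"
      using v i by (auto simp: poly_norm_eq intro!: exI[of _ i])
  qed
qed

lemma height_eq:
  assumes "finite T" "T \<subseteq> places" "{v \<in> places. poly_norm v P \<noteq> 1} \<subseteq> T"
  shows "height P = (\<Prod>v\<in>T. poly_norm v P)"
  unfolding height_def using assms by (intro prod.mono_neutral_left) auto

text \<open>The norm at each place is at least the value of the leading coefficient, and these
  values multiply to 1.\<close>

lemma height_ge_1:
  fixes P :: "'k :: field_char_0 poly"
  assumes nf: "number_field TYPE('k)" and P: "P \<noteq> 0"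
  shows "height P \<ge> 1"
proof -
  define c where "c = Polynomial.lead_coeff P"
  have c: "c \<noteq> 0" using P by (simp add: c_def)
  define T where "T = {v \<in> places. poly_norm v P \<noteq> 1} \<union> {v \<in> places. place_abs v c \<noteq> 1}"
  have T: "finite T" "T \<subseteq> places" using finite_height_support[OF nf P] product_formula(1)[OF nf c] by (auto simp: T_def)
  have "(\<Prod>v\<in>{v \<in> places. place_abs v c \<noteq> 1}. place_abs v c) = (\<Prod>v\<in>T. place_abs v c)"
    using T by (intro prod.mono_neutral_left) (auto simp: T_def)
  then have "1 = (\<Prod>v\<in>T. place_abs v c)" using product_formula(2)[OF nf c] by simp
  also have "\<dots> \<le> (\<Prod>v\<in>T. poly_norm v P)"
  proof (rule prod_mono)
    fix v assume "v \<in> T"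
    then interpret abs_value "place_abs v" using T place_abs_value[OF nf] by auto
    show "0 \<le> place_abs v c \<and> place_abs v c \<le> poly_norm v P" unfolding c_def poly_norm_eq using pnorm_ge by simp
  qed
  also have "\<dots> = height P" using T by (intro height_eq[symmetric]) (auto simp: T_def)
  finally show ?thesis .
qed

lemma pnorm_powr:
  assumes "absolute_value b" "absolute_value (\<lambda>x. b x powr e)" "e > 0"
  shows "pnorm (\<lambda>x. b x powr e) P = pnorm b P powr e"
proof (rule antisym)
  interpret b: abs_value b by unfold_locales fact
  interpret c: abs_value "\<lambda>x. b x powr e" by unfold_locales fact
  show "pnorm (\<lambda>x. b x powr e) P \<le> pnorm b P powr e"
    by (rule c.pnorm_le) (use b.pnorm_ge assms(3) in \<open>auto intro!: powr_mono2\<close>)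
  obtain i where "b (Polynomial.coeff P i) = pnorm b P" using b.pnorm_attained by blast
  then show "pnorm b P powr e \<le> pnorm (\<lambda>x. b x powr e) P" using c.pnorm_ge[of P i] by simp
qed

lemma arch_place_cases:
  assumes nf: "number_field TYPE('k :: field_char_0)" and v: "v \<in> (arch_places :: ('k :: field_char_0 \<Rightarrow> real) set set)"
  obtains \<eta> :: "'k :: field_char_0 \<Rightarrow> complex" where "field_embedding \<eta>" "place_abs v = (\<lambda>x. cmod (\<eta> x) powr weight v)"
    "absolute_value (\<lambda>x. cmod (\<eta> x))" "weight v > 0" "absolute_value (\<lambda>x. cmod (\<eta> x) powr weight v)"
proof -
  obtain \<eta> :: "'k \<Rightarrow> complex" where \<eta>: "field_embedding \<eta>" "place_abs v = (\<lambda>x. cmod (\<eta> x) powr weight v)"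
    using arch_place_abs[OF nf v] by blast
  have vp: "v \<in> places" using arch_places_subset[OF nf] v by blast
  have "(\<lambda>x. cmod (\<eta> x)) \<in> embedding_values cmod" using \<eta>(1) by (auto simp: embedding_values_def)
  then have "absolute_value (\<lambda>x. cmod (\<eta> x))"
    using embedding_values_subset[OF cmod_absolute_value cmod_of_rat] by (auto simp: extensions_def)
  moreover have "absolute_value (\<lambda>x. cmod (\<eta> x) powr weight v)" using place_abs_absolute_value[OF nf vp] \<eta>(2) by simp
  ultimately show thesis using that[of \<eta>] \<eta> weight_pos[OF nf vp] by blast
qed

lemma prod_list_powr: "(\<And>x. x \<in> set xs \<Longrightarrow> f x \<ge> 0) \<Longrightarrow> (\<Prod>x\<leftarrow>xs. f x powr e) = (\<Prod>x\<leftarrow>xs. f x :: real) powr e"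
  by (induction xs) (auto simp: powr_mult prod_list_nonneg)

lemma field_embedding_sum: "field_embedding \<eta> \<Longrightarrow> \<eta> (sum f A) = (\<Sum>i\<in>A. \<eta> (f i))"
  by (induction A rule: infinite_finite_induct) (auto simp: field_embedding_0, auto simp: field_embedding_def)

lemma map_poly_field_embedding_mult:
  assumes "field_embedding \<eta>" shows "map_poly \<eta> (P * Q) = map_poly \<eta> P * map_poly \<eta> Q"
proof (rule poly_eqI)
  fix i
  have m: "\<eta> (x * y) = \<eta> x * \<eta> y" for x y using assms by (simp add: field_embedding_def)
  show "Polynomial.coeff (map_poly \<eta> (P * Q)) i = Polynomial.coeff (map_poly \<eta> P * map_poly \<eta> Q) i"
    by (simp add: coeff_map_poly field_embedding_0[OF assms] Polynomial.coeff_mult field_embedding_sum[OF assms] m)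
qed

lemma map_poly_field_embedding_prod_list:
  assumes "field_embedding \<eta>" shows "map_poly \<eta> (prod_list Qs) = prod_list (map (map_poly \<eta>) Qs)"
proof (induction Qs)
  case Nil
  have "\<eta> 1 = 1" using assms by (simp add: field_embedding_def)
  then show ?case by (simp add: map_poly_1')
qed (simp add: map_poly_field_embedding_mult[OF assms])

lemma degree_map_poly_field_embedding: "field_embedding \<eta> \<Longrightarrow> Polynomial.degree (map_poly \<eta> P) = Polynomial.degree P"
  by (rule degree_map_poly) (simp add: field_embedding_eq_0)

lemma pnorm_map_poly: "field_embedding \<eta> \<Longrightarrow> pnorm (\<lambda>x. cmod (\<eta> x)) P = pnorm cmod (map_poly \<eta> P)"
  by (simp add: pnorm_def degree_map_poly_field_embedding coeff_map_poly field_embedding_0)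

lemma gelfond_const_pos: "gelfond_const d > 0"
  by (simp add: gelfond_const_def)

lemma gelfond_place:
  fixes Qs :: "'k :: field_char_0 poly list"
  assumes nf: "number_field TYPE('k)" and v: "v \<in> places" and Qs: "0 \<notin> set Qs"
  shows "(\<Prod>Q\<leftarrow>Qs. poly_norm v Q) \<le>
    (if v \<in> arch_places then gelfond_const (Polynomial.degree (prod_list Qs)) powr weight v else 1) * poly_norm v (prod_list Qs)"
proof (cases "v \<in> arch_places")
  case True
  obtain \<eta> :: "'k \<Rightarrow> complex" where \<eta>: "field_embedding \<eta>" "place_abs v = (\<lambda>x. cmod (\<eta> x) powr weight v)"
    "absolute_value (\<lambda>x. cmod (\<eta> x))" "weight v > 0" "absolute_value (\<lambda>x. cmod (\<eta> x) powr weight v)"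
    using arch_place_cases[OF nf True] by metis
  have pn: "poly_norm v Q = pnorm cmod (map_poly \<eta> Q) powr weight v" for Q
    unfolding poly_norm_eq \<eta>(2) pnorm_powr[OF \<eta>(3,5,4)] pnorm_map_poly[OF \<eta>(1)] ..
  have nz: "0 \<notin> set (map (map_poly \<eta>) Qs)"
  proof
    assume "0 \<in> set (map (map_poly \<eta>) Qs)"
    then obtain Q where "Q \<in> set Qs" "map_poly \<eta> Q = 0" by auto
    then have "Q = 0" using field_embedding_eq_0[OF \<eta>(1)] field_embedding_0[OF \<eta>(1)] by (metis coeff_0 coeff_map_poly poly_eqI)
    then show False using \<open>Q \<in> set Qs\<close> Qs by simp
  qed
  have "(\<Prod>Q\<leftarrow>Qs. poly_norm v Q) = (\<Prod>Q\<leftarrow>Qs. pnorm cmod (map_poly \<eta> Q)) powr weight v"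
    unfolding pn by (rule prod_list_powr) (simp add: cmod.pnorm_nonneg)
  also have "\<dots> \<le> (gelfond_const (Polynomial.degree (prod_list Qs)) * pnorm cmod (map_poly \<eta> (prod_list Qs))) powr weight v"
  proof (rule powr_mono2)
    show "(\<Prod>Q\<leftarrow>Qs. pnorm cmod (map_poly \<eta> Q)) \<le> gelfond_const (Polynomial.degree (prod_list Qs)) * pnorm cmod (map_poly \<eta> (prod_list Qs))"
      using gelfond_complex[OF nz] unfolding map_poly_field_embedding_prod_list[OF \<eta>(1), symmetric] degree_map_poly_field_embedding[OF \<eta>(1)]
      by (simp add: comp_def)
  qed (use \<eta>(4) in \<open>auto intro!: prod_list_nonneg simp: cmod.pnorm_nonneg\<close>)
  also have "\<dots> = gelfond_const (Polynomial.degree (prod_list Qs)) powr weight v * poly_norm v (prod_list Qs)"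
    unfolding pn using gelfond_const_pos[of "Polynomial.degree (prod_list Qs)"] by (simp add: powr_mult cmod.pnorm_nonneg)
  finally show ?thesis using True by simp
next
  case False
  interpret abs_value "place_abs v" by (rule place_abs_value[OF nf v])
  show ?thesis using gauss_lemma_prod_list[OF nonarch_ultrametric[OF nf v False]] False by (simp add: poly_norm_eq)
qed

text \<open>The archimedean weights add up to 1. Local constants of this form therefore assemble to
  a global constant that does not depend on K.\<close>

lemma prod_arch_weights:
  assumes nf: "number_field TYPE('k :: field_char_0)" and T: "finite T" "(arch_places :: ('k :: field_char_0 \<Rightarrow> real) set set) \<subseteq> T" and c: "c > 0"
  shows "(\<Prod>v\<in>T. if v \<in> arch_places then c powr weight v else 1) = c"
proof -
  have "(\<Prod>v\<in>T. if v \<in> arch_places then c powr weight v else 1) = (\<Prod>v\<in>(arch_places :: ('k \<Rightarrow> real) set set). c powr weight v)"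
    using T by (intro prod.mono_neutral_cong_right) auto
  also have "\<dots> = c powr (\<Sum>v\<in>(arch_places :: ('k \<Rightarrow> real) set set). weight v)"
    using sum_arch_weights(1)[OF nf] c by (subst powr_sum) auto
  also have "\<dots> = c" using sum_arch_weights(2)[OF nf] c by simp
  finally show ?thesis .
qed

lemma prod_list_prod_swap: "(\<Prod>x\<leftarrow>xs. \<Prod>v\<in>T. f x v) = (\<Prod>v\<in>T. \<Prod>x\<leftarrow>xs. f x v :: 'b :: comm_monoid_mult)"
  by (induction xs) (simp_all add: prod.distrib)

theorem gelfond_height:
  fixes Qs :: "'k :: field_char_0 poly list"
  assumes nf: "number_field TYPE('k)" and Qs: "0 \<notin> set Qs"
  shows "(\<Prod>Q\<leftarrow>Qs. height Q) \<le> gelfond_const (Polynomial.degree (prod_list Qs)) * height (prod_list Qs)"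
proof -
  define P where "P = prod_list Qs"
  define G where "G = gelfond_const (Polynomial.degree P)"
  have P: "P \<noteq> 0" using Qs by (auto simp: P_def prod_list_zero_iff)
  define T where "T = arch_places \<union> (\<Union>Q\<in>insert P (set Qs). {v \<in> places. poly_norm v Q \<noteq> 1})"
  have nz: "Q \<noteq> 0" if "Q \<in> insert P (set Qs)" for Q using that P Qs by auto
  have T: "finite T" unfolding T_def
    using sum_arch_weights(1)[OF nf] finite_height_support[OF nf nz] by blast
  have "T \<subseteq> places" unfolding T_def using arch_places_subset[OF nf] by blast
  note T = T this
  have h: "height Q = (\<Prod>v\<in>T. poly_norm v Q)" if "Q \<in> insert P (set Qs)" for Q
    by (rule height_eq[OF T]) (use that in \<open>auto simp: T_def\<close>)
  have "(\<Prod>Q\<leftarrow>Qs. height Q) = (\<Prod>Q\<leftarrow>Qs. \<Prod>v\<in>T. poly_norm v Q)"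
    by (intro arg_cong[where f = prod_list] map_cong refl h) auto
  also have "\<dots> = (\<Prod>v\<in>T. \<Prod>Q\<leftarrow>Qs. poly_norm v Q)" by (rule prod_list_prod_swap)
  also have "\<dots> \<le> (\<Prod>v\<in>T. (if v \<in> arch_places then G powr weight v else 1) * poly_norm v P)"
  proof (rule prod_mono, intro conjI)
    fix v assume "v \<in> T"
    then have v: "v \<in> places" using T by blast
    interpret abs_value "place_abs v" by (rule place_abs_value[OF nf v])
    show "0 \<le> (\<Prod>Q\<leftarrow>Qs. poly_norm v Q)" by (auto intro!: prod_list_nonneg simp: poly_norm_eq)
    show "(\<Prod>Q\<leftarrow>Qs. poly_norm v Q) \<le> (if v \<in> arch_places then G powr weight v else 1) * poly_norm v P"
      unfolding G_def P_def by (rule gelfond_place[OF nf v Qs])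
  qed
  also have "\<dots> = G * height P"
    unfolding prod.distrib h[OF insertI1] using gelfond_const_pos T
    by (subst prod_arch_weights[OF nf]) (auto simp: G_def T_def)
  finally show ?thesis by (simp add: G_def P_def)
qed

text \<open>Expanding with the normalized value itself would cost the full n! at each archimedean
  place. The estimate is made for the modulus of the embedding, where r and s appear with exponent 1
  / \<open>weight v\<close>, and is then raised to the weight, which leaves n! with exponent
  \<open>weight v\<close>.\<close>

lemma place_det_le:
  fixes A :: "'k :: field_char_0 mat"
  assumes nf: "number_field TYPE('k)" and v: "v \<in> places" and A: "A \<in> carrier_mat n n"
    and le: "\<And>i j. i < n \<Longrightarrow> j < n \<Longrightarrow> place_abs v (A $$ (i, j)) \<le> r i * s j"
    and nn: "\<And>i. i < n \<Longrightarrow> r i \<ge> 0" "\<And>i. i < n \<Longrightarrow> s i \<ge> 0"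
  shows "place_abs v (Determinant.det A) \<le> (if v \<in> arch_places then fact n powr weight v else 1) * ((\<Prod>i<n. r i) * (\<Prod>j<n. s j))"
proof (cases "v \<in> arch_places")
  case True
  obtain \<eta> :: "'k \<Rightarrow> complex" where \<eta>: "field_embedding \<eta>" "place_abs v = (\<lambda>x. cmod (\<eta> x) powr weight v)"
    "absolute_value (\<lambda>x. cmod (\<eta> x))" "weight v > 0" "absolute_value (\<lambda>x. cmod (\<eta> x) powr weight v)"
    using arch_place_cases[OF nf True] by metis
  define e where "e = weight v"
  have e: "e > 0" using \<eta>(4) by (simp add: e_def)
  interpret b: abs_value "\<lambda>x. cmod (\<eta> x)" by unfold_locales (rule \<eta>(3))
  have entry: "cmod (\<eta> (A $$ (i, j))) \<le> r i powr (1 / e) * s j powr (1 / e)" if "i < n" "j < n" for i j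
  proof -
    have "(cmod (\<eta> (A $$ (i, j))) powr e) powr (1 / e) \<le> (r i * s j) powr (1 / e)"
      using le[OF that] e \<eta>(2) by (intro powr_mono2) (auto simp: e_def)
    then show ?thesis using nn that e by (simp add: powr_powr powr_mult)
  qed
  have "cmod (\<eta> (Determinant.det A)) \<le> fact n * ((\<Prod>i<n. r i powr (1 / e)) * (\<Prod>j<n. s j powr (1 / e)))"
    by (rule b.det_le_rows_columns(1)[OF A entry])
  also have "\<dots> = fact n * ((\<Prod>i<n. r i) * (\<Prod>j<n. s j)) powr (1 / e)"
  proof -
    have "(\<Prod>i<n. r i powr (1 / e)) = (\<Prod>i<n. r i) powr (1 / e)" "(\<Prod>i<n. s i powr (1 / e)) = (\<Prod>i<n. s i) powr (1 / e)"
      by (rule prod_powr; use nn in simp)+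
    then show ?thesis using nn by (simp add: powr_mult prod_nonneg)
  qed
  finally have "cmod (\<eta> (Determinant.det A)) powr e \<le> (fact n * ((\<Prod>i<n. r i) * (\<Prod>j<n. s j)) powr (1 / e)) powr e"
    using e by (intro powr_mono2) auto
  also have "\<dots> = fact n powr e * ((\<Prod>i<n. r i) * (\<Prod>j<n. s j))"
  proof -
    have "(\<Prod>i<n. r i) \<ge> 0" "(\<Prod>i<n. s i) \<ge> 0" by (rule prod_nonneg; use nn in simp)+
    then have "(\<Prod>i<n. r i) * (\<Prod>j<n. s j) \<ge> 0" by simp
    moreover have "(fact n * z powr (1 / e)) powr e = fact n powr e * z" if "z \<ge> 0" for z :: real
      using e that by (simp add: powr_mult powr_powr)
    ultimately show ?thesis by blast
  qed
  finally show ?thesis using True \<eta>(2) by (simp add: e_def)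
next
  case False
  interpret abs_value "place_abs v" by (rule place_abs_value[OF nf v])
  show ?thesis
    using det_le_rows_columns(2)[OF A le nonarch_ultrametric[OF nf v False] nn] False by simp
qed

section \<open>The resultant of two small polynomials\<close>

text \<open>The rows of the Sylvester matrix as polynomials, T^i P followed by T^i Q. Since
  \<open>sylvester\<close> lists coefficients from the constant term upwards, its column 0 holds the
  constant terms.\<close>

definition row_poly :: "'a :: comm_ring_1 poly \<Rightarrow> 'a poly \<Rightarrow> nat \<Rightarrow> 'a poly" where
  "row_poly P Q i = (if i < Polynomial.degree Q then Polynomial.monom 1 i * P else Polynomial.monom 1 (i - Polynomial.degree Q) * Q)"

definition sylvester :: "'a :: comm_ring_1 poly \<Rightarrow> 'a poly \<Rightarrow> 'a mat" where
  "sylvester P Q = mat (Polynomial.degree P + Polynomial.degree Q) (Polynomial.degree P + Polynomial.degree Q)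
     (\<lambda>(i, j). Polynomial.coeff (row_poly P Q i) j)"

lemma sylvester_carrier: "sylvester P Q \<in> carrier_mat (Polynomial.degree P + Polynomial.degree Q) (Polynomial.degree P + Polynomial.degree Q)"
  by (simp add: sylvester_def)

lemma degree_row_poly:
  fixes P Q :: "'a :: field poly"
  assumes "P \<noteq> 0" "Q \<noteq> 0" "i < Polynomial.degree P + Polynomial.degree Q"
  shows "Polynomial.degree (row_poly P Q i) < Polynomial.degree P + Polynomial.degree Q"
  using assms by (auto simp: row_poly_def degree_mult_eq degree_monom_eq)

lemma sum_lessThan_add: "(\<Sum>i<n + m. f i) = (\<Sum>i<n. f i) + (\<Sum>i<m. f (n + i) :: 'b :: comm_monoid_add)" for n m :: nat
  by (induction m) (simp_all add: add.assoc)

text \<open>A row dependence gives A P + B Q = 0 with deg B < deg P. As P is prime and does not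
  divide Q, it divides B, so B = 0 and then A = 0.\<close>

lemma det_sylvester_nonzero:
  fixes P Q :: "'a :: field poly"
  assumes irr: "Factorial_Ring.irreducible P" and ndvd: "\<not> P dvd Q" and dQ: "Q \<noteq> 0"
  shows "Determinant.det (sylvester P Q) \<noteq> 0"
proof
  let ?m = "Polynomial.degree P" and ?n = "Polynomial.degree Q"
  let ?D = "?m + ?n"
  have P0: "P \<noteq> 0" using irr by auto
  assume "Determinant.det (sylvester P Q) = 0"
  then have "Determinant.det (transpose_mat (sylvester P Q)) = 0" using det_transpose[OF sylvester_carrier[of P Q]] by simp
  then obtain w where w: "w \<in> carrier_vec ?D" "w \<noteq> 0\<^sub>v ?D" "transpose_mat (sylvester P Q) *\<^sub>v w = 0\<^sub>v ?D"
    using det_0_iff_vec_prod_zero_field[of "transpose_mat (sylvester P Q)" ?D] sylvester_carrier[of P Q] by auto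
  define F where "F = (\<Sum>i<?D. Polynomial.smult (w $ i) (row_poly P Q i))"
  have "Polynomial.coeff F j = 0" for j
  proof (cases "j < ?D")
    case True
    have "Polynomial.coeff F j = (\<Sum>i<?D. w $ i * Polynomial.coeff (row_poly P Q i) j)" by (simp add: F_def Polynomial.coeff_sum)
    also have "\<dots> = (transpose_mat (sylvester P Q) *\<^sub>v w) $ j"
      using True w(1) by (simp add: sylvester_def scalar_prod_def lessThan_atLeast0 mult.commute)
    finally show ?thesis using w(3) True by simp
  next
    case False
    have "Polynomial.coeff (row_poly P Q i) j = 0" if "i < ?D" for i
      by (rule coeff_eq_0) (use degree_row_poly[OF P0 dQ that] False in linarith)
    then show ?thesis unfolding F_def Polynomial.coeff_sum by (intro sum.neutral) auto
  qed
  then have F0: "F = 0" by (intro poly_eqI) simp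
  define A where "A = (\<Sum>i<?n. Polynomial.monom (w $ i) i)"
  define B where "B = (\<Sum>i<?m. Polynomial.monom (w $ (?n + i)) i)"
  have cA: "Polynomial.coeff A i = (if i < ?n then w $ i else 0)" for i
    by (simp add: A_def Polynomial.coeff_sum)
  have cB: "Polynomial.coeff B i = (if i < ?m then w $ (?n + i) else 0)" for i
    by (simp add: B_def Polynomial.coeff_sum)
  have smm: "Polynomial.smult c (Polynomial.monom 1 k * R) = Polynomial.monom c k * R" for c k and R :: "'a poly"
    by (simp add: mult_smult_left[symmetric] smult_monom)
  have "F = (\<Sum>i<?n. Polynomial.smult (w $ i) (row_poly P Q i)) + (\<Sum>i<?m. Polynomial.smult (w $ (?n + i)) (row_poly P Q (?n + i)))"
    unfolding F_def by (subst add.commute[of ?m]) (rule sum_lessThan_add)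
  also have "\<dots> = A * P + B * Q"
    by (simp add: A_def B_def row_poly_def smm sum_distrib_right)
  finally have AB: "A * P + B * Q = 0" using F0 by simp
  then have "P dvd B * Q" by (metis add_eq_0_iff dvd_minus_iff dvd_triv_right)
  moreover have "prime_elem P" using irr by (rule field_poly_irreducible_imp_prime)
  ultimately have "P dvd B" using ndvd by (auto simp: prime_elem_dvd_mult_iff)
  have "B = 0"
  proof (rule ccontr)
    assume B: "B \<noteq> 0"
    have "?m > 0"
      using B cB by (metis gr0I less_nat_zero_code poly_eqI coeff_0)
    have "Polynomial.degree B < ?m" using B cB by (metis leading_coeff_0_iff)
    then show False using dvd_imp_degree_le[OF \<open>P dvd B\<close> B] by simp
  qed
  then have "A = 0" using AB P0 by simp
  have "w = 0\<^sub>v ?D"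
  proof (rule eq_vecI)
    fix i assume "i < dim_vec (0\<^sub>v ?D :: 'a vec)"
    then have i: "i < ?D" by simp
    show "w $ i = 0\<^sub>v ?D $ i"
    proof (cases "i < ?n")
      case True
      then show ?thesis using cA[of i] \<open>A = 0\<close> i by simp
    next
      case False
      have "i - ?n < ?m" "?n + (i - ?n) = i" using False i by linarith+
      then show ?thesis using cB[of "i - ?n"] \<open>B = 0\<close> i by simp
    qed
  qed (use w(1) in auto)
  then show False using w(2) by simp
qed

lemma prod_lessThan_add: "(\<Prod>i<n + m. f i) = (\<Prod>i<n. f i) * (\<Prod>i<m. f (n + i) :: 'b :: comm_monoid_mult)" for n m :: nat
  by (induction m) (simp_all add: mult.assoc)

lemma (in abs_value) row_poly_coeff_le:
  "a (Polynomial.coeff (row_poly P Q i) j) \<le> (if i < Polynomial.degree Q then pnorm a P else pnorm a Q)"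
  by (auto simp: row_poly_def coeff_monom_mult pnorm_ge)

lemma prod_row_norms:
  "(\<Prod>i<m + n. if i < n then x else y :: real) = x ^ n * y ^ m" for m n :: nat
proof -
  have "(\<Prod>i<n + m. if i < n then x else y :: real) = x ^ n * y ^ m" unfolding prod_lessThan_add by simp
  then show ?thesis by (simp add: add.commute)
qed

section \<open>Evaluation at a point inside the Sylvester matrix\<close>

definition column_mat :: "nat \<Rightarrow> nat \<Rightarrow> (nat \<Rightarrow> 'a :: comm_ring_1) \<Rightarrow> 'a mat" where
  "column_mat D j0 y = mat D D (\<lambda>(k, j). if j = j0 then y k else if k = j then 1 else 0)"

text \<open>Replacing the first or the last column of the identity matrix leaves it triangular,
  whence the restriction on \<open>j0\<close>.\<close>

lemma det_column_mat:
  assumes "j0 = 0 \<or> j0 = D - 1" "j0 < D" "y j0 = 1"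
  shows "Determinant.det (column_mat D j0 y) = 1"
proof -
  have c: "column_mat D j0 y \<in> carrier_mat D D" by (simp add: column_mat_def)
  have "diag_mat (column_mat D j0 y) = map (\<lambda>i. 1) [0..<D]"
    unfolding diag_mat_def using assms(3) by (auto simp: column_mat_def)
  then have diag: "prod_list (diag_mat (column_mat D j0 y)) = 1" by (simp add: map_replicate_const prod_list_replicate)
  show ?thesis
    using assms(1)
  proof
    assume "j0 = 0"
    then have "Determinant.det (column_mat D j0 y) = prod_list (diag_mat (column_mat D j0 y))"
      by (intro det_lower_triangular[OF _ c]) (auto simp: column_mat_def)
    then show ?thesis using diag by simp
  next
    assume "j0 = D - 1"
    then have "upper_triangular (column_mat D j0 y)" unfolding upper_triangular_def by (auto simp: column_mat_def)
    from det_upper_triangular[OF this c] show ?thesis using diag by simp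
  qed
qed

lemma mult_column_mat:
  assumes "A \<in> carrier_mat D D" "i < D" "j < D"
  shows "(A * column_mat D j0 y) $$ (i, j) = (if j = j0 then (\<Sum>k<D. A $$ (i, k) * y k) else A $$ (i, j))"
proof -
  have "(A * column_mat D j0 y) $$ (i, j) = (\<Sum>k<D. A $$ (i, k) * (if j = j0 then y k else if k = j then 1 else 0))"
    using assms by (simp add: column_mat_def scalar_prod_def lessThan_atLeast0)
  then show ?thesis using assms(3) by (simp add: if_distrib[of "\<lambda>x. _ * x"] cong: if_cong)
qed

text \<open>Adding multiples of the other columns to the first (or last) one turns its entries into
  values at \<open>x\<close>. Which column is used depends on whether \<open>\<bar>x\<bar>\<^sub>w \<le> 1\<close>.\<close>

lemma (in abs_value) sylvester_column:
  fixes P Q :: "'k poly"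
  assumes PQ: "P \<noteq> 0" "Q \<noteq> 0" and D: "D = Polynomial.degree P + Polynomial.degree Q" "D > 0"
    and x: "a (poly P x) \<le> \<delta> * pnorm a P" "a (poly Q x) \<le> \<delta> * pnorm a Q"
  obtains A j0 where "A \<in> carrier_mat D D" "j0 < D" "Determinant.det A = Determinant.det (sylvester P Q)"
    "\<And>i j. i < D \<Longrightarrow> j < D \<Longrightarrow> a (A $$ (i, j)) \<le> (if i < Polynomial.degree Q then pnorm a P else pnorm a Q) * (if j = j0 then \<delta> else 1)"
proof -
  let ?S = "sylvester P Q"
  have Sc: "?S \<in> carrier_mat D D" using sylvester_carrier[of P Q] D by simp
  have Sij: "?S $$ (i, k) = Polynomial.coeff (row_poly P Q i) k" if "i < D" "k < D" for i k
    using that D by (simp add: sylvester_def)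
  have eval: "(\<Sum>k<D. ?S $$ (i, k) * x ^ k) = poly (row_poly P Q i) x" if i: "i < D" for i
  proof -
    have "poly (row_poly P Q i) x = (\<Sum>k\<le>Polynomial.degree (row_poly P Q i). Polynomial.coeff (row_poly P Q i) k * x ^ k)" by (rule poly_altdef)
    also have "\<dots> = (\<Sum>k<D. Polynomial.coeff (row_poly P Q i) k * x ^ k)"
      using degree_row_poly[OF PQ, of i] i D by (intro sum.mono_neutral_left) (auto simp: coeff_eq_0)
    finally show ?thesis using Sij i by simp
  qed
  \<comment> \<open>Exponent of the monomial in row i. Being at most D - 1, it is harmless when x
    has value at most 1 and is compensated by x^-(D-1) otherwise.\<close>
  define e where "e i = (if i < Polynomial.degree Q then i else i - Polynomial.degree Q)" for i
  define V where "V i = (if i < Polynomial.degree Q then poly P x else poly Q x)" for i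
  define r where "r i = (if i < Polynomial.degree Q then pnorm a P else pnorm a Q)" for i
  have ev: "poly (row_poly P Q i) x = x ^ e i * V i" for i by (simp add: row_poly_def e_def V_def poly_monom)
  have V: "a (V i) \<le> r i * \<delta>" for i using x by (simp add: V_def r_def mult.commute)
  have e: "e i \<le> D - 1" if "i < D" for i using that by (auto simp: e_def)
  have entry: "a ((?S * column_mat D j0 y) $$ (i, j)) \<le> r i * (if j = j0 then \<delta> else 1)"
    if ij: "i < D" "j < D" and c: "a (\<Sum>k<D. ?S $$ (i, k) * y k) \<le> r i * \<delta>" for i j j0 y
    unfolding mult_column_mat[OF Sc ij] using c row_poly_coeff_le[of P Q i j] Sij[OF ij] by (simp add: r_def)
  have det: "Determinant.det (?S * column_mat D j0 y) = Determinant.det ?S" if "j0 = 0 \<or> j0 = D - 1" "j0 < D" "y j0 = 1" for j0 y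
    using det_mult[OF Sc, of "column_mat D j0 y"] det_column_mat[of j0 D y, OF that] by (simp add: column_mat_def)
  have car: "?S * column_mat D j0 y \<in> carrier_mat D D" for j0 y using Sc by (simp add: column_mat_def)
  show thesis
  proof (cases "a x \<le> 1")
    case True
    define y where "y k = x ^ k" for k
    have "a (\<Sum>k<D. ?S $$ (i, k) * y k) \<le> r i * \<delta>" if "i < D" for i
    proof -
      have "a (\<Sum>k<D. ?S $$ (i, k) * y k) = a x ^ e i * a (V i)" using eval[OF that] by (simp add: y_def ev mult power)
      also have "\<dots> \<le> 1 * a (V i)" using True by (intro mult_right_mono power_le_one) auto
      finally show ?thesis using V[of i] by simp
    qed
    then show thesis using that[of "?S * column_mat D 0 y" 0] entry[of _ _ y 0] det[of 0 y] car D
      by (simp add: r_def y_def)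
  next
    case False
    \<comment> \<open>The powers of x divided by \<open>x ^ (D - 1)\<close>; the entry of index D -
      1 is 1, as the column matrix requires.\<close>
    define y where "y k = inverse x ^ (D - 1 - k)" for k
    have x0: "x \<noteq> 0" using False by auto
    have "a (\<Sum>k<D. ?S $$ (i, k) * y k) \<le> r i * \<delta>" if "i < D" for i
    proof -
      have "(\<Sum>k<D. ?S $$ (i, k) * y k) = (\<Sum>k<D. inverse x ^ (D - 1) * (?S $$ (i, k) * x ^ k))"
      proof (intro sum.cong refl)
        fix k assume "k \<in> {..<D}"
        then have "inverse x ^ (D - 1) = inverse x ^ (D - 1 - k) * inverse x ^ k" by (simp add: power_add[symmetric])
        then show "?S $$ (i, k) * y k = inverse x ^ (D - 1) * (?S $$ (i, k) * x ^ k)" using x0 by (simp add: y_def field_simps)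
      qed
      also have "\<dots> = inverse x ^ (D - 1) * (x ^ e i * V i)" using eval[OF that] by (simp add: sum_distrib_left[symmetric] ev)
      finally have "a (\<Sum>k<D. ?S $$ (i, k) * y k) = inverse (a x ^ (D - 1)) * a x ^ e i * a (V i)"
        by (simp add: mult power inverse power_inverse)
      also have "\<dots> \<le> 1 * a (V i)"
      proof (intro mult_right_mono)
        have "a x ^ e i \<le> a x ^ (D - 1)" using False e[OF that] by (intro power_increasing) auto
        then show "inverse (a x ^ (D - 1)) * a x ^ e i \<le> 1" using x0 by (simp add: field_simps)
      qed simp
      finally show ?thesis using V[of i] by simp
    qed
    moreover have "y (D - 1) = 1" by (simp add: y_def)
    ultimately show thesis using that[of "?S * column_mat D (D - 1) y" "D - 1"] entry[of _ _ y "D - 1"] det[of "D - 1" y] car D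
      by (simp add: r_def)
  qed
qed

text \<open>The product formula is applied to the resultant R. Every place bounds R by norms, and w
  contributes an additional factor \<delta> from the modified column. The norms multiply to heights,
  the archimedean constants to the factorial of the size of the matrix.\<close>

theorem resultant_height:
  fixes P Q :: "'k :: field_char_0 poly"
  assumes nf: "number_field TYPE('k)" and w: "w \<in> places"
    and irr: "Factorial_Ring.irreducible P" and ndvd: "\<not> P dvd Q" and Q: "Q \<noteq> 0" and \<delta>: "\<delta> \<ge> 0"
    and x: "place_abs w (poly P x) \<le> \<delta> * poly_norm w P" "place_abs w (poly Q x) \<le> \<delta> * poly_norm w Q"
  shows "1 \<le> fact (Polynomial.degree P + Polynomial.degree Q) *
    (height P ^ Polynomial.degree Q * height Q ^ Polynomial.degree P) * \<delta>"
proof -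
  let ?m = "Polynomial.degree P" and ?n = "Polynomial.degree Q"
  define D where "D = ?m + ?n"
  have P: "P \<noteq> 0" using irr by auto
  have "?m > 0"
  proof (rule ccontr)
    assume "\<not> ?m > 0"
    then have "is_unit P" using P by (simp add: is_unit_iff_degree)
    then show False using irr by (simp add: Factorial_Ring.irreducible_def)
  qed
  then have D0: "D > 0" by (simp add: D_def)
  define R where "R = Determinant.det (sylvester P Q)"
  have R: "R \<noteq> 0" unfolding R_def by (rule det_sylvester_nonzero[OF irr ndvd Q])
  define T where "T = insert w (arch_places \<union> {v \<in> places. poly_norm v P \<noteq> 1} \<union> {v \<in> places. poly_norm v Q \<noteq> 1} \<union> {v \<in> places. place_abs v R \<noteq> 1})"
  have finT: "finite T" unfolding T_def
    using sum_arch_weights(1)[OF nf] finite_height_support[OF nf P] finite_height_support[OF nf Q] product_formula(1)[OF nf R] by blast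
  have T: "T \<subseteq> places" unfolding T_def using arch_places_subset[OF nf] w by blast
  define \<kappa> where "\<kappa> v = (if v \<in> arch_places then fact D powr weight v else 1 :: real)" for v :: "('k \<Rightarrow> real) set"
  define N where "N v = poly_norm v P ^ ?n * poly_norm v Q ^ ?m" for v
  have Sc: "sylvester P Q \<in> carrier_mat D D" using sylvester_carrier[of P Q] by (simp add: D_def)
  have prodr: "(\<Prod>i<D. if i < ?n then poly_norm v P else poly_norm v Q) = N v" for v
    unfolding D_def N_def by (rule prod_row_norms)
  have bound: "place_abs v R \<le> \<kappa> v * N v" if v: "v \<in> places" for v
  proof -
    interpret abs_value "place_abs v" by (rule place_abs_value[OF nf v])
    have "place_abs v R \<le> \<kappa> v * ((\<Prod>i<D. if i < ?n then poly_norm v P else poly_norm v Q) * (\<Prod>j<D. 1))"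
      unfolding R_def \<kappa>_def
    proof (rule place_det_le[OF nf v Sc])
      fix i j assume "i < D" "j < D"
      then show "place_abs v (sylvester P Q $$ (i, j)) \<le> (if i < ?n then poly_norm v P else poly_norm v Q) * 1"
        using row_poly_coeff_le[of P Q i j] by (simp add: sylvester_def D_def poly_norm_eq split: if_splits)
    qed (auto simp: poly_norm_eq)
    then show ?thesis unfolding prodr by simp
  qed
  have boundw: "place_abs w R \<le> \<kappa> w * (N w * \<delta>)"
  proof -
    interpret abs_value "place_abs w" by (rule place_abs_value[OF nf w])
    obtain A j0 where A: "A \<in> carrier_mat D D" "j0 < D" "Determinant.det A = R"
      "\<And>i j. i < D \<Longrightarrow> j < D \<Longrightarrow> place_abs w (A $$ (i, j)) \<le> (if i < ?n then poly_norm w P else poly_norm w Q) * (if j = j0 then \<delta> else 1)"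
      using sylvester_column[OF P Q D_def D0 x[unfolded poly_norm_eq]] unfolding R_def poly_norm_eq by metis
    have "place_abs w R \<le> \<kappa> w * ((\<Prod>i<D. if i < ?n then poly_norm w P else poly_norm w Q) * (\<Prod>j<D. if j = j0 then \<delta> else 1))"
      unfolding A(3)[symmetric] \<kappa>_def by (rule place_det_le[OF nf w A(1) A(4)]) (use \<delta> in \<open>auto simp: poly_norm_eq\<close>)
    then show ?thesis unfolding prodr using A(2) by simp
  qed
  have "(\<Prod>v\<in>{v \<in> places. place_abs v R \<noteq> 1}. place_abs v R) = (\<Prod>v\<in>T. place_abs v R)"
    using finT T by (intro prod.mono_neutral_left) (auto simp: T_def)
  then have "1 = (\<Prod>v\<in>T. place_abs v R)" using product_formula(2)[OF nf R] by simp
  also have "\<dots> = place_abs w R * (\<Prod>v\<in>T-{w}. place_abs v R)" using finT by (intro prod.remove) (auto simp: T_def)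
  also have "\<dots> \<le> (\<kappa> w * (N w * \<delta>)) * (\<Prod>v\<in>T-{w}. \<kappa> v * N v)"
  proof (intro mult_mono prod_mono conjI)
    have nn: "place_abs v y \<ge> 0" if "v \<in> places" for v :: "('k \<Rightarrow> real) set" and y using abs_value.nonneg[OF place_abs_value[OF nf that]] .
    show "0 \<le> place_abs v R" "place_abs v R \<le> \<kappa> v * N v" if "v \<in> T - {w}" for v using bound nn that T by auto
    show "0 \<le> (\<Prod>v\<in>T-{w}. place_abs v R)" using nn T by (intro prod_nonneg) auto
    show "0 \<le> \<kappa> w * (N w * \<delta>)" using boundw nn[OF w, of R] by linarith
  qed (use boundw in auto)
  also have "\<dots> = \<delta> * ((\<kappa> w * N w) * (\<Prod>v\<in>T-{w}. \<kappa> v * N v))" by (simp add: mult_ac)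
  also have "(\<kappa> w * N w) * (\<Prod>v\<in>T-{w}. \<kappa> v * N v) = (\<Prod>v\<in>T. \<kappa> v * N v)"
    using finT by (intro prod.remove[symmetric]) (auto simp: T_def)
  also have "\<dots> = fact D * (height P ^ ?n * height Q ^ ?m)"
  proof -
    have "(\<Prod>v\<in>T. \<kappa> v) = fact D" unfolding \<kappa>_def by (rule prod_arch_weights[OF nf finT]) (auto simp: T_def)
    moreover have "height P = (\<Prod>v\<in>T. poly_norm v P)" "height Q = (\<Prod>v\<in>T. poly_norm v Q)"
      by (rule height_eq[OF finT T]; auto simp: T_def)+
    ultimately show ?thesis by (simp add: prod.distrib N_def prod_power_distrib)
  qed
  finally show ?thesis by (simp add: D_def mult_ac)
qed

section \<open>The approximation argument\<close>

lemma irreducible_factorization: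
  fixes P :: "'k :: field poly"
  assumes "Polynomial.degree P > 0"
  shows "\<exists>Qs. (\<forall>Q\<in>set Qs. Factorial_Ring.irreducible Q) \<and> prod_list Qs = P \<and> Qs \<noteq> []"
  using assms
proof (induction "Polynomial.degree P" arbitrary: P rule: less_induct)
  case less
  show ?case
  proof (cases "Factorial_Ring.irreducible P")
    case True
    then show ?thesis by (intro exI[of _ "[P]"]) auto
  next
    case False
    have P0: "P \<noteq> 0" using less.prems by auto
    have "\<not> is_unit P" using less.prems P0 by (simp add: is_unit_iff_degree)
    then obtain A B where AB: "P = A * B" "\<not> is_unit A" "\<not> is_unit B"
      using False P0 by (auto simp: Factorial_Ring.irreducible_def)
    have nz: "A \<noteq> 0" "B \<noteq> 0" using AB P0 by auto
    have d: "Polynomial.degree A > 0" "Polynomial.degree B > 0" using AB nz by (auto simp: is_unit_iff_degree)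
    have dp: "Polynomial.degree P = Polynomial.degree A + Polynomial.degree B" using nz by (simp add: AB(1) degree_mult_eq)
    obtain Qs where Qs: "\<forall>Q\<in>set Qs. Factorial_Ring.irreducible Q" "prod_list Qs = A" "Qs \<noteq> []"
      using less.hyps[of A] d dp by auto
    obtain Rs where Rs: "\<forall>Q\<in>set Rs. Factorial_Ring.irreducible Q" "prod_list Rs = B" "Rs \<noteq> []"
      using less.hyps[of B] d dp by auto
    show ?thesis using Qs Rs AB(1) by (intro exI[of _ "Qs @ Rs"]) auto
  qed
qed

lemma irreducible_degree_pos:
  fixes P :: "'k :: field poly"
  assumes "Factorial_Ring.irreducible P" shows "Polynomial.degree P > 0"
proof (rule ccontr)
  assume "\<not> ?thesis"
  then have "is_unit P" using assms by (auto simp: is_unit_iff_degree)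
  then show False using assms by (simp add: Factorial_Ring.irreducible_def)
qed

lemma prod_list_less:
  fixes f g :: "'b \<Rightarrow> real"
  assumes "\<And>x. x \<in> set xs \<Longrightarrow> 0 < g x \<and> g x < f x" "xs \<noteq> []"
  shows "(\<Prod>x\<leftarrow>xs. g x) < (\<Prod>x\<leftarrow>xs. f x)" "0 < (\<Prod>x\<leftarrow>xs. g x)"
proof -
  have "0 < (\<Prod>x\<leftarrow>xs. g x) \<and> (\<Prod>x\<leftarrow>xs. g x) < (\<Prod>x\<leftarrow>xs. f x)" using assms(2,1)
  proof (induction xs rule: list_nonempty_induct)
    case (cons x xs)
    then have "0 < g x" "g x < f x" "0 < (\<Prod>x\<leftarrow>xs. g x)" "(\<Prod>x\<leftarrow>xs. g x) < (\<Prod>x\<leftarrow>xs. f x)" by auto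
    then show ?case by (auto intro!: mult_strict_mono)
  qed auto
  then show "(\<Prod>x\<leftarrow>xs. g x) < (\<Prod>x\<leftarrow>xs. f x)" "0 < (\<Prod>x\<leftarrow>xs. g x)" by auto
qed

lemma degree_prod_list:
  fixes Qs :: "'k :: field poly list"
  shows "0 \<notin> set Qs \<Longrightarrow> Polynomial.degree (prod_list Qs) = (\<Sum>Q\<leftarrow>Qs. Polynomial.degree Q)"
  by (induction Qs) (auto simp: degree_mult_eq prod_list_zero_iff)

text \<open>25 / 16 is a quarter of 25 / 4, a lower bound for e^2; the inequality absorbs the factor
  n + 1 in the square of \<open>gelfond_const n\<close>.\<close>

lemma power_gt_self: "(25 / 16 :: real) ^ k > real k"
proof (induction k)
  case (Suc k)
  show ?case
  proof (cases "k \<ge> 2")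
    case True
    have "real (Suc k) \<le> 25 / 16 * real k" using True by simp
    also have "\<dots> < 25 / 16 * (25 / 16) ^ k" using Suc by simp
    finally show ?thesis by simp
  next
    case False
    then have "k = 0 \<or> k = 1" by linarith
    then show ?thesis by (auto simp: power2_eq_square)
  qed
qed simp

text \<open>The factor 4 leaves room for comparing parameters \<open>Y \<le> Y' \<le> 2 Y\<close>.\<close>

lemma gelfond_const_exp: "4 * (gelfond_const n)\<^sup>2 < exp (real (2 * (n + 1)))"
proof -
  have "exp 1 \<ge> (5 / 2 :: real)" using exp_lower_Taylor_quadratic[of 1] by simp
  then have "exp (1::real) ^ 2 \<ge> (5 / 2) ^ 2" by (intro power_mono) auto
  then have e2: "exp (2::real) \<ge> 25 / 4" by (simp add: exp_double[of 1, simplified] power2_eq_square)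
  have "4 * (gelfond_const n)\<^sup>2 = 4 ^ (n + 1) * real (n + 1)"
  proof -
    have "(2::real) ^ n * 2 ^ n = 4 ^ n" by (simp add: power_mult_distrib[symmetric])
    moreover have "(gelfond_const n)\<^sup>2 = (2 ^ n * 2 ^ n) * real (n + 1)"
      by (simp add: gelfond_const_def power2_eq_square power_mult_distrib)
    ultimately show ?thesis by simp
  qed
  also have "\<dots> < 4 ^ (n + 1) * (25 / 16) ^ (n + 1)"
    using power_gt_self[of "n + 1"] by (intro mult_strict_left_mono) auto
  also have "\<dots> = (25 / 4) ^ (n + 1)" by (simp add: power_mult_distrib[symmetric] del: power_Suc)
  also have "\<dots> \<le> exp 2 ^ (n + 1)" using e2 by (intro power_mono) auto
  also have "\<dots> = exp (real (2 * (n + 1)))" by (simp add: exp_of_nat_mult[symmetric] mult.commute del: power_Suc)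
  finally show ?thesis .
qed

lemma gelfond_const_mono: "m \<le> n \<Longrightarrow> gelfond_const m \<le> gelfond_const n"
  unfolding gelfond_const_def by (intro mult_mono power_increasing) auto

lemma gelfond_const_ge_1: "gelfond_const n \<ge> 1"
proof -
  have "1 * 1 \<le> (2::real) ^ n * sqrt (real (n + 1))" by (intro mult_mono) auto
  then show ?thesis by (simp add: gelfond_const_def)
qed

section \<open>Values at a point of the completion\<close>

locale approximation =
  fixes w :: "('k :: field_char_0 \<Rightarrow> real) set" and f :: "nat \<Rightarrow> 'k"
  assumes nf: "number_field TYPE('k)" and w: "w \<in> places"
    and cauchy: "abs_value.cauchy_seq (place_abs w) f"
begin

sublocale abs_value "place_abs w"
  by (rule place_abs_value[OF nf w])

definition val :: "'k poly \<Rightarrow> real" where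
  "val P = lim (\<lambda>k. place_abs w (poly P (f k)))"

lemma val_lim: "(\<lambda>k. place_abs w (poly P (f k))) \<longlonglongrightarrow> val P"
  unfolding val_def using cauchy_abs_convergent[OF cauchy_poly[OF cauchy]] convergent_LIMSEQ_iff by blast

lemma val_eq: "completion_abs (place_abs w) (poly_at w P (coset f)) = val P"
  unfolding poly_at_def place_completion_def eval_coset[OF cauchy] by (rule completion_abs_coset[OF val_lim])

lemma val_nonneg: "val P \<ge> 0"
  by (rule LIMSEQ_le_const[OF val_lim]) auto

lemma val_mult: "val (P * Q) = val P * val Q"
proof -
  have "(\<lambda>k. place_abs w (poly P (f k)) * place_abs w (poly Q (f k))) \<longlonglongrightarrow> val P * val Q"
    by (intro tendsto_mult val_lim)
  then have "(\<lambda>k. place_abs w (poly (P * Q) (f k))) \<longlonglongrightarrow> val P * val Q" by (simp add: mult)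
  then show ?thesis using val_lim LIMSEQ_unique by blast
qed

lemma val_const: "val [:c:] = place_abs w c"
  using val_lim[of "[:c:]"] by (simp add: LIMSEQ_const_iff)

lemma val_prod_list: "val (prod_list Qs) = (\<Prod>Q\<leftarrow>Qs. val Q)"
  using val_const[of 1] by (induction Qs) (simp_all add: val_mult one_pCons)

lemma val_0_iff: "poly_at w P (coset f) = \<zero>\<^bsub>place_completion w\<^esub> \<longleftrightarrow> val P = 0"
proof -
  have "poly_at w P (coset f) = \<zero>\<^bsub>place_completion w\<^esub> \<longleftrightarrow> (\<lambda>k. poly P (f k)) \<in> null_seqs (place_abs w)"
    unfolding poly_at_def place_completion_def eval_coset[OF cauchy] by (rule coset_eq_zero)
  also have "\<dots> \<longleftrightarrow> val P = 0" using val_lim[of P] LIMSEQ_unique by (auto simp: null_seqs_def)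
  finally show ?thesis .
qed

definition rel_val :: "'k poly \<Rightarrow> real" where "rel_val P = val P / poly_norm w P"

lemma rel_val_nonneg: "rel_val P \<ge> 0"
  by (simp add: rel_val_def val_nonneg poly_norm_eq)

text \<open>\<open>resultant_height\<close> is applied at each \<open>f k\<close> with \<delta> the
  larger of the two relative values there; the resulting inequality is not strict and survives the
  limit.\<close>

lemma rel_val_bound:
  assumes irr: "Factorial_Ring.irreducible P" and ndvd: "\<not> P dvd Q" and Q: "Q \<noteq> 0"
  shows "1 \<le> fact (Polynomial.degree P + Polynomial.degree Q) *
    (height P ^ Polynomial.degree Q * height Q ^ Polynomial.degree P) * max (rel_val P) (rel_val Q)"
proof -
  have P: "P \<noteq> 0" using irr by auto
  have pos: "poly_norm w P > 0" "poly_norm w Q > 0" using poly_norm_pos[OF nf w] P Q by auto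
  define d where "d k = max (place_abs w (poly P (f k)) / poly_norm w P) (place_abs w (poly Q (f k)) / poly_norm w Q)" for k
  have le: "place_abs w (poly P (f k)) \<le> d k * poly_norm w P" "place_abs w (poly Q (f k)) \<le> d k * poly_norm w Q" for k
    using pos by (auto simp: d_def pos_divide_le_eq[symmetric])
  have d0: "d k \<ge> 0" for k using pos by (auto simp: d_def le_max_iff_disj)
  have lim: "d \<longlonglongrightarrow> max (rel_val P) (rel_val Q)"
    unfolding d_def rel_val_def using pos by (intro tendsto_max tendsto_divide val_lim tendsto_const) auto
  let ?C = "fact (Polynomial.degree P + Polynomial.degree Q) * (height P ^ Polynomial.degree Q * height Q ^ Polynomial.degree P) :: real"
  have "(\<lambda>k. ?C * d k) \<longlonglongrightarrow> ?C * max (rel_val P) (rel_val Q)" by (intro tendsto_mult tendsto_const lim)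
  moreover have "1 \<le> ?C * d k" for k by (rule resultant_height[OF nf w irr ndvd Q d0 le])
  ultimately show ?thesis by (intro LIMSEQ_le_const) auto
qed

lemma poly_norm_smult: "poly_norm w ([:c:] * P) = place_abs w c * poly_norm w P"
proof (cases "c = 0")
  case True
  then show ?thesis by (simp add: poly_norm_eq pnorm_def)
next
  case False
  show ?thesis unfolding poly_norm_eq
  proof (rule antisym)
    show "pnorm (place_abs w) ([:c:] * P) \<le> place_abs w c * pnorm (place_abs w) P"
      by (rule pnorm_le) (auto simp: mult intro!: mult_left_mono pnorm_ge)
    obtain i where "place_abs w (Polynomial.coeff P i) = pnorm (place_abs w) P" using pnorm_attained by blast
    then show "place_abs w c * pnorm (place_abs w) P \<le> pnorm (place_abs w) ([:c:] * P)"
      using pnorm_ge[of "[:c:] * P" i] by (simp add: mult)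
  qed
qed

lemma rel_val_associated:
  assumes "Factorial_Ring.irreducible P" "Factorial_Ring.irreducible Q" "P dvd Q"
  shows "rel_val Q = rel_val P" "Polynomial.degree Q = Polynomial.degree P"
proof -
  obtain R where R: "Q = P * R" using assms(3) by blast
  have "\<not> is_unit P" using assms(1) by (simp add: Factorial_Ring.irreducible_def)
  then have u: "is_unit R" using assms(2) R by (auto simp: Factorial_Ring.irreducible_def)
  then have "R \<noteq> 0" by auto
  with u have "Polynomial.degree R = 0" by (simp add: is_unit_iff_degree)
  with \<open>R \<noteq> 0\<close> obtain c where c: "R = [:c:]" "c \<noteq> 0" by (metis degree_eq_zeroE pCons_0_0)
  have Q: "Q = [:c:] * P" using R c by (simp add: mult.commute)
  show "rel_val Q = rel_val P" unfolding rel_val_def Q poly_norm_smult val_mult val_const using c by simp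
  show "Polynomial.degree Q = Polynomial.degree P" using Q c by simp
qed

text \<open>The quantity F, relative value times height^n times (A Y)^degree, is multiplied over the
  irreducible factors. Gelfond's inequality for the heights and \<open>pnorm_prod_list_le\<close> at
  w bound this product by 1, because A is the constant of the hypothesis divided by 2 G; so one
  factor has F \<le> 1. Its height is at most the product of all heights, as each of them is at
  least 1.\<close>

lemma small_irreducible_factor:
  assumes n: "n > 0" and P: "P \<noteq> 0" "Polynomial.degree P \<le> n" "Polynomial.degree P > 0"
    and Y: "Y \<ge> 1" "height P \<le> Y" and c: "c \<ge> 1"
    and dlP: "rel_val P \<le> inverse ((exp (real (2 * (n + 1))) * c) ^ n) * inverse (height P ^ n) * inverse (Y ^ Polynomial.degree P)"
    and A: "A = exp (real (2 * (n + 1))) * c / (2 * gelfond_const n)" "A \<ge> 1"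
  shows "\<exists>Q. Factorial_Ring.irreducible Q \<and> Q dvd P \<and> height Q \<le> gelfond_const n * Y \<and>
    rel_val Q * height Q ^ n * (A * Y) ^ Polynomial.degree Q \<le> 1"
proof -
  define G where "G = gelfond_const n"
  have G: "G \<ge> 1" unfolding G_def by (rule gelfond_const_ge_1)
  obtain Qs where Qs: "\<forall>Q\<in>set Qs. Factorial_Ring.irreducible Q" "prod_list Qs = P" "Qs \<noteq> []"
    using irreducible_factorization[OF P(3)] by blast
  have nz: "0 \<notin> set Qs" using Qs(1) by auto
  have hQ: "height Q \<ge> 1" if "Q \<in> set Qs" for Q using height_ge_1[OF nf] nz that by metis
  have hP: "height P \<ge> 1" by (rule height_ge_1[OF nf P(1)])
  have prodh: "(\<Prod>Q\<leftarrow>Qs. height Q) \<le> G * height P"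
  proof -
    have "(\<Prod>Q\<leftarrow>Qs. height Q) \<le> gelfond_const (Polynomial.degree P) * height P" using gelfond_height[OF nf nz] Qs(2) by simp
    also have "\<dots> \<le> G * height P" unfolding G_def using gelfond_const_mono[OF P(2)] hP by (intro mult_right_mono) auto
    finally show ?thesis .
  qed
  have single: "height Q \<le> (\<Prod>Q\<leftarrow>Qs. height Q)" if "Q \<in> set Qs" for Q
    using that hQ
  proof (induction Qs)
    case (Cons R Qs)
    have ge1: "1 \<le> (\<Prod>Q\<leftarrow>Rs. height Q)" if "\<And>Q. Q \<in> set Rs \<Longrightarrow> height Q \<ge> 1" for Rs :: "'k poly list"
      using that by (induction Rs) (auto intro: mult_ge1_I)
    show ?case
    proof (cases "Q = R")
      case True
      have "height R * 1 \<le> height R * (\<Prod>Q\<leftarrow>Qs. height Q)"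
        using Cons.prems ge1[of Qs] by (intro mult_left_mono) (auto intro: order.trans[of 0 1])
      then show ?thesis using True by simp
    next
      case False
      then have "height Q \<le> (\<Prod>Q\<leftarrow>Qs. height Q)" using Cons by auto
      moreover have "1 * (\<Prod>Q\<leftarrow>Qs. height Q) \<le> height R * (\<Prod>Q\<leftarrow>Qs. height Q)"
        using Cons.prems ge1[of Qs] by (intro mult_right_mono) auto
      ultimately show ?thesis by simp
    qed
  qed simp
  have hle: "height Q \<le> G * Y" if "Q \<in> set Qs" for Q
  proof -
    have "G * height P \<le> G * Y" using Y G by (intro mult_left_mono) auto
    then show ?thesis using single[OF that] prodh by linarith
  qed
  let ?d = "Polynomial.degree P"
  have deg: "?d = (\<Sum>Q\<leftarrow>Qs. Polynomial.degree Q)" using degree_prod_list[OF nz] Qs(2) by simp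
  have npos: "poly_norm w Q > 0" if "Q \<in> set Qs" for Q using poly_norm_pos[OF nf w] nz that by metis
  \<comment> \<open>Values at the point are multiplicative, while the norms in the denominators are
    so only up to 2^n.\<close>
  have proddl: "(\<Prod>Q\<leftarrow>Qs. rel_val Q) \<le> 2 ^ n * rel_val P"
  proof -
    have pp: "(\<Prod>Q\<leftarrow>Qs. poly_norm w Q) > 0" using npos by (induction Qs) auto
    have "(\<Prod>Q\<leftarrow>Qs. rel_val Q) * (\<Prod>Q\<leftarrow>Qs. poly_norm w Q) = (\<Prod>Q\<leftarrow>Qs. val Q)"
    proof -
      have "rel_val Q * poly_norm w Q = val Q" if "Q \<in> set Qs" for Q using npos[OF that] by (simp add: rel_val_def)
      then show ?thesis by (induction Qs) (auto simp: mult_ac)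
    qed
    then have 1: "(\<Prod>Q\<leftarrow>Qs. rel_val Q) = val P / (\<Prod>Q\<leftarrow>Qs. poly_norm w Q)"
      unfolding val_prod_list[of Qs, unfolded Qs(2)]
      by (rule eq_divide_imp[OF pp[THEN less_imp_neq, symmetric]])
    have "poly_norm w P \<le> 2 ^ ?d * (\<Prod>Q\<leftarrow>Qs. poly_norm w Q)"
      using pnorm_prod_list_le[OF nz] unfolding Qs(2) poly_norm_eq .
    also have "\<dots> \<le> 2 ^ n * (\<Prod>Q\<leftarrow>Qs. poly_norm w Q)" using pp P(2) by (intro mult_right_mono power_increasing) auto
    finally have 2: "poly_norm w P \<le> 2 ^ n * (\<Prod>Q\<leftarrow>Qs. poly_norm w Q)" .
    have "val P * poly_norm w P \<le> val P * (2 ^ n * (\<Prod>Q\<leftarrow>Qs. poly_norm w Q))"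
      using 2 val_nonneg by (intro mult_left_mono) auto
    then have "val P / (\<Prod>Q\<leftarrow>Qs. poly_norm w Q) \<le> 2 ^ n * (val P / poly_norm w P)"
      using pp poly_norm_pos[OF nf w P(1)] by (simp add: field_simps)
    then show ?thesis unfolding 1[symmetric] rel_val_def[of P] .
  qed
  define F where "F Q = rel_val Q * height Q ^ n * (A * Y) ^ Polynomial.degree Q" for Q
  have AY: "A * Y > 0" using A(2) Y by simp
  have prodF: "(\<Prod>Q\<leftarrow>Qs. F Q) = (\<Prod>Q\<leftarrow>Qs. rel_val Q) * (\<Prod>Q\<leftarrow>Qs. height Q) ^ n * (A * Y) ^ ?d"
    unfolding deg F_def by (induction Qs) (simp_all add: power_mult_distrib power_add)
  have dl0: "(\<Prod>Q\<leftarrow>Qs. rel_val Q) \<ge> 0" by (intro prod_list_nonneg) (auto simp: rel_val_nonneg)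
  have h0: "(\<Prod>Q\<leftarrow>Qs. height Q) \<ge> 0" by (intro prod_list_nonneg) (use hQ in force)
  have "(\<Prod>Q\<leftarrow>Qs. F Q) \<le> (2 ^ n * rel_val P) * (G * height P) ^ n * (A * Y) ^ ?d"
    unfolding prodF using proddl prodh h0 A(2) Y rel_val_nonneg[of P] G hP dl0
    by (intro mult_mono power_mono mult_nonneg_nonneg zero_le_power) auto
  also have "\<dots> \<le> (2 ^ n * (inverse ((exp (real (2 * (n + 1))) * c) ^ n) * inverse (height P ^ n) * inverse (Y ^ ?d))) * (G * height P) ^ n * (A * Y) ^ ?d"
    using dlP A(2) Y G hP by (intro mult_right_mono mult_left_mono) auto
  also have "\<dots> = (2 * G) ^ n * inverse ((exp (real (2 * (n + 1))) * c) ^ n) * A ^ ?d"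
    using hP Y by (simp add: power_mult_distrib field_simps)
  \<comment> \<open>A \<ge> 1 allows the exponent deg P to be raised to n, where A cancels exactly
    against the other constants.\<close>
  also have "\<dots> \<le> (2 * G) ^ n * inverse ((exp (real (2 * (n + 1))) * c) ^ n) * A ^ n"
    using A(2) P(2) G c by (intro mult_left_mono power_increasing) auto
  also have "\<dots> = 1"
  proof -
    have "(2 * G) ^ n * inverse (e ^ n) * (e / (2 * G)) ^ n = 1" if "e > 0" for e
      using that G by (simp add: power_divide)
    moreover have "exp (real (2 * (n + 1))) * c > 0" using c by simp
    ultimately show ?thesis unfolding A(1) G_def[symmetric] by blast
  qed
  finally have le1: "(\<Prod>Q\<leftarrow>Qs. F Q) \<le> 1" .
  have "\<exists>Q\<in>set Qs. F Q \<le> 1"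
  proof (rule ccontr)
    assume "\<not> ?thesis"
    then have "(\<Prod>Q\<leftarrow>Qs. 1) < (\<Prod>Q\<leftarrow>Qs. F Q)" by (intro prod_list_less Qs) auto
    moreover have "(\<Prod>Q\<leftarrow>Qs. 1) = (1::real)" by (induction Qs) auto
    ultimately show False using le1 by simp
  qed
  then obtain Q where Q: "Q \<in> set Qs" "F Q \<le> 1" by blast
  have "Q dvd P" using Q(1) Qs(2) by (auto dest: split_list)
  then show ?thesis using Q Qs(1) hle by (auto simp: F_def G_def)
qed

text \<open>If Q did not divide Q', the resultant inequality would hold with the larger of the two
  relative values. The height of the polynomial owning it has exponent at most n and is absorbed by
  the bound for that relative value; the other height is compared with A times the parameter. What
  remains is at most (2n)! (2 G / A)^k for a positive degree k, which is below 1.\<close>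

lemma consecutive_factors_divide:
  assumes Q: "Factorial_Ring.irreducible Q" "Polynomial.degree Q \<le> n" "height Q \<le> G * Y"
      "rel_val Q * height Q ^ n * (A * Y) ^ Polynomial.degree Q \<le> 1"
    and Q': "Factorial_Ring.irreducible Q'" "Polynomial.degree Q' \<le> n" "height Q' \<le> G * Y'"
      "rel_val Q' * height Q' ^ n * (A * Y') ^ Polynomial.degree Q' \<le> 1"
    and Y: "1 \<le> Y" "Y \<le> Y'" "Y' \<le> 2 * Y" and G: "G \<ge> 1" and A: "2 * G * fact (2 * n) < A"
  shows "Q dvd Q'"
proof (rule ccontr)
  assume nd: "\<not> Q dvd Q'"
  let ?m = "Polynomial.degree Q" and ?m' = "Polynomial.degree Q'"
  define c3 :: real where "c3 = fact (2 * n)"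
  have c3: "c3 \<ge> 1" by (simp add: c3_def fact_ge_1)
  have nz: "Q \<noteq> 0" "Q' \<noteq> 0" using Q(1) Q'(1) by auto
  have h: "height Q \<ge> 1" "height Q' \<ge> 1" using height_ge_1[OF nf] nz by auto
  have m: "?m > 0" "?m' > 0" using irreducible_degree_pos Q(1) Q'(1) by auto
  have A0: "A > 0" using A G c3 by (smt (verit) c3_def mult_nonneg_nonneg)
  have ratio: "c3 * (t / A) ^ k < 1" if "0 \<le> t" "t \<le> 2 * G" "k > 0" for t k
  proof -
    have lt: "c3 * (t / A) < 1"
    proof -
      have "c3 * t \<le> c3 * (2 * G)" using that c3 by (intro mult_left_mono) auto
      also have "\<dots> < A" using A by (simp add: c3_def mult.commute)
      finally have "c3 * t < A" .
      then show ?thesis using A0 by (simp add: field_simps)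
    qed
    have "t / A \<le> c3 * (t / A)" using mult_right_mono[OF c3, of "t / A"] that A0 by simp
    then have "t / A \<le> 1" using lt by linarith
    then have "(t / A) ^ k \<le> (t / A) ^ 1" using that A0 by (intro power_decreasing) auto
    then have "c3 * (t / A) ^ k \<le> c3 * (t / A)" using c3 by (intro mult_left_mono) auto
    then show ?thesis using lt by linarith
  qed
  \<comment> \<open>Formulated for either factor, since the larger relative value may belong to Q or
    to Q'. In both cases the opposite parameter Z' is at most 2 Z.\<close>
  have key: "fact (k + k') * (hR ^ k' * hR' ^ k) * d < 1"
    if "k \<le> n" "k' \<le> n" "k > 0" "1 \<le> hR" "0 \<le> hR'" "hR' \<le> G * Z'" "d \<ge> 0" "d * hR ^ n * (A * Z) ^ k \<le> 1" "1 \<le> Z" "0 \<le> Z'" "Z' \<le> 2 * Z"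
    for k k' hR hR' d Z Z'
  proof -
    have AZ: "A * Z > 0" using A0 that by simp
    have f: "fact (k + k') \<le> c3" unfolding c3_def using that by (intro fact_mono) auto
    have "fact (k + k') * (hR ^ k' * hR' ^ k) * d \<le> c3 * (hR ^ n * (G * Z') ^ k) * d"
      using that f c3 G by (intro mult_right_mono mult_mono power_increasing power_mono mult_nonneg_nonneg) auto
    also have "\<dots> = c3 * (d * hR ^ n * (A * Z) ^ k) * (G * Z' / (A * Z)) ^ k"
    proof -
      have "A \<noteq> 0" "Z \<noteq> 0" using AZ by auto
      then show ?thesis by (simp add: power_divide)
    qed
    also have "\<dots> \<le> c3 * 1 * (G * Z' / (A * Z)) ^ k"
      using that c3 AZ G by (intro mult_right_mono mult_left_mono) auto
    also have "G * Z' / (A * Z) = (G * (Z' / Z)) / A" by simp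
    also have "c3 * 1 * ((G * (Z' / Z)) / A) ^ k < 1"
    proof -
      have "Z' / Z \<le> 2" using that by (simp add: field_simps)
      then have "G * (Z' / Z) \<le> 2 * G" using mult_left_mono[of "Z' / Z" 2 G] G by simp
      then show ?thesis using ratio[of "G * (Z' / Z)" k] that G by simp
    qed
    finally show ?thesis .
  qed
  have k1: "fact (?m + ?m') * (height Q ^ ?m' * height Q' ^ ?m) * rel_val Q < 1"
    by (rule key[OF Q(2) Q'(2) m(1) h(1) _ Q'(3) rel_val_nonneg Q(4)]) (use h Y in auto)
  have k2: "fact (?m' + ?m) * (height Q' ^ ?m * height Q ^ ?m') * rel_val Q' < 1"
    by (rule key[OF Q'(2) Q(2) m(2) h(2) _ Q(3) rel_val_nonneg Q'(4)]) (use h Y in auto)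
  have "fact (?m + ?m') * (height Q ^ ?m' * height Q' ^ ?m) * max (rel_val Q) (rel_val Q') < 1"
    using k1 k2 by (auto simp: max_def add.commute mult.commute)
  then show False using rel_val_bound[OF Q(1) nd nz(2)] by simp
qed

end

lemma exp_mult_power: "exp (real (2 * n * (n + 1))) * c ^ n = (exp (real (2 * (n + 1))) * c) ^ n"
  by (simp add: power_mult_distrib exp_of_nat_mult[symmetric] algebra_simps)

theorem theorem4p2:
  fixes n :: nat
    and w :: "('k :: field_char_0 \<Rightarrow> real) set"
    and \<xi> :: "(nat \<Rightarrow> 'k) set"
    and P :: "real \<Rightarrow> 'k poly"
    and c3 c4 :: real
  assumes "number_field TYPE('k)"
    and "n > 0"
    and "w \<in> places"
    and "\<xi> \<in> carrier (place_completion w)"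
    and "c3 = fact (2 * n)"
    and "c4 = exp (real (2 * n * (n + 1))) * c3 ^ n"
    and "\<forall>\<^sub>F Y in at_top.
           P Y \<noteq> 0 \<and> Polynomial.degree (P Y) \<le> n \<and> height (P Y) \<le> Y \<and>
           completion_abs (place_abs w) (poly_at w (P Y) \<xi>) / poly_norm w (P Y)
             \<le> inverse c4 * height (P Y) powi (- int n) * Y powi (- int (Polynomial.degree (P Y)))"
  shows "ring.algebraic (place_completion w) (base_field w) \<xi> \<and>
         algebraic_degree w \<xi> \<le> n \<and>
         (\<forall>\<^sub>F Y in at_top. poly_at w (P Y) \<xi> = \<zero>\<^bsub>place_completion w\<^esub>)"
proof -
  interpret abs_value "place_abs w" by (rule place_abs_value[OF assms(1,3)])
  obtain f where f: "cauchy_seq f" "\<xi> = coset f"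
    using assms(4) carrier_completion unfolding place_completion_def by auto
  interpret approximation w f by unfold_locales (use assms(1,3) f(1) in auto)
  \<comment> \<open>The n-th root of \<open>c4\<close> after the losses of the factorization: 2 for
    the norm at w and G for the heights. It must still exceed 2 G (2n)!, which amounts to 4 G^2 <
    e^(2(n+1)).\<close>
  define A where "A = exp (real (2 * (n + 1))) * c3 / (2 * gelfond_const n)"
  let ?G = "gelfond_const n"
  have G: "?G \<ge> 1" by (rule gelfond_const_ge_1)
  have c3: "c3 \<ge> 1" using assms(5) by (simp add: fact_ge_1)
  have Agt: "2 * ?G * fact (2 * n) < A"
  proof -
    have "4 * ?G\<^sup>2 * c3 < exp (real (2 * (n + 1))) * c3"
      using gelfond_const_exp[of n] c3 by (intro mult_strict_right_mono) auto
    then show ?thesis using G unfolding A_def assms(5)[symmetric] by (simp add: power2_eq_square field_simps)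
  qed
  have A1: "A \<ge> 1"
  proof -
    have "1 * 1 \<le> (2 * ?G) * (fact (2 * n) :: real)" using G by (intro mult_mono) (auto simp: fact_ge_1)
    then show ?thesis using Agt by linarith
  qed
  have c4: "c4 = (exp (real (2 * (n + 1))) * c3) ^ n" unfolding assms(6) by (rule exp_mult_power)
  have c4gt: "c4 > 1"
  proof -
    have "1 * 1 < exp (real (2 * (n + 1))) * c3" using c3 by (intro mult_less_le_imp_less) auto
    then show ?thesis unfolding c4 using assms(2) by (intro one_less_power) auto
  qed
  obtain Y1 where Y1: "\<And>Y. Y \<ge> Y1 \<Longrightarrow> P Y \<noteq> 0 \<and> Polynomial.degree (P Y) \<le> n \<and> height (P Y) \<le> Y \<and>
      rel_val (P Y) \<le> inverse c4 * inverse (height (P Y) ^ n) * inverse (Y ^ Polynomial.degree (P Y))"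
    using assms(7) unfolding eventually_at_top_linorder f(2) val_eq rel_val_def power_int_minus power_int_of_nat by blast
  define Y0 where "Y0 = max 1 Y1"
  have Y0: "Y0 \<ge> 1" by (simp add: Y0_def)
  have "Y \<ge> Y1" if "Y \<ge> Y0" for Y using that by (simp add: Y0_def)
  note PY = Y1[OF this]
  \<comment> \<open>A nonzero constant has relative value 1, whereas the hypothesis with heights at
    least 1 and \<open>c4\<close> > 1 would make it smaller.\<close>
  have degpos: "Polynomial.degree (P Y) > 0" if Y: "Y \<ge> Y0" for Y
  proof (rule ccontr)
    assume "\<not> ?thesis"
    then obtain c where c: "P Y = [:c:]" by (metis degree_eq_zeroE not_gr0)
    with PY[OF Y] have "c \<noteq> 0" by auto
    then have "rel_val (P Y) = 1" by (simp add: c rel_val_def val_const poly_norm_def)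
    moreover have "height (P Y) ^ n \<ge> 1" using height_ge_1[OF nf, of "P Y"] PY[OF Y] by (intro one_le_power) auto
    moreover have "inverse c4 < 1" using c4gt by (simp add: inverse_less_1_iff)
    ultimately have "1 \<le> inverse c4 * inverse (height (P Y) ^ n)" using PY[OF Y] c by simp
    also have "\<dots> \<le> inverse c4 * 1" using c4gt \<open>height (P Y) ^ n \<ge> 1\<close> by (intro mult_left_mono) (auto simp: inverse_le_1_iff)
    finally show False using \<open>inverse c4 < 1\<close> by simp
  qed
  define good where "good Y Q \<longleftrightarrow> Factorial_Ring.irreducible Q \<and> Polynomial.degree Q \<le> n \<and> height Q \<le> ?G * Y \<and>
    rel_val Q * height Q ^ n * (A * Y) ^ Polynomial.degree Q \<le> 1" for Y Q
  have ex: "\<exists>Q. good Y Q \<and> Q dvd P Y" if Y: "Y \<ge> Y0" for Y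
  proof -
    have "Y \<ge> 1" using Y Y0 by linarith
    obtain Q where Q: "Factorial_Ring.irreducible Q" "Q dvd P Y" "height Q \<le> ?G * Y" "rel_val Q * height Q ^ n * (A * Y) ^ Polynomial.degree Q \<le> 1"
      using small_irreducible_factor[OF assms(2) _ _ degpos[OF Y] \<open>Y \<ge> 1\<close> _ c3 _ A_def A1] PY[OF Y] c4 by metis
    have "Polynomial.degree Q \<le> Polynomial.degree (P Y)" using Q(2) PY[OF Y] by (intro dvd_imp_degree_le) auto
    then show ?thesis using Q PY[OF Y] by (auto simp: good_def)
  qed
  have step: "Q dvd Q'" if "good Y Q" "good Y' Q'" "Y0 \<le> Y" "Y \<le> Y'" "Y' \<le> 2 * Y" for Y Y' Q Q'
    using consecutive_factors_divide[of Q n ?G Y A Q' Y'] that Y0 G Agt by (auto simp: good_def)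
  obtain Q0 where Q0: "good Y0 Q0" using ex[of Y0] by blast
  have irr: "Factorial_Ring.irreducible Q0" and deg0: "Polynomial.degree Q0 \<le> n" using Q0 by (auto simp: good_def)
  \<comment> \<open>\<open>step\<close> compares parameters only up to a factor 2. The endpoints
    \<open>Y0 * 2 ^ k\<close>, each with a good factor of its own, link any Y back to
    \<open>Y0\<close>.\<close>
  have dyadic: "Y0 * 2 ^ k \<le> Y \<Longrightarrow> Y \<le> Y0 * 2 ^ Suc k \<Longrightarrow> good Y Q \<Longrightarrow> Q0 dvd Q" for k Y Q
  proof (induction k arbitrary: Y Q)
    case 0
    then show ?case using step[OF Q0, of Y Q] by simp
  next
    case (Suc k)
    let ?Z = "Y0 * 2 ^ Suc k"
    have Z: "Y0 \<le> ?Z" using Y0 mult_left_mono[OF one_le_power[of "2::real" "Suc k"], of Y0] by simp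
    then obtain R where R: "good ?Z R" using ex by blast
    have "Q0 dvd R" by (rule Suc.IH[OF _ order.refl R]) (use Y0 in simp)
    moreover have "R dvd Q" by (rule step[OF R Suc.prems(3) Z Suc.prems(1)]) (use Suc.prems(2) in simp)
    ultimately show ?case by (rule dvd_trans)
  qed
  have all: "Q0 dvd Q" if Y: "Y \<ge> Y0" and Q: "good Y Q" for Y Q
  proof -
    have "Y / Y0 \<ge> 1" using Y Y0 by simp
    obtain k where "Y / Y0 < 2 ^ k" using real_arch_pow[of 2 "Y / Y0"] by auto
    then have "\<exists>k. Y < Y0 * 2 ^ k" using Y0 by (intro exI[of _ k]) (simp add: field_simps)
    \<comment> \<open>The least such k is positive, and its predecessor is the index of the dyadic
      interval containing Y.\<close>
    then obtain k where k: "Y < Y0 * 2 ^ k" "\<And>j. j < k \<Longrightarrow> \<not> Y < Y0 * 2 ^ j"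
      using exists_least_iff[of "\<lambda>k. Y < Y0 * 2 ^ k"] by blast
    have "k \<noteq> 0" using k(1) Y by (cases k) auto
    then obtain j where j: "k = Suc j" using not0_implies_Suc by blast
    show ?thesis by (rule dyadic[of j Y Q]) (use k j Q in \<open>auto simp: not_less\<close>)
  qed
  \<comment> \<open>The good factor at Y is associated to \<open>Q0\<close>, so the relative value
    of \<open>Q0\<close> inherits its bound for every Y. Height and A are at least 1 and the degree
    is positive, which leaves 1 / Y.\<close>
  have small: "rel_val Q0 * Y \<le> 1" if Y: "Y \<ge> Y0" for Y
  proof -
    obtain Q where Q: "good Y Q" using ex[OF Y] by blast
    have "Factorial_Ring.irreducible Q" using Q by (simp add: good_def)
    note as = rel_val_associated[OF irr this all[OF Y Q]]
    have "height Q \<ge> 1" using Q height_ge_1[OF nf, of Q] by (auto simp: good_def)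
    then have h: "height Q ^ n \<ge> 1" by (rule one_le_power)
    have Y1: "Y \<ge> 1" using Y Y0 by linarith
    have AY: "Y \<le> A * Y" using A1 Y1 mult_right_mono[of 1 A Y] by simp
    then have "1 \<le> A * Y" using Y1 by linarith
    note AY
    also have "\<dots> \<le> (A * Y) ^ Polynomial.degree Q"
      using \<open>1 \<le> A * Y\<close> irreducible_degree_pos[of Q] Q by (intro self_le_power) (auto simp: good_def)
    finally have "rel_val Q0 * 1 * Y \<le> rel_val Q * height Q ^ n * (A * Y) ^ Polynomial.degree Q"
      unfolding as(1)[symmetric] using h Y1 rel_val_nonneg[of Q] by (intro mult_mono) auto
    then show ?thesis using Q by (simp add: good_def)
  qed
  have "rel_val Q0 = 0"
  proof (rule ccontr)
    assume "rel_val Q0 \<noteq> 0"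
    then have pos: "rel_val Q0 > 0" using rel_val_nonneg[of Q0] by simp
    \<comment> \<open>Chosen so that the product in \<open>small\<close> would be at least
      2.\<close>
    define Z where "Z = max Y0 (2 / rel_val Q0)"
    have "rel_val Q0 * (2 / rel_val Q0) \<le> rel_val Q0 * Z" using pos by (intro mult_left_mono) (auto simp: Z_def)
    then show False using small[of Z] pos by (simp add: Z_def)
  qed
  then have val0: "val Q0 = 0" using poly_norm_pos[OF nf w, of Q0] irr by (auto simp: rel_val_def)
  have van: "poly_at w (P Y) \<xi> = \<zero>\<^bsub>place_completion w\<^esub>" if Y: "Y \<ge> Y0" for Y
  proof -
    obtain Q where "good Y Q" "Q dvd P Y" using ex[OF Y] by blast
    then have "Q0 dvd P Y" using all[OF Y] dvd_trans by blast
    then show ?thesis unfolding f(2) val_0_iff using val0 by (auto simp: val_mult)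
  qed
  have "(\<lambda>k. poly Q0 (f k)) \<in> null_seqs (place_abs w)"
    using val_lim[of Q0] val0 by (simp add: null_seqs_def)
  moreover have "Q0 \<noteq> 0" using irr by auto
  ultimately have "ring.algebraic (completion (place_abs w)) (range (embed (place_abs w))) (coset f)"
    "Polynomials.degree (ring.Irr (completion (place_abs w)) (range (embed (place_abs w))) (coset f)) \<le> Polynomial.degree Q0"
    using root_imp_algebraic[OF f(1)] by auto
  then show ?thesis
    using deg0 van unfolding place_completion_def base_field_def algebraic_degree_def f(2) eventually_at_top_linorder
    by auto
qed

end
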